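(* Let $\mathfrak{g}$ be a solvable non-nilpotent Lie algebra with filiform nilradical $\mathfrak{n}$, and let $n=\dim\mathfrak{n}$. Then $\mathfrak{g}$ admits an inner product of negative Ricci curvature if and only if one of the following holds: (a) either $\mathfrak{n}=L_n$ and $\mathfrak{g}$ is a one-dimensional extension of $\mathfrak{n}$ by a vector $Y$ such that $\iota_2(Y)>0$ and $\iota_n(Y)>0$, where $\iota_2,\iota_n$ are the one-forms defined for solvable extensions of $L_n$; (b) or $\mathfrak{n}=Q_n$, $n=2m$, $m>2$, and $\mathfrak{g}$ is a one-dimensional extension of $\mathfrak{n}$ by a vector $Y$ such that $\iota_k(Y)>0$ for all $k=m+1,\dots,n$, where $\iota_k$ are the one-forms defined for solvable extensions of $Q_n$; (c) or, with no restrictions, in all the other cases: either $\mathfrak{n}$ is any other filiform algebra, or otherwise $\mathfrak{n}$ is $L_n$ or $Q_n$ and $\mathfrak{g}$ is an extension of $\mathfrak{n}$ of dimension greater than one (that is, $\dim\mathfrak{g}-\dim\mathfrak{n}>1$).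
   Context: All Lie algebras are real and finite-dimensional, and equalities such as $\mathfrak{n}=L_n$ are understood up to isomorphism. The nilradical of a Lie algebra is its maximal nilpotent ideal. A solvable Lie algebra $\mathfrak{g}$ with nilradical $\mathfrak{n}$ is called an extension of $\mathfrak{n}$ of dimension $\dim\mathfrak{g}-\dim\mathfrak{n}$; it is a one-dimensional extension of $\mathfrak{n}$ by a vector $Y\in\mathfrak{g}$ if $\mathfrak{g}=\mathbb{R}Y\oplus\mathfrak{n}$ as a vector space. Filiform: for a nilpotent Lie algebra $\mathfrak{n}$ put $\mathfrak{n}^{(0)}=\mathfrak{n}$, $\mathfrak{n}^{(i+1)}=[\mathfrak{n},\mathfrak{n}^{(i)}]$. A nilpotent Lie algebra $\mathfrak{n}$ of dimension $n$ is filiform if $\mathfrak{n}^{(n-2)}\neq 0$, that is, if its lower central series has the maximal possible number of nonzero terms for its dimension. Ricci curvature: for an inner product $\langle\cdot,\cdot\rangle$ on $\mathfrak{g}$, let $B$ be the Killing form of $\mathfrak{g}$, let $H\in\mathfrak{g}$ be defined by $\langle H,X\rangle=\operatorname{Tr}\operatorname{ad}_X$ for all $X\in\mathfrak g$, and let $\{E_i\}$ be an orthonormal basis. The Ricci curvature is the quadratic form $$\mathrm{ric}(X)=-\langle[H,X],X\rangle-\tfrac12B(X,X)-\tfrac12\sum_i\|[X,E_i]\|^2+\tfrac14\sum_{i,j}\langle[E_i,E_j],X\rangle^2 ,$$ which is the Ricci curvature at the identity of the corresponding left-invariant metric on a Lie group with Lie algebra $\mathfrak{g}$. The inner product has negative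 Ricci curvature if $\mathrm{ric}(X)<0$ for all nonzero $X\in\mathfrak{g}$. In the following, brackets of basis elements that are not listed and do not follow from the listed ones by skew-symmetry are zero. The algebra $L_n=\operatorname{Span}(X_1,\dots,X_n)$ is defined by $[X_1,X_i]=X_{i+1}$, $i=2,\dots,n-1$. The codimension one abelian ideal $\mathfrak{i}=\operatorname{Span}(X_2,\dots,X_n)$ and the one-dimensional centre $\mathbb{R}X_n$ of $L_n$ are both characteristic ideals of $L_n$ (invariant under the action of any derivation of $L_n$). If $\mathfrak{g}$ is a solvable extension of $L_n$, the one-forms $\iota_2$ and $\iota_n$ on $\mathfrak{g}$ are defined as follows: for $Y\in\mathfrak{g}$, $[Y,X_n]=\iota_n(Y)X_n$ and $\iota_2(Y)=\operatorname{Tr}((\operatorname{ad}_Y)_{|\mathfrak{i}})$. The algebra $Q_n=\operatorname{Span}(X_1,\dots,X_n)$, $n=2m$, is defined by $[X_1,X_i]=X_{i+1}$, $i=2,\dots,n-2$, and $[X_j,X_{n-j+1}]=(-1)^{j+1}X_n$, $j=2,\dots,n-1$. (The algebra $Q_4$ is isomorphic to $L_4$.) The members $\mathfrak{i}_k=Q_n^{(k-2)}=\operatorname{Span}(X_k,\dots,X_n)$, $k=3,\dots,n$, of the lower central series are all characteristic ideals of $Q_n$. If $\mathfrak{g}$ is a solvable extension of $Q_n$, the one-forms $\iota_k$, $k=3,\dots,n$, on $\mathfrak{g}$ are defined by $\iota_k(Y)=\operatorname{Tr}((\operatorname{ad}_Y)_{|\mathfrak{i}_k})$ for $Y\in\m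athfrak{g}$.
   Formalization: One-dimensional extensions with n = 2 or 3 are excluded: there Span(X_2,…,X_n) is not characteristic in L_n (for n = 2 the centre is not even one-dimensional), so the forms in (a) are undefined, and (a) for a chosen basis is false, e.g. ad_Y = diag(−1.2, 2, 0.8) on L_3. *)

theory Defs
  imports "HOL-Analysis.Analysis"
begin

section \<open>Lie algebras\<close>

text \<open>A finite-dimensional real Lie algebra is a bracket on a whole type of class real_vector,
  which, unlike euclidean_space, carries no preferred inner product. Ideals are sets.\<close>

definition lie_algebra :: "('a::real_vector \<Rightarrow> 'a \<Rightarrow> 'a) \<Rightarrow> bool" where
  "lie_algebra br \<longleftrightarrow>
     (\<exists>B. finite B \<and> span B = (UNIV :: 'a set)) \<and>
     bilinear br \<and>
     (\<forall>x. br x x = 0) \<and>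
     (\<forall>x y z. br x (br y z) + br y (br z x) + br z (br x y) = 0)"

definition bracket_span :: "('a::real_vector \<Rightarrow> 'a \<Rightarrow> 'a) \<Rightarrow> 'a set \<Rightarrow> 'a set \<Rightarrow> 'a set" where
  "bracket_span br S T = span {br x y | x y. x \<in> S \<and> y \<in> T}"

definition lie_ideal :: "('a::real_vector \<Rightarrow> 'a \<Rightarrow> 'a) \<Rightarrow> 'a set \<Rightarrow> bool" where
  "lie_ideal br I \<longleftrightarrow> subspace I \<and> (\<forall>x. \<forall>y\<in>I. br x y \<in> I)"

fun lower_central :: "('a::real_vector \<Rightarrow> 'a \<Rightarrow> 'a) \<Rightarrow> 'a set \<Rightarrow> nat \<Rightarrow> 'a set" where
  "lower_central br N 0 = N"
| "lower_central br N (Suc i) = bracket_span br N (lower_central br N i)"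

fun derived_series :: "('a::real_vector \<Rightarrow> 'a \<Rightarrow> 'a) \<Rightarrow> 'a set \<Rightarrow> nat \<Rightarrow> 'a set" where
  "derived_series br S 0 = S"
| "derived_series br S (Suc i) = bracket_span br (derived_series br S i) (derived_series br S i)"

definition lie_nilpotent :: "('a::real_vector \<Rightarrow> 'a \<Rightarrow> 'a) \<Rightarrow> 'a set \<Rightarrow> bool" where
  "lie_nilpotent br N \<longleftrightarrow> (\<exists>k. lower_central br N k = {0})"

definition lie_solvable :: "('a::real_vector \<Rightarrow> 'a \<Rightarrow> 'a) \<Rightarrow> 'a set \<Rightarrow> bool" where
  "lie_solvable br S \<longleftrightarrow> (\<exists>k. derived_series br S k = {0})"

text \<open>Maximality is with respect to inclusion; such an ideal is unique, since the sum of two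
  nilpotent ideals is a nilpotent ideal.\<close>

definition is_nilradical :: "('a::real_vector \<Rightarrow> 'a \<Rightarrow> 'a) \<Rightarrow> 'a set \<Rightarrow> bool" where
  "is_nilradical br N \<longleftrightarrow>
     lie_ideal br N \<and> lie_nilpotent br N \<and>
     (\<forall>I. lie_ideal br I \<and> lie_nilpotent br I \<and> N \<subseteq> I \<longrightarrow> I = N)"

text \<open>The bound on the dimension makes the index of the series meaningful, as subtraction on
  natural numbers truncates.\<close>

definition filiform :: "('a::real_vector \<Rightarrow> 'a \<Rightarrow> 'a) \<Rightarrow> 'a set \<Rightarrow> bool" where
  "filiform br N \<longleftrightarrow> lie_nilpotent br N \<and> 2 \<le> dim N \<and> lower_central br N (dim N - 2) \<noteq> {0}"


section \<open>Traces and Ricci curvature\<close>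

text \<open>The trace on the subspace S of a linear map leaving S invariant. The value does not depend
  on the basis chosen; it is meaningless if S is not invariant.\<close>

definition trace_on :: "'a::real_vector set \<Rightarrow> ('a \<Rightarrow> 'a) \<Rightarrow> real" where
  "trace_on S f =
     (let B = (SOME B. independent B \<and> span B = S) in \<Sum>b\<in>B. representation B (f b) b)"

definition killing_form :: "('a::real_vector \<Rightarrow> 'a \<Rightarrow> 'a) \<Rightarrow> 'a \<Rightarrow> 'a \<Rightarrow> real" where
  "killing_form br X Y = trace_on UNIV (\<lambda>Z. br X (br Y Z))"

definition inner_product :: "('a::real_vector \<Rightarrow> 'a \<Rightarrow> real) \<Rightarrow> bool" where
  "inner_product ip \<longleftrightarrow>
     bilinear ip \<and> (\<forall>x y. ip x y = ip y x) \<and> (\<forall>x. x \<noteq> 0 \<longrightarrow> 0 < ip x x)"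

definition orthonormal_basis :: "('a::real_vector \<Rightarrow> 'a \<Rightarrow> real) \<Rightarrow> 'a set \<Rightarrow> bool" where
  "orthonormal_basis ip E \<longleftrightarrow>
     (\<forall>x\<in>E. \<forall>y\<in>E. ip x y = (if x = y then 1 else 0)) \<and> span E = UNIV"

definition mean_curvature_vector ::
  "('a::real_vector \<Rightarrow> 'a \<Rightarrow> 'a) \<Rightarrow> ('a \<Rightarrow> 'a \<Rightarrow> real) \<Rightarrow> 'a" where
  "mean_curvature_vector br ip = (THE H. \<forall>X. ip H X = trace_on UNIV (br X))"

text \<open>The value does not depend on the orthonormal basis chosen.\<close>

definition ricci ::
  "('a::real_vector \<Rightarrow> 'a \<Rightarrow> 'a) \<Rightarrow> ('a \<Rightarrow> 'a \<Rightarrow> real) \<Rightarrow> 'a \<Rightarrow> real" where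
  "ricci br ip X =
     (let H = mean_curvature_vector br ip; E = (SOME E. orthonormal_basis ip E) in
        - ip (br H X) X
        - 1/2 * killing_form br X X
        - 1/2 * (\<Sum>e\<in>E. ip (br X e) (br X e))
        + 1/4 * (\<Sum>e\<in>E. \<Sum>e'\<in>E. (ip (br e e') X)\<^sup>2))"

definition negative_ricci ::
  "('a::real_vector \<Rightarrow> 'a \<Rightarrow> 'a) \<Rightarrow> ('a \<Rightarrow> 'a \<Rightarrow> real) \<Rightarrow> bool" where
  "negative_ricci br ip \<longleftrightarrow> (\<forall>X. X \<noteq> 0 \<longrightarrow> ricci br ip X < 0)"


section \<open>The filiform algebras L and Q\<close>

definition basis_family :: "nat \<Rightarrow> (nat \<Rightarrow> 'a::real_vector) \<Rightarrow> 'a set \<Rightarrow> bool" where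
  "basis_family n X N \<longleftrightarrow>
     inj_on X {1..n} \<and> independent (X ` {1..n}) \<and> span (X ` {1..n}) = N"

text \<open>Only the brackets of basis elements with increasing indices are listed; the others follow
  by skew-symmetry.\<close>

definition L_basis ::
  "('a::real_vector \<Rightarrow> 'a \<Rightarrow> 'a) \<Rightarrow> nat \<Rightarrow> (nat \<Rightarrow> 'a) \<Rightarrow> 'a set \<Rightarrow> bool" where
  "L_basis br n X N \<longleftrightarrow>
     basis_family n X N \<and>
     (\<forall>i\<in>{1..n}. \<forall>j\<in>{1..n}. i < j \<longrightarrow>
        br (X i) (X j) = (if i = 1 \<and> j \<le> n - 1 then X (j + 1) else 0))"

definition Q_basis ::
  "('a::real_vector \<Rightarrow> 'a \<Rightarrow> 'a) \<Rightarrow> nat \<Rightarrow> (nat \<Rightarrow> 'a) \<Rightarrow> 'a set \<Rightarrow> bool" where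
  "Q_basis br n X N \<longleftrightarrow>
     basis_family n X N \<and>
     (\<forall>i\<in>{1..n}. \<forall>j\<in>{1..n}. i < j \<longrightarrow>
        br (X i) (X j) =
          (if i = 1 \<and> j \<le> n - 2 then X (j + 1)
           else if 2 \<le> i \<and> j = n - i + 1 then (-1) ^ (i + 1) *\<^sub>R X n
           else 0))"

definition isomorphic_L :: "('a::real_vector \<Rightarrow> 'a \<Rightarrow> 'a) \<Rightarrow> 'a set \<Rightarrow> bool" where
  "isomorphic_L br N \<longleftrightarrow> (\<exists>X. L_basis br (dim N) X N)"

definition isomorphic_Q :: "('a::real_vector \<Rightarrow> 'a \<Rightarrow> 'a) \<Rightarrow> 'a set \<Rightarrow> bool" where
  "isomorphic_Q br N \<longleftrightarrow> even (dim N) \<and> (\<exists>X. Q_basis br (dim N) X N)"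

text \<open>The ideals spanned by X 2, ..., X n and by X n do not depend on the L-basis X, and are
  invariant under all derivations, if and only if n is at least 4. In the Heisenberg algebra
  (n = 3) the vectors X 1 and X 2 play interchangeable roles, so iota_L2 is not well defined
  there; for n = 2 neither form is.\<close>

definition iota_L2 ::
  "('a::real_vector \<Rightarrow> 'a \<Rightarrow> 'a) \<Rightarrow> nat \<Rightarrow> (nat \<Rightarrow> 'a) \<Rightarrow> 'a \<Rightarrow> real" where
  "iota_L2 br n X Y = trace_on (span (X ` {2..n})) (br Y)"

definition iota_Ln ::
  "('a::real_vector \<Rightarrow> 'a \<Rightarrow> 'a) \<Rightarrow> nat \<Rightarrow> (nat \<Rightarrow> 'a) \<Rightarrow> 'a \<Rightarrow> real" where
  "iota_Ln br n X Y = (THE c. br Y (X n) = c *\<^sub>R X n)"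

text \<open>For k = 3, ..., n and a Q-basis X of N, the term of the lower central series used here is
  the span of X k, ..., X n.\<close>

definition iota_Q :: "('a::real_vector \<Rightarrow> 'a \<Rightarrow> 'a) \<Rightarrow> 'a set \<Rightarrow> nat \<Rightarrow> 'a \<Rightarrow> real" where
  "iota_Q br N k Y = trace_on (lower_central br N (k - 2)) (br Y)"

text \<open>For a subspace N this says that the whole space is the direct sum of N and the line
  spanned by the nonzero vector Y.\<close>

definition one_dim_extension_by :: "'a::real_vector set \<Rightarrow> 'a \<Rightarrow> bool" where
  "one_dim_extension_by N Y \<longleftrightarrow> Y \<notin> N \<and> span (insert Y N) = UNIV"

definition extension_dim :: "'a::real_vector set \<Rightarrow> nat" where
  "extension_dim N = dim (UNIV :: 'a set) - dim N"

end

theory Submission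
  imports Defs
begin

text \<open>
  The trace of the Ricci form over an abelian ideal is the source of every restriction. If \<open>X\<close>
  lies in an abelian ideal \<open>h\<close>, then \<open>ad X\<close> squares to zero, so the Killing term vanishes, and
  summed over an orthonormal basis of \<open>h\<close> the two terms made of squared norms of brackets add up
  to something nonnegative. Negative Ricci curvature therefore forces \<open>ad H\<close> to have positive
  trace on \<open>h\<close>, where \<open>H\<close> is the mean curvature vector (\<open>abelian_ideal_trace_pos\<close>). For \<open>L\<close> the
  ideals spanned by \<open>X 2, ..., X n\<close> and by \<open>X n\<close>, and for \<open>Q\<close> the second half of the lower central
  series, give exactly the inequalities on the forms \<open>\<iota>\<close>, with \<open>Y = H\<close>; this \<open>H\<close> is not in the
  nilradical, whose elements act on these ideals with trace zero.

  Conversely, metrics are found by degeneration. Declare the vectors \<open>(d i / q ^ f i) X i\<close> of a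
  rescaled basis orthonormal and let \<open>q\<close> tend to 0. A structure constant \<open>c i j k\<close> is multiplied by
  \<open>q ^ (f k - f i - f j)\<close>; if no bracket lowers the degree \<open>f\<close>, the part preserving the degree
  survives and everything else disappears. For well chosen degrees the Ricci form of the limit is
  diagonal, and since negativity is an open condition it is enough that its diagonal entries are
  negative (\<open>negative_form_perturbation\<close>, \<open>negative_ricci_graded_limit\<close>). With one vector \<open>Y\<close>
  outside the nilradical, acting with weights \<open>\<lambda> i\<close> of sum \<open>T\<close>, the entry at \<open>X i\<close> is
  \<open>- T \<lambda> i\<close>, minus half the squared constants of the brackets starting at \<open>X i\<close>, plus a quarter
  of those of the brackets ending there. For \<open>L\<close> and \<open>Q\<close> the surviving constants can be prescribed,
  for \<open>Q\<close> up to a system of multiplicative relations, and the resulting linear inequalities are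
  solvable under the stated positivity (\<open>L_coefficients\<close>, \<open>Q_coefficients_nonneg\<close>,
  \<open>Q_coefficients_neg\<close>).

  For one-dimensional extensions of other filiform algebras let \<open>\<alpha>\<close> and \<open>\<beta>\<close> be the weights of \<open>Y\<close>
  on the two steps of a \<open>Y\<close>-invariant flag of the abelianisation. Each further weight arises from
  the previous one by adding \<open>\<alpha>\<close> or \<open>\<beta>\<close> (\<open>flag_weights\<close>). If, up to the sign of \<open>Y\<close>, \<open>\<alpha>\<close> is nonnegative and \<open>\<beta>\<close> positive, then all
  weights but possibly \<open>\<alpha>\<close> are positive, and it suffices to keep the bracket of \<open>X 1\<close> and \<open>X 2\<close>
  alone (\<open>positive_weights_sufficient\<close>). If both vanish, \<open>Y\<close> would lie in the nilradical. In the
  remaining case, after scaling, \<open>\<alpha> = 1\<close> and \<open>\<beta> \<le> 0\<close>, and generalised weight vectors can be made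
  into a basis of type \<open>L\<close> or \<open>Q\<close> (\<open>classification\<close>).

  If the extension has dimension greater than one, the algebra acts on the abelianisation of the
  nilradical by 2 by 2 matrices; the kernel of this action is the nilradical
  (\<open>kernel_on_abelianization\<close>) and the image is commutative (\<open>commutators_in_N\<close>). A commutative
  space of 2 by 2 matrices of dimension at least two is spanned by the identity and one further
  matrix. An element \<open>Y\<close> acting as the identity has positive integral weights, so that all
  brackets of the nilradical can be contracted away, and a second vector \<open>A\<close> commuting with \<open>Y\<close> is
  made very long; its Ricci curvature is negative as soon as the symmetric part of its action does
  not vanish (\<open>negative_ricci_codim2\<close>).
\<close>

section \<open>Bases and traces\<close>

text \<open>A basis of \<open>S\<close> as an indexed family. The index set is explicit so that a frame of the nilradical
  and its extension by vectors outside share their indices.\<close>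

definition frame :: "'i set \<Rightarrow> ('i \<Rightarrow> 'a::real_vector) \<Rightarrow> 'a set \<Rightarrow> bool" where
  "frame I e S \<longleftrightarrow> finite I \<and> inj_on e I \<and> independent (e ` I) \<and> span (e ` I) = S"

definition coord :: "'i set \<Rightarrow> ('i \<Rightarrow> 'a::real_vector) \<Rightarrow> 'a \<Rightarrow> 'i \<Rightarrow> real" where
  "coord I e v i = representation (e ` I) v (e i)"

lemma frame_subspace: "frame I e S \<Longrightarrow> subspace S"
  unfolding frame_def by auto

lemma frame_in: "frame I e S \<Longrightarrow> i \<in> I \<Longrightarrow> e i \<in> S"
  unfolding frame_def by (auto intro: span_base)

lemma coord_expand: "frame I e S \<Longrightarrow> v \<in> S \<Longrightarrow> (\<Sum>i\<in>I. coord I e v i *\<^sub>R e i) = v"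
  unfolding frame_def coord_def
  using real_vector.sum_representation_eq[of "e ` I" v "e ` I"]
  by (simp add: sum.reindex)

lemma coord_add: "frame I e S \<Longrightarrow> v \<in> S \<Longrightarrow> w \<in> S \<Longrightarrow> coord I e (v + w) i = coord I e v i + coord I e w i"
  unfolding frame_def coord_def by (auto simp: real_vector.representation_add)

lemma coord_diff:
  "frame I e S \<Longrightarrow> v \<in> S \<Longrightarrow> w \<in> S \<Longrightarrow> coord I e (v - w) i = coord I e v i - coord I e w i"
  unfolding frame_def coord_def by (auto simp: real_vector.representation_diff)

lemma coord_scale: "frame I e S \<Longrightarrow> v \<in> S \<Longrightarrow> coord I e (c *\<^sub>R v) i = c * coord I e v i"
  unfolding frame_def coord_def by (auto simp: real_vector.representation_scale)

lemma coord_zero: "coord I e 0 i = 0"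
  unfolding coord_def by (simp add: real_vector.representation_zero)

lemma coord_basis:
  "frame I e S \<Longrightarrow> i \<in> I \<Longrightarrow> j \<in> I \<Longrightarrow> coord I e (e i) j = (if i = j then 1 else 0)"
  unfolding frame_def coord_def by (auto simp: real_vector.representation_basis inj_on_def)

lemma coord_setsum:
  assumes "frame I e S" "\<And>a. a \<in> A \<Longrightarrow> v a \<in> S"
  shows "coord I e (\<Sum>a\<in>A. v a) i = (\<Sum>a\<in>A. coord I e (v a) i)"
  using assms(2)
proof (induction A rule: infinite_finite_induct)
  case (insert x F)
  then have "sum v F \<in> S"
    using frame_subspace[OF assms(1)] by (meson insertCI subspace_sum)
  with insert show ?case by (simp add: coord_add[OF assms(1)])
qed (auto simp: coord_zero)

lemma coord_sum:
  assumes "frame I e S" "j \<in> I"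
  shows "coord I e (\<Sum>i\<in>I. x i *\<^sub>R e i) j = x j"
proof -
  have "coord I e (\<Sum>i\<in>I. x i *\<^sub>R e i) j = (\<Sum>i\<in>I. coord I e (x i *\<^sub>R e i) j)"
    using frame_in[OF assms(1)] frame_subspace[OF assms(1)]
    by (intro coord_setsum[OF assms(1)]) (auto simp: subspace_scale)
  also have "\<dots> = (\<Sum>i\<in>I. if i = j then x i else 0)"
    using assms frame_in[OF assms(1)] by (intro sum.cong) (auto simp: coord_scale coord_basis)
  also have "\<dots> = x j"
    using assms unfolding frame_def by simp
  finally show ?thesis .
qed

lemma sum_swap_mult:
  fixes u :: "'i \<Rightarrow> 'j \<Rightarrow> real"
  shows "(\<Sum>i\<in>I. \<Sum>j\<in>J. u i j * w j i) = (\<Sum>j\<in>J. \<Sum>i\<in>I. w j i * u i j)"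
  by (subst sum.swap) (simp add: mult.commute)

text \<open>Either trace is the double sum of the entries of \<open>f\<close>, read from one frame to the other, against
  the entries of the transition matrix back.\<close>

lemma trace_change_of_frame:
  assumes e: "frame I e S" and b: "frame J b S" and f: "linear f" and inv: "\<And>v. v \<in> S \<Longrightarrow> f v \<in> S"
  shows "(\<Sum>i\<in>I. coord I e (f (e i)) i) = (\<Sum>j\<in>J. coord J b (f (b j)) j)"
proof -
  interpret f: linear f by fact
  have eS: "e i \<in> S" if "i \<in> I" for i using frame_in[OF e that] .
  have bS: "b j \<in> S" if "j \<in> J" for j using frame_in[OF b that] .
  have S: "subspace S" using frame_subspace[OF e] .
  have A: "coord I e (f (e i)) i = (\<Sum>j\<in>J. coord J b (f (e i)) j * coord I e (b j) i)"
    if "i \<in> I" for i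
  proof -
    have "coord I e (f (e i)) i = coord I e (\<Sum>j\<in>J. coord J b (f (e i)) j *\<^sub>R b j) i"
      using coord_expand[OF b inv[OF eS[OF that]]] by simp
    also have "\<dots> = (\<Sum>j\<in>J. coord J b (f (e i)) j * coord I e (b j) i)"
      using S bS by (subst coord_setsum[OF e]) (auto simp: subspace_scale coord_scale[OF e])
    finally show ?thesis .
  qed
  have B: "coord J b (f (b j)) j = (\<Sum>i\<in>I. coord I e (b j) i * coord J b (f (e i)) j)"
    if "j \<in> J" for j
  proof -
    have "f (b j) = f (\<Sum>i\<in>I. coord I e (b j) i *\<^sub>R e i)"
      using coord_expand[OF e bS[OF that]] by simp
    also have "\<dots> = (\<Sum>i\<in>I. coord I e (b j) i *\<^sub>R f (e i))"
      by (simp add: f.sum f.scale)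
    finally have "coord J b (f (b j)) j = coord J b (\<Sum>i\<in>I. coord I e (b j) i *\<^sub>R f (e i)) j"
      by simp
    also have "\<dots> = (\<Sum>i\<in>I. coord I e (b j) i * coord J b (f (e i)) j)"
      using S eS inv by (subst coord_setsum[OF b]) (auto simp: subspace_scale coord_scale[OF b])
    finally show ?thesis .
  qed
  show ?thesis
    using sum_swap_mult[of "\<lambda>i j. coord J b (f (e i)) j" "\<lambda>j i. coord I e (b j) i" J I]
    by (simp add: A B)
qed

text \<open>The trace is defined through a chosen basis; here it becomes computable in any frame.\<close>

lemma trace_on_frame:
  assumes e: "frame I e S" and f: "linear f" and inv: "\<And>i. i \<in> I \<Longrightarrow> f (e i) \<in> S"
  shows "trace_on S f = (\<Sum>i\<in>I. coord I e (f (e i)) i)"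
proof -
  interpret f: linear f by fact
  let ?B = "SOME B. independent B \<and> span B = S"
  have "\<exists>B. independent B \<and> span B = S"
    using e unfolding frame_def by auto
  then have B: "independent ?B \<and> span ?B = S" by (rule someI_ex)
  have "finite ?B"
    using real_vector.independent_span_bound[of "e ` I" ?B] B e unfolding frame_def
    by (metis finite_imageI span_superset)
  then have b: "frame ?B id S" using B unfolding frame_def by auto
  have inv': "f v \<in> S" if "v \<in> S" for v
  proof -
    have "f v = f (\<Sum>i\<in>I. coord I e v i *\<^sub>R e i)"
      using coord_expand[OF e that] by simp
    also have "\<dots> = (\<Sum>i\<in>I. coord I e v i *\<^sub>R f (e i))"
      by (simp add: f.sum f.scale)
    finally show ?thesis
      using inv frame_subspace[OF e] by (metis (mono_tags, lifting) subspace_scale subspace_sum)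
  qed
  have "trace_on S f = (\<Sum>v\<in>?B. coord ?B id (f (id v)) v)"
    unfolding trace_on_def coord_def Let_def by simp
  also have "\<dots> = (\<Sum>i\<in>I. coord I e (f (e i)) i)"
    using trace_change_of_frame[OF b e f inv'] by simp
  finally show ?thesis .
qed

section \<open>Finite dimension\<close>

text \<open>A finite spanning set contains a basis, which instantiates the locale of finite-dimensional
  vector spaces.\<close>

lemma
  assumes "\<exists>B. finite B \<and> span B = (UNIV :: 'a::real_vector set)"
  shows fd_dim_mono: "\<And>S T :: 'a set. S \<subseteq> T \<Longrightarrow> dim S \<le> dim T"
    and fd_subspace_dim_equal:
      "\<And>S T :: 'a set. subspace S \<Longrightarrow> subspace T \<Longrightarrow> S \<subseteq> T \<Longrightarrow> dim T \<le> dim S \<Longrightarrow> S = T"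
    and fd_dim_insert:
      "\<And>(x::'a) S. dim (insert x S) = (if x \<in> span S then dim S else dim S + 1)"
    and fd_finite_independent: "\<And>B :: 'a set. independent B \<Longrightarrow> finite B"
proof -
  obtain C :: "'a set" where C: "finite C" "span C = UNIV" using assms by auto
  obtain B where B: "B \<subseteq> C" "independent B" "C \<subseteq> span B"
    using real_vector.maximal_independent_subset[of C] by auto
  have "span B = UNIV" using B C by (metis real_vector.span_mono real_vector.span_span top.extremum_uniqueI)
  moreover have "finite B" by (rule finite_subset[OF B(1) C(1)])
  ultimately interpret fd: finite_dimensional_vector_space "scaleR :: real \<Rightarrow> 'a \<Rightarrow> 'a" B
    using B by unfold_locales (auto simp: dependent_raw_def span_raw_def)
  show "\<And>S T :: 'a set. S \<subseteq> T \<Longrightarrow> dim S \<le> dim T"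
    using fd.dim_subset unfolding dim_raw_def by blast
  show "\<And>S T :: 'a set. subspace S \<Longrightarrow> subspace T \<Longrightarrow> S \<subseteq> T \<Longrightarrow> dim T \<le> dim S \<Longrightarrow> S = T"
    using fd.subspace_dim_equal unfolding dim_raw_def subspace_raw_def by blast
  show "\<And>(x::'a) S. dim (insert x S) = (if x \<in> span S then dim S else dim S + 1)"
    using fd.dim_insert unfolding dim_raw_def span_raw_def by blast
  show "\<And>B :: 'a set. independent B \<Longrightarrow> finite B"
    using fd.finiteI_independent unfolding dependent_raw_def by blast
qed

lemma frame_basis_family: "basis_family n X N \<longleftrightarrow> frame {1..n} X N"
  unfolding basis_family_def frame_def by auto

lemma frame_rescale:
  assumes e: "frame I e S" and d: "\<And>i. i \<in> I \<Longrightarrow> d i \<noteq> 0"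
  shows "frame I (\<lambda>i. d i *\<^sub>R e i) S"
proof -
  have fin: "finite I" and inj: "inj_on e I" and ind: "independent (e ` I)" and sp: "span (e ` I) = S"
    using e unfolding frame_def by auto
  have sc: "e i = inverse (d i) *\<^sub>R (d i *\<^sub>R e i)" if "i \<in> I" for i using d[OF that] by simp
  have inj': "inj_on (\<lambda>i. d i *\<^sub>R e i) I"
  proof (rule inj_onI)
    fix i j assume ij: "i \<in> I" "j \<in> I" "d i *\<^sub>R e i = d j *\<^sub>R e j"
    have "d i * coord I e (e i) i = d j * coord I e (e j) i"
      using ij(3) frame_in[OF e ij(1)] frame_in[OF e ij(2)] coord_scale[OF e] by metis
    then show "i = j"
      using d[OF ij(1)] coord_basis[OF e ij(1) ij(1)] coord_basis[OF e ij(2) ij(1)] by (cases "i = j") auto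
  qed
  have sp': "span ((\<lambda>i. d i *\<^sub>R e i) ` I) = S"
  proof
    show "span ((\<lambda>i. d i *\<^sub>R e i) ` I) \<subseteq> S"
      using frame_in[OF e] frame_subspace[OF e]
      by (intro span_minimal) (auto intro: subspace_scale)
    have "e i \<in> span ((\<lambda>i. d i *\<^sub>R e i) ` I)" if "i \<in> I" for i
      by (subst sc[OF that]) (intro span_scale span_base imageI that)
    then show "S \<subseteq> span ((\<lambda>i. d i *\<^sub>R e i) ` I)"
      unfolding sp[symmetric] by (intro span_minimal) auto
  qed
  have "independent ((\<lambda>i. d i *\<^sub>R e i) ` I)"
  proof (rule ccontr)
    assume "\<not> independent ((\<lambda>i. d i *\<^sub>R e i) ` I)"
    then obtain i where i: "i \<in> I" "d i *\<^sub>R e i \<in> span ((\<lambda>i. d i *\<^sub>R e i) ` I - {d i *\<^sub>R e i})"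
      unfolding dependent_def by auto
    have "span ((\<lambda>i. d i *\<^sub>R e i) ` I - {d i *\<^sub>R e i}) \<subseteq> span (e ` I - {e i})"
    proof (intro span_minimal subspace_span subsetI)
      fix v assume "v \<in> (\<lambda>i. d i *\<^sub>R e i) ` I - {d i *\<^sub>R e i}"
      then obtain j where "j \<in> I" "v = d j *\<^sub>R e j" "j \<noteq> i" by auto
      then have "e j \<in> e ` I - {e i}" using inj i(1) by (auto simp: inj_on_def)
      then show "v \<in> span (e ` I - {e i})"
        unfolding \<open>v = d j *\<^sub>R e j\<close> by (intro span_scale span_base)
    qed
    then have "d i *\<^sub>R e i \<in> span (e ` I - {e i})" using i by auto
    then have "e i \<in> span (e ` I - {e i})" using sc[OF i(1)] span_scale by metis
    then show False using ind i unfolding dependent_def by auto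
  qed
  then show ?thesis using fin inj' sp' unfolding frame_def by auto
qed

lemma frame_insert:
  assumes e: "frame I e S" and a: "a \<notin> I" and v: "e a \<notin> S"
  shows "frame (insert a I) e (span (insert (e a) S))"
proof -
  have fin: "finite I" and inj: "inj_on e I" and ind: "independent (e ` I)" and sp: "span (e ` I) = S"
    using e unfolding frame_def by auto
  have "span (insert (e a) S) = span (insert (e a) (e ` I))"
    unfolding sp[symmetric]
  proof
    show "span (insert (e a) (span (e ` I))) \<subseteq> span (insert (e a) (e ` I))"
    proof (intro span_minimal subspace_span subsetI)
      fix x assume "x \<in> insert (e a) (span (e ` I))"
      then show "x \<in> span (insert (e a) (e ` I))"
        using span_mono[of "e ` I" "insert (e a) (e ` I)", OF subset_insertI] span_base[of "e a" "insert (e a) (e ` I)"] by blast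
    qed
    show "span (insert (e a) (e ` I)) \<subseteq> span (insert (e a) (span (e ` I)))"
      using span_superset[of "e ` I"] by (intro span_mono) blast
  qed
  moreover have "independent (insert (e a) (e ` I))"
    using ind v sp real_vector.independent_insert by metis
  moreover have "inj_on e (insert a I)"
  proof -
    have "e a \<notin> e ` I"
    proof
      assume "e a \<in> e ` I"
      then obtain i where "i \<in> I" "e a = e i" by auto
      then show False using v frame_in[OF e, of i] by simp
    qed
    then show ?thesis using inj a by (simp add: inj_on_insert)
  qed
  ultimately show ?thesis unfolding frame_def using fin by auto
qed

section \<open>Orthonormal bases\<close>

definition orthonormal :: "('a::real_vector \<Rightarrow> 'a \<Rightarrow> real) \<Rightarrow> 'a set \<Rightarrow> bool" where
  "orthonormal ip E \<longleftrightarrow> (\<forall>x\<in>E. \<forall>y\<in>E. ip x y = (if x = y then 1 else 0))"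

lemma orthonormal_basis_alt: "orthonormal_basis ip E \<longleftrightarrow> orthonormal ip E \<and> span E = UNIV"
  unfolding orthonormal_basis_def orthonormal_def ..

lemma bilinear_sums:
  fixes h :: "'a::real_vector \<Rightarrow> 'b::real_vector \<Rightarrow> 'c::real_vector"
  assumes "bilinear h"
  shows "h (\<Sum>i\<in>A. x i *\<^sub>R u i) w = (\<Sum>i\<in>A. x i *\<^sub>R h (u i) w)"
    and "h v (\<Sum>i\<in>B. y i *\<^sub>R z i) = (\<Sum>i\<in>B. y i *\<^sub>R h v (z i))"
proof -
  have 1: "linear (\<lambda>x. h x w)" and 2: "linear (h v)"
    using assms unfolding bilinear_def by auto
  show "h (\<Sum>i\<in>A. x i *\<^sub>R u i) w = (\<Sum>i\<in>A. x i *\<^sub>R h (u i) w)"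
    by (simp add: linear_sum[OF 1] linear_cmul[OF 1])
  show "h v (\<Sum>i\<in>B. y i *\<^sub>R z i) = (\<Sum>i\<in>B. y i *\<^sub>R h v (z i))"
    by (simp add: linear_sum[OF 2] linear_cmul[OF 2])
qed

lemma bilinear_sums2:
  assumes "bilinear h"
  shows "h (\<Sum>i\<in>A. x i *\<^sub>R u i) (\<Sum>j\<in>B. y j *\<^sub>R w j) = (\<Sum>i\<in>A. \<Sum>j\<in>B. (x i * y j) *\<^sub>R h (u i) (w j))"
  by (simp only: bilinear_sums(1)[OF assms]) (simp add: bilinear_sums(2)[OF assms] scaleR_sum_right)

lemma bilinearD:
  assumes "bilinear h"
  shows "linear (\<lambda>x. h x y)" "linear (h x)"
  using assms unfolding bilinear_def by auto

lemma bilinear_times: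
  fixes f g :: "'a::real_vector \<Rightarrow> real"
  assumes f: "linear f" and g: "linear g"
  shows "bilinear (\<lambda>x y. f x * g y)"
  unfolding bilinear_def
  by (intro conjI allI linearI)
    (simp_all add: linear_add[OF f] linear_add[OF g] linear_cmul[OF f] linear_cmul[OF g] ring_distribs)

lemma bilinear_compose:
  assumes h: "bilinear h" and f: "linear f" and g: "linear g"
  shows "bilinear (\<lambda>x y. h (f x) (g y))"
  unfolding bilinear_def
  by (intro conjI allI linearI)
    (simp_all add: linear_add[OF f] linear_add[OF g] linear_cmul[OF f] linear_cmul[OF g]
      bilinear_ladd[OF h] bilinear_radd[OF h] bilinear_lmul[OF h] bilinear_rmul[OF h])

lemmas bilinear_simps = bilinear_ladd bilinear_radd bilinear_lsub bilinear_rsub bilinear_lmul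
  bilinear_rmul bilinear_lzero bilinear_rzero bilinear_lneg bilinear_rneg

lemma orthonormal_independent:
  assumes ip: "inner_product ip" and E: "orthonormal ip E"
  shows "independent E"
proof
  assume "dependent E"
  then obtain e where e: "e \<in> E" "e \<in> span (E - {e})" unfolding dependent_def by auto
  have lin: "linear (ip e)" using ip unfolding inner_product_def by (auto intro: bilinearD)
  have "ip e v = 0" if "v \<in> span (E - {e})" for v
  proof (rule linear_eq_0_on_span[OF lin _ that])
    show "ip e x = 0" if "x \<in> E - {e}" for x
      using that E e(1) unfolding orthonormal_def by auto
  qed
  then show False using e E unfolding orthonormal_def by force
qed

lemma orthonormal_frame:
  assumes ip: "inner_product ip" and E: "orthonormal ip E" "finite E"
  shows "frame E id (span E)"
  unfolding frame_def using orthonormal_independent[OF ip E(1)] E by auto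

lemma orthonormal_coord:
  assumes ip: "inner_product ip" and E: "orthonormal ip E" "finite E" and v: "v \<in> span E" "e \<in> E"
  shows "coord E id v e = ip v e"
proof -
  have bl: "bilinear ip" using ip unfolding inner_product_def by auto
  have "ip v e = ip (\<Sum>a\<in>E. coord E id v a *\<^sub>R id a) e"
    using coord_expand[OF orthonormal_frame[OF ip E] v(1)] by simp
  also have "\<dots> = (\<Sum>a\<in>E. if a = e then coord E id v a else 0)"
    using E v unfolding bilinear_sums(1)[OF bl] orthonormal_def by (intro sum.cong) auto
  finally show ?thesis using E v by simp
qed

lemma orthonormal_expand:
  assumes ip: "inner_product ip" and E: "orthonormal ip E" "finite E" and v: "v \<in> span E"
  shows "(\<Sum>e\<in>E. ip v e *\<^sub>R e) = v"
  using coord_expand[OF orthonormal_frame[OF ip E] v] orthonormal_coord[OF ip E v] by simp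

lemma parseval:
  assumes ip: "inner_product ip" and E: "orthonormal ip E" "finite E" and v: "v \<in> span E"
  shows "(\<Sum>e\<in>E. ip v e * ip w e) = ip v w"
proof -
  have bl: "bilinear ip" and sym: "\<And>x y. ip x y = ip y x"
    using ip unfolding inner_product_def by auto
  have "ip v w = ip (\<Sum>e\<in>E. ip v e *\<^sub>R e) w" using orthonormal_expand[OF ip E v] by simp
  also have "\<dots> = (\<Sum>e\<in>E. ip v e * ip w e)"
    unfolding bilinear_sums(1)[OF bl] by (simp add: sym)
  finally show ?thesis by simp
qed

lemma orthonormal_trace:
  assumes ip: "inner_product ip" and E: "orthonormal ip E" "finite E"
    and f: "linear f" "\<And>e. e \<in> E \<Longrightarrow> f e \<in> span E"
  shows "trace_on (span E) f = (\<Sum>e\<in>E. ip (f e) e)"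
  using trace_on_frame[OF orthonormal_frame[OF ip E] f(1)] f(2) orthonormal_coord[OF ip E] by simp

lemma gram_schmidt_step:
  assumes ip: "inner_product ip" and E: "orthonormal ip E" "finite E" and v: "v \<notin> span E"
  shows "\<exists>u. orthonormal ip (insert u E) \<and> span (insert u E) = span (insert v E)"
proof -
  have bl: "bilinear ip" and sym: "\<And>x y. ip x y = ip y x" and pos: "\<And>x. x \<noteq> 0 \<Longrightarrow> 0 < ip x x"
    using ip unfolding inner_product_def by auto
  define p where "p = (\<Sum>e\<in>E. ip v e *\<^sub>R e)"
  define w where "w = v - p"
  define u where "u = (1 / sqrt (ip w w)) *\<^sub>R w"
  have p: "p \<in> span E" unfolding p_def by (intro span_sum span_scale span_base)
  have w0: "w \<noteq> 0" using v p unfolding w_def by auto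
  have pw: "0 < ip w w" using pos[OF w0] .
  have orth: "ip w e = 0" if "e \<in> E" for e
  proof -
    have "ip p e = (\<Sum>a\<in>E. if a = e then ip v a else 0)"
      using E that unfolding p_def bilinear_sums(1)[OF bl] orthonormal_def by (intro sum.cong) auto
    then show ?thesis using E that unfolding w_def by (simp add: bilinear_simps[OF bl])
  qed
  have uu: "ip u u = 1"
    using pw unfolding u_def by (simp add: bilinear_simps[OF bl] field_simps)
  have ue: "ip u e = 0" "ip e u = 0" if "e \<in> E" for e
    using orth[OF that] sym[of e w] unfolding u_def by (simp_all add: bilinear_simps[OF bl])
  have "orthonormal ip (insert u E)"
    using E uu ue unfolding orthonormal_def by auto
  moreover have "span (insert u E) = span (insert v E)"
  proof (rule antisym; intro span_minimal subspace_span)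
    have "v \<in> span (insert v E)" "p \<in> span (insert v E)"
      using p span_mono[of E "insert v E"] by (auto intro: span_base)
    then have "u \<in> span (insert v E)" unfolding u_def w_def by (intro span_scale span_diff)
    then show "insert u E \<subseteq> span (insert v E)" by (auto intro: span_base)
    have "v = sqrt (ip w w) *\<^sub>R u + p" unfolding u_def using pw by (simp add: w_def)
    moreover have "u \<in> span (insert u E)" "p \<in> span (insert u E)"
      using p span_mono[of E "insert u E"] by (auto intro: span_base)
    ultimately have "v \<in> span (insert u E)" by (metis span_add span_scale)
    then show "insert v E \<subseteq> span (insert u E)" by (auto intro: span_base)
  qed
  ultimately show ?thesis by blast
qed

text \<open>Extending, instead of only constructing, provides orthonormal bases adapted to an ideal.\<close>

lemma orthonormal_extension:
  assumes ip: "inner_product ip" and E: "orthonormal ip E" "finite E" and B: "finite B"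
  shows "\<exists>E'. E \<subseteq> E' \<and> finite E' \<and> orthonormal ip E' \<and> span E' = span (E \<union> B)"
  using B
proof induction
  case empty
  then show ?case using E by auto
next
  case (insert v B)
  then obtain E' where E': "E \<subseteq> E'" "finite E'" "orthonormal ip E'" "span E' = span (E \<union> B)" by auto
  have sp: "span (insert v E') = span (E \<union> insert v B)"
    using E'(4) by (simp add: real_vector.span_insert)
  show ?case
  proof (cases "v \<in> span E'")
    case True
    then have "span E' = span (E \<union> insert v B)" using sp real_vector.span_redundant by metis
    then show ?thesis using E' by blast
  next
    case False
    then obtain u where "orthonormal ip (insert u E')" "span (insert u E') = span (insert v E')"
      using gram_schmidt_step[OF ip E'(3,2)] by auto
    then show ?thesis using E' sp by (intro exI[of _ "insert u E'"]) auto
  qed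
qed

text \<open>Expand one basis in the other: by Parseval the coefficients of \<open>q a b\<close> sum to a Kronecker
  delta.\<close>

lemma orthonormal_sum_invariant:
  fixes q :: "'a::real_vector \<Rightarrow> 'a \<Rightarrow> real"
  assumes ip: "inner_product ip" and q: "bilinear q"
    and E: "orthonormal_basis ip E" "finite E" and F: "orthonormal_basis ip F" "finite F"
  shows "(\<Sum>e\<in>E. q e e) = (\<Sum>a\<in>F. q a a)"
proof -
  have E': "orthonormal ip E" "span E = UNIV" and F': "orthonormal ip F" "span F = UNIV"
    using E F unfolding orthonormal_basis_alt by auto
  have sym: "\<And>x y. ip x y = ip y x" using ip unfolding inner_product_def by auto
  have "(\<Sum>e\<in>E. q e e) = (\<Sum>e\<in>E. \<Sum>a\<in>F. \<Sum>b\<in>F. ip e a * ip e b * q a b)"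
  proof (intro sum.cong refl)
    fix e assume "e \<in> E"
    have "q e e = q (\<Sum>a\<in>F. ip e a *\<^sub>R a) (\<Sum>b\<in>F. ip e b *\<^sub>R b)"
      using orthonormal_expand[OF ip F'(1) F(2), of e] F'(2) by simp
    then show "q e e = (\<Sum>a\<in>F. \<Sum>b\<in>F. ip e a * ip e b * q a b)"
      by (simp add: bilinear_sums2[OF q])
  qed
  also have "\<dots> = (\<Sum>a\<in>F. \<Sum>b\<in>F. (\<Sum>e\<in>E. ip a e * ip b e) * q a b)"
    by (subst sum.swap, rule sum.cong[OF refl], subst sum.swap) (simp add: sum_distrib_right sym)
  also have "\<dots> = (\<Sum>a\<in>F. \<Sum>b\<in>F. if a = b then q a b else 0)"
    using parseval[OF ip E'(1) E(2)] E'(2) F'(1) unfolding orthonormal_def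
    by (intro sum.cong refl) auto
  also have "\<dots> = (\<Sum>a\<in>F. q a a)" using F(2) by simp
  finally show ?thesis .
qed

section \<open>The Ricci form in an orthonormal basis\<close>

locale lie =
  fixes br :: "'a::real_vector \<Rightarrow> 'a \<Rightarrow> 'a"
  assumes lie_algebra: "lie_algebra br"
begin

lemma fin_dim: "\<exists>B. finite B \<and> span B = (UNIV :: 'a set)"
  and bil: "bilinear br"
  and alt: "br x x = 0"
  and jacobi: "br x (br y z) + br y (br z x) + br z (br x y) = 0"
  using lie_algebra unfolding lie_algebra_def by auto

lemmas dim_mono = fd_dim_mono[OF fin_dim]
  and subspace_dim_equal = fd_subspace_dim_equal[OF fin_dim]
  and dim_insert = fd_dim_insert[OF fin_dim]
  and finite_independent = fd_finite_independent[OF fin_dim]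

lemmas br_simps = bilinear_simps[OF bil]
lemmas br_sums = bilinear_sums[OF bil]

lemma lin: "linear (br x)" and lin': "linear (\<lambda>x. br x y)"
  using bilinearD[OF bil] by auto

lemma skew: "br x y = - br y x"
proof -
  have "br x y + br y x = br (x + y) (x + y)"
    unfolding br_simps by (simp add: alt)
  then show ?thesis by (simp add: alt eq_neg_iff_add_eq_0)
qed

lemma leibniz: "br x (br y z) = br (br x y) z + br y (br x z)"
proof -
  have "br x (br y z) = - br y (br z x) - br z (br x y)"
    using jacobi[of x y z] by (simp add: eq_diff_eq eq_neg_iff_add_eq_0 ac_simps)
  then show ?thesis
    using skew[of z x] skew[of z "br x y"] by (simp add: br_simps)
qed

text \<open>The Riesz vector of the form sending \<open>x\<close> to the trace of \<open>ad x\<close>, which makes the defining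
  description unique.\<close>

lemma mean_curvature_vector_eq:
  assumes ip: "inner_product ip" and E: "orthonormal_basis ip E" "finite E"
  shows "mean_curvature_vector br ip = (\<Sum>e\<in>E. trace_on UNIV (br e) *\<^sub>R e)" (is "_ = ?H")
    and "trace_on UNIV (br x) = ip (mean_curvature_vector br ip) x"
proof -
  have E': "orthonormal ip E" "span E = UNIV"
    using E unfolding orthonormal_basis_alt by auto
  have bl: "bilinear ip" and sym: "\<And>x y. ip x y = ip y x" and pos: "\<And>x. x \<noteq> 0 \<Longrightarrow> 0 < ip x x"
    using ip unfolding inner_product_def by auto
  have tr: "trace_on UNIV (br x) = (\<Sum>a\<in>E. ip (br x a) a)" for x
    using orthonormal_trace[OF ip E'(1) E(2) lin] E'(2) by simp
  have H: "ip ?H x = trace_on UNIV (br x)" for x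
  proof -
    have "ip (\<Sum>e\<in>E. trace_on UNIV (br e) *\<^sub>R e) x = (\<Sum>e\<in>E. \<Sum>a\<in>E. ip e x * ip (br e a) a)"
      by (simp add: bilinear_sums[OF bl] tr sum_distrib_right sum_distrib_left mult.commute)
    also have "\<dots> = (\<Sum>a\<in>E. ip (br (\<Sum>e\<in>E. ip x e *\<^sub>R e) a) a)"
      by (subst sum.swap) (simp add: br_sums bilinear_sums[OF bl] sym)
    also have "\<dots> = trace_on UNIV (br x)"
      using orthonormal_expand[OF ip E'(1) E(2)] E'(2) by (simp add: tr)
    finally show ?thesis .
  qed
  show *: "mean_curvature_vector br ip = ?H"
    unfolding mean_curvature_vector_def
  proof (rule the_equality)
    show "\<forall>X. ip ?H X = trace_on UNIV (br X)" using H by simp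
    fix H' assume "\<forall>X. ip H' X = trace_on UNIV (br X)"
    then have "ip (H' - ?H) (H' - ?H) = 0"
      using H by (simp add: bilinear_lsub[OF bl])
    then show "H' = ?H" using pos[of "H' - ?H"] by force
  qed
  show "trace_on UNIV (br x) = ip (mean_curvature_vector br ip) x"
    using H * by simp
qed

text \<open>The Ricci form is defined with a chosen orthonormal basis; each of its sums is the trace of a
  bilinear form, so any orthonormal basis gives the same value.\<close>

lemma ricci_eq:
  assumes ip: "inner_product ip" and E: "orthonormal_basis ip E" "finite E"
  shows "ricci br ip X =
    - ip (br (mean_curvature_vector br ip) X) X
    - 1/2 * (\<Sum>e\<in>E. ip (br X (br X e)) e)
    - 1/2 * (\<Sum>e\<in>E. ip (br X e) (br X e))
    + 1/4 * (\<Sum>e\<in>E. \<Sum>e'\<in>E. (ip (br e e') X)\<^sup>2)"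
proof -
  let ?F = "SOME E. orthonormal_basis ip E"
  have bl: "bilinear ip" using ip unfolding inner_product_def by auto
  have "orthonormal_basis ip ?F" using E(1) by (rule someI)
  moreover from this have "finite ?F"
    using finite_independent orthonormal_independent[OF ip] unfolding orthonormal_basis_alt by auto
  ultimately have F: "orthonormal_basis ip ?F" "finite ?F" .
  have inv: "(\<Sum>e\<in>?F. q e e) = (\<Sum>e\<in>E. q e e)" if "bilinear q" for q :: "'a \<Rightarrow> 'a \<Rightarrow> real"
    by (rule orthonormal_sum_invariant[OF ip that F E])
  have lin_ip: "linear (\<lambda>x. ip (f x) y)" if "linear f" for f :: "'a \<Rightarrow> 'a" and y
    using linear_compose[OF that bilinearD(1)[OF bl, of y]] by (simp add: o_def)
  have 1: "(\<Sum>e\<in>?F. ip (br X e) (br X e)) = (\<Sum>e\<in>E. ip (br X e) (br X e))"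
    by (rule inv, rule bilinear_compose[OF bl lin lin])
  have 2: "(\<Sum>e\<in>?F. \<Sum>e'\<in>?F. (ip (br e e') X)\<^sup>2) = (\<Sum>e\<in>E. \<Sum>e'\<in>E. (ip (br e e') X)\<^sup>2)"
  proof -
    have "(\<Sum>e\<in>?F. \<Sum>e'\<in>?F. ip (br e e') X * ip (br e e') X) = (\<Sum>e\<in>?F. \<Sum>e'\<in>E. ip (br e e') X * ip (br e e') X)"
      by (rule sum.cong[OF refl], rule inv, intro bilinear_times lin_ip lin)
    also have "\<dots> = (\<Sum>e'\<in>E. \<Sum>e\<in>?F. ip (br e e') X * ip (br e e') X)" by (rule sum.swap)
    also have "\<dots> = (\<Sum>e'\<in>E. \<Sum>e\<in>E. ip (br e e') X * ip (br e e') X)"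
      by (rule sum.cong[OF refl], rule inv, intro bilinear_times lin_ip lin')
    also have "\<dots> = (\<Sum>e\<in>E. \<Sum>e'\<in>E. ip (br e e') X * ip (br e e') X)" by (rule sum.swap)
    finally show ?thesis by (simp add: power2_eq_square)
  qed
  have 3: "killing_form br X X = (\<Sum>e\<in>E. ip (br X (br X e)) e)"
    unfolding killing_form_def
    using orthonormal_trace[OF ip _ E(2) linear_compose[OF lin lin, unfolded o_def]] E
    unfolding orthonormal_basis_alt by simp
  show ?thesis unfolding ricci_def Let_def 1 2 3 ..
qed

section \<open>The trace obstruction\<close>

text \<open>Sum the Ricci form over an orthonormal basis \<open>F\<close> of \<open>h\<close>, extended to \<open>E\<close>. The Killing term drops
  out because \<open>ad f\<close> maps into \<open>h\<close> and kills it. Let \<open>S\<close> be the sum of the squared norms of the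
  brackets of \<open>F\<close> with \<open>E\<close>. The third term of the Ricci form contributes \<open>- S / 2\<close>, and the fourth at
  least \<open>S / 2\<close>: a bracket of \<open>f\<close> and \<open>e\<close> is counted in both orders, and other pairs from \<open>E\<close> only add
  to it. So a negative sum needs a positive trace.\<close>

lemma abelian_ideal_trace_pos:
  fixes ip :: "'a \<Rightarrow> 'a \<Rightarrow> real"
  assumes ip: "inner_product ip" and neg: "negative_ricci br ip"
    and h: "lie_ideal br h" "h \<noteq> {0}" and abelian: "\<And>x y. x \<in> h \<Longrightarrow> y \<in> h \<Longrightarrow> br x y = 0"
  shows "0 < trace_on h (br (mean_curvature_vector br ip))"
proof -
  let ?H = "mean_curvature_vector br ip"
  have bl: "bilinear ip" using ip unfolding inner_product_def by auto
  have sh: "subspace h" and ideal: "\<And>x y. y \<in> h \<Longrightarrow> br x y \<in> h"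
    using h unfolding lie_ideal_def by auto
  have ideal': "br x y \<in> h" if "x \<in> h" for x y
    using ideal[OF that, of y] skew[of x y] sh subspace_neg by metis
  obtain B where B: "B \<subseteq> h" "independent B" "h \<subseteq> span B"
    using real_vector.maximal_independent_subset[of h] by auto
  then have "finite B" "span B = h"
    using finite_independent sh by (auto simp: span_minimal subset_antisym)
  then obtain F where F: "finite F" "orthonormal ip F" "span F = h"
    using orthonormal_extension[OF ip, of "{}" B] by (auto simp: orthonormal_def)
  obtain C where "finite C" "span C = (UNIV::'a set)" using fin_dim by auto
  then obtain E where E: "F \<subseteq> E" "finite E" "orthonormal ip E" "span E = UNIV"
    using orthonormal_extension[OF ip F(2,1), of C] real_vector.span_Un[of F C]
    by (metis (no_types, lifting) Un_upper2 real_vector.span_mono top.extremum_uniqueI)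
  have E': "orthonormal_basis ip E" using E unfolding orthonormal_basis_alt by auto
  have Fh: "f \<in> h" if "f \<in> F" for f using F(3) that span_base by auto
  define S where "S = (\<Sum>f\<in>F. \<Sum>e\<in>E. ip (br f e) (br f e))"
  (* The squared norm of the component in h of the bracket of e and e'. *)
  define g where "g e e' = (\<Sum>f\<in>F. (ip (br e e') f)\<^sup>2)" for e e'
  have g0: "0 \<le> g e e'" for e e' unfolding g_def by (intro sum_nonneg) auto
  have gsym: "g e e' = g e' e" for e e'
    unfolding g_def using skew[of e e'] by (simp add: bilinear_simps[OF bl])
  have gF: "g f e = ip (br f e) (br f e)" if "f \<in> F" for f e
    unfolding g_def using parseval[OF ip F(2,1), of "br f e" "br f e"] ideal'[OF Fh[OF that]] F(3)
    by (simp add: power2_eq_square)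
  have S1: "(\<Sum>f\<in>F. \<Sum>e\<in>E. g f e) = S" unfolding S_def using gF by simp
  have "(\<Sum>e\<in>E-F. \<Sum>f\<in>F. g e f) = (\<Sum>f\<in>F. \<Sum>e\<in>E-F. g f e)"
    by (subst sum.swap) (simp add: gsym)
  also have "\<dots> = (\<Sum>f\<in>F. \<Sum>e\<in>E. g f e)"
  proof (rule sum.cong[OF refl], rule sum.mono_neutral_left)
    fix f assume f: "f \<in> F"
    show "\<forall>e\<in>E - (E - F). g f e = 0"
    proof
      fix e assume "e \<in> E - (E - F)"
      then have "br f e = 0" using abelian[OF Fh[OF f] Fh] by auto
      then show "g f e = 0" using gF[OF f] by (simp add: bilinear_simps[OF bl])
    qed
  qed (use E in auto)
  finally have S2: "(\<Sum>e\<in>E-F. \<Sum>f\<in>F. g e f) = S" using S1 by simp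
  have "(\<Sum>e\<in>E. \<Sum>e'\<in>E. g e e') = (\<Sum>e\<in>F. \<Sum>e'\<in>E. g e e') + (\<Sum>e\<in>E-F. \<Sum>e'\<in>E. g e e')"
    using sum.subset_diff[OF E(1,2), of "\<lambda>e. \<Sum>e'\<in>E. g e e'"] by (simp add: add.commute)
  moreover have "(\<Sum>e\<in>E-F. \<Sum>f\<in>F. g e f) \<le> (\<Sum>e\<in>E-F. \<Sum>e'\<in>E. g e e')"
    using E g0 by (intro sum_mono sum_mono2) auto
  ultimately have S3: "2 * S \<le> (\<Sum>e\<in>E. \<Sum>e'\<in>E. g e e')" using S1 S2 by linarith
  have nilsq: "br f (br f e) = 0" if "f \<in> F" for f e
    using abelian[OF Fh[OF that] ideal'[OF Fh[OF that]]] .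
  have "(\<Sum>f\<in>F. ricci br ip f) = - (\<Sum>f\<in>F. ip (br ?H f) f) - 1/2 * S + 1/4 * (\<Sum>f\<in>F. \<Sum>e\<in>E. \<Sum>e'\<in>E. (ip (br e e') f)\<^sup>2)"
    unfolding S_def ricci_eq[OF ip E' E(2)]
    by (simp add: sum.distrib sum_subtractf sum_negf sum_distrib_left nilsq bilinear_simps[OF bl])
  moreover have "(\<Sum>f\<in>F. \<Sum>e\<in>E. \<Sum>e'\<in>E. (ip (br e e') f)\<^sup>2) = (\<Sum>e\<in>E. \<Sum>e'\<in>E. g e e')"
    unfolding g_def by (subst sum.swap, rule sum.cong[OF refl], rule sum.swap)
  moreover have "(\<Sum>f\<in>F. ip (br ?H f) f) = trace_on h (br ?H)"
    using orthonormal_trace[OF ip F(2,1) lin, of ?H] ideal Fh F(3) by auto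
  moreover have "(\<Sum>f\<in>F. ricci br ip f) < 0"
  proof -
    have "F \<noteq> {}" using F(3) h(2) by auto
    moreover have "0 \<notin> F" using F(2) bilinear_simps[OF bl] unfolding orthonormal_def by force
    ultimately show ?thesis
      using neg F(1) unfolding negative_ricci_def
      by (metis (no_types, lifting) sum_negf neg_0_less_iff_less sum_pos)
  qed
  ultimately show ?thesis using S3 by linarith
qed

end

section \<open>The Ricci form in terms of structure constants\<close>

lemma coord_nonzero:
  assumes "frame I e S" "v \<in> S" "v \<noteq> 0"
  shows "\<exists>i\<in>I. coord I e v i \<noteq> 0"
proof (rule ccontr)
  assume "\<not> ?thesis"
  then have "v = 0" using coord_expand[OF assms(1,2)] by simp
  then show False using assms(3) by simp
qed

lemma sum_rotate:
  "(\<Sum>k\<in>A. \<Sum>l\<in>B. \<Sum>i\<in>C. f k l i) = (\<Sum>i\<in>C. \<Sum>k\<in>A. \<Sum>l\<in>B. f k l i)"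
proof -
  have "(\<Sum>k\<in>A. \<Sum>l\<in>B. \<Sum>i\<in>C. f k l i) = (\<Sum>k\<in>A. \<Sum>i\<in>C. \<Sum>l\<in>B. f k l i)"
    by (rule sum.cong[OF refl], rule sum.swap)
  also have "\<dots> = (\<Sum>i\<in>C. \<Sum>k\<in>A. \<Sum>l\<in>B. f k l i)" by (rule sum.swap)
  finally show ?thesis .
qed

lemma sum_swap_pairs:
  "(\<Sum>k\<in>A. \<Sum>l\<in>B. \<Sum>i\<in>C. \<Sum>j\<in>D. f k l i j) = (\<Sum>i\<in>C. \<Sum>j\<in>D. \<Sum>k\<in>A. \<Sum>l\<in>B. f k l i j)"
  by (subst sum_rotate) (rule sum.cong[OF refl], rule sum_rotate)

text \<open>The inner product in which the frame \<open>e\<close> is orthonormal.\<close>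

definition inner_of :: "'i set \<Rightarrow> ('i \<Rightarrow> 'a::real_vector) \<Rightarrow> 'a \<Rightarrow> 'a \<Rightarrow> real" where
  "inner_of I e x y = (\<Sum>i\<in>I. coord I e x i * coord I e y i)"

lemma inner_of_basis:
  assumes e: "frame I e UNIV" and i: "i \<in> I"
  shows "inner_of I e v (e i) = coord I e v i"
proof -
  have "inner_of I e v (e i) = (\<Sum>j\<in>I. if j = i then coord I e v j else 0)"
    unfolding inner_of_def using i by (intro sum.cong) (auto simp: coord_basis[OF e])
  then show ?thesis using e i unfolding frame_def by simp
qed

lemma inner_product_inner_of:
  assumes e: "frame I e UNIV"
  shows "inner_product (inner_of I e)"
  unfolding inner_product_def
proof (intro conjI allI impI)
  have fin: "finite I" using e unfolding frame_def by auto
  show "bilinear (inner_of I e)"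
    unfolding bilinear_def inner_of_def
    by (intro conjI allI linearI)
      (simp_all add: coord_add[OF e] coord_scale[OF e] sum.distrib sum_distrib_left algebra_simps)
  show "inner_of I e x y = inner_of I e y x" for x y
    unfolding inner_of_def by (simp add: mult.commute)
  fix x :: 'b assume "x \<noteq> 0"
  then obtain i where "i \<in> I" "coord I e x i \<noteq> 0"
    using coord_nonzero[OF e] by auto
  then show "0 < inner_of I e x x"
    unfolding inner_of_def using fin
    by (intro sum_pos2[of I i]) (auto simp: zero_less_mult_iff linorder_neq_iff)
qed

lemma orthonormal_basis_inner_of:
  assumes e: "frame I e UNIV"
  shows "orthonormal_basis (inner_of I e) (e ` I)" "finite (e ` I)"
proof -
  have "inj_on e I" "span (e ` I) = UNIV" "finite I" using e unfolding frame_def by auto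
  then show "orthonormal_basis (inner_of I e) (e ` I)" "finite (e ` I)"
    unfolding orthonormal_basis_def
    using inner_of_basis[OF e] coord_basis[OF e] by (auto simp: inj_on_def)
qed

lemma combine_quadratic_forms:
  fixes f g h k :: "'i \<Rightarrow> 'i \<Rightarrow> real"
  shows "- (\<Sum>i\<in>I. \<Sum>j\<in>I. f i j * x i * x j) - 1/2 * (\<Sum>i\<in>I. \<Sum>j\<in>I. g i j * x i * x j)
      - 1/2 * (\<Sum>i\<in>I. \<Sum>j\<in>I. h i j * x i * x j) + 1/4 * (\<Sum>i\<in>I. \<Sum>j\<in>I. k i j * x i * x j)
    = (\<Sum>i\<in>I. \<Sum>j\<in>I. (- f i j - 1/2 * g i j - 1/2 * h i j + 1/4 * k i j) * x i * x j)"
  by (simp add: left_diff_distrib distrib_right sum.distrib sum_subtractf sum_negf mult.assoc sum_distrib_left)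

text \<open>The matrix of the Ricci form in an orthonormal basis with brackets
  \<open>[e i, e j] = (\<Sum>k. c i j k e k)\<close>; its four lines are the four terms of the Ricci form.\<close>

definition ric_matrix :: "'i set \<Rightarrow> ('i \<Rightarrow> 'i \<Rightarrow> 'i \<Rightarrow> real) \<Rightarrow> 'i \<Rightarrow> 'i \<Rightarrow> real" where
  "ric_matrix I c i j =
     - (\<Sum>a\<in>I. (\<Sum>b\<in>I. c a b b) * c a i j)
     - 1/2 * (\<Sum>k\<in>I. \<Sum>l\<in>I. c i k l * c j l k)
     - 1/2 * (\<Sum>k\<in>I. \<Sum>l\<in>I. c i k l * c j k l)
     + 1/4 * (\<Sum>k\<in>I. \<Sum>l\<in>I. c k l i * c k l j)"

context lie
begin

lemma coord_bracket:
  assumes e: "frame I e UNIV"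
  shows "coord I e (br (\<Sum>i\<in>I. x i *\<^sub>R e i) v) k = (\<Sum>i\<in>I. x i * coord I e (br (e i) v) k)"
    and "coord I e (br v (\<Sum>i\<in>I. x i *\<^sub>R e i)) k = (\<Sum>i\<in>I. x i * coord I e (br v (e i)) k)"
  by (simp_all add: br_sums coord_setsum[OF e] coord_scale[OF e])

text \<open>In an orthonormal frame the mean curvature vector has the coordinates \<open>\<Sum>b. c a b b\<close>, and every
  term of the Ricci form becomes a sum of products of two structure constants; only the order of
  summation has to be changed.\<close>

lemma ricci_ric_matrix:
  fixes e :: "'i \<Rightarrow> 'a"
  assumes e: "frame I e UNIV"
  defines "c \<equiv> \<lambda>i j. coord I e (br (e i) (e j))"
  shows "ricci br (inner_of I e) (\<Sum>i\<in>I. x i *\<^sub>R e i) = (\<Sum>i\<in>I. \<Sum>j\<in>I. ric_matrix I c i j * x i * x j)"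
proof -
  let ?ip = "inner_of I e" and ?X = "\<Sum>i\<in>I. x i *\<^sub>R e i"
  note ip = inner_product_inner_of[OF e] and onb = orthonormal_basis_inner_of[OF e]
  have bl: "bilinear ?ip" using ip unfolding inner_product_def by auto
  have inj: "inj_on e I" using e unfolding frame_def by auto
  have tr: "trace_on UNIV (br v) = (\<Sum>b\<in>I. coord I e (br v (e b)) b)" for v
    using trace_on_frame[OF e lin] by simp
  have H: "mean_curvature_vector br ?ip = (\<Sum>a\<in>I. (\<Sum>b\<in>I. c a b b) *\<^sub>R e a)"
    unfolding mean_curvature_vector_eq(1)[OF ip onb] by (simp add: sum.reindex[OF inj] tr c_def)
  have ipX: "?ip v ?X = (\<Sum>i\<in>I. x i * coord I e v i)" for v
    by (simp add: bilinear_sums[OF bl] inner_of_basis[OF e])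
  have t1: "?ip (br (mean_curvature_vector br ?ip) ?X) ?X
      = (\<Sum>i\<in>I. \<Sum>j\<in>I. (\<Sum>a\<in>I. (\<Sum>b\<in>I. c a b b) * c a i j) * x i * x j)"
  proof -
    have "?ip (br (mean_curvature_vector br ?ip) ?X) ?X
      = (\<Sum>j\<in>I. x j * (\<Sum>i\<in>I. x i * (\<Sum>a\<in>I. (\<Sum>b\<in>I. c a b b) * c a i j)))"
      unfolding ipX H by (simp add: coord_bracket[OF e] c_def)
    also have "\<dots> = (\<Sum>j\<in>I. \<Sum>i\<in>I. \<Sum>a\<in>I. (\<Sum>b\<in>I. c a b b) * c a i j * x i * x j)"
      by (simp add: sum_distrib_left sum_distrib_right mult_ac)
    also have "\<dots> = (\<Sum>i\<in>I. \<Sum>j\<in>I. \<Sum>a\<in>I. (\<Sum>b\<in>I. c a b b) * c a i j * x i * x j)"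
      by (rule sum.swap)
    finally show ?thesis by (simp add: sum_distrib_right)
  qed
  have cX: "coord I e (br ?X (e k)) l = (\<Sum>i\<in>I. x i * c i k l)" for k l
    by (simp add: coord_bracket[OF e] c_def)
  have t2: "(\<Sum>v\<in>e ` I. ?ip (br ?X (br ?X v)) v) = (\<Sum>i\<in>I. \<Sum>j\<in>I. (\<Sum>k\<in>I. \<Sum>l\<in>I. c i k l * c j l k) * x i * x j)"
  proof -
    have "(\<Sum>v\<in>e ` I. ?ip (br ?X (br ?X v)) v) = (\<Sum>k\<in>I. coord I e (br ?X (br ?X (e k))) k)"
      by (simp add: sum.reindex[OF inj] inner_of_basis[OF e])
    also have "\<dots> = (\<Sum>k\<in>I. \<Sum>l\<in>I. (\<Sum>i\<in>I. x i * c i k l) * (\<Sum>j\<in>I. x j * c j l k))"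
    proof (rule sum.cong[OF refl])
      fix k assume "k \<in> I"
      have "coord I e (br ?X (br ?X (e k))) k = coord I e (br ?X (\<Sum>l\<in>I. coord I e (br ?X (e k)) l *\<^sub>R e l)) k"
        using coord_expand[OF e, of "br ?X (e k)"] by simp
      also have "\<dots> = (\<Sum>l\<in>I. coord I e (br ?X (e k)) l * coord I e (br ?X (e l)) k)"
        by (rule coord_bracket(2)[OF e])
      finally show "coord I e (br ?X (br ?X (e k))) k = (\<Sum>l\<in>I. (\<Sum>i\<in>I. x i * c i k l) * (\<Sum>j\<in>I. x j * c j l k))"
        unfolding cX .
    qed
    also have "\<dots> = (\<Sum>k\<in>I. \<Sum>l\<in>I. \<Sum>i\<in>I. \<Sum>j\<in>I. c i k l * c j l k * x i * x j)"
      by (simp add: sum_product mult_ac)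
    also have "\<dots> = (\<Sum>i\<in>I. \<Sum>j\<in>I. \<Sum>k\<in>I. \<Sum>l\<in>I. c i k l * c j l k * x i * x j)"
      by (rule sum_swap_pairs)
    finally show ?thesis by (simp add: sum_distrib_right)
  qed
  have t3: "(\<Sum>v\<in>e ` I. ?ip (br ?X v) (br ?X v)) = (\<Sum>i\<in>I. \<Sum>j\<in>I. (\<Sum>k\<in>I. \<Sum>l\<in>I. c i k l * c j k l) * x i * x j)"
  proof -
    have "(\<Sum>v\<in>e ` I. ?ip (br ?X v) (br ?X v)) = (\<Sum>k\<in>I. \<Sum>l\<in>I. (\<Sum>i\<in>I. x i * c i k l) * (\<Sum>j\<in>I. x j * c j k l))"
      by (simp add: sum.reindex[OF inj] inner_of_def cX)
    also have "\<dots> = (\<Sum>k\<in>I. \<Sum>l\<in>I. \<Sum>i\<in>I. \<Sum>j\<in>I. c i k l * c j k l * x i * x j)"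
      by (simp add: sum_product mult_ac)
    also have "\<dots> = (\<Sum>i\<in>I. \<Sum>j\<in>I. \<Sum>k\<in>I. \<Sum>l\<in>I. c i k l * c j k l * x i * x j)"
      by (rule sum_swap_pairs)
    finally show ?thesis by (simp add: sum_distrib_right)
  qed
  have t4: "(\<Sum>v\<in>e ` I. \<Sum>w\<in>e ` I. (?ip (br v w) ?X)\<^sup>2) = (\<Sum>i\<in>I. \<Sum>j\<in>I. (\<Sum>k\<in>I. \<Sum>l\<in>I. c k l i * c k l j) * x i * x j)"
  proof -
    have "(\<Sum>v\<in>e ` I. \<Sum>w\<in>e ` I. (?ip (br v w) ?X)\<^sup>2) = (\<Sum>k\<in>I. \<Sum>l\<in>I. (\<Sum>i\<in>I. x i * c k l i) * (\<Sum>j\<in>I. x j * c k l j))"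
      by (simp add: sum.reindex[OF inj] ipX c_def power2_eq_square)
    also have "\<dots> = (\<Sum>k\<in>I. \<Sum>l\<in>I. \<Sum>i\<in>I. \<Sum>j\<in>I. c k l i * c k l j * x i * x j)"
      by (simp add: sum_product mult_ac)
    also have "\<dots> = (\<Sum>i\<in>I. \<Sum>j\<in>I. \<Sum>k\<in>I. \<Sum>l\<in>I. c k l i * c k l j * x i * x j)"
      by (rule sum_swap_pairs)
    finally show ?thesis by (simp add: sum_distrib_right)
  qed
  show ?thesis
    unfolding ricci_eq[OF ip onb] t1 t2 t3 t4 ric_matrix_def by (rule combine_quadratic_forms)
qed

lemma negative_ricci_of_matrix:
  fixes e :: "'i \<Rightarrow> 'a"
  assumes e: "frame I e UNIV"
    and neg: "\<And>x. \<exists>i\<in>I. x i \<noteq> 0 \<Longrightarrow>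
      (\<Sum>i\<in>I. \<Sum>j\<in>I. ric_matrix I (\<lambda>i j. coord I e (br (e i) (e j))) i j * x i * x j) < 0"
  shows "inner_product (inner_of I e) \<and> negative_ricci br (inner_of I e)"
proof -
  have "ricci br (inner_of I e) X < 0" if "X \<noteq> 0" for X
  proof -
    have X: "X = (\<Sum>i\<in>I. coord I e X i *\<^sub>R e i)" using coord_expand[OF e, of X] by simp
    have "\<exists>i\<in>I. coord I e X i \<noteq> 0" using coord_nonzero[OF e _ that] by simp
    from neg[OF this] show ?thesis
      using ricci_ric_matrix[OF e, of "coord I e X"] X by simp
  qed
  then show ?thesis using inner_product_inner_of[OF e] unfolding negative_ricci_def by simp
qed

end

text \<open>A perturbation with entries below \<open>\<delta>\<close> changes a quadratic form by at most
  \<open>\<delta> * card I * (\<Sum>i. (x i)\<^sup>2)\<close>, because \<open>2 \<bar>x y\<bar> \<le> x\<^sup>2 + y\<^sup>2\<close>; this is less than the gap \<open>\<kappa>\<close> of a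
  negative diagonal form.\<close>

lemma negative_form_perturbation:
  fixes M :: "'q \<Rightarrow> 'i \<Rightarrow> 'i \<Rightarrow> real"
  assumes fin: "finite I"
    and lim: "\<And>i j. i \<in> I \<Longrightarrow> j \<in> I \<Longrightarrow> ((\<lambda>q. M q i j) \<longlongrightarrow> L i j) F"
    and diag: "\<And>i j. i \<in> I \<Longrightarrow> j \<in> I \<Longrightarrow> i \<noteq> j \<Longrightarrow> L i j = 0"
    and neg: "\<And>i. i \<in> I \<Longrightarrow> L i i < 0"
  shows "\<forall>\<^sub>F q in F. \<forall>x. (\<exists>i\<in>I. x i \<noteq> 0) \<longrightarrow> (\<Sum>i\<in>I. \<Sum>j\<in>I. M q i j * x i * x j) < 0"
proof (cases "I = {}")
  case False
  define \<kappa> where "\<kappa> = Min ((\<lambda>i. - L i i) ` I)"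
  have \<kappa>: "0 < \<kappa>" "\<And>i. i \<in> I \<Longrightarrow> \<kappa> \<le> - L i i"
    unfolding \<kappa>_def using fin False neg by auto
  define \<delta> where "\<delta> = \<kappa> / (real (card I) + 1)"
  have \<delta>: "0 < \<delta>" "\<delta> * card I < \<kappa>" unfolding \<delta>_def using \<kappa> by (auto simp: field_simps)
  have "\<forall>\<^sub>F q in F. \<forall>i\<in>I. \<forall>j\<in>I. dist (M q i j) (L i j) < \<delta>"
    using fin lim \<delta> by (intro eventually_ball_finite ballI) (auto dest: tendstoD)
  then show ?thesis
  proof (rule eventually_mono, intro allI impI)
    fix q x assume close: "\<forall>i\<in>I. \<forall>j\<in>I. dist (M q i j) (L i j) < \<delta>" and x: "\<exists>i\<in>I. x i \<noteq> (0::real)"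
    have "(\<Sum>i\<in>I. \<Sum>j\<in>I. M q i j * x i * x j) \<le> (\<Sum>i\<in>I. \<Sum>j\<in>I. L i j * x i * x j + \<delta> * ((x i)\<^sup>2 + (x j)\<^sup>2) / 2)"
    proof (intro sum_mono)
      fix i j assume ij: "i \<in> I" "j \<in> I"
      have "(M q i j - L i j) * (x i * x j) \<le> \<bar>M q i j - L i j\<bar> * \<bar>x i * x j\<bar>"
        by (metis abs_ge_self abs_mult)
      also have "\<dots> \<le> \<delta> * (((x i)\<^sup>2 + (x j)\<^sup>2) / 2)"
      proof (intro mult_mono)
        show "\<bar>M q i j - L i j\<bar> \<le> \<delta>" using close ij by (auto simp: dist_real_def less_imp_le)
        show "\<bar>x i * x j\<bar> \<le> ((x i)\<^sup>2 + (x j)\<^sup>2) / 2"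
          using sum_squares_bound[of "\<bar>x i\<bar>" "\<bar>x j\<bar>"] by (simp add: abs_mult)
      qed (use \<delta> in auto)
      finally show "M q i j * x i * x j \<le> L i j * x i * x j + \<delta> * ((x i)\<^sup>2 + (x j)\<^sup>2) / 2"
        by (simp add: field_simps)
    qed
    also have "\<dots> = (\<Sum>i\<in>I. \<Sum>j\<in>I. L i j * x i * x j) + (\<Sum>i\<in>I. \<Sum>j\<in>I. \<delta> * (x i)\<^sup>2 / 2) + (\<Sum>i\<in>I. \<Sum>j\<in>I. \<delta> * (x j)\<^sup>2 / 2)"
      by (simp add: sum.distrib ring_distribs add_divide_distrib)
    also have "(\<Sum>i\<in>I. \<Sum>j\<in>I. L i j * x i * x j) = (\<Sum>i\<in>I. L i i * (x i)\<^sup>2)"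
    proof (rule sum.cong[OF refl])
      fix i assume i: "i \<in> I"
      have "(\<Sum>j\<in>I. L i j * x i * x j) = (\<Sum>j\<in>I. if j = i then L i i * (x i)\<^sup>2 else 0)"
        using diag i by (intro sum.cong) (auto simp: power2_eq_square)
      then show "(\<Sum>j\<in>I. L i j * x i * x j) = L i i * (x i)\<^sup>2" using fin i by simp
    qed
    also have "(\<Sum>i\<in>I. \<Sum>j\<in>I. \<delta> * (x j)\<^sup>2 / 2) = (\<Sum>i\<in>I. \<Sum>j\<in>I. \<delta> * (x i)\<^sup>2 / 2)"
      by (rule sum.swap)
    also have "(\<Sum>i\<in>I. L i i * (x i)\<^sup>2) + (\<Sum>i\<in>I. \<Sum>j\<in>I. \<delta> * (x i)\<^sup>2 / 2) + (\<Sum>i\<in>I. \<Sum>j\<in>I. \<delta> * (x i)\<^sup>2 / 2)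
       = (\<Sum>i\<in>I. (L i i + \<delta> * card I) * (x i)\<^sup>2)"
      unfolding sum.distrib[symmetric] by (intro sum.cong refl) (simp add: algebra_simps)
    also have "\<dots> < 0"
    proof -
      obtain i where i: "i \<in> I" "x i \<noteq> 0" using x by auto
      have neg': "L i i + \<delta> * card I < 0" if "i \<in> I" for i
        using \<kappa>(2)[OF that] \<delta>(2) by linarith
      have "0 < (\<Sum>i\<in>I. - ((L i i + \<delta> * card I) * (x i)\<^sup>2))"
        using fin neg' i by (intro sum_pos2[of I i]) (auto simp: mult_less_0_iff mult_le_0_iff less_imp_le)
      then show ?thesis by (simp add: sum_negf)
    qed
    finally show "(\<Sum>i\<in>I. \<Sum>j\<in>I. M q i j * x i * x j) < 0" .
  qed
qed auto

section \<open>Limits of semidirect products\<close>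

text \<open>The Ricci matrix of a semidirect product of an abelian algebra with basis \<open>P\<close> and an ideal with
  basis \<open>J\<close> and structure constants \<open>v\<close>, after scaling the vector \<open>u\<close> of \<open>P\<close> by \<open>w u\<close> and dividing the
  entry at \<open>i, j\<close> by \<open>w i * w j\<close>. In this form \<open>w\<close> may tend to zero.\<close>

definition semidirect_form ::
  "'i set \<Rightarrow> 'i set \<Rightarrow> ('i \<Rightarrow> real) \<Rightarrow> ('i \<Rightarrow> 'i \<Rightarrow> 'i \<Rightarrow> real) \<Rightarrow> 'i \<Rightarrow> 'i \<Rightarrow> real" where
  "semidirect_form P J w v i j =
     (if i \<in> P \<or> j \<in> P then - 1/2 * (\<Sum>k\<in>J. \<Sum>l\<in>J. v i k l * (v j l k + v j k l))
      else - (\<Sum>u\<in>P. (w u)\<^sup>2 * (\<Sum>b\<in>J. v u b b) * v u i j)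
        - 1/2 * (\<Sum>k\<in>J. \<Sum>l\<in>J. v i k l * v j l k)
        - 1/2 * (\<Sum>k\<in>J. \<Sum>l\<in>J. v i k l * v j k l)
        + 1/4 * (\<Sum>k\<in>J. \<Sum>l\<in>J. v k l i * v k l j)
        - 1/2 * (\<Sum>u\<in>P. (w u)\<^sup>2 * (\<Sum>l\<in>J. v u i l * v u j l - v u l i * v u l j)))"

text \<open>Brackets never have components in \<open>P\<close>, and the trace of \<open>ad i\<close> vanishes for \<open>i\<close> in \<open>J\<close>. Hence the
  factor \<open>w i * w j\<close> splits off from every sum; elsewhere only the squares \<open>(w u)\<^sup>2\<close> remain.\<close>

lemma ric_matrix_semidirect:
  fixes v :: "'i \<Rightarrow> 'i \<Rightarrow> 'i \<Rightarrow> real"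
  assumes fin: "finite P" "finite J" and disj: "P \<inter> J = {}"
    and w: "\<And>i. i \<in> J \<Longrightarrow> w i = 1"
    and skew: "\<And>i j k. i \<in> P \<union> J \<Longrightarrow> j \<in> P \<union> J \<Longrightarrow> k \<in> P \<union> J \<Longrightarrow> v i j k = - v j i k"
    and target: "\<And>i j u. i \<in> P \<union> J \<Longrightarrow> j \<in> P \<union> J \<Longrightarrow> u \<in> P \<Longrightarrow> v i j u = 0"
    and abelian: "\<And>u u' k. u \<in> P \<Longrightarrow> u' \<in> P \<Longrightarrow> k \<in> P \<union> J \<Longrightarrow> v u u' k = 0"
    and unimodular: "\<And>i. i \<in> J \<Longrightarrow> (\<Sum>k\<in>J. v i k k) = 0"
    and ij: "i \<in> P \<union> J" "j \<in> P \<union> J"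
  shows "ric_matrix (P \<union> J) (\<lambda>i j k. w i * w j * v i j k) i j = w i * w j * semidirect_form P J w v i j"
proof -
  have split: "(\<Sum>k\<in>P \<union> J. g k) = (\<Sum>k\<in>P. g k) + (\<Sum>k\<in>J. g k)" for g :: "'i \<Rightarrow> real"
    using fin disj by (rule sum.union_disjoint)
  have abelian': "v u u' k = 0" if "u \<in> P" "u' \<in> P" "k \<in> J" for u u' k using abelian that by auto
  have target': "v i j u = 0" if "i \<in> J" "j \<in> J" "u \<in> P" for i j u using target that by auto
  have target'': "v i j u = 0" if "i \<in> P" "j \<in> J" "u \<in> P" for i j u using target that by auto
  have target''': "v i j u = 0" if "i \<in> J" "j \<in> P" "u \<in> P" for i j u using target that by auto
  have abelian'': "v u u' k = 0" if "u \<in> P" "u' \<in> P" "k \<in> P" for u u' k using abelian that by auto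
  note zeros = abelian' abelian'' target' target'' target'''
  have H: "(\<Sum>b\<in>P \<union> J. w a * w b * v a b b) = (if a \<in> P then w a * (\<Sum>b\<in>J. v a b b) else 0)"
    if "a \<in> P \<union> J" for a
    using that unimodular[of a] disj by (auto simp: split zeros w sum_distrib_left[symmetric])
  have sw: "v i u l = - v u i l" if "i \<in> J" "u \<in> P" "l \<in> J" for i u l using skew[of i u l] that by auto
  have t1: "(\<Sum>a\<in>P \<union> J. (\<Sum>b\<in>P \<union> J. w a * w b * v a b b) * (w a * w i * v a i j))
      = (\<Sum>u\<in>P. (w u)\<^sup>2 * w i * (\<Sum>b\<in>J. v u b b) * v u i j)"
  proof -
    have "(\<Sum>a\<in>P \<union> J. (\<Sum>b\<in>P \<union> J. w a * w b * v a b b) * (w a * w i * v a i j))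
       = (\<Sum>a\<in>P \<union> J. (if a \<in> P then w a * (\<Sum>b\<in>J. v a b b) else 0) * (w a * w i * v a i j))"
      by (rule sum.cong[OF refl]) (simp add: H)
    also have "\<dots> = (\<Sum>u\<in>P. (w u)\<^sup>2 * w i * (\<Sum>b\<in>J. v u b b) * v u i j) + (\<Sum>a\<in>J. 0)"
      unfolding split using disj by (intro arg_cong2[where f="(+)"] sum.cong) (auto simp: power2_eq_square)
    finally show ?thesis by simp
  qed
  consider "i \<in> P \<or> j \<in> P" | "i \<in> J" "j \<in> J" "i \<notin> P" "j \<notin> P" using ij disj by auto
  then show ?thesis
  proof cases
    case 1
    then have z: "v u i j = 0" if "u \<in> P" for u using ij that target abelian by auto
    have a: "(\<Sum>k\<in>P \<union> J. \<Sum>l\<in>P \<union> J. (w i * w k * v i k l) * (w j * w l * v j l k)) = w i * w j * (\<Sum>k\<in>J. \<Sum>l\<in>J. v i k l * v j l k)"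
      using ij 1 by (auto simp: split zeros w sum_distrib_left sum_distrib_right mult_ac)
    have b: "(\<Sum>k\<in>P \<union> J. \<Sum>l\<in>P \<union> J. (w i * w k * v i k l) * (w j * w k * v j k l)) = w i * w j * (\<Sum>k\<in>J. \<Sum>l\<in>J. v i k l * v j k l)"
      using ij 1 by (auto simp: split zeros w sum_distrib_left sum_distrib_right mult_ac)
    have d: "(\<Sum>k\<in>P \<union> J. \<Sum>l\<in>P \<union> J. (w k * w l * v k l i) * (w k * w l * v k l j)) = 0"
      using ij 1 by (auto simp: split zeros)
    show ?thesis
      unfolding ric_matrix_def a b d t1 semidirect_form_def using 1 z
      by (simp add: distrib_left sum.distrib algebra_simps)
  next
    case 2
    have a: "(\<Sum>k\<in>P \<union> J. \<Sum>l\<in>P \<union> J. (w i * w k * v i k l) * (w j * w l * v j l k)) = (\<Sum>k\<in>J. \<Sum>l\<in>J. v i k l * v j l k)"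
      using 2 by (auto simp: split zeros w)
    have b: "(\<Sum>k\<in>P \<union> J. \<Sum>l\<in>P \<union> J. (w i * w k * v i k l) * (w j * w k * v j k l))
      = (\<Sum>k\<in>J. \<Sum>l\<in>J. v i k l * v j k l) + (\<Sum>u\<in>P. (w u)\<^sup>2 * (\<Sum>l\<in>J. v u i l * v u j l))"
      using 2 by (simp add: split zeros w sw sum_distrib_left power2_eq_square mult_ac)
    have d0: "(\<Sum>k\<in>J. \<Sum>u\<in>P. (w u * v k u i) * (w u * v k u j)) = (\<Sum>u\<in>P. \<Sum>k\<in>J. (w u * v k u i) * (w u * v k u j))"
      by (rule sum.swap)
    have d: "(\<Sum>k\<in>P \<union> J. \<Sum>l\<in>P \<union> J. (w k * w l * v k l i) * (w k * w l * v k l j))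
      = (\<Sum>k\<in>J. \<Sum>l\<in>J. v k l i * v k l j) + 2 * (\<Sum>u\<in>P. (w u)\<^sup>2 * (\<Sum>l\<in>J. v u l i * v u l j))"
      using 2 d0 by (simp add: split zeros w sw sum.distrib sum_distrib_left power2_eq_square mult_ac)
    show ?thesis
      unfolding ric_matrix_def a b d t1 semidirect_form_def using 2
      by (simp add: w sum_subtractf right_diff_distrib algebra_simps)
  qed
qed

lemma tendsto_semidirect_form:
  assumes "\<And>i j k. i \<in> P \<union> J \<Longrightarrow> j \<in> P \<union> J \<Longrightarrow> k \<in> P \<union> J \<Longrightarrow> ((\<lambda>q. v q i j k) \<longlongrightarrow> v' i j k) F"
    and "\<And>u. u \<in> P \<Longrightarrow> ((\<lambda>q. w q u) \<longlongrightarrow> w' u) F"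
    and "i \<in> P \<union> J" "j \<in> P \<union> J"
  shows "((\<lambda>q. semidirect_form P J (w q) (v q) i j) \<longlongrightarrow> semidirect_form P J w' v' i j) F"
proof (cases "i \<in> P \<or> j \<in> P")
  case True
  then show ?thesis
    unfolding semidirect_form_def using assms by (simp only: if_True) (intro tendsto_intros; auto)
next
  case False
  then show ?thesis
    unfolding semidirect_form_def using assms by (simp only: if_False) (intro tendsto_intros; auto)
qed

lemma coord_rescale:
  assumes e: "frame I e S" and d: "\<And>i. i \<in> I \<Longrightarrow> d i \<noteq> 0" and v: "v \<in> S" and i: "i \<in> I"
  shows "coord I (\<lambda>i. d i *\<^sub>R e i) v i = coord I e v i / d i"
proof -
  have "v = (\<Sum>i\<in>I. coord I e v i *\<^sub>R e i)" using coord_expand[OF e v] by simp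
  also have "\<dots> = (\<Sum>i\<in>I. (coord I e v i / d i) *\<^sub>R (d i *\<^sub>R e i))"
    using d by (intro sum.cong) auto
  finally have v: "v = (\<Sum>i\<in>I. (coord I e v i / d i) *\<^sub>R (d i *\<^sub>R e i))" .
  have "frame I (\<lambda>i. d i *\<^sub>R e i) S" by (rule frame_rescale[OF e d])
  from coord_sum[OF this i, of "\<lambda>i. coord I e v i / d i"] show ?thesis
    using v by simp
qed

lemma tendsto_power_at_right_0:
  "((\<lambda>q::real. q ^ m) \<longlongrightarrow> (if m = 0 then 1 else 0)) (at_right 0)"
  by (cases "m = 0") (auto intro!: tendsto_eq_intros)

context lie
begin

text \<open>The basis vectors are scaled by \<open>w * s\<close>: the factor \<open>s\<close> changes the structure constants to \<open>v\<close>, the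
  factor \<open>w\<close> lengthens or shortens the vectors of \<open>P\<close>. Substituting \<open>w i * x i\<close> for \<open>x i\<close> shows that
  negativity of the Ricci form is negativity of \<open>semidirect_form\<close>, which is an open condition and can
  be tested in the limit, even where \<open>w'\<close> vanishes and the metrics themselves degenerate.\<close>

lemma negative_ricci_semidirect_limit:
  fixes e :: "'i \<Rightarrow> 'a" and P J :: "'i set" and s w :: "real \<Rightarrow> 'i \<Rightarrow> real"
  assumes e: "frame (P \<union> J) e UNIV" and disj: "P \<inter> J = {}"
    and target: "\<And>i j u. i \<in> P \<union> J \<Longrightarrow> j \<in> P \<union> J \<Longrightarrow> u \<in> P \<Longrightarrow> coord (P \<union> J) e (br (e i) (e j)) u = 0"
    and abelian: "\<And>u u'. u \<in> P \<Longrightarrow> u' \<in> P \<Longrightarrow> br (e u) (e u') = 0"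
    and diag0: "\<And>i k. i \<in> J \<Longrightarrow> k \<in> J \<Longrightarrow> coord (P \<union> J) e (br (e i) (e k)) k = 0"
    and s: "\<And>q i. 0 < q \<Longrightarrow> i \<in> P \<union> J \<Longrightarrow> s q i \<noteq> 0" "\<And>q i. i \<in> P \<Longrightarrow> s q i = 1"
    and w: "\<And>q i. 0 < q \<Longrightarrow> i \<in> P \<Longrightarrow> 0 < w q i" "\<And>q i. i \<in> J \<Longrightarrow> w q i = 1"
    and limv: "\<And>i j k. i \<in> P \<union> J \<Longrightarrow> j \<in> P \<union> J \<Longrightarrow> k \<in> P \<union> J \<Longrightarrow>
      ((\<lambda>q. coord (P \<union> J) e (br (e i) (e j)) k * (s q i * s q j / s q k)) \<longlongrightarrow> v' i j k) (at_right 0)"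
    and limw: "\<And>u. u \<in> P \<Longrightarrow> ((\<lambda>q. w q u) \<longlongrightarrow> w' u) (at_right 0)"
    and diag: "\<And>i j. i \<in> P \<union> J \<Longrightarrow> j \<in> P \<union> J \<Longrightarrow> i \<noteq> j \<Longrightarrow> semidirect_form P J w' v' i j = 0"
    and neg: "\<And>i. i \<in> P \<union> J \<Longrightarrow> semidirect_form P J w' v' i i < 0"
  shows "\<exists>ip. inner_product ip \<and> negative_ricci br ip"
proof -
  let ?I = "P \<union> J"
  define c where "c i j k = coord ?I e (br (e i) (e j)) k" for i j k
  define v where "v q i j k = c i j k * (s q i * s q j / s q k)" for q i j k
  have fin: "finite P" "finite J" using e unfolding frame_def by auto
  have "\<forall>\<^sub>F q in at_right 0. \<forall>x. (\<exists>i\<in>?I. x i \<noteq> 0) \<longrightarrow>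
      (\<Sum>i\<in>?I. \<Sum>j\<in>?I. semidirect_form P J (w q) (v q) i j * x i * x j) < 0"
  proof (rule negative_form_perturbation[where L="semidirect_form P J w' v'"])
    show "((\<lambda>q. semidirect_form P J (w q) (v q) i j) \<longlongrightarrow> semidirect_form P J w' v' i j) (at_right 0)"
      if "i \<in> ?I" "j \<in> ?I" for i j
      unfolding v_def c_def by (rule tendsto_semidirect_form[OF limv limw that])
  qed (use fin diag neg in auto)
  moreover have "\<forall>\<^sub>F q in at_right 0. (0::real) < q"
    by (simp add: eventually_at_right_less)
  ultimately obtain q :: real where q: "0 < q"
    and negq: "\<And>x. \<exists>i\<in>?I. x i \<noteq> 0 \<Longrightarrow> (\<Sum>i\<in>?I. \<Sum>j\<in>?I. semidirect_form P J (w q) (v q) i j * x i * x j) < 0"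
    using eventually_happens'[OF trivial_limit_at_right_real eventually_conj] by (smt (verit, best))
  define E where "E i = (w q i * s q i) *\<^sub>R e i" for i
  have ws: "w q i * s q i \<noteq> 0" if "i \<in> ?I" for i using that s q w(1)[of q i] w(2)[of i q] by force
  have E: "frame ?I E UNIV" unfolding E_def by (rule frame_rescale[OF e ws])
  have skew: "c i j k = - c j i k" for i j k
    using skew[of "e i" "e j"] coord_scale[OF e, of "br (e j) (e i)" "-1" k] unfolding c_def by simp
  have cE: "coord ?I E (br (E i) (E j)) k = w q i * w q j * v q i j k"
    if "i \<in> ?I" "j \<in> ?I" "k \<in> ?I" for i j k
  proof -
    have "coord ?I E (br (E i) (E j)) k = coord ?I e (br (E i) (E j)) k / (w q k * s q k)"
      unfolding E_def by (rule coord_rescale[OF e ws _ that(3)]) auto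
    also have "\<dots> = (w q i * s q i) * (w q j * s q j) * c i j k / (w q k * s q k)"
      unfolding E_def by (simp add: br_simps coord_scale[OF e] c_def)
    also have "\<dots> = w q i * w q j * v q i j k"
    proof (cases "k \<in> P")
      case True
      then show ?thesis using target[OF that(1,2)] by (simp add: c_def v_def)
    next
      case False
      then show ?thesis using w(2)[of k q] that unfolding v_def by simp
    qed
    finally show ?thesis .
  qed
  have ric: "ric_matrix ?I (\<lambda>i j. coord ?I E (br (E i) (E j))) i j = w q i * w q j * semidirect_form P J (w q) (v q) i j"
    if "i \<in> ?I" "j \<in> ?I" for i j
  proof -
    have "ric_matrix ?I (\<lambda>i j. coord ?I E (br (E i) (E j))) i j = ric_matrix ?I (\<lambda>i j k. w q i * w q j * v q i j k) i j"
      unfolding ric_matrix_def using cE that by simp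
    also have "\<dots> = w q i * w q j * semidirect_form P J (w q) (v q) i j"
    proof (rule ric_matrix_semidirect[OF fin disj])
      show "v q i j k = - v q j i k" for i j k unfolding v_def using skew[of i j k] by simp
      show "v q i j u = 0" if "i \<in> ?I" "j \<in> ?I" "u \<in> P" for i j u
        unfolding v_def c_def using target[OF that] by simp
      show "v q u u' k = 0" if "u \<in> P" "u' \<in> P" for u u' k
        unfolding v_def c_def using abelian[OF that] by (simp add: coord_zero)
      show "(\<Sum>k\<in>J. v q i k k) = 0" if "i \<in> J" for i
        unfolding v_def c_def using diag0[OF that] by simp
    qed (use w that in auto)
    finally show ?thesis .
  qed
  have "inner_product (inner_of ?I E) \<and> negative_ricci br (inner_of ?I E)"
  proof (rule negative_ricci_of_matrix[OF E])
    fix x :: "'i \<Rightarrow> real" assume "\<exists>i\<in>?I. x i \<noteq> 0"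
    moreover have "w q i \<noteq> 0" if "i \<in> ?I" for i using ws[OF that] by simp
    ultimately have "\<exists>i\<in>?I. w q i * x i \<noteq> 0" by auto
    from negq[OF this]
    show "(\<Sum>i\<in>?I. \<Sum>j\<in>?I. ric_matrix ?I (\<lambda>i j. coord ?I E (br (E i) (E j))) i j * x i * x j) < 0"
      by (simp add: ric mult_ac)
  qed
  then show ?thesis by blast
qed

text \<open>With \<open>s q i = d i / q ^ f i\<close> the constant \<open>c i j k\<close> is multiplied by \<open>d i * d j / d k\<close> and
  \<open>q ^ (f k - f i - f j)\<close>, so the limit for \<open>q\<close> to 0 is its part \<open>G d\<close> of degree zero. Since \<open>f\<close> is
  positive on \<open>J\<close> and zero on \<open>P\<close>, the condition on degrees also forces brackets to avoid \<open>P\<close> and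
  \<open>ad i\<close> to have zero diagonal for \<open>i\<close> in \<open>J\<close>.\<close>

lemma negative_ricci_graded_limit:
  fixes e :: "'i \<Rightarrow> 'a" and P J :: "'i set" and w :: "real \<Rightarrow> 'i \<Rightarrow> real" and f :: "'i \<Rightarrow> nat"
  defines "c \<equiv> \<lambda>i j. coord (P \<union> J) e (br (e i) (e j))"
  defines "G \<equiv> \<lambda>d i j k. if f i + f j = f k then c i j k * (d i * d j / d k) else 0"
  assumes e: "frame (P \<union> J) e UNIV" and disj: "P \<inter> J = {}"
    and abelian: "\<And>u u'. u \<in> P \<Longrightarrow> u' \<in> P \<Longrightarrow> br (e u) (e u') = 0"
    and f: "\<And>u. u \<in> P \<Longrightarrow> f u = 0" "\<And>i. i \<in> J \<Longrightarrow> 0 < f i"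
    and d: "\<And>u. u \<in> P \<Longrightarrow> d u = 1" "\<And>i. i \<in> J \<Longrightarrow> 0 < d i"
    and graded: "\<And>i j k. i \<in> P \<union> J \<Longrightarrow> j \<in> P \<union> J \<Longrightarrow> k \<in> P \<union> J \<Longrightarrow> c i j k \<noteq> 0 \<Longrightarrow> f i + f j \<le> f k"
    and w: "\<And>q i. 0 < q \<Longrightarrow> i \<in> P \<Longrightarrow> 0 < w q i" "\<And>q i. i \<in> J \<Longrightarrow> w q i = 1"
    and limw: "\<And>u. u \<in> P \<Longrightarrow> ((\<lambda>q. w q u) \<longlongrightarrow> w' u) (at_right 0)"
    and diag: "\<And>i j. i \<in> P \<union> J \<Longrightarrow> j \<in> P \<union> J \<Longrightarrow> i \<noteq> j \<Longrightarrow> semidirect_form P J w' (G d) i j = 0"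
    and neg: "\<And>i. i \<in> P \<union> J \<Longrightarrow> semidirect_form P J w' (G d) i i < 0"
  shows "\<exists>ip. inner_product ip \<and> negative_ricci br ip"
proof (rule negative_ricci_semidirect_limit[where P=P and J=J and e=e and s="\<lambda>q i. d i / q ^ f i"
      and w=w and w'=w' and v'="G d"])
  have d': "0 < d i" if "i \<in> P \<union> J" for i using d that by force
  show "coord (P \<union> J) e (br (e i) (e j)) u = 0" if "i \<in> P \<union> J" "j \<in> P \<union> J" "u \<in> P" for i j u
  proof (rule ccontr)
    assume "coord (P \<union> J) e (br (e i) (e j)) u \<noteq> 0"
    then have "f i + f j \<le> f u" using graded[of i j u] that unfolding c_def by auto
    then have "f i = 0" "f j = 0" using f(1)[OF that(3)] by auto
    then have "i \<in> P" "j \<in> P" using that f(2) by force+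
    then have "br (e i) (e j) = 0" by (rule abelian)
    then show False using \<open>coord (P \<union> J) e (br (e i) (e j)) u \<noteq> 0\<close> by (simp add: coord_zero)
  qed
  show "coord (P \<union> J) e (br (e i) (e k)) k = 0" if "i \<in> J" "k \<in> J" for i k
    using graded[of i k k] f(2)[OF that(1)] that unfolding c_def by force
  show "((\<lambda>q. coord (P \<union> J) e (br (e i) (e j)) k * (d i / q ^ f i * (d j / q ^ f j) / (d k / q ^ f k))) \<longlongrightarrow> G d i j k) (at_right 0)"
    if "i \<in> P \<union> J" "j \<in> P \<union> J" "k \<in> P \<union> J" for i j k
  proof (cases "c i j k = 0")
    case True
    then show ?thesis unfolding G_def by (simp add: c_def)
  next
    case False
    then have le: "f i + f j \<le> f k" using graded that by auto
    have "((\<lambda>q. c i j k * (d i * d j / d k) * q ^ (f k - (f i + f j))) \<longlongrightarrow>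
        c i j k * (d i * d j / d k) * (if f k - (f i + f j) = 0 then 1 else 0)) (at_right 0)"
      by (intro tendsto_intros tendsto_power_at_right_0)
    moreover have "c i j k * (d i * d j / d k) * (if f k - (f i + f j) = 0 then 1 else 0) = G d i j k"
      unfolding G_def using le by simp
    moreover have "\<forall>\<^sub>F q in at_right 0. c i j k * (d i * d j / d k) * q ^ (f k - (f i + f j))
        = c i j k * (d i / q ^ f i * (d j / q ^ f j) / (d k / q ^ f k))"
      unfolding eventually_at_right_field
    proof (intro exI[of _ 1] conjI allI impI)
      fix q :: real assume "0 < q" "q < 1"
      then show "c i j k * (d i * d j / d k) * q ^ (f k - (f i + f j))
        = c i j k * (d i / q ^ f i * (d j / q ^ f j) / (d k / q ^ f k))"
        using le by (simp add: power_diff power_add mult_ac)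
    qed simp
    ultimately show ?thesis unfolding c_def by (auto elim: Lim_transform_eventually)
  qed
  show "d i / q ^ f i \<noteq> 0" if "0 < q" "i \<in> P \<union> J" for q :: real and i
    using d'[OF that(2)] that by simp
  show "d u / q ^ f u = 1" if "u \<in> P" for q :: real and u using d f that by simp
qed (use e disj abelian w limw diag neg in auto)

text \<open>As the degrees are distinct, in the limit \<open>e 0\<close> acts diagonally on the other basis vectors. The
  conditions \<open>nice1\<close> and \<open>nice2\<close> say that a pair of source and target, or a pair of sources,
  determines the third vector of a bracket; then all off-diagonal entries of the Ricci matrix
  vanish. At \<open>e 0\<close> the entry is minus the sum of the squares of the weights.\<close>

lemma negative_ricci_codim1:
  fixes e :: "nat \<Rightarrow> 'a" and f :: "nat \<Rightarrow> nat" and n :: nat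
  defines "c \<equiv> \<lambda>i j. coord ({0} \<union> {1..n}) e (br (e i) (e j))"
  defines "G \<equiv> \<lambda>d i j k. if f i + f j = f k then c i j k * (d i * d j / d k) else 0"
  assumes e: "frame ({0} \<union> {1..n}) e UNIV"
    and f: "f 0 = 0" "\<And>i. i \<in> {1..n} \<Longrightarrow> 0 < f i" "inj_on f {1..n}"
    and d: "d 0 = 1" "\<And>i. i \<in> {1..n} \<Longrightarrow> 0 < d i"
    and graded: "\<And>i j k. i \<le> n \<Longrightarrow> j \<le> n \<Longrightarrow> k \<le> n \<Longrightarrow> c i j k \<noteq> 0 \<Longrightarrow> f i + f j \<le> f k"
    and nice1: "\<And>i j k l. i \<in> {1..n} \<Longrightarrow> j \<in> {1..n} \<Longrightarrow> k \<in> {1..n} \<Longrightarrow> l \<in> {1..n} \<Longrightarrow> i \<noteq> j \<Longrightarrow>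
      G d i k l = 0 \<or> G d j k l = 0"
    and nice2: "\<And>i j k l. i \<in> {1..n} \<Longrightarrow> j \<in> {1..n} \<Longrightarrow> k \<in> {1..n} \<Longrightarrow> l \<in> {1..n} \<Longrightarrow> i \<noteq> j \<Longrightarrow>
      G d k l i = 0 \<or> G d k l j = 0"
    and weight: "\<exists>i\<in>{1..n}. c 0 i i \<noteq> 0"
    and neg: "\<And>i. i \<in> {1..n} \<Longrightarrow> - (\<Sum>k\<in>{1..n}. c 0 k k) * c 0 i i
       - 1/2 * (\<Sum>k\<in>{1..n}. \<Sum>l\<in>{1..n}. (G d i k l)\<^sup>2)
       + 1/4 * (\<Sum>k\<in>{1..n}. \<Sum>l\<in>{1..n}. (G d k l i)\<^sup>2) < 0"
  shows "\<exists>ip. inner_product ip \<and> negative_ricci br ip"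
proof -
  let ?J = "{1..n}"
  have G0: "G d 0 k l = (if k = l then c 0 k k else 0)" if "k \<in> ?J" "l \<in> ?J" for k l
    using f(1) d(1) d(2)[OF that(1)] inj_onD[OF f(3) _ that] unfolding G_def by auto
  have Gd: "G d i k k = 0" if "i \<in> ?J" for i k
    using f(2)[OF that] unfolding G_def by auto
  have GG: "G d i k l * G d j l k = 0" if "i \<in> ?J" "j \<in> ?J" for i j k l
    using f(2)[OF that(1)] f(2)[OF that(2)] unfolding G_def by auto
  have off: "semidirect_form {0} ?J (\<lambda>_. 1) (G d) 0 i = 0" "semidirect_form {0} ?J (\<lambda>_. 1) (G d) i 0 = 0"
    if "i \<in> ?J" for i
  proof -
    have "(\<Sum>k\<in>?J. \<Sum>l\<in>?J. G d 0 k l * (G d i l k + G d i k l)) = 0"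
      by (intro sum.neutral ballI) (simp add: G0 Gd[OF that])
    moreover have "(\<Sum>k\<in>?J. \<Sum>l\<in>?J. G d i k l * (G d 0 l k + G d 0 k l)) = 0"
      by (intro sum.neutral ballI) (simp add: G0 Gd[OF that])
    ultimately show "semidirect_form {0} ?J (\<lambda>_. 1) (G d) 0 i = 0" "semidirect_form {0} ?J (\<lambda>_. 1) (G d) i 0 = 0"
      unfolding semidirect_form_def by simp_all
  qed
  have J: "semidirect_form {0} ?J (\<lambda>_. 1) (G d) i j = (if i = j then - (\<Sum>k\<in>?J. c 0 k k) * c 0 i i
       - 1/2 * (\<Sum>k\<in>?J. \<Sum>l\<in>?J. (G d i k l)\<^sup>2)
       + 1/4 * (\<Sum>k\<in>?J. \<Sum>l\<in>?J. (G d k l i)\<^sup>2) else 0)" if ij: "i \<in> ?J" "j \<in> ?J" for i j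
  proof -
    have 1: "(\<Sum>k\<in>?J. \<Sum>l\<in>?J. G d i k l * G d j k l) = (if i = j then \<Sum>k\<in>?J. \<Sum>l\<in>?J. (G d i k l)\<^sup>2 else 0)"
      using nice1[OF ij] by (auto simp: power2_eq_square intro!: sum.neutral)
    have 2: "(\<Sum>k\<in>?J. \<Sum>l\<in>?J. G d k l i * G d k l j) = (if i = j then \<Sum>k\<in>?J. \<Sum>l\<in>?J. (G d k l i)\<^sup>2 else 0)"
      using nice2[OF ij] by (auto simp: power2_eq_square intro!: sum.neutral)
    have 3: "(\<Sum>l\<in>?J. G d 0 i l * G d 0 j l - G d 0 l i * G d 0 l j) = 0"
      using ij by (intro sum.neutral) (auto simp: G0)
    have 4: "(\<Sum>b\<in>?J. G d 0 b b) = (\<Sum>b\<in>?J. c 0 b b)" by (simp add: G0)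
    show ?thesis
      unfolding semidirect_form_def using ij by (simp add: 1 2 3 4 GG G0[OF ij] del: One_nat_def)
  qed
  have Y: "semidirect_form {0} ?J (\<lambda>_. 1) (G d) 0 0 < 0"
  proof -
    have "(\<Sum>k\<in>?J. \<Sum>l\<in>?J. G d 0 k l * (G d 0 l k + G d 0 k l)) = (\<Sum>k\<in>?J. 2 * (c 0 k k)\<^sup>2)"
    proof (rule sum.cong[OF refl])
      fix k assume k: "k \<in> ?J"
      have "(\<Sum>l\<in>?J. G d 0 k l * (G d 0 l k + G d 0 k l)) = (\<Sum>l\<in>?J. if l = k then 2 * (c 0 k k)\<^sup>2 else 0)"
        using k by (intro sum.cong) (auto simp: G0 power2_eq_square)
      then show "(\<Sum>l\<in>?J. G d 0 k l * (G d 0 l k + G d 0 k l)) = 2 * (c 0 k k)\<^sup>2" using k by simp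
    qed
    moreover have "0 < (\<Sum>k\<in>?J. 2 * (c 0 k k)\<^sup>2)"
    proof -
      obtain i where "i \<in> ?J" "c 0 i i \<noteq> 0" using weight by auto
      then show ?thesis by (intro sum_pos2[of _ i]) auto
    qed
    ultimately show ?thesis unfolding semidirect_form_def by simp
  qed
  show ?thesis
  proof (rule negative_ricci_graded_limit[where P="{0}" and J="?J" and f=f and d=d and w="\<lambda>_ _. 1" and w'="\<lambda>_. 1" and e=e])
    show "f i + f j \<le> f k" if "i \<in> {0} \<union> ?J" "j \<in> {0} \<union> ?J" "k \<in> {0} \<union> ?J"
       "coord ({0} \<union> ?J) e (br (e i) (e j)) k \<noteq> 0" for i j k
      using graded[of i j k] that unfolding c_def by auto
    show "semidirect_form {0} ?J (\<lambda>_. 1) (\<lambda>i j k. if f i + f j = f k then coord ({0} \<union> ?J) e (br (e i) (e j)) k * (d i * d j / d k) else 0) i j = 0"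
      if "i \<in> {0} \<union> ?J" "j \<in> {0} \<union> ?J" "i \<noteq> j" for i j
      using that off J unfolding G_def c_def by auto
    show "semidirect_form {0} ?J (\<lambda>_. 1) (\<lambda>i j k. if f i + f j = f k then coord ({0} \<union> ?J) e (br (e i) (e j)) k * (d i * d j / d k) else 0) i i < 0"
      if "i \<in> {0} \<union> ?J" for i
      using that Y J[of i i] neg[of i] unfolding G_def c_def by auto
  qed (use e f d in \<open>auto simp: alt\<close>)
qed

text \<open>By \<open>strict\<close> all brackets inside the nilradical disappear in the limit, and what remains is an
  abelian ideal on which \<open>e 0\<close> acts by its positive weights and \<open>A = e (Suc n)\<close> by some matrix.
  Scaling \<open>A\<close> by \<open>q\<close> removes its influence on the ideal. After division by \<open>q\<^sup>2\<close> the entry at \<open>A\<close> itself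
  is minus the squared norm of the symmetric part of its limit action, and \<open>orth\<close> makes
  the entry between \<open>e 0\<close> and \<open>A\<close> vanish.\<close>

lemma negative_ricci_codim2:
  fixes e :: "nat \<Rightarrow> 'a" and f :: "nat \<Rightarrow> nat" and n :: nat
  defines "c \<equiv> \<lambda>i j. coord ({0, Suc n} \<union> {1..n}) e (br (e i) (e j))"
  assumes e: "frame ({0, Suc n} \<union> {1..n}) e UNIV"
    and comm: "br (e 0) (e (Suc n)) = 0"
    and f: "f 0 = 0" "f (Suc n) = 0" "\<And>i. i \<in> {1..n} \<Longrightarrow> 0 < f i"
    and graded: "\<And>i j k. i \<le> Suc n \<Longrightarrow> j \<le> Suc n \<Longrightarrow> k \<le> Suc n \<Longrightarrow> c i j k \<noteq> 0 \<Longrightarrow> f i + f j \<le> f k"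
    and strict: "\<And>i j k. i \<in> {1..n} \<Longrightarrow> j \<in> {1..n} \<Longrightarrow> k \<in> {1..n} \<Longrightarrow> c i j k \<noteq> 0 \<Longrightarrow> f i + f j < f k"
    and diagonal: "\<And>i j. i \<in> {1..n} \<Longrightarrow> j \<in> {1..n} \<Longrightarrow> f i = f j \<Longrightarrow> i \<noteq> j \<Longrightarrow> c 0 i j = 0"
    and pos: "\<And>i. i \<in> {1..n} \<Longrightarrow> 0 < c 0 i i" and n: "0 < n"
    and orth: "(\<Sum>i\<in>{1..n}. c 0 i i * c (Suc n) i i) = 0"
    and sym_part: "\<exists>i\<in>{1..n}. \<exists>j\<in>{1..n}. f i = f j \<and> c (Suc n) i j + c (Suc n) j i \<noteq> 0"
  shows "\<exists>ip. inner_product ip \<and> negative_ricci br ip"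
proof -
  let ?J = "{1..n}" and ?A = "Suc n"
  let ?P = "{0, ?A}"
  define G where "G i j k = (if f i + f j = f k then c i j k else 0)" for i j k
  define w' where "w' i = (if i = ?A then 0 else 1 :: real)" for i
  have G0: "G 0 k l = (if k = l then c 0 k k else 0)" if "k \<in> ?J" "l \<in> ?J" for k l
    using f diagonal[OF that] unfolding G_def by auto
  have GJ: "G i k l = 0" if "i \<in> ?J" "k \<in> ?J" "l \<in> ?J" for i k l
    using strict[OF that] unfolding G_def by (cases "c i k l = 0") auto
  have PJ: "semidirect_form ?P ?J w' G u i = 0" "semidirect_form ?P ?J w' G i u = 0"
    if "u \<in> ?P" "i \<in> ?J" for u i
    unfolding semidirect_form_def using that by (simp_all add: GJ)
  have JJ: "semidirect_form ?P ?J w' G i j = (if i = j then - (\<Sum>k\<in>?J. c 0 k k) * c 0 i i else 0)"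
    if ij: "i \<in> ?J" "j \<in> ?J" for i j
  proof -
    have 3: "(\<Sum>l\<in>?J. G 0 i l * G 0 j l - G 0 l i * G 0 l j) = 0"
      using ij by (intro sum.neutral) (auto simp: G0)
    have 4: "(\<Sum>b\<in>?J. G 0 b b) = (\<Sum>b\<in>?J. c 0 b b)" by (simp add: G0)
    show ?thesis
      unfolding semidirect_form_def w'_def using ij by (simp add: 3 4 GJ G0[OF ij] del: One_nat_def)
  qed
  have "0 < (\<Sum>k\<in>?J. c 0 k k)" using pos n by (intro sum_pos) auto
  then have JJ_neg: "semidirect_form ?P ?J w' G i i < 0" if "i \<in> ?J" for i
    using JJ[OF that that] pos[OF that] by simp
  have delta: "(\<Sum>k\<in>?J. \<Sum>l\<in>?J. G 0 k l * (v l k + v k l)) = 2 * (\<Sum>k\<in>?J. c 0 k k * v k k)"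
    for v :: "nat \<Rightarrow> nat \<Rightarrow> real"
    unfolding sum_distrib_left
  proof (rule sum.cong[OF refl])
    fix k assume k: "k \<in> ?J"
    have "(\<Sum>l\<in>?J. G 0 k l * (v l k + v k l)) = (\<Sum>l\<in>?J. if l = k then 2 * (c 0 k k * v k k) else 0)"
      using k by (intro sum.cong) (auto simp: G0)
    then show "(\<Sum>l\<in>?J. G 0 k l * (v l k + v k l)) = 2 * (c 0 k k * v k k)" using k by simp
  qed
  have YY: "semidirect_form ?P ?J w' G 0 0 < 0"
  proof -
    have "0 < (\<Sum>k\<in>?J. c 0 k k * G 0 k k)" using pos n by (intro sum_pos) (auto simp: G0)
    then show ?thesis unfolding semidirect_form_def by (simp add: delta del: One_nat_def)
  qed
  have 0: "(\<Sum>k\<in>?J. c 0 k k * G ?A k k) = 0"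
    using orth f(2) unfolding G_def by simp
  have YA: "semidirect_form ?P ?J w' G 0 ?A = 0"
    unfolding semidirect_form_def by (simp add: delta 0 del: One_nat_def)
  have AY: "semidirect_form ?P ?J w' G ?A 0 = 0"
  proof -
    have "(\<Sum>k\<in>?J. \<Sum>l\<in>?J. G ?A k l * (G 0 l k + G 0 k l)) = (\<Sum>k\<in>?J. \<Sum>l\<in>?J. G ?A k l * G 0 l k) + (\<Sum>k\<in>?J. \<Sum>l\<in>?J. G ?A k l * G 0 k l)"
      by (simp add: distrib_left sum.distrib)
    also have "(\<Sum>k\<in>?J. \<Sum>l\<in>?J. G ?A k l * G 0 l k) = (\<Sum>k\<in>?J. \<Sum>l\<in>?J. G 0 k l * G ?A l k)"
      by (subst sum.swap) (simp add: mult.commute)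
    also have "\<dots> + (\<Sum>k\<in>?J. \<Sum>l\<in>?J. G ?A k l * G 0 k l) = (\<Sum>k\<in>?J. \<Sum>l\<in>?J. G 0 k l * (G ?A l k + G ?A k l))"
      by (simp add: distrib_left sum.distrib mult.commute)
    finally show ?thesis unfolding semidirect_form_def by (simp add: delta 0 del: One_nat_def)
  qed
  have AA: "semidirect_form ?P ?J w' G ?A ?A < 0"
  proof -
    have "(\<Sum>k\<in>?J. \<Sum>l\<in>?J. G ?A k l * (G ?A l k + G ?A k l)) = (\<Sum>k\<in>?J. \<Sum>l\<in>?J. G ?A l k * (G ?A l k + G ?A k l))"
      by (subst sum.swap) (simp add: add.commute)
    then have "2 * (\<Sum>k\<in>?J. \<Sum>l\<in>?J. G ?A k l * (G ?A l k + G ?A k l)) = (\<Sum>k\<in>?J. \<Sum>l\<in>?J. (G ?A l k + G ?A k l)\<^sup>2)"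
      by (simp add: power2_eq_square distrib_right sum.distrib)
    moreover obtain i j where "i \<in> ?J" "j \<in> ?J" "f i = f j" "c ?A i j + c ?A j i \<noteq> 0"
      using sym_part by auto
    then have "0 < (\<Sum>k\<in>?J. \<Sum>l\<in>?J. (G ?A l k + G ?A k l)\<^sup>2)"
      using f(2) by (intro sum_pos2[of _ i] sum_pos2[of _ j] sum_nonneg) (auto simp: G_def add.commute)
    ultimately show ?thesis unfolding semidirect_form_def by simp
  qed
  have G_alt: "G = (\<lambda>i j k. if f i + f j = f k then coord (?P \<union> ?J) e (br (e i) (e j)) k * (1 * 1 / 1) else 0)"
    unfolding G_def c_def by (intro ext) simp
  show ?thesis
  proof (rule negative_ricci_graded_limit[where P="?P" and J="?J" and f=f and d="\<lambda>_. 1"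
        and w="\<lambda>q i. if i = ?A then q else 1" and w'=w' and e=e])
    show "f i + f j \<le> f k" if "i \<in> ?P \<union> ?J" "j \<in> ?P \<union> ?J" "k \<in> ?P \<union> ?J"
       "coord (?P \<union> ?J) e (br (e i) (e j)) k \<noteq> 0" for i j k
      using graded[of i j k] that unfolding c_def by auto
    show "br (e u) (e u') = 0" if "u \<in> ?P" "u' \<in> ?P" for u u'
      using that comm skew[of "e ?A" "e 0"] by (auto simp: alt)
    show "((\<lambda>q. if u = ?A then q else 1) \<longlongrightarrow> w' u) (at_right 0)" for u
      unfolding w'_def by (auto intro: tendsto_ident_at)
    show "semidirect_form ?P ?J w' (\<lambda>i j k. if f i + f j = f k then coord (?P \<union> ?J) e (br (e i) (e j)) k * (1 * 1 / 1) else 0) i j = 0"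
      if "i \<in> ?P \<union> ?J" "j \<in> ?P \<union> ?J" "i \<noteq> j" for i j
      unfolding G_alt[symmetric] using that PJ[of i j] PJ[of j i] JJ YA AY by auto
    show "semidirect_form ?P ?J w' (\<lambda>i j k. if f i + f j = f k then coord (?P \<union> ?J) e (br (e i) (e j)) k * (1 * 1 / 1) else 0) i i < 0"
      if "i \<in> ?P \<union> ?J" for i
      unfolding G_alt[symmetric] using that YY AA JJ_neg by auto
  qed (use e f in auto)
qed

end

section \<open>Weights and bracket coefficients\<close>

lemma exists_small_positive:
  fixes b :: "'i \<Rightarrow> real"
  assumes "finite A" "\<And>a. a \<in> A \<Longrightarrow> 0 < b a"
  shows "\<exists>\<epsilon>>0. \<forall>a\<in>A. \<epsilon> < b a"
  using assms
proof (induction A)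
  case (insert x F)
  then obtain \<epsilon> where "\<epsilon> > 0" "\<forall>a\<in>F. \<epsilon> < b a" by auto
  then show ?case using insert.prems[of x] by (intro exI[of _ "min \<epsilon> (b x / 2)"]) (auto simp: min_def)
qed (auto intro: exI[of _ 1])

text \<open>The weights of an extension of \<open>L\<close> on \<open>X 2, ..., X n\<close> form an arithmetic progression of difference
  \<open>\<alpha>\<close>; \<open>C k\<close> stands for the square of the constant of the bracket from \<open>X k\<close> to \<open>X (k + 1)\<close>, up to a
  factor. Let \<open>\<sigma> k\<close> be the sum of the weights from \<open>k\<close> on. With \<open>C k = \<sigma> (k + 1)\<close> all differences
  \<open>C (k - 1) - C k\<close> would equal the weights, and the linear term \<open>\<epsilon> * (n - k)\<close> makes the inequalities
  strict. So it is needed that the tail sums of the progression are positive, which follows from the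
  positivity of the whole sum and of the last term.\<close>

lemma L_coefficients:
  fixes lam :: "nat \<Rightarrow> real"
  assumes n: "4 \<le> n"
    and lam: "lam 1 = \<alpha>" "\<And>k. k \<in> {2..n} \<Longrightarrow> lam k = \<beta> + (real k - 2) * \<alpha>"
    and pos: "0 < (\<Sum>k\<in>{2..n}. lam k)" "0 < lam n"
  obtains C :: "nat \<Rightarrow> real" where "\<And>k. k \<in> {2..n-1} \<Longrightarrow> 0 < C k" "0 < lam 1 + (\<Sum>k\<in>{2..n-1}. C k)"
    "\<And>k. k \<in> {2..n} \<Longrightarrow> (if 3 \<le> k then C (k - 1) else 0) - (if k \<le> n - 1 then C k else 0) < lam k"
    "0 < (\<Sum>k\<in>{1..n}. lam k)"
proof -
  define \<sigma> where "\<sigma> k = (\<Sum>j\<in>{k..n}. lam j)" for k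
  have lam_mono: "lam j - lam k = (real j - real k) * \<alpha>" if "k \<in> {2..n}" "j \<in> {2..n}" for j k
    using lam(2)[OF that(1)] lam(2)[OF that(2)] by (simp add: algebra_simps)
  (* The weights are monotone: either every term of the tail is positive, or the terms before the
     tail are at most 0 and the tail sum is at least the whole sum. *)
  have \<sigma>: "0 < \<sigma> k" if k: "k \<in> {2..n}" for k
  proof (cases "0 < lam k \<or> \<alpha> \<le> 0")
    case True
    have "0 < lam j" if j: "j \<in> {k..n}" for j
    proof (cases "\<alpha> \<le> 0")
      case True
      then have "(real j - real n) * \<alpha> \<ge> 0" using j by (intro mult_nonpos_nonpos) auto
      then show ?thesis using lam_mono[of n j] pos(2) j k n by auto
    next
      case False
      then have "(real j - real k) * \<alpha> \<ge> 0" using j by (intro mult_nonneg_nonneg) auto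
      moreover have "lam j - lam k = (real j - real k) * \<alpha>" using lam_mono[of k j] j k by auto
      moreover have "0 < lam k" using True False by auto
      ultimately show ?thesis by linarith
    qed
    then show ?thesis unfolding \<sigma>_def using k by (intro sum_pos) auto
  next
    case False
    have "(\<Sum>j\<in>{2..<k}. lam j) \<le> 0"
    proof (rule sum_nonpos)
      fix j assume j: "j \<in> {2..<k}"
      then have "(real j - real k) * \<alpha> \<le> 0" using False by (intro mult_nonpos_nonneg) auto
      then show "lam j \<le> 0" using lam_mono[of k j] False j k by auto
    qed
    moreover have "(\<Sum>j\<in>{2..n}. lam j) = (\<Sum>j\<in>{2..<k}. lam j) + \<sigma> k"
      unfolding \<sigma>_def using k by (subst sum.union_disjoint[symmetric]) (auto intro!: sum.cong)
    ultimately show ?thesis using pos(1) by linarith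
  qed
  have \<sigma>_step: "\<sigma> k = lam k + \<sigma> (Suc k)" if "k \<le> n" for k
    unfolding \<sigma>_def using that by (simp add: sum.atLeast_Suc_atMost)
  have \<sigma>n: "\<sigma> n = lam n" unfolding \<sigma>_def by simp
  (* For a decreasing progression the last two terms already outweigh the negative weight of X 1. *)
  have neg_alpha: "\<sigma> (n - 1) > - \<alpha>" "\<sigma> 2 > - \<alpha>" if "\<alpha> < 0"
  proof -
    have "lam (n - 1) = lam n - \<alpha>" using lam_mono[of n "n-1"] n by (simp add: of_nat_diff algebra_simps)
    moreover have "\<sigma> (n - 1) = lam (n - 1) + lam n" using \<sigma>_step[of "n-1"] \<sigma>n n by simp
    ultimately show *: "\<sigma> (n - 1) > - \<alpha>" using pos(2) by linarith
    have "0 \<le> lam j" if j: "j \<in> {2..n}" for j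
    proof -
      have "(real j - real n) * \<alpha> \<ge> 0" using j \<open>\<alpha> < 0\<close> by (intro mult_nonpos_nonpos) auto
      then show ?thesis using lam_mono[of n j] pos(2) j n by auto
    qed
    then have "\<sigma> (n - 1) \<le> \<sigma> 2" unfolding \<sigma>_def using n by (intro sum_mono2) auto
    then show "\<sigma> 2 > - \<alpha>" using * by linarith
  qed
  define S where "S = \<alpha> + (\<Sum>k\<in>{2..n-1}. \<sigma> (Suc k))"
  have S: "0 < S"
  proof -
    have nonneg: "0 \<le> \<sigma> (Suc k)" if "k \<in> {2..n-1}" for k
    proof -
      have "Suc k \<in> {2..n}" using that n by auto
      then show ?thesis using \<sigma> by (simp add: less_imp_le)
    qed
    have "0 < \<sigma> (Suc (n - 1))" using \<sigma>[of n] n by simp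
    then have "0 < (\<Sum>k\<in>{2..n-1}. \<sigma> (Suc k))" using nonneg n by (intro sum_pos2[of _ "n-1"]) auto
    moreover have "\<sigma> (Suc (n - 2)) \<le> (\<Sum>k\<in>{2..n-1}. \<sigma> (Suc k))"
      using nonneg n by (intro member_le_sum[where i="n-2" and f="\<lambda>k. \<sigma> (Suc k)"]) auto
    moreover have "Suc (n - 2) = n - 1" using n by simp
    ultimately show ?thesis unfolding S_def using neg_alpha(1) by (cases "\<alpha> < 0") auto
  qed
  have "\<exists>\<epsilon>>0. \<forall>k\<in>{1..n}. \<epsilon> < (if k = 1 then S / (real n * real n) else \<sigma> k / real n)"
    using S \<sigma> n by (intro exists_small_positive) auto
  then obtain \<epsilon> where \<epsilon>0: "0 < \<epsilon>" "\<And>k. k \<in> {1..n} \<Longrightarrow> \<epsilon> < (if k = 1 then S / (real n * real n) else \<sigma> k / real n)"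
    by blast
  have \<epsilon>: "0 < \<epsilon>" "\<And>k. k \<in> {2..n} \<Longrightarrow> \<epsilon> * n < \<sigma> k" "\<epsilon> * (real n * real n) < S"
  proof -
    show "\<epsilon> * n < \<sigma> k" if "k \<in> {2..n}" for k
      using \<epsilon>0(2)[of k] that n by (simp add: pos_less_divide_eq)
    show "\<epsilon> * (real n * real n) < S"
      using \<epsilon>0(2)[of 1] n by (simp add: pos_less_divide_eq)
  qed (rule \<epsilon>0(1))
  define C where "C k = \<sigma> (Suc k) - \<epsilon> * (real n - real k)" for k
  have small: "\<epsilon> * (real n - real k) \<le> \<epsilon> * n" for k using \<epsilon>(1) by (simp add: mult_left_mono)
  show thesis
  proof (rule that[of C])
    show "0 < C k" if "k \<in> {2..n-1}" for k
    proof -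
      have "Suc k \<in> {2..n}" using that n by auto
      from \<epsilon>(2)[OF this] show ?thesis using small[of k] unfolding C_def by linarith
    qed
    have "(\<Sum>k\<in>{2..n-1}. \<epsilon> * (real n - real k)) \<le> (\<Sum>k\<in>{2..n-1}. \<epsilon> * n)"
      by (intro sum_mono small)
    also have "\<dots> = real (n - 2) * (\<epsilon> * n)" using n by (simp add: Suc_diff_Suc numeral_2_eq_2)
    also have "\<dots> \<le> n * (\<epsilon> * n)" using \<epsilon>(1) by (intro mult_right_mono) auto
    finally have "(\<Sum>k\<in>{2..n-1}. \<epsilon> * (real n - real k)) < S" using \<epsilon>(3) by (simp add: mult_ac)
    then show "0 < lam 1 + (\<Sum>k\<in>{2..n-1}. C k)"
      unfolding C_def S_def lam(1) by (simp add: sum_subtractf)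
    show "(if 3 \<le> k then C (k - 1) else 0) - (if k \<le> n - 1 then C k else 0) < lam k" if k: "k \<in> {2..n}" for k
    proof -
      consider "k = 2" | "3 \<le> k" "k \<le> n - 1" | "k = n" "3 \<le> k" using k n by fastforce
      then show ?thesis
      proof cases
        case 1
        then show ?thesis
          using \<epsilon>(2)[of 2] small[of 2] \<sigma>_step[of 2] n unfolding C_def by auto
      next
        case 2
        then have "Suc (k - 1) = k" "real (k - 1) = real k - 1" by auto
        then show ?thesis using 2 \<epsilon>(1) \<sigma>_step[of k] unfolding C_def by (simp add: algebra_simps)
      next
        case 3
        then have "Suc (k - 1) = k" "real (k - 1) = real k - 1" by auto
        then show ?thesis using 3 \<epsilon>(1) \<sigma>n n unfolding C_def by (auto simp: algebra_simps)
      qed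
    qed
    have "(\<Sum>k\<in>{1..n}. lam k) = \<alpha> + \<sigma> 2"
      unfolding \<sigma>_def using n lam(1) by (simp add: sum.atLeast_Suc_atMost numeral_2_eq_2)
    then show "0 < (\<Sum>k\<in>{1..n}. lam k)" using neg_alpha(2) \<sigma>[of 2] n by (cases "\<alpha> < 0") auto
  qed
qed

text \<open>For an extension of \<open>Q\<close> the weights on \<open>X 2, ..., X (n - 1)\<close> are symmetric about half the weight \<open>\<mu>\<close>
  of \<open>X n\<close>. Here \<open>C k\<close> belongs to the bracket from \<open>X k\<close> to \<open>X (k + 1)\<close> and \<open>B k\<close> to the bracket of \<open>X k\<close>
  with \<open>X (n + 1 - k)\<close>; the relations between them are those among the constants obtained by
  scaling the basis vectors. If the weights do not decrease, a constant \<open>B\<close> and a quadratic polynomial \<open>C\<close>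
  symmetric under \<open>k \<mapsto> n - k\<close> satisfy the relations; the differences of \<open>C\<close> reproduce the linear part
  of the weights, with the slope raised by \<open>\<delta>\<close> so that \<open>C\<close> is positive even for \<open>\<alpha> = 0\<close>.\<close>

lemma Q_coefficients_nonneg:
  fixes lam :: "nat \<Rightarrow> real"
  assumes m: "2 \<le> m" and n: "n = 2 * m" and \<alpha>: "0 \<le> \<alpha>"
    and lam: "\<And>k. k \<in> {2..n-1} \<Longrightarrow> lam k = \<mu> / 2 + \<alpha> * (real k - real m - 1/2)"
    and \<mu>: "0 < \<mu>"
  obtains C B :: "nat \<Rightarrow> real" where "\<And>k. k \<in> {2..n-2} \<Longrightarrow> 0 < C k"
    "\<And>k. k \<in> {2..n-1} \<Longrightarrow> 0 < B k" "\<And>k. k \<in> {2..n-1} \<Longrightarrow> B (n + 1 - k) = B k"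
    "\<And>j. j \<in> {2..n-2} \<Longrightarrow> B (j + 1) * C j = B j * C (n - j)"
    "0 < \<alpha> + (\<Sum>k\<in>{2..n-2}. C k)"
    "\<And>k. k \<in> {2..n-1} \<Longrightarrow> (if 3 \<le> k then C (k - 1) else 0) - (if k \<le> n - 2 then C k else 0) - B k < lam k"
    "(\<Sum>k\<in>{2..n-1}. B k) < 2 * \<mu>"
proof -
  define \<delta> where "\<delta> = \<mu> / (4 * real m)"
  define C where "C k = (\<alpha> + \<delta>) * (real k - 1) * (real n - 1 - real k) / 2" for k
  define B where "B k = \<mu> / (2 * real m)" for k :: nat
  have \<delta>: "0 < \<delta>" "\<delta> * real m = \<mu> / 4" unfolding \<delta>_def using \<mu> m by auto
  have Cpos: "0 < C k" if "k \<in> {2..n-2}" for k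
    unfolding C_def using that \<alpha> \<delta> by (intro divide_pos_pos mult_pos_pos) auto
  show thesis
  proof (rule that[of C B])
    show "0 < C k" if "k \<in> {2..n-2}" for k by (rule Cpos[OF that])
    show "0 < B k" for k unfolding B_def using \<mu> m by auto
    show "B (n + 1 - k) = B k" for k unfolding B_def ..
    show "B (j + 1) * C j = B j * C (n - j)" if "j \<in> {2..n-2}" for j
    proof -
      have "real (n - j) = real n - real j" using that by auto
      then show ?thesis unfolding B_def C_def by (simp add: algebra_simps)
    qed
    have "0 < (\<Sum>k\<in>{2..n-2}. C k)" using Cpos m n by (intro sum_pos) auto
    then show "0 < \<alpha> + (\<Sum>k\<in>{2..n-2}. C k)" using \<alpha> by linarith
    show "(if 3 \<le> k then C (k - 1) else 0) - (if k \<le> n - 2 then C k else 0) - B k < lam k" if k: "k \<in> {2..n-1}" for k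
    proof -
      have "(if 3 \<le> k then C (k - 1) else 0) = C (k - 1)" using k unfolding C_def by (auto simp: le_Suc_eq numeral_3_eq_3)
      moreover have "(if k \<le> n - 2 then C k else 0) = C k"
      proof -
        have "k = n - 1" if "\<not> k \<le> n - 2" using that k by auto
        then show ?thesis using k unfolding C_def by (auto simp: of_nat_diff)
      qed
      moreover have "C (k - 1) - C k = (\<alpha> + \<delta>) * (real k - real m - 1/2)"
        using k unfolding C_def n by (simp add: of_nat_diff field_simps)
      moreover have "\<delta> * (real k - real m - 1/2) \<le> \<delta> * real m"
        using k n \<delta>(1) by (intro mult_left_mono) auto
      moreover have "0 < B k" unfolding B_def using \<mu> m by auto
      ultimately show ?thesis using lam[OF k] \<delta>(2) \<mu> by (simp add: distrib_right)
    qed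
    have "(\<Sum>k\<in>{2..n-1}. B k) = (2 * real m - 2) * (\<mu> / (2 * real m))"
      using m unfolding B_def n by (simp add: of_nat_diff)
    also have "\<dots> \<le> \<mu>" using \<mu> m by (simp add: field_simps)
    finally show "(\<Sum>k\<in>{2..n-1}. B k) < 2 * \<mu>" using \<mu> by linarith
  qed
qed

text \<open>The case of weights decreasing with slope \<open>a\<close>. The weight \<open>- a\<close> of \<open>X 1\<close> has to be compensated by
  the sum of the \<open>C k\<close>, and a single large one is affordable: \<open>C (m - 1) = c\<close> between \<open>a\<close> and \<open>lam m\<close>;
  all other \<open>C k\<close> are kept below a small \<open>\<delta>\<close>. Negative weights, which occur only beyond the middle,
  are paid for by \<open>B k\<close>, slightly larger than the negative part of \<open>lam k\<close>. The hypothesis \<open>iota\<close>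
  bounds the sum of these negative parts by \<open>\<mu>\<close>, and at \<open>k = m + 1\<close> gives \<open>a < \<mu>\<close>. In the second half
  \<open>C\<close> is then prescribed by the relations; \<open>B m\<close> is of order \<open>\<delta>\<^sup>2\<close> so that the partner \<open>C (m + 1)\<close> of the
  large \<open>C (m - 1)\<close> stays small.\<close>

lemma Q_coefficients_neg:
  fixes lam :: "nat \<Rightarrow> real"
  assumes m: "3 \<le> m" and n: "n = 2 * m" and a: "0 < a"
    and lam: "\<And>k. k \<in> {2..n-1} \<Longrightarrow> lam k = \<mu> / 2 - a * (real k - real m - 1/2)"
    and iota: "\<And>k. k \<in> {m+1..n} \<Longrightarrow> 0 < \<mu> + (\<Sum>j\<in>{k..n-1}. lam j)"
  obtains C B :: "nat \<Rightarrow> real" where "\<And>k. k \<in> {2..n-2} \<Longrightarrow> 0 < C k"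
    "\<And>k. k \<in> {2..n-1} \<Longrightarrow> 0 < B k" "\<And>k. k \<in> {2..n-1} \<Longrightarrow> B (n + 1 - k) = B k"
    "\<And>j. j \<in> {2..n-2} \<Longrightarrow> B (j + 1) * C j = B j * C (n - j)"
    "0 < - a + (\<Sum>k\<in>{2..n-2}. C k)"
    "\<And>k. k \<in> {2..n-1} \<Longrightarrow> (if 3 \<le> k then C (k - 1) else 0) - (if k \<le> n - 2 then C k else 0) - B k < lam k"
    "(\<Sum>k\<in>{2..n-1}. B k) < 2 * \<mu>" "a < \<mu>"
proof -
  have dec: "lam k \<le> lam j" if "j \<le> k" "j \<in> {2..n-1}" "k \<in> {2..n-1}" for j k
    using lam[OF that(2)] lam[OF that(3)] that(1) a by (simp add: mult_left_mono)
  (* Otherwise lam (m + 1) is at most 0 and lam (m + 2) at most - a, against iota at m + 1. *)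
  have \<mu>a: "a < \<mu>"
  proof (rule ccontr)
    assume "\<not> a < \<mu>"
    then have le: "\<mu> \<le> a" by simp
    have lm: "lam (m + 1) \<le> 0" using lam[of "m+1"] le m n by simp
    have "m + 2 \<in> {2..n-1}" using m n by auto
    then have lm2: "lam (m + 2) \<le> - a" using lam[of "m+2"] le by (simp add: algebra_simps)
    have "(\<Sum>j\<in>{m+1..n-1}. lam j) \<le> (\<Sum>j\<in>{m+1..n-1}. if j = m + 2 then - a else 0)"
    proof (rule sum_mono)
      fix j assume "j \<in> {m+1..n-1}"
      then show "lam j \<le> (if j = m + 2 then - a else 0)"
        using dec[of "m+1" j] lm lm2 m by auto
    qed
    also have "\<dots> = - a" using m n by simp
    finally show False using iota[of "m+1"] le m n by simp
  qed
  define neg where "neg k = max 0 (- lam k)" for k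
  have lm1: "0 < lam (m + 1)" using lam[of "m+1"] \<mu>a m n by simp
  have lm: "lam m = (\<mu> + a) / 2" using lam[of m] m n by (simp add: field_simps)
  (* Downward induction: where lam k is at most 0 the sum is minus the sum of all weights of the
     tail, and once lam k is positive it no longer changes. *)
  have negsum: "(\<Sum>j\<in>{k..n-1}. neg j) < \<mu>" if "k \<in> {m+1..n}" for k
  proof -
    have "m + 1 \<le> n - i \<longrightarrow> (\<Sum>j\<in>{n-i..n-1}. neg j) < \<mu>" for i
    proof (induction i)
      case 0
      then show ?case using \<mu>a a m n by simp
    next
      case (Suc i)
      show ?case
      proof
        assume k: "m + 1 \<le> n - Suc i"
        let ?k = "n - Suc i"
        show "(\<Sum>j\<in>{?k..n-1}. neg j) < \<mu>"
        proof (cases "lam ?k \<le> 0")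
          case True
          have "neg j = - lam j" if "j \<in> {?k..n-1}" for j
            using dec[of ?k j] True that k m n unfolding neg_def by auto
          then have "(\<Sum>j\<in>{?k..n-1}. neg j) = - (\<Sum>j\<in>{?k..n-1}. lam j)"
            by (simp add: sum_negf)
          then show ?thesis using iota[of ?k] k by auto
        next
          case False
          have "n - i = Suc ?k" "?k \<le> n - 1" using k m n by auto
          then have "(\<Sum>j\<in>{?k..n-1}. neg j) = neg ?k + (\<Sum>j\<in>{n-i..n-1}. neg j)"
            by (simp add: sum.atLeast_Suc_atMost)
          then show ?thesis using Suc.IH False k unfolding neg_def by auto
        qed
      qed
    qed
    from this[of "n - k"] show ?thesis using that by auto
  qed
  (* The midpoint of a and lam m = (\<mu> + a) / 2. *)
  define c where "c = (3 * a + \<mu>) / 4"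
  have c: "a < c" "c < lam m" "0 < c" unfolding c_def lm using \<mu>a a by auto
  define \<eta> where "\<eta> = \<mu> - (\<Sum>j\<in>{m+1..n-1}. neg j)"
  have \<eta>: "0 < \<eta>" unfolding \<eta>_def using negsum[of "m+1"] m n by auto
  have "\<exists>\<delta>>0. \<forall>a\<in>{1, lam (m+1), \<eta> / (2 * real m)}. \<delta> < id a"
    using lm1 \<eta> m by (intro exists_small_positive) auto
  then obtain \<delta> where \<delta>: "0 < \<delta>" "\<delta> < 1" "\<delta> < lam (m + 1)" "\<delta> < \<eta> / (2 * real m)"
    by auto
  (* The values on the first half, to be continued to the second half by symmetry and by the relations. *)
  define Bh where "Bh j = (if j = m then \<delta>\<^sup>2 / (c + 1) else neg (n + 1 - j) + 2 * \<delta>)" for j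
  define Ch where "Ch j = (if j = m - 1 then c else \<delta>)" for j
  define B where "B j = (if j \<le> m then Bh j else Bh (n + 1 - j))" for j
  define C where "C j = (if j \<le> m then Ch j else Ch (n - j) * Bh (n - j + 1) / Bh (n - j))" for j
  have neg0: "0 \<le> neg k" for k unfolding neg_def by simp
  have Bm: "Bh m \<le> \<delta>\<^sup>2" "Bh m \<le> \<delta>" "c * Bh m \<le> \<delta>\<^sup>2"
  proof -
    show *: "Bh m \<le> \<delta>\<^sup>2" using c \<delta> unfolding Bh_def by (simp add: field_simps)
    have "\<delta>\<^sup>2 \<le> \<delta>" using \<delta> by (simp add: power2_eq_square mult_left_le)
    then show "Bh m \<le> \<delta>" using * by linarith
    show "c * Bh m \<le> \<delta>\<^sup>2" using c \<delta> unfolding Bh_def by (simp add: field_simps)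
  qed
  have Bpos: "0 < Bh j" for j
    unfolding Bh_def using neg0[of "n+1-j"] \<delta> c by (auto intro!: add_nonneg_pos divide_pos_pos)
  have Chpos: "0 < Ch j" for j unfolding Ch_def using c \<delta> by auto
  have Bdec: "Bh (j + 1) \<le> Bh j" if "j \<in> {2..m-1}" for j
  proof (cases "j + 1 = m")
    case True
    then show ?thesis using Bm(2) neg0[of "n+1-j"] \<delta> unfolding Bh_def by auto
  next
    case False
    have "n + 1 - (j + 1) \<in> {2..n-1}" "n + 1 - j \<in> {2..n-1}" "n + 1 - (j + 1) \<le> n + 1 - j"
      using that m n by auto
    from dec[OF this(3,1,2)] have "neg (n + 1 - (j + 1)) \<le> neg (n + 1 - j)"
      unfolding neg_def by auto
    then show ?thesis using False that unfolding Bh_def by auto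
  qed
  have Chigh: "C k \<le> \<delta>" if "k \<in> {m..n-2}" for k
  proof (cases "k = m")
    case True
    then show ?thesis using m unfolding C_def Ch_def by auto
  next
    case False
    let ?i = "n - k"
    have i: "?i \<in> {2..m-1}" using False that m n by auto
    have Ck: "C k = Ch ?i * Bh (?i + 1) / Bh ?i" using False that unfolding C_def by auto
    show ?thesis
    proof (cases "?i = m - 1")
      case True
      then have "C k = c * Bh m / Bh ?i" using Ck m unfolding Ch_def by simp
      also have "\<dots> \<le> \<delta>\<^sup>2 / Bh ?i" using Bm(3) Bpos[of ?i] by (intro divide_right_mono) (auto simp: less_imp_le)
      also have "\<dots> \<le> \<delta>\<^sup>2 / \<delta>"
        using neg0[of "n+1-?i"] \<delta> True m Bpos[of ?i] unfolding Bh_def by (intro divide_left_mono) auto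
      finally show ?thesis using \<delta> by (simp add: power2_eq_square)
    next
      case False
      then have "C k = \<delta> * Bh (?i + 1) / Bh ?i" using Ck unfolding Ch_def by simp
      also have "\<dots> \<le> \<delta>" using Bdec[OF i] Bpos[of ?i] \<delta> by (simp add: field_simps)
      finally show ?thesis .
    qed
  qed
  have Cpos: "0 < C k" for k unfolding C_def using Chpos Bpos by auto
  show thesis
  proof (rule that[of C B])
    show "0 < C k" for k by (rule Cpos)
    show "0 < B k" for k unfolding B_def using Bpos by auto
    show "B (n + 1 - k) = B k" if "k \<in> {2..n-1}" for k
      unfolding B_def using that m n by auto
    show "B (j + 1) * C j = B j * C (n - j)" if j: "j \<in> {2..n-2}" for j
    proof -
      consider "j \<le> m - 1" | "j = m" | "m < j" by linarith
      then show ?thesis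
      proof cases
        case 1
        then have "\<not> n - j \<le> m" "j + 1 \<le> m" "j \<le> m" "n - (n - j) = j" using j m n by auto
        then show ?thesis unfolding B_def C_def using Bpos[of j] by simp
      next
        case 2
        then have "n + 1 - (j + 1) = m" "n - j = m" using n by auto
        then show ?thesis unfolding B_def C_def using 2 by simp
      next
        case 3
        then have "n - j \<le> m" "n + 1 - (j + 1) = n - j" "n + 1 - j = n - j + 1" using j n by auto
        then show ?thesis unfolding B_def C_def using 3 Bpos[of "n-j"] by simp
      qed
    qed
    have "C (m - 1) \<le> (\<Sum>k\<in>{2..n-2}. C k)"
      using Cpos m n by (intro member_le_sum) (auto simp: less_imp_le)
    moreover have "C (m - 1) = c" unfolding C_def Ch_def by simp
    ultimately show "0 < - a + (\<Sum>k\<in>{2..n-2}. C k)" using c by linarith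
    show "(if 3 \<le> k then C (k - 1) else 0) - (if k \<le> n - 2 then C k else 0) - B k < lam k" if k: "k \<in> {2..n-1}" for k
    proof -
      have p: "0 \<le> (if k \<le> n - 2 then C k else 0)" "0 < B k" using Cpos Bpos unfolding B_def by (auto simp: less_imp_le)
      consider "k \<le> m - 1" | "k = m" | "k = m + 1" | "m + 2 \<le> k" by linarith
      then show ?thesis
      proof cases
        case 1
        then have "(if 3 \<le> k then C (k - 1) else 0) \<le> \<delta>" using \<delta> m unfolding C_def Ch_def by auto
        moreover have "lam (m + 1) \<le> lam k" using dec[of k "m+1"] k 1 m n by auto
        ultimately show ?thesis using p \<delta>(3) by linarith
      next
        case 2
        then have "(if 3 \<le> k then C (k - 1) else 0) = c" using m unfolding C_def Ch_def by auto
        then show ?thesis using p c 2 by auto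
      next
        case 3
        then have "(if 3 \<le> k then C (k - 1) else 0) \<le> \<delta>" using Chigh[of m] m n by auto
        then show ?thesis using p \<delta>(3) 3 by auto
      next
        case 4
        then have "k - 1 \<in> {m..n-2}" using k m n by auto
        from Chigh[OF this] have 1: "(if 3 \<le> k then C (k - 1) else 0) \<le> \<delta>" using \<delta>(1) by auto
        have "B k = neg k + 2 * \<delta>" using 4 k m n unfolding B_def Bh_def by auto
        moreover have "- lam k \<le> neg k" unfolding neg_def by simp
        ultimately show ?thesis using 1 p(1) \<delta>(1) by linarith
      qed
    qed
    have "(\<Sum>k\<in>{2..n-1}. B k) = (\<Sum>k\<in>{2..m}. B k) + (\<Sum>k\<in>{m+1..n-1}. B k)"
      using m n by (subst sum.union_disjoint[symmetric]) (auto intro!: sum.cong)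
    also have "(\<Sum>k\<in>{m+1..n-1}. B k) = (\<Sum>k\<in>{2..m}. B k)"
      by (rule sum.reindex_bij_witness[of _ "\<lambda>k. n + 1 - k" "\<lambda>k. n + 1 - k"]) (use m n in \<open>auto simp: B_def\<close>)
    also have "(\<Sum>k\<in>{2..m}. B k) \<le> (\<Sum>k\<in>{2..m}. neg (n + 1 - k) + 2 * \<delta>)"
    proof (rule sum_mono)
      fix k assume "k \<in> {2..m}"
      then show "B k \<le> neg (n + 1 - k) + 2 * \<delta>"
        using Bm(2) neg0[of "n+1-k"] \<delta> unfolding B_def by (cases "k = m") (auto simp: Bh_def)
    qed
    also have "\<dots> = (\<Sum>k\<in>{2..m}. neg (n + 1 - k)) + real (m - 1) * (2 * \<delta>)"
      using m by (simp add: sum.distrib)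
    also have "(\<Sum>k\<in>{2..m}. neg (n + 1 - k)) = (\<Sum>j\<in>{m+1..n-1}. neg j)"
      by (rule sum.reindex_bij_witness[of _ "\<lambda>k. n + 1 - k" "\<lambda>k. n + 1 - k"]) (use m n in auto)
    finally have "(\<Sum>k\<in>{2..n-1}. B k) \<le> 2 * ((\<Sum>j\<in>{m+1..n-1}. neg j) + real (m - 1) * (2 * \<delta>))"
      by (simp add: mult.commute)
    moreover have "(\<Sum>j\<in>{m+1..n-1}. neg j) + real (m - 1) * (2 * \<delta>) < \<mu>"
    proof -
      have "real (m - 1) * (2 * \<delta>) \<le> real m * (2 * \<delta>)" using \<delta> by (intro mult_right_mono) auto
      also have "\<dots> < \<eta>" using \<delta>(4) m by (simp add: field_simps)
      finally show ?thesis unfolding \<eta>_def by simp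
    qed
    ultimately show "(\<Sum>k\<in>{2..n-1}. B k) < 2 * \<mu>" by (meson dual_order.strict_trans2 le_less_trans mult_strict_left_mono zero_less_numeral)
    show "a < \<mu>" by (rule \<mu>a)
  qed
qed

section \<open>Extensions by one vector\<close>

text \<open>Index intervals start at 1, which is kept as a numeral.\<close>

declare One_nat_def [simp del]

lemma frame_subframe:
  assumes e: "frame I e S" and J: "J \<subseteq> I"
  shows "frame J e (span (e ` J))"
  using e J unfolding frame_def
  by (meson finite_subset image_mono inj_on_subset real_vector.independent_mono)

lemma coord_subframe:
  assumes e: "frame I e S" and J: "J \<subseteq> I" and v: "v \<in> span (e ` J)" and i: "i \<in> I"
  shows "coord I e v i = (if i \<in> J then coord J e v i else 0)"
proof -
  have "finite I" using e unfolding frame_def by auto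
  have "v = (\<Sum>j\<in>J. coord J e v j *\<^sub>R e j)"
    using coord_expand[OF frame_subframe[OF e J] v] by simp
  also have "\<dots> = (\<Sum>i\<in>I. (if i \<in> J then coord J e v i else 0) *\<^sub>R e i)"
    using J \<open>finite I\<close> by (intro sum.mono_neutral_cong_left) auto
  finally have *: "v = (\<Sum>i\<in>I. (if i \<in> J then coord J e v i else 0) *\<^sub>R e i)" .
  show ?thesis
    using coord_sum[OF e i, of "\<lambda>i. if i \<in> J then coord J e v i else 0"] * by simp
qed

text \<open>The tails of a frame form a flag, and lying in one of its members is the vanishing of initial
  coordinates.\<close>

lemma span_tail_iff:
  fixes X :: "nat \<Rightarrow> 'a::real_vector"
  assumes e: "frame {1..n} X N" and k: "1 \<le> k"
  shows "v \<in> span (X ` {k..n}) \<longleftrightarrow> v \<in> N \<and> (\<forall>j\<in>{1..n}. j < k \<longrightarrow> coord {1..n} X v j = 0)"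
proof
  have sub: "{k..n} \<subseteq> {1..n}" using k by auto
  {
    assume v: "v \<in> span (X ` {k..n})"
    have "v \<in> N"
      using v real_vector.span_mono[OF image_mono[OF sub, of X]] e unfolding frame_def by auto
    then show "v \<in> N \<and> (\<forall>j\<in>{1..n}. j < k \<longrightarrow> coord {1..n} X v j = 0)"
      using coord_subframe[OF e sub v] by auto
  }
  assume v: "v \<in> N \<and> (\<forall>j\<in>{1..n}. j < k \<longrightarrow> coord {1..n} X v j = 0)"
  have "v = (\<Sum>i\<in>{1..n}. coord {1..n} X v i *\<^sub>R X i)" using coord_expand[OF e] v by simp
  also have "\<dots> \<in> span (X ` {k..n})"
  proof (intro span_sum)
    fix i assume i: "i \<in> {1..n}"
    show "coord {1..n} X v i *\<^sub>R X i \<in> span (X ` {k..n})"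
    proof (cases "i < k")
      case True
      then show ?thesis using v i by (simp add: real_vector.span_zero)
    next
      case False
      then show ?thesis using i by (intro span_scale span_base) auto
    qed
  qed
  finally show "v \<in> span (X ` {k..n})" .
qed

context lie
begin

lemma coord_br:
  assumes X: "frame J X N" and N: "lie_ideal br N" and v: "v \<in> N"
  shows "k \<in> J \<Longrightarrow> coord J X (br v (X k)) l = (\<Sum>i\<in>J. coord J X v i * coord J X (br (X i) (X k)) l)"
    and "coord J X (br u v) l = (\<Sum>i\<in>J. coord J X v i * coord J X (br u (X i)) l)"
proof -
  have sN: "subspace N" and br: "\<And>x y. y \<in> N \<Longrightarrow> br x y \<in> N" using N unfolding lie_ideal_def by auto
  have v': "v = (\<Sum>i\<in>J. coord J X v i *\<^sub>R X i)" using coord_expand[OF X v] by simp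
  have "coord J X (br u v) l = coord J X (\<Sum>i\<in>J. coord J X v i *\<^sub>R br u (X i)) l"
    by (subst v') (simp add: br_sums)
  also have "\<dots> = (\<Sum>i\<in>J. coord J X v i * coord J X (br u (X i)) l)"
    using br frame_in[OF X] sN by (subst coord_setsum[OF X]) (auto simp: coord_scale[OF X] subspace_scale)
  finally show "coord J X (br u v) l = (\<Sum>i\<in>J. coord J X v i * coord J X (br u (X i)) l)" .
  assume k: "k \<in> J"
  have "coord J X (br v (X k)) l = coord J X (\<Sum>i\<in>J. coord J X v i *\<^sub>R br (X i) (X k)) l"
    by (subst v') (simp add: br_sums)
  also have "\<dots> = (\<Sum>i\<in>J. coord J X v i * coord J X (br (X i) (X k)) l)"
    using br frame_in[OF X k] sN by (subst coord_setsum[OF X]) (auto simp: coord_scale[OF X] subspace_scale)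
  finally show "coord J X (br v (X k)) l = (\<Sum>i\<in>J. coord J X v i * coord J X (br (X i) (X k)) l)" .
qed

lemma coord_skew:
  assumes X: "frame J X N" and "br u v \<in> N"
  shows "coord J X (br v u) l = - coord J X (br u v) l"
  using coord_scale[OF X assms(2), of "-1" l] skew[of v u] by simp

text \<open>The vector outside the nilradical receives the index 0.\<close>

lemma extended_frame:
  fixes X :: "nat \<Rightarrow> 'a"
  assumes X: "frame {1..n} X N" and Y: "Y \<notin> N" "span (insert Y N) = UNIV"
  shows "frame ({0} \<union> {1..n}) (X(0 := Y)) UNIV"
    and "v \<in> N \<Longrightarrow> k \<in> {0} \<union> {1..n} \<Longrightarrow>
      coord ({0} \<union> {1..n}) (X(0 := Y)) v k = (if k = 0 then 0 else coord {1..n} X v k)"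
proof -
  let ?e = "X(0 := Y)"
  have im: "?e ` {1..n} = X ` {1..n}" by auto
  have X': "frame {1..n} ?e N"
  proof -
    have "inj_on ?e {1..n} = inj_on X {1..n}" by (rule inj_on_cong) auto
    then show ?thesis using X unfolding frame_def im by simp
  qed
  show e: "frame ({0} \<union> {1..n}) ?e UNIV"
    using frame_insert[OF X', of 0] Y by simp
  assume v: "v \<in> N" and k: "k \<in> {0} \<union> {1..n}"
  have "v \<in> span (?e ` {1..n})" using X' v unfolding frame_def by simp
  from coord_subframe[OF e Un_upper2 this k]
  have "coord ({0} \<union> {1..n}) ?e v k = (if k \<in> {1..n} then coord {1..n} ?e v k else 0)" .
  moreover have "coord {1..n} ?e v k = coord {1..n} X v k" if "k \<in> {1..n}"
    unfolding coord_def im using that by simp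
  moreover have "k = 0 \<longleftrightarrow> k \<notin> {1..n}" using k by auto
  ultimately show "coord ({0} \<union> {1..n}) ?e v k = (if k = 0 then 0 else coord {1..n} X v k)"
    by presburger
qed

text \<open>The criterion \<open>negative_ricci_codim1\<close> expressed by the matrix \<open>a\<close> of \<open>ad Y\<close> and the structure
  constants \<open>b\<close> of the ideal. The vector \<open>Y\<close> has degree 0, so triangularity of \<open>a\<close> is the condition that
  brackets with \<open>Y\<close> do not lower degrees.\<close>

lemma negative_ricci_extension:
  fixes X :: "nat \<Rightarrow> 'a" and f :: "nat \<Rightarrow> nat" and n :: nat and Y :: 'a
  defines "a \<equiv> \<lambda>i. coord {1..n} X (br Y (X i))"
  defines "b \<equiv> \<lambda>i j. coord {1..n} X (br (X i) (X j))"
  defines "G \<equiv> \<lambda>d i j k. if f i + f j = f k then b i j k * (d i * d j / d k) else 0"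
  assumes N: "lie_ideal br N" and X: "frame {1..n} X N" and Y: "one_dim_extension_by N Y"
    and f: "\<And>i. i \<in> {1..n} \<Longrightarrow> 0 < f i" "inj_on f {1..n}"
    and d: "\<And>i. i \<in> {1..n} \<Longrightarrow> 0 < d i"
    and triangular: "\<And>i j. i \<in> {1..n} \<Longrightarrow> j \<in> {1..n} \<Longrightarrow> a i j \<noteq> 0 \<Longrightarrow> f i \<le> f j"
    and graded: "\<And>i j k. i \<in> {1..n} \<Longrightarrow> j \<in> {1..n} \<Longrightarrow> k \<in> {1..n} \<Longrightarrow> b i j k \<noteq> 0 \<Longrightarrow> f i + f j \<le> f k"
    and nice1: "\<And>i j k l. i \<in> {1..n} \<Longrightarrow> j \<in> {1..n} \<Longrightarrow> k \<in> {1..n} \<Longrightarrow> l \<in> {1..n} \<Longrightarrow> i \<noteq> j \<Longrightarrow>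
      G d i k l = 0 \<or> G d j k l = 0"
    and nice2: "\<And>i j k l. i \<in> {1..n} \<Longrightarrow> j \<in> {1..n} \<Longrightarrow> k \<in> {1..n} \<Longrightarrow> l \<in> {1..n} \<Longrightarrow> i \<noteq> j \<Longrightarrow>
      G d k l i = 0 \<or> G d k l j = 0"
    and weight: "\<exists>i\<in>{1..n}. a i i \<noteq> 0"
    and neg: "\<And>i. i \<in> {1..n} \<Longrightarrow> - (\<Sum>k\<in>{1..n}. a k k) * a i i
       - 1/2 * (\<Sum>k\<in>{1..n}. \<Sum>l\<in>{1..n}. (G d i k l)\<^sup>2)
       + 1/4 * (\<Sum>k\<in>{1..n}. \<Sum>l\<in>{1..n}. (G d k l i)\<^sup>2) < 0"
  shows "\<exists>ip. inner_product ip \<and> negative_ricci br ip"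
proof -
  have Y': "Y \<notin> N" "span (insert Y N) = UNIV" using Y unfolding one_dim_extension_by_def by auto
  have br: "\<And>x y. y \<in> N \<Longrightarrow> br x y \<in> N" using N unfolding lie_ideal_def by auto
  let ?e = "X(0 := Y)" and ?I = "{0} \<union> {1..n}"
  define c where "c i j k = coord ?I ?e (br (?e i) (?e j)) k" for i j k
  note e = extended_frame[OF X Y']
  have XN: "X i \<in> N" if "i \<in> {1..n}" for i using frame_in[OF X that] .
  have c1: "c 0 i k = (if k = 0 then 0 else a i k)" if "i \<in> {1..n}" "k \<in> ?I" for i k
    unfolding c_def a_def using e(2)[OF br[OF XN[OF that(1)]] that(2), of Y] that by auto
  have c2: "c i 0 k = (if k = 0 then 0 else - a i k)" if "i \<in> {1..n}" "k \<in> ?I" for i k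
    using coord_skew[OF e(1), of Y "X i" k] c1[OF that] that unfolding c_def by auto
  have c3: "c i j k = (if k = 0 then 0 else b i j k)" if "i \<in> {1..n}" "j \<in> {1..n}" "k \<in> ?I" for i j k
    unfolding c_def b_def using e(2)[OF br[OF XN[OF that(2)]] that(3), of "X i"] that by auto
  have c4: "c 0 0 k = 0" for k unfolding c_def by (simp add: alt coord_zero)
  let ?f = "f(0 := 0)" and ?d = "d(0 := 1)"
  have G: "(if ?f i + ?f j = ?f k then c i j k * (?d i * ?d j / ?d k) else 0) = G d i j k"
    if "i \<in> {1..n}" "j \<in> {1..n}" "k \<in> {1..n}" for i j k
  proof -
    have "c i j k = b i j k" "i \<noteq> 0" "j \<noteq> 0" "k \<noteq> 0" using c3[OF that(1,2), of k] that by simp_all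
    then show ?thesis unfolding G_def by simp
  qed
  show ?thesis
  proof (rule negative_ricci_codim1[OF e(1), where f="?f" and d="?d"], unfold c_def[symmetric])
    show "?f 0 = 0" by simp
    show "0 < ?f i" if "i \<in> {1..n}" for i using f(1)[OF that] that by auto
    show "inj_on ?f {1..n}" using f(2) inj_on_cong[of "{1..n}" ?f f] by simp
    show "?d 0 = 1" by simp
    show "0 < ?d i" if "i \<in> {1..n}" for i using d[OF that] that by auto
    show "?f i + ?f j \<le> ?f k" if ijk: "i \<le> n" "j \<le> n" "k \<le> n" "c i j k \<noteq> 0" for i j k
    proof -
      consider "i = 0" "j = 0" | "i = 0" "j \<in> {1..n}" | "i \<in> {1..n}" "j = 0" | "i \<in> {1..n}" "j \<in> {1..n}"
        using ijk by (cases "i = 0"; cases "j = 0") auto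
      then show ?thesis
      proof cases
        case 1 then show ?thesis using ijk c4 by auto
      next
        case 2 then show ?thesis using ijk c1[of j k] triangular[of j k] by (auto split: if_splits)
      next
        case 3 then show ?thesis using ijk c2[of i k] triangular[of i k] by (auto split: if_splits)
      next
        case 4 then show ?thesis using ijk c3[of i j k] graded[of i j k] by (auto split: if_splits)
      qed
    qed
    show "\<exists>i\<in>{1..n}. c 0 i i \<noteq> 0" using weight c1 by fastforce
    have cc: "c 0 i i = a i i" if "i \<in> {1..n}" for i using c1[of i i] that by auto
    show "(if ?f i + ?f k = ?f l then c i k l * (?d i * ?d k / ?d l) else 0) = 0 \<or>
        (if ?f j + ?f k = ?f l then c j k l * (?d j * ?d k / ?d l) else 0) = 0"
      if "i \<in> {1..n}" "j \<in> {1..n}" "k \<in> {1..n}" "l \<in> {1..n}" "i \<noteq> j" for i j k l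
      unfolding G[OF that(1,3,4)] G[OF that(2,3,4)] by (rule nice1[OF that])
    show "(if ?f k + ?f l = ?f i then c k l i * (?d k * ?d l / ?d i) else 0) = 0 \<or>
        (if ?f k + ?f l = ?f j then c k l j * (?d k * ?d l / ?d j) else 0) = 0"
      if "i \<in> {1..n}" "j \<in> {1..n}" "k \<in> {1..n}" "l \<in> {1..n}" "i \<noteq> j" for i j k l
      unfolding G[OF that(3,4,1)] G[OF that(3,4,2)] by (rule nice2[OF that])
    show "- (\<Sum>k = 1..n. c 0 k k) * c 0 i i
         - 1 / 2 * (\<Sum>k = 1..n. \<Sum>l = 1..n. (if ?f i + ?f k = ?f l then c i k l * (?d i * ?d k / ?d l) else 0)\<^sup>2)
         + 1 / 4 * (\<Sum>k = 1..n. \<Sum>l = 1..n. (if ?f k + ?f l = ?f i then c k l i * (?d k * ?d l / ?d i) else 0)\<^sup>2) < 0"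
      if i: "i \<in> {1..n}" for i
    proof -
      have 1: "(\<Sum>k = 1..n. c 0 k k) = (\<Sum>k = 1..n. a k k)" using cc by (intro sum.cong) auto
      have 2: "(\<Sum>k = 1..n. \<Sum>l = 1..n. (if ?f i + ?f k = ?f l then c i k l * (?d i * ?d k / ?d l) else 0)\<^sup>2)
         = (\<Sum>k\<in>{1..n}. \<Sum>l\<in>{1..n}. (G d i k l)\<^sup>2)"
        by (intro sum.cong refl arg_cong[where f="\<lambda>x. x\<^sup>2"] G i) auto
      have 3: "(\<Sum>k = 1..n. \<Sum>l = 1..n. (if ?f k + ?f l = ?f i then c k l i * (?d k * ?d l / ?d i) else 0)\<^sup>2)
         = (\<Sum>k\<in>{1..n}. \<Sum>l\<in>{1..n}. (G d k l i)\<^sup>2)"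
        by (intro sum.cong refl arg_cong[where f="\<lambda>x. x\<^sup>2"] G i) auto
      show ?thesis unfolding 1 2 3 cc[OF i] by (rule neg[OF i])
    qed
  qed
qed

lemma trace_on_tail:
  fixes X :: "nat \<Rightarrow> 'a"
  assumes X: "frame {1..n} X N" and N: "lie_ideal br N" and k: "1 \<le> k"
    and tri: "\<And>i j. i \<in> {1..n} \<Longrightarrow> j \<in> {1..n} \<Longrightarrow> j < i \<Longrightarrow> coord {1..n} X (br Z (X i)) j = 0"
  shows "trace_on (span (X ` {k..n})) (br Z) = (\<Sum>j\<in>{k..n}. coord {1..n} X (br Z (X j)) j)"
    and "v \<in> span (X ` {k..n}) \<Longrightarrow> br Z v \<in> span (X ` {k..n})"
proof -
  have sub: "{k..n} \<subseteq> {1..n}" using k by auto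
  have br: "\<And>x y. y \<in> N \<Longrightarrow> br x y \<in> N" using N unfolding lie_ideal_def by auto
  have inv: "br Z (X i) \<in> span (X ` {k..n})" if "i \<in> {k..n}" for i
    unfolding span_tail_iff[OF X k] using tri[of i] br frame_in[OF X, of i] that sub by auto
  have "trace_on (span (X ` {k..n})) (br Z) = (\<Sum>j\<in>{k..n}. coord {k..n} X (br Z (X j)) j)"
    by (rule trace_on_frame[OF frame_subframe[OF X sub] lin inv])
  also have "\<dots> = (\<Sum>j\<in>{k..n}. coord {1..n} X (br Z (X j)) j)"
    using coord_subframe[OF X sub inv] sub by (intro sum.cong) auto
  finally show "trace_on (span (X ` {k..n})) (br Z) = (\<Sum>j\<in>{k..n}. coord {1..n} X (br Z (X j)) j)" .
  assume v: "v \<in> span (X ` {k..n})"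
  show "br Z v \<in> span (X ` {k..n})"
    using v
  proof (induction rule: span_induct_alt)
    case base
    then show ?case by (simp add: br_simps real_vector.span_zero)
  next
    case (step c x y)
    then show ?case using inv by (auto simp: br_simps intro!: span_add span_scale)
  qed
qed

section \<open>Extensions of L\<close>

lemma L_structure:
  assumes L: "L_basis br n X N" and ijk: "i \<in> {1..n}" "j \<in> {1..n}" "k \<in> {1..n}"
  shows "coord {1..n} X (br (X i) (X j)) k =
    (if i = 1 \<and> 2 \<le> j \<and> k = j + 1 then 1 else if j = 1 \<and> 2 \<le> i \<and> k = i + 1 then - 1 else 0)"
proof -
  have X: "frame {1..n} X N" using L unfolding L_basis_def frame_basis_family by auto
  have lt: "coord {1..n} X (br (X i) (X j)) k = (if i = 1 \<and> k = j + 1 then 1 else 0) \<and> br (X i) (X j) \<in> N"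
    if "i \<in> {1..n}" "j \<in> {1..n}" "i < j" for i j
  proof -
    have "br (X i) (X j) = (if i = 1 \<and> j \<le> n - 1 then X (j + 1) else 0)"
      using L that unfolding L_basis_def by blast
    moreover have "0 \<in> N" using frame_subspace[OF X] subspace_0 by auto
    ultimately show ?thesis using that ijk frame_in[OF X] by (auto simp: coord_zero coord_basis[OF X])
  qed
  consider "i < j" | "i = j" | "j < i" by linarith
  then show ?thesis
  proof cases
    case 1 then show ?thesis using lt[OF ijk(1,2)] ijk by auto
  next
    case 2 then show ?thesis by (auto simp: alt coord_zero)
  next
    case 3
    then show ?thesis using lt[OF ijk(2,1)] coord_skew[OF X, of "X j" "X i" k] ijk by auto
  qed
qed

text \<open>Every derivation is triangular with weights in arithmetic progression: apply it to
  \<open>X (k + 1) = [X 1, X k]\<close>. The induction starts with \<open>a 2 1 = 0\<close>, which comes from \<open>[X 2, X 3] = 0\<close> and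
  \<open>[X 1, X 3] = X 4 \<noteq> 0\<close>.\<close>

lemma L_derivation:
  fixes Z :: 'a and n :: nat and X :: "nat \<Rightarrow> 'a"
  assumes N: "lie_ideal br N" and L: "L_basis br n X N" and n: "4 \<le> n"
  defines "a \<equiv> \<lambda>i. coord {1..n} X (br Z (X i))"
  shows "\<And>i j. i \<in> {1..n} \<Longrightarrow> j \<in> {1..n} \<Longrightarrow> j < i \<Longrightarrow> a i j = 0"
    and "\<And>k. k \<in> {2..n} \<Longrightarrow> a k k = a 2 2 + (real k - 2) * a 1 1"
proof -
  have X: "frame {1..n} X N" using L unfolding L_basis_def frame_basis_family by auto
  have sN: "subspace N" and br: "\<And>x y. y \<in> N \<Longrightarrow> br x y \<in> N" using N unfolding lie_ideal_def by auto
  have br': "br x y \<in> N" if "x \<in> N" for x y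
    using br[OF that, of y] skew[of x y] sN subspace_neg by metis
  have XN: "X i \<in> N" if "i \<in> {1..n}" for i using frame_in[OF X that] .
  have brk: "coord {1..n} X (br v (X k)) l = (if l = k + 1 then coord {1..n} X v 1 else 0)"
    if v: "v \<in> N" and k: "k \<in> {2..n}" and l: "l \<in> {1..n}" for v k l
  proof -
    have "coord {1..n} X (br v (X k)) l = (\<Sum>i\<in>{1..n}. if i = 1 then (if l = k + 1 then coord {1..n} X v 1 else 0) else 0)"
      using k l by (subst coord_br(1)[OF X N v]) (simp, rule sum.cong[OF refl], auto simp: L_structure[OF L])
    then show ?thesis using n by simp
  qed
  have br1: "coord {1..n} X (br (X 1) v) l = (if 3 \<le> l then coord {1..n} X v (l - 1) else 0)"
    if v: "v \<in> N" and l: "l \<in> {1..n}" for v l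
  proof -
    have "coord {1..n} X (br (X 1) v) l = (\<Sum>i\<in>{1..n}. if i = l - 1 then (if 3 \<le> l then coord {1..n} X v (l - 1) else 0) else 0)"
      using l by (subst coord_br(2)[OF X N v], intro sum.cong[OF refl]) (auto simp: L_structure[OF L])
    also have "\<dots> = (if 3 \<le> l then coord {1..n} X v (l - 1) else 0)"
      using l by (cases "3 \<le> l") auto
    finally show ?thesis .
  qed
  have rec: "a (k + 1) l = (if l = k + 1 then a 1 1 else 0) + (if 3 \<le> l then a k (l - 1) else 0)"
    if k: "k \<in> {2..n-1}" and l: "l \<in> {1..n}" for k l
  proof -
    have "X (k + 1) = br (X 1) (X k)" using L k n unfolding L_basis_def by auto
    then have "a (k + 1) l = coord {1..n} X (br (br Z (X 1)) (X k) + br (X 1) (br Z (X k))) l"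
      unfolding a_def using leibniz[of Z "X 1" "X k"] by simp
    also have "\<dots> = coord {1..n} X (br (br Z (X 1)) (X k)) l + coord {1..n} X (br (X 1) (br Z (X k))) l"
      using XN[of 1] XN[of k] k n by (intro coord_add[OF X] br br') auto
    also have "\<dots> = (if l = k + 1 then a 1 1 else 0) + (if 3 \<le> l then a k (l - 1) else 0)"
      unfolding a_def using brk[OF br[OF XN], of 1 k l Z] br1[OF br[OF XN], of k l Z] k l n by auto
    finally show ?thesis .
  qed
  have "a 2 1 = 0"
  proof -
    have "br (X 2) (X 3) = 0" using L n unfolding L_basis_def by auto
    then have "0 = coord {1..n} X (br (br Z (X 2)) (X 3) + br (X 2) (br Z (X 3))) 4"
      using leibniz[of Z "X 2" "X 3"] by (simp add: br_simps coord_zero)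
    also have "\<dots> = coord {1..n} X (br (br Z (X 2)) (X 3)) 4 + coord {1..n} X (br (X 2) (br Z (X 3))) 4"
      using XN[of 2] XN[of 3] n by (intro coord_add[OF X] br br') auto
    also have "coord {1..n} X (br (X 2) (br Z (X 3))) 4 = 0"
      using n XN[of 3] by (subst coord_br(2)[OF X N br]) (auto intro!: sum.neutral simp: L_structure[OF L])
    also have "coord {1..n} X (br (br Z (X 2)) (X 3)) 4 = a 2 1"
      unfolding a_def using brk[OF br[OF XN], of 2 3 4 Z] n by auto
    finally show ?thesis by simp
  qed
  have low: "\<forall>j\<in>{1..n}. j < k \<longrightarrow> a k j = 0" if "2 \<le> k" "k \<le> n" for k
    using that
  proof (induction k rule: dec_induct)
    case base
    show ?case
    proof (intro ballI impI)
      fix j assume "j \<in> {1..n}" "j < 2"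
      then have "j = 1" by auto
      then show "a 2 j = 0" using \<open>a 2 1 = 0\<close> by simp
    qed
  next
    case (step k)
    have k: "k \<in> {2..n-1}" using step n by auto
    show ?case
    proof (intro ballI impI)
      fix j assume j: "j \<in> {1..n}" "j < Suc k"
      have "a k (j - 1) = 0" if "3 \<le> j"
      proof -
        have "j - 1 \<in> {1..n}" "j - 1 < k" using j that by auto
        then show ?thesis using step by auto
      qed
      then show "a (Suc k) j = 0" using rec[OF k j(1)] j(2) by (auto simp: Suc_eq_plus1)
    qed
  qed
  show "a i j = 0" if "i \<in> {1..n}" "j \<in> {1..n}" "j < i" for i j
    using low[of i] that by auto
  show "a k k = a 2 2 + (real k - 2) * a 1 1" if "k \<in> {2..n}" for k
  proof -
    have "2 \<le> k" "k \<le> n" using that by auto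
    then show ?thesis
    proof (induction k rule: dec_induct)
      case (step k)
      then have "a (Suc k) (Suc k) = a 1 1 + a k k" using rec[of k "k+1"] by (auto simp: Suc_eq_plus1)
      then show ?case using step by (simp add: algebra_simps)
    qed simp
  qed
qed

lemma L_iota:
  fixes Y :: 'a and n :: nat and X :: "nat \<Rightarrow> 'a"
  assumes N: "lie_ideal br N" and L: "L_basis br n X N" and n: "4 \<le> n"
  defines "a \<equiv> \<lambda>i. coord {1..n} X (br Y (X i))"
  shows "iota_L2 br n X Y = (\<Sum>j\<in>{2..n}. a j j)" "iota_Ln br n X Y = a n n"
proof -
  have X: "frame {1..n} X N" using L unfolding L_basis_def frame_basis_family by auto
  have tri: "coord {1..n} X (br Y (X i)) j = 0" if "i \<in> {1..n}" "j \<in> {1..n}" "j < i" for i j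
    using L_derivation(1)[OF N L n that] .
  show "iota_L2 br n X Y = (\<Sum>j\<in>{2..n}. a j j)"
    unfolding iota_L2_def a_def by (rule trace_on_tail(1)[OF X N _ tri]) auto
  have "X n \<in> N" using frame_in[OF X, of n] n by auto
  then have "br Y (X n) \<in> N" using N unfolding lie_ideal_def by auto
  then have "br Y (X n) = (\<Sum>j\<in>{1..n}. a n j *\<^sub>R X j)" using coord_expand[OF X] unfolding a_def by simp
  also have "\<dots> = (\<Sum>j\<in>{1..n}. if j = n then a n n *\<^sub>R X n else 0)"
    using tri[of n] n unfolding a_def by (intro sum.cong) auto
  finally have "br Y (X n) = a n n *\<^sub>R X n" using n by simp
  moreover have "X n \<noteq> 0"
    using coord_basis[OF X, of n n] n coord_zero[of "{1..n}" X n] by auto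
  ultimately show "iota_Ln br n X Y = a n n" unfolding iota_Ln_def by (auto intro!: the_equality)
qed

lemma sum_single_pair:
  assumes "p \<in> A" "q \<in> B" "finite A" "finite B"
  shows "(\<Sum>k\<in>A. \<Sum>l\<in>B. if k = p \<and> l = q then x else 0) = (x::real)"
proof -
  have "(\<Sum>k\<in>A. \<Sum>l\<in>B. if k = p \<and> l = q then x else 0) = (\<Sum>k\<in>A. if k = p then x else 0)"
    using assms by (intro sum.cong refl) auto
  then show ?thesis using assms by simp
qed

text \<open>With \<open>X i\<close> in degree \<open>i\<close> the brackets are graded, and diagonal scalings \<open>d\<close> realise any positive
  constants \<open>\<gamma> k\<close> for the brackets \<open>[X 1, X k]\<close>. For \<open>(\<gamma> k)\<^sup>2 = 2 T C k\<close> a factor \<open>- T\<close> can be taken out of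
  the Ricci form, leaving the inequalities of \<open>L_coefficients\<close>.\<close>

lemma L_sufficient:
  assumes N: "lie_ideal br N" and L: "L_basis br n X N" and n: "4 \<le> n"
    and Y: "one_dim_extension_by N Y"
    and iota: "0 < iota_L2 br n X Y" "0 < iota_Ln br n X Y"
  shows "\<exists>ip. inner_product ip \<and> negative_ricci br ip"
proof -
  have X: "frame {1..n} X N" using L unfolding L_basis_def frame_basis_family by auto
  define a where "a i = coord {1..n} X (br Y (X i))" for i
  have tri: "a i j = 0" if "i \<in> {1..n}" "j \<in> {1..n}" "j < i" for i j
    unfolding a_def using L_derivation(1)[OF N L n that] .
  define lam where "lam k = a k k" for k
  have lam: "lam k = a 2 2 + (real k - 2) * a 1 1" if "k \<in> {2..n}" for k
    unfolding lam_def a_def using L_derivation(2)[OF N L n that] .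
  have pos: "0 < (\<Sum>k\<in>{2..n}. lam k)" "0 < lam n"
    using iota L_iota[OF N L n, of Y] unfolding lam_def a_def by auto
  obtain C where C: "\<And>k. k \<in> {2..n-1} \<Longrightarrow> 0 < C k" "0 < lam 1 + (\<Sum>k\<in>{2..n-1}. C k)"
    "\<And>k. k \<in> {2..n} \<Longrightarrow> (if 3 \<le> k then C (k - 1) else 0) - (if k \<le> n - 1 then C k else 0) < lam k"
    "0 < (\<Sum>k\<in>{1..n}. lam k)"
    using L_coefficients[OF n lam_def[of 1] lam pos] by blast
  define T where "T = (\<Sum>k\<in>{1..n}. lam k)"
  have T: "0 < T" using C(4) unfolding T_def .
  define \<gamma> where "\<gamma> k = (if k \<in> {2..n-1} then sqrt (2 * T * C k) else 1)" for k
  have \<gamma>: "0 < \<gamma> k" for k unfolding \<gamma>_def using C(1) T by auto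
  have \<gamma>2: "(\<gamma> k)\<^sup>2 = 2 * T * C k" if "k \<in> {2..n-1}" for k
    using C(1)[OF that] T that unfolding \<gamma>_def by simp
  define d where "d k = (\<Prod>j\<in>{2..<k}. 1 / \<gamma> j)" for k
  have d: "0 < d k" for k unfolding d_def using \<gamma> by (intro prod_pos) auto
  have d1: "d 1 = 1" unfolding d_def by simp
  have dS: "d k / d (k + 1) = \<gamma> k" if "2 \<le> k" for k
  proof -
    have "d (k + 1) = d k * (1 / \<gamma> k)" unfolding d_def using prod.atLeastLessThan_Suc[of 2 k "\<lambda>j. 1 / \<gamma> j"] that by (simp add: Suc_eq_plus1)
    then show ?thesis using d[of k] \<gamma>[of k] by simp
  qed
  define b where "b i j k = coord {1..n} X (br (X i) (X j)) k" for i j k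
  define G where "G i j k = (if i + j = k then b i j k * (d i * d j / d k) else 0)" for i j k
  have b: "b i j k = (if i = 1 \<and> 2 \<le> j \<and> k = j + 1 then 1 else if j = 1 \<and> 2 \<le> i \<and> k = i + 1 then - 1 else 0)"
    if "i \<in> {1..n}" "j \<in> {1..n}" "k \<in> {1..n}" for i j k
    unfolding b_def by (rule L_structure[OF L that])
  have G: "G i j k = (if i = 1 \<and> 2 \<le> j \<and> k = j + 1 then \<gamma> j else if j = 1 \<and> 2 \<le> i \<and> k = i + 1 then - \<gamma> i else 0)"
    if "i \<in> {1..n}" "j \<in> {1..n}" "k \<in> {1..n}" for i j k
    using dS[of j] dS[of i] d1 unfolding G_def b[OF that] by auto
  (* Brackets starting at X i, and below those ending at X i. *)
  have out: "(\<Sum>k\<in>{1..n}. \<Sum>l\<in>{1..n}. (G i k l)\<^sup>2) =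
      (if i = 1 then 2 * T * (\<Sum>k\<in>{2..n-1}. C k) else if i \<le> n - 1 then 2 * T * C i else 0)"
    if i: "i \<in> {1..n}" for i
  proof (cases "i = 1")
    case True
    have "(\<Sum>k\<in>{1..n}. \<Sum>l\<in>{1..n}. (G i k l)\<^sup>2) = (\<Sum>k\<in>{1..n}. if k \<in> {2..n-1} then 2 * T * C k else 0)"
    proof (rule sum.cong[OF refl])
      fix k assume k: "k \<in> {1..n}"
      have "(\<Sum>l\<in>{1..n}. (G i k l)\<^sup>2) = (\<Sum>l\<in>{1..n}. if l = k + 1 then (if 2 \<le> k then (\<gamma> k)\<^sup>2 else 0) else 0)"
        using k i True by (intro sum.cong refl) (auto simp: G)
      also have "\<dots> = (if k \<in> {2..n-1} then 2 * T * C k else 0)"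
        using k \<gamma>2[of k] by (auto simp: sum.delta)
      finally show "(\<Sum>l\<in>{1..n}. (G i k l)\<^sup>2) = (if k \<in> {2..n-1} then 2 * T * C k else 0)" .
    qed
    also have "\<dots> = (\<Sum>k\<in>{2..n-1}. 2 * T * C k)"
      by (rule sum.mono_neutral_cong_right) auto
    finally show ?thesis using True by (simp add: sum_distrib_left)
  next
    case False
    have "(\<Sum>k\<in>{1..n}. \<Sum>l\<in>{1..n}. (G i k l)\<^sup>2) = (\<Sum>k\<in>{1..n}. \<Sum>l\<in>{1..n}. if k = 1 \<and> l = i + 1 then (\<gamma> i)\<^sup>2 else 0)"
      using i False by (intro sum.cong refl) (auto simp: G)
    also have "\<dots> = (if i \<le> n - 1 then 2 * T * C i else 0)"
    proof (cases "i \<le> n - 1")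
      case True
      then show ?thesis using sum_single_pair[of 1 "{1..n}" "i+1" "{1..n}"] \<gamma>2[of i] i False by auto
    next
      case False
      then show ?thesis using i by (auto intro!: sum.neutral)
    qed
    finally show ?thesis using False by simp
  qed
  have into: "(\<Sum>k\<in>{1..n}. \<Sum>l\<in>{1..n}. (G k l i)\<^sup>2) = (if 3 \<le> i then 4 * T * C (i - 1) else 0)"
    if i: "i \<in> {1..n}" for i
  proof (cases "3 \<le> i")
    case True
    have "(\<Sum>k\<in>{1..n}. \<Sum>l\<in>{1..n}. (G k l i)\<^sup>2) = (\<Sum>k\<in>{1..n}. \<Sum>l\<in>{1..n}.
        (if k = 1 \<and> l = i - 1 then (\<gamma> (i - 1))\<^sup>2 else 0) + (if k = i - 1 \<and> l = 1 then (\<gamma> (i - 1))\<^sup>2 else 0))"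
      using i True by (intro sum.cong refl) (auto simp: G)
    also have "\<dots> = 2 * (\<gamma> (i - 1))\<^sup>2"
    proof -
      have "i - 1 \<in> {1..n}" "1 \<in> {1..n}" using i True by auto
      then show ?thesis
        unfolding sum.distrib by (simp only: sum_single_pair finite_atLeastAtMost)
    qed
    also have "\<dots> = 4 * T * C (i - 1)"
    proof -
      have "i - 1 \<in> {2..n-1}" using i True by auto
      from \<gamma>2[OF this] show ?thesis by simp
    qed
    finally show ?thesis using True by simp
  next
    case False
    then show ?thesis using i by (auto intro!: sum.neutral simp: G)
  qed
  show ?thesis
  proof (rule negative_ricci_extension[OF N X Y, where f="\<lambda>i. i" and d=d], unfold a_def[symmetric] b_def[symmetric] G_def[symmetric])
    show "i \<le> j" if "i \<in> {1..n}" "j \<in> {1..n}" "a i j \<noteq> 0" for i j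
      using tri[OF that(1,2)] that(3) by (meson not_le)
    show "i + j \<le> k" if "i \<in> {1..n}" "j \<in> {1..n}" "k \<in> {1..n}" "b i j k \<noteq> 0" for i j k
      using b[OF that(1-3)] that by (auto split: if_splits)
    show "G i k l = 0 \<or> G j k l = 0"
      if "i \<in> {1..n}" "j \<in> {1..n}" "k \<in> {1..n}" "l \<in> {1..n}" "i \<noteq> j" for i j k l
      using G[OF that(1,3,4)] G[OF that(2,3,4)] that(5) by (auto split: if_splits)
    show "G k l i = 0 \<or> G k l j = 0"
      if "i \<in> {1..n}" "j \<in> {1..n}" "k \<in> {1..n}" "l \<in> {1..n}" "i \<noteq> j" for i j k l
      using G[OF that(3,4,1)] G[OF that(3,4,2)] that(5) by (auto split: if_splits)
    show "\<exists>i\<in>{1..n}. a i i \<noteq> 0" using pos(2) n unfolding lam_def by (intro bexI[of _ n]) auto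
    show "- (\<Sum>k = 1..n. a k k) * a i i - 1 / 2 * (\<Sum>k = 1..n. \<Sum>l = 1..n. (G i k l)\<^sup>2)
         + 1 / 4 * (\<Sum>k = 1..n. \<Sum>l = 1..n. (G k l i)\<^sup>2) < 0" if i: "i \<in> {1..n}" for i
    proof -
      define r where "r = (if i = 1 then lam 1 + (\<Sum>k\<in>{2..n-1}. C k)
         else lam i - ((if 3 \<le> i then C (i - 1) else 0) - (if i \<le> n - 1 then C i else 0)))"
      have "0 < r" unfolding r_def using C(2) C(3)[of i] i by auto
      have "- (\<Sum>k = 1..n. a k k) * a i i - 1 / 2 * (\<Sum>k = 1..n. \<Sum>l = 1..n. (G i k l)\<^sup>2)
         + 1 / 4 * (\<Sum>k = 1..n. \<Sum>l = 1..n. (G k l i)\<^sup>2) = - T * r"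
        unfolding out[OF i] into[OF i] lam_def[symmetric] T_def[symmetric] r_def
        by (auto simp: algebra_simps)
      then show ?thesis using T \<open>0 < r\<close> by simp
    qed
  qed (use d in auto)
qed

text \<open>Each span of \<open>X k, ..., X n\<close> with \<open>k \<ge> 2\<close> is an abelian ideal; \<open>k = 2\<close> and \<open>k = n\<close> give the two
  forms. Elements of the nilradical annihilate \<open>X n\<close>, so \<open>H\<close> cannot be one of them.\<close>

lemma L_necessary:
  fixes ip :: "'a \<Rightarrow> 'a \<Rightarrow> real"
  assumes N: "lie_ideal br N" and L: "L_basis br n X N" and n: "4 \<le> n"
    and ip: "inner_product ip" "negative_ricci br ip"
  defines "H \<equiv> mean_curvature_vector br ip"
  shows "0 < iota_L2 br n X H" "0 < iota_Ln br n X H" "H \<notin> N"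
proof -
  have X: "frame {1..n} X N" using L unfolding L_basis_def frame_basis_family by auto
  have tri: "coord {1..n} X (br Z (X i)) j = 0" if "i \<in> {1..n}" "j \<in> {1..n}" "j < i" for Z i j
    using L_derivation(1)[OF N L n that] .
  have pos: "0 < (\<Sum>j\<in>{k..n}. coord {1..n} X (br H (X j)) j)" if k: "k \<in> {2..n}" for k
  proof -
    let ?h = "span (X ` {k..n})"
    have k1: "1 \<le> k" using k by auto
    have "X k \<in> ?h" "X k \<noteq> 0" using k coord_basis[OF X, of k k] coord_zero[of "{1..n}" X k]
      by (auto intro: span_base)
    then have "?h \<noteq> {0}" by auto
    moreover have "lie_ideal br ?h"
      unfolding lie_ideal_def using trace_on_tail(2)[OF X N k1 tri] by auto
    moreover have "br x y = 0" if x: "x \<in> ?h" and y: "y \<in> ?h" for x y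
    proof -
      have 1: "br (X i) (X j) = 0" if "i \<in> {k..n}" "j \<in> {k..n}" for i j
      proof -
        have "br (X i) (X j) = 0" if "i \<in> {k..n}" "j \<in> {k..n}" "i < j" for i j
          using L that k unfolding L_basis_def by auto
        then show ?thesis using that skew[of "X i" "X j"] alt by (metis linorder_neqE_nat neg_0_equal_iff_equal)
      qed
      have 2: "br (X i) y = 0" if "i \<in> {k..n}" for i
        by (rule linear_eq_0_on_span[OF lin _ y]) (use 1[OF that] in auto)
      show ?thesis by (rule linear_eq_0_on_span[OF lin' _ x]) (use 2 in auto)
    qed
    ultimately have "0 < trace_on ?h (br H)"
      unfolding H_def by (intro abelian_ideal_trace_pos[OF ip]) auto
    then show ?thesis using trace_on_tail(1)[OF X N k1 tri] by simp
  qed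
  show "0 < iota_L2 br n X H" "0 < iota_Ln br n X H"
    unfolding L_iota[OF N L n] using pos[of 2] pos[of n] n by auto
  show "H \<notin> N"
  proof
    assume H: "H \<in> N"
    have "coord {1..n} X (br H (X n)) n = 0"
      using n by (subst coord_br(1)[OF X N H]) (auto intro!: sum.neutral simp: L_structure[OF L])
    then show False using pos[of n] n by auto
  qed
qed

section \<open>Extensions of Q\<close>

lemma Q_structure:
  fixes X :: "nat \<Rightarrow> 'a"
  assumes Q: "Q_basis br n X N" and n: "even n" and ijk: "i \<in> {1..n}" "j \<in> {1..n}" "k \<in> {1..n}"
  shows "coord {1..n} X (br (X i) (X j)) k =
    (if i = 1 \<and> 2 \<le> j \<and> k = j + 1 \<and> k \<le> n - 1 then 1
     else if j = 1 \<and> 2 \<le> i \<and> k = i + 1 \<and> k \<le> n - 1 then - 1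
     else if 2 \<le> i \<and> 2 \<le> j \<and> i + j = n + 1 \<and> k = n then (- 1) ^ (i + 1) else 0)"
proof -
  have X: "frame {1..n} X N" using Q unfolding Q_basis_def frame_basis_family by auto
  have lt: "coord {1..n} X (br (X i) (X j)) k =
      (if i = 1 \<and> k = j + 1 \<and> k \<le> n - 1 then 1 else if 2 \<le> i \<and> i + j = n + 1 \<and> k = n then (- 1) ^ (i + 1) else 0)
      \<and> br (X i) (X j) \<in> N"
    if ij: "i \<in> {1..n}" "j \<in> {1..n}" "i < j" for i j
  proof -
    have eq: "br (X i) (X j) = (if i = 1 \<and> j \<le> n - 2 then X (j + 1)
           else if 2 \<le> i \<and> j = n - i + 1 then (-1) ^ (i + 1) *\<^sub>R X n else 0)"
      using Q ij unfolding Q_basis_def by blast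
    have XN: "X i \<in> N" if "i \<in> {1..n}" for i using frame_in[OF X that] .
    have nn: "n \<in> {1..n}" using ij by auto
    consider "i = 1" "j \<le> n - 2" | "i = 1" "\<not> j \<le> n - 2" | "2 \<le> i" "j = n - i + 1" | "2 \<le> i" "j \<noteq> n - i + 1"
      using ij by fastforce
    then show ?thesis
    proof cases
      case 1
      then have j: "j + 1 \<in> {1..n}" using ij by auto
      then show ?thesis using eq 1 ij XN[OF j] coord_basis[OF X j ijk(3)] by auto
    next
      case 2
      then show ?thesis using eq ij subspace_0[OF frame_subspace[OF X]] by (auto simp: coord_zero)
    next
      case 3
      then have "i + j = n + 1" using ij by auto
      then show ?thesis
        using eq 3 ij coord_basis[OF X nn ijk(3)] subspace_scale[OF frame_subspace[OF X] XN[OF nn]]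
        by (auto simp: coord_scale[OF X XN[OF nn]])
    next
      case 4
      then have "i + j \<noteq> n + 1" using ij by auto
      then show ?thesis using eq 4 ij subspace_0[OF frame_subspace[OF X]] by (auto simp: coord_zero)
    qed
  qed
  consider "i < j" | "i = j" | "j < i" by linarith
  then show ?thesis
  proof cases
    case 1 then show ?thesis using lt[OF ijk(1,2)] ijk by auto
  next
    case 2
    then have "i + j \<noteq> n + 1" using n by presburger
    then show ?thesis using 2 by (auto simp: alt coord_zero)
  next
    case 3
    have sgn: "(- 1 :: real) ^ (i + 1) = - ((- 1) ^ (j + 1))" if "i + j = n + 1"
    proof -
      have "even (i + 1) \<longleftrightarrow> odd (j + 1)" using that n by presburger
      then show ?thesis by (cases "even (j + 1)") auto
    qed
    show ?thesis using 3 lt[OF ijk(2,1)] coord_skew[OF X, of "X j" "X i" k] ijk sgn by auto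
  qed
qed

text \<open>As for \<open>L\<close>, apply the derivation to \<open>X (k + 1) = [X 1, X k]\<close> and to \<open>X n = - [X 2, X (n - 1)]\<close>. The
  value \<open>a 2 1 = 0\<close> is read off from \<open>[X 2, X 3] = 0\<close>, which needs \<open>n \<ge> 6\<close>.\<close>

lemma Q_derivation:
  fixes Z :: 'a and n :: nat and X :: "nat \<Rightarrow> 'a"
  assumes N: "lie_ideal br N" and Q: "Q_basis br n X N" and n: "even n" "6 \<le> n"
  defines "a \<equiv> \<lambda>i. coord {1..n} X (br Z (X i))"
  shows "\<And>i j. i \<in> {1..n} \<Longrightarrow> j \<in> {1..n} \<Longrightarrow> j < i \<Longrightarrow> a i j = 0"
    and "\<And>k. k \<in> {2..n-1} \<Longrightarrow> a k k = a 2 2 + (real k - 2) * a 1 1"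
    and "a n n = 2 * a 2 2 + (real n - 3) * a 1 1"
proof -
  have X: "frame {1..n} X N" using Q unfolding Q_basis_def frame_basis_family by auto
  have sN: "subspace N" and br: "\<And>x y. y \<in> N \<Longrightarrow> br x y \<in> N" using N unfolding lie_ideal_def by auto
  have br': "br x y \<in> N" if "x \<in> N" for x y
    using br[OF that, of y] skew[of x y] sN subspace_neg by metis
  have XN: "X i \<in> N" if "i \<in> {1..n}" for i using frame_in[OF X that] .
  note b = Q_structure[OF Q n(1)]
  have brk: "coord {1..n} X (br v (X k)) l = (if l = k + 1 then coord {1..n} X v 1 else 0)"
    if v: "v \<in> N" and k: "k \<in> {2..n}" and l: "l \<in> {1..n-1}" for v k l
  proof -
    have ln: "l < n" using l n by auto
    have "coord {1..n} X (br v (X k)) l = (\<Sum>i\<in>{1..n}. if i = 1 then (if l = k + 1 then coord {1..n} X v 1 else 0) else 0)"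
      using k l ln by (subst coord_br(1)[OF X N v]) (simp, rule sum.cong[OF refl], auto simp: b)
    then show ?thesis using n by simp
  qed
  have brn: "coord {1..n} X (br v (X (n - 1))) n = - coord {1..n} X v 2" if v: "v \<in> N" for v
  proof -
    have "coord {1..n} X (br v (X (n - 1))) n = (\<Sum>i\<in>{1..n}. if i = 2 then - coord {1..n} X v 2 else 0)"
      using n by (subst coord_br(1)[OF X N v]) (simp, rule sum.cong[OF refl], auto simp: b)
    then show ?thesis using n by simp
  qed
  have br1: "coord {1..n} X (br (X 1) v) l = (if 3 \<le> l then coord {1..n} X v (l - 1) else 0)"
    if v: "v \<in> N" and l: "l \<in> {1..n-1}" for v l
  proof -
    have "coord {1..n} X (br (X 1) v) l = (\<Sum>i\<in>{1..n}. if i = l - 1 then (if 3 \<le> l then coord {1..n} X v (l - 1) else 0) else 0)"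
    proof -
      have "coord {1..n} X (br (X 1) (X j)) l = (if 2 \<le> j \<and> l = j + 1 then 1 else 0)" if "j \<in> {1..n}" for j
        using b[of 1 j l] that l by auto
      then show ?thesis using l by (subst coord_br(2)[OF X N v], intro sum.cong[OF refl]) auto
    qed
    also have "\<dots> = (if 3 \<le> l then coord {1..n} X v (l - 1) else 0)"
      using l by (cases "3 \<le> l") auto
    finally show ?thesis .
  qed
  have rec: "a (k + 1) l = (if l = k + 1 then a 1 1 else 0) + (if 3 \<le> l then a k (l - 1) else 0)"
    if k: "k \<in> {2..n-2}" and l: "l \<in> {1..n-1}" for k l
  proof -
    have k': "k \<in> {1..n}" "1 \<in> {1..n}" "k \<in> {2..n}" using k n by auto
    have "br (X 1) (X k) = X (k + 1)" using Q k n unfolding Q_basis_def by auto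
    then have "a (k + 1) l = coord {1..n} X (br (br Z (X 1)) (X k) + br (X 1) (br Z (X k))) l"
      unfolding a_def using leibniz[of Z "X 1" "X k"] by simp
    also have "\<dots> = coord {1..n} X (br (br Z (X 1)) (X k)) l + coord {1..n} X (br (X 1) (br Z (X k))) l"
      using XN k' by (intro coord_add[OF X] br br') auto
    also have "\<dots> = (if l = k + 1 then a 1 1 else 0) + (if 3 \<le> l then a k (l - 1) else 0)"
      unfolding a_def using brk[OF br[OF XN[OF k'(2)]] k'(3) l, of Z] br1[OF br[OF XN[OF k'(1)]] l, of Z] by simp
    finally show ?thesis .
  qed
  have "a 2 1 = 0"
  proof -
    have "br (X 2) (X 3) = 0" using Q n unfolding Q_basis_def by auto
    then have "0 = coord {1..n} X (br (br Z (X 2)) (X 3) + br (X 2) (br Z (X 3))) 4"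
      using leibniz[of Z "X 2" "X 3"] by (simp add: br_simps coord_zero)
    also have "\<dots> = coord {1..n} X (br (br Z (X 2)) (X 3)) 4 + coord {1..n} X (br (X 2) (br Z (X 3))) 4"
      using XN[of 2] XN[of 3] n by (intro coord_add[OF X] br br') auto
    also have "coord {1..n} X (br (X 2) (br Z (X 3))) 4 = 0"
      using n XN[of 3] by (subst coord_br(2)[OF X N br]) (auto intro!: sum.neutral simp: b)
    also have "coord {1..n} X (br (br Z (X 2)) (X 3)) 4 = a 2 1"
      unfolding a_def using brk[OF br[OF XN], of 2 3 4 Z] n by auto
    finally show ?thesis by simp
  qed
  have low: "\<forall>j\<in>{1..n}. j < k \<longrightarrow> a k j = 0" if "2 \<le> k" "k \<le> n - 1" for k
    using that
  proof (induction k rule: dec_induct)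
    case base
    show ?case
    proof (intro ballI impI)
      fix j assume "j \<in> {1..n}" "j < 2"
      then have "j = 1" by auto
      then show "a 2 j = 0" using \<open>a 2 1 = 0\<close> by simp
    qed
  next
    case (step k)
    have k: "k \<in> {2..n-2}" using step n by auto
    show ?case
    proof (intro ballI impI)
      fix j assume j: "j \<in> {1..n}" "j < Suc k"
      then have j': "j \<in> {1..n-1}" using k by auto
      have "a k (j - 1) = 0" if "3 \<le> j"
      proof -
        have "j - 1 \<in> {1..n}" "j - 1 < k" using j that by auto
        then show ?thesis using step by auto
      qed
      then show "a (Suc k) j = 0" using rec[OF k j'] j(2) by (auto simp: Suc_eq_plus1)
    qed
  qed
  have diag: "a k k = a 2 2 + (real k - 2) * a 1 1" if "k \<in> {2..n-1}" for k
  proof -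
    have "2 \<le> k" "k \<le> n - 1" using that by auto
    then show ?thesis
    proof (induction k rule: dec_induct)
      case (step k)
      then have "a (Suc k) (Suc k) = a 1 1 + a k k" using rec[of k "k+1"] by (auto simp: Suc_eq_plus1)
      then show ?case using step by (simp add: algebra_simps)
    qed simp
  qed
  have last: "a n l = (if l = n then a 2 2 + a (n - 1) (n - 1) else 0)" if l: "l \<in> {1..n}" for l
  proof -
    have m: "2 \<in> {1..n}" "n - 1 \<in> {1..n}" "n \<in> {1..n}" "n - 1 \<in> {2..n}" using n by auto
    have "br (X 2) (X (n - 1)) = - X n"
      using Q n unfolding Q_basis_def by auto
    then have "X n = - br (X 2) (X (n - 1))" by simp
    then have "br Z (X n) = - br Z (br (X 2) (X (n - 1)))" by (simp add: br_simps)
    then have "a n l = - coord {1..n} X (br (br Z (X 2)) (X (n - 1)) + br (X 2) (br Z (X (n - 1)))) l"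
      unfolding a_def leibniz[of Z "X 2" "X (n - 1)"]
      using coord_scale[OF X, of "br (br Z (X 2)) (X (n - 1)) + br (X 2) (br Z (X (n - 1)))" "-1" l]
        subspace_add[OF sN br'[OF br[OF XN[OF m(1)]]] br[OF br[OF XN[OF m(2)]]]] by simp
    also have "\<dots> = - (coord {1..n} X (br (br Z (X 2)) (X (n - 1))) l + coord {1..n} X (br (X 2) (br Z (X (n - 1)))) l)"
      using XN m by (subst coord_add[OF X]) (auto intro: br br')
    also have "coord {1..n} X (br (br Z (X 2)) (X (n - 1))) l = (if l = n then - a 2 2 else 0)"
    proof (cases "l = n")
      case True
      then show ?thesis unfolding a_def using brn[OF br[OF XN[OF m(1)]]] by simp
    next
      case False
      then have "l \<in> {1..n-1}" using l by auto
      moreover have "l \<noteq> n - 1 + 1" using False n by auto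
      ultimately show ?thesis using brk[OF br[OF XN[OF m(1)]] m(4)] False by simp
    qed
    also have "coord {1..n} X (br (X 2) (br Z (X (n - 1)))) l = (if l = n then - a (n - 1) (n - 1) else 0)"
    proof -
      have a0: "a (n - 1) 1 = 0" using low[of "n-1"] n by auto
      have "coord {1..n} X (br (X 2) (br Z (X (n - 1)))) l = (\<Sum>j\<in>{1..n}. a (n - 1) j * coord {1..n} X (br (X 2) (X j)) l)"
        unfolding a_def by (rule coord_br(2)[OF X N br[OF XN[OF m(2)]]])
      also have "\<dots> = (\<Sum>j\<in>{1..n}. if j = n - 1 then (if l = n then - a (n - 1) (n - 1) else 0) else 0)"
      proof (rule sum.cong[OF refl])
        fix j assume j: "j \<in> {1..n}"
        show "a (n - 1) j * coord {1..n} X (br (X 2) (X j)) l = (if j = n - 1 then (if l = n then - a (n - 1) (n - 1) else 0) else 0)"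
          using b[OF m(1) j l] a0 n by (cases "j = 1") auto
      qed
      finally show ?thesis using m by simp
    qed
    finally show ?thesis by auto
  qed
  show "a i j = 0" if "i \<in> {1..n}" "j \<in> {1..n}" "j < i" for i j
    using low[of i] last[of j] that by (cases "i = n") auto
  show "a k k = a 2 2 + (real k - 2) * a 1 1" if "k \<in> {2..n-1}" for k by (rule diag[OF that])
  show "a n n = 2 * a 2 2 + (real n - 3) * a 1 1"
    using last[of n] diag[of "n-1"] n by (simp add: of_nat_diff algebra_simps)
qed

text \<open>The Leibniz rule. It makes all terms of the lower central and of the derived series of an ideal
  into ideals of the whole algebra.\<close>

lemma lie_ideal_bracket_span:
  assumes A: "lie_ideal br A" and B: "lie_ideal br B"
  shows "lie_ideal br (bracket_span br A B)"
proof -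
  let ?S = "{br x y | x y. x \<in> A \<and> y \<in> B}"
  have "br z v \<in> span ?S" if "v \<in> span ?S" for z v
    using that
  proof (induction rule: span_induct_alt)
    case base
    then show ?case by (simp add: br_simps real_vector.span_zero)
  next
    case (step c w v)
    then obtain x y where xy: "w = br x y" "x \<in> A" "y \<in> B" by auto
    have "br z x \<in> A" "br z y \<in> B" using A B xy unfolding lie_ideal_def by auto
    then have "br (br z x) y \<in> span ?S" "br x (br z y) \<in> span ?S"
      using xy by (auto intro!: span_base)
    then have "br z w \<in> span ?S" unfolding xy(1) leibniz[of z x y] by (rule span_add)
    then show ?case using step by (auto simp: br_simps intro: span_add span_scale)
  qed
  then show ?thesis unfolding lie_ideal_def by (auto simp: bracket_span_def)
qed

lemma lie_ideal_lower_central: "lie_ideal br N \<Longrightarrow> lie_ideal br (lower_central br N i)"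
  by (induction i) (auto intro: lie_ideal_bracket_span)

lemma lie_ideal_derived_series: "lie_ideal br (derived_series br UNIV i)"
proof (induction i)
  case 0
  show ?case by (simp add: lie_ideal_def)
next
  case (Suc i)
  then show ?case by (simp add: lie_ideal_bracket_span)
qed

text \<open>Brackets with the nilradical raise the index by at least one, and \<open>X (k + 1), ..., X n\<close> are reached
  through \<open>[X 1, X k]\<close> and \<open>[X 2, X (n - 1)]\<close>. The first step, from the whole algebra to
  \<open>X 3, ..., X n\<close>, skips the index 2.\<close>

lemma Q_lower_central:
  fixes X :: "nat \<Rightarrow> 'a"
  assumes N: "lie_ideal br N" and Q: "Q_basis br n X N" and n: "even n" "6 \<le> n" and k: "k \<in> {3..n}"
  shows "lower_central br N (k - 2) = span (X ` {k..n})"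
proof -
  have X: "frame {1..n} X N" using Q unfolding Q_basis_def frame_basis_family by auto
  have br: "\<And>x y. y \<in> N \<Longrightarrow> br x y \<in> N" using N unfolding lie_ideal_def by auto
  have XN: "X i \<in> N" if "i \<in> {1..n}" for i using frame_in[OF X that] .
  note b = Q_structure[OF Q n(1)]
  have step: "bracket_span br N M = span (X ` {k+1..n})"
    if M: "M = (if k = 2 then N else span (X ` {k..n}))" and k: "k \<in> {2..n-1}" for k M
  proof
    have MN: "M \<subseteq> N" using M span_tail_iff[OF X, of k] k by auto
    have "br x y \<in> span (X ` {k+1..n})" if x: "x \<in> N" and y: "y \<in> M" for x y
    proof -
      have yN: "y \<in> N" using y MN by auto
      have low: "coord {1..n} X y j = 0" if "j \<in> {1..n}" "j < k" "3 \<le> k" for j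
        using y M span_tail_iff[OF X, of k] that by auto
      have "coord {1..n} X (br x y) l = 0" if l: "l \<in> {1..n}" "l < k + 1" for l
      proof -
        have "coord {1..n} X (br x y) l = (\<Sum>j\<in>{1..n}. coord {1..n} X y j * coord {1..n} X (br x (X j)) l)"
          by (rule coord_br(2)[OF X N yN])
        also have "\<dots> = (\<Sum>j\<in>{1..n}. coord {1..n} X y j * (\<Sum>i\<in>{1..n}. coord {1..n} X x i * coord {1..n} X (br (X i) (X j)) l))"
          by (intro sum.cong refl) (simp add: coord_br(1)[OF X N x])
        also have "\<dots> = 0"
        proof (rule sum.neutral, rule ballI)
          fix j assume j: "j \<in> {1..n}"
          show "coord {1..n} X y j * (\<Sum>i\<in>{1..n}. coord {1..n} X x i * coord {1..n} X (br (X i) (X j)) l) = 0"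
          proof (cases "j < k \<and> 3 \<le> k")
            case True
            then show ?thesis using low[OF j] by simp
          next
            case False
            have "coord {1..n} X (br (X i) (X j)) l = 0" if "i \<in> {1..n}" for i
              using b[OF that j l(1)] False l k that by auto
            then show ?thesis by (simp add: sum.neutral)
          qed
        qed
        finally show ?thesis .
      qed
      then show ?thesis using span_tail_iff[OF X, of "k+1"] br[OF yN] by auto
    qed
    then show "bracket_span br N M \<subseteq> span (X ` {k+1..n})"
      unfolding bracket_span_def by (intro span_minimal) auto
    have XM: "X j \<in> M" if "j \<in> {k..n}" for j
      using M that k XN[of j] by (auto intro: span_base)
    have "X l \<in> bracket_span br N M" if l: "l \<in> {k+1..n}" for l
    proof (cases "l = n")
      case True
      have "br (X 2) (X (n - 1)) = - X n"
        using Q n unfolding Q_basis_def by auto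
      moreover have "br (X 2) (X (n - 1)) \<in> bracket_span br N M"
        unfolding bracket_span_def using XN[of 2] XM[of "n-1"] n k by (intro span_base) auto
      ultimately have "- X n \<in> bracket_span br N M" by simp
      then have "- (- X n) \<in> bracket_span br N M"
        unfolding bracket_span_def by (rule subspace_neg[OF real_vector.subspace_span])
      then show ?thesis using True by simp
    next
      case False
      have l': "1 \<in> {1..n}" "l - 1 \<in> {1..n}" "1 < l - 1" "l - 1 \<le> n - 2" "l - 1 + 1 = l"
        using n False l k by auto
      then have "br (X 1) (X (l - 1)) = (if (1::nat) = 1 \<and> l - 1 \<le> n - 2 then X (l - 1 + 1)
           else if 2 \<le> (1::nat) \<and> l - 1 = n - 1 + 1 then (-1) ^ (1 + 1) *\<^sub>R X n else 0)"
        using Q unfolding Q_basis_def by blast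
      then have "X l = br (X 1) (X (l - 1))" using l' by simp
      moreover have "br (X 1) (X (l - 1)) \<in> bracket_span br N M"
      proof -
        have "l - 1 \<in> {k..n}" "1 \<in> {1..n}" using l n by auto
        then show ?thesis unfolding bracket_span_def using XN XM by (intro span_base) blast
      qed
      ultimately show ?thesis by simp
    qed
    then show "span (X ` {k+1..n}) \<subseteq> bracket_span br N M"
      unfolding bracket_span_def by (intro span_minimal) auto
  qed
  have "3 \<le> k" "k \<le> n" using k by auto
  then show ?thesis
  proof (induction k rule: dec_induct)
    case base
    show ?case using step[of N 2] n by (simp add: numeral_3_eq_3 numeral_2_eq_2 One_nat_def)
  next
    case (step k)
    have "lower_central br N (Suc k - 2) = bracket_span br N (lower_central br N (k - 2))"
    proof -
      have "Suc k - 2 = Suc (k - 2)" using step.hyps by simp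
      then show ?thesis by simp
    qed
    then show ?case using step \<open>\<And>M k. M = (if k = 2 then N else span (X ` {k..n})) \<Longrightarrow> k \<in> {2..n-1} \<Longrightarrow> bracket_span br N M = span (X ` {k+1..n})\<close>[of "span (X ` {k..n})" k]
      by (auto simp: Suc_eq_plus1)
  qed
qed

lemma Q_iota:
  fixes Y :: 'a and n :: nat and X :: "nat \<Rightarrow> 'a"
  assumes N: "lie_ideal br N" and Q: "Q_basis br n X N" and n: "even n" "6 \<le> n" and k: "k \<in> {3..n}"
  shows "iota_Q br N k Y = (\<Sum>j\<in>{k..n}. coord {1..n} X (br Y (X j)) j)"
proof -
  have X: "frame {1..n} X N" using Q unfolding Q_basis_def frame_basis_family by auto
  show ?thesis
    unfolding iota_Q_def Q_lower_central[OF assms]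
    by (rule trace_on_tail(1)[OF X N _ Q_derivation(1)[OF N Q n]]) (use k in auto)
qed

text \<open>For \<open>k > m\<close> two indices from \<open>k\<close> on never add up to \<open>n + 1\<close>, so this part of the lower central series
  is abelian.\<close>

lemma Q_necessary:
  fixes ip :: "'a \<Rightarrow> 'a \<Rightarrow> real"
  assumes N: "lie_ideal br N" and Q: "Q_basis br n X N" and n: "n = 2 * m" "3 \<le> m"
    and ip: "inner_product ip" "negative_ricci br ip"
  defines "H \<equiv> mean_curvature_vector br ip"
  shows "\<And>k. k \<in> {m+1..n} \<Longrightarrow> 0 < iota_Q br N k H" "H \<notin> N"
proof -
  have n': "even n" "6 \<le> n" using n by auto
  have X: "frame {1..n} X N" using Q unfolding Q_basis_def frame_basis_family by auto
  note b = Q_structure[OF Q n'(1)]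
  show pos: "0 < iota_Q br N k H" if k: "k \<in> {m+1..n}" for k
  proof -
    let ?h = "span (X ` {k..n})"
    have k3: "k \<in> {3..n}" using k n by auto
    note h = Q_lower_central[OF N Q n' k3]
    have "X k \<in> ?h" "X k \<noteq> 0" using k coord_basis[OF X, of k k] coord_zero[of "{1..n}" X k]
      by (auto intro: span_base)
    then have "?h \<noteq> {0}" by auto
    moreover have "lie_ideal br ?h"
      using lie_ideal_lower_central[OF N, of "k-2"] unfolding h .
    moreover have "br x y = 0" if x: "x \<in> ?h" and y: "y \<in> ?h" for x y
    proof -
      have 1: "br (X i) (X j) = 0" if "i \<in> {k..n}" "j \<in> {k..n}" for i j
      proof -
        have "br (X i) (X j) = 0" if "i \<in> {k..n}" "j \<in> {k..n}" "i < j" for i j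
          using Q that k n unfolding Q_basis_def by auto
        then show ?thesis using that skew[of "X i" "X j"] alt by (metis linorder_neqE_nat neg_0_equal_iff_equal)
      qed
      have 2: "br (X i) y = 0" if "i \<in> {k..n}" for i
        by (rule linear_eq_0_on_span[OF lin _ y]) (use 1[OF that] in auto)
      show ?thesis by (rule linear_eq_0_on_span[OF lin' _ x]) (use 2 in auto)
    qed
    ultimately have "0 < trace_on ?h (br H)"
      unfolding H_def by (intro abelian_ideal_trace_pos[OF ip]) auto
    then show ?thesis unfolding iota_Q_def h .
  qed
  show "H \<notin> N"
  proof
    assume H: "H \<in> N"
    have nn: "n \<in> {1..n}" using n by auto
    have "coord {1..n} X (br (X i) (X n)) n = 0" if "i \<in> {1..n}" for i
      unfolding b[OF that nn nn] using n by auto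
    then have "coord {1..n} X (br H (X n)) n = 0"
      unfolding coord_br(1)[OF X N H nn] by (intro sum.neutral) auto
    then show False using pos[of n] Q_iota[OF N Q n', of n H] n by auto
  qed
qed

text \<open>The degree of \<open>X i\<close> is \<open>i\<close>, except that \<open>X n\<close> has degree \<open>n + 1\<close>, to make \<open>[X i, X (n + 1 - i)] = \<plusminus> X n\<close>
  graded. The scalings of \<open>X 1, ..., X (n - 1)\<close> realise prescribed constants \<open>\<gamma>\<close> of the brackets with
  \<open>X 1\<close>, and that of \<open>X n\<close> prescribes one constant \<open>\<beta> 2\<close> of a bracket with values in the centre; the other
  \<open>\<beta> i\<close> are then determined and satisfy \<open>(\<beta> i)\<^sup>2 = 2 T B i\<close> because of the relations between \<open>B\<close> and \<open>C\<close>.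
  Taking out \<open>- T\<close> leaves the inequalities on \<open>B\<close> and \<open>C\<close>.\<close>

lemma Q_sufficient:
  assumes N: "lie_ideal br N" and Q: "Q_basis br n X N" and n: "n = 2 * m" "3 \<le> m"
    and Y: "one_dim_extension_by N Y"
    and iota: "\<And>k. k \<in> {m+1..n} \<Longrightarrow> 0 < iota_Q br N k Y"
  shows "\<exists>ip. inner_product ip \<and> negative_ricci br ip"
proof -
  have n': "even n" "6 \<le> n" using n by auto
  have X: "frame {1..n} X N" using Q unfolding Q_basis_def frame_basis_family by auto
  define a where "a i = coord {1..n} X (br Y (X i))" for i
  have tri: "a i j = 0" if "i \<in> {1..n}" "j \<in> {1..n}" "j < i" for i j
    unfolding a_def using Q_derivation(1)[OF N Q n' that] .
  define lam where "lam k = a k k" for k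
  define \<alpha> where "\<alpha> = a 1 1"
  define \<mu> where "\<mu> = lam n"
  have \<mu>: "\<mu> = 2 * a 2 2 + (real n - 3) * \<alpha>"
    unfolding \<mu>_def lam_def \<alpha>_def a_def by (rule Q_derivation(3)[OF N Q n'])
  have lam: "lam k = \<mu> / 2 + \<alpha> * (real k - real m - 1/2)" if "k \<in> {2..n-1}" for k
    unfolding \<mu> lam_def \<alpha>_def a_def Q_derivation(2)[OF N Q n' that] using n by (simp add: field_simps)
  have pos: "0 < \<mu> + (\<Sum>j\<in>{k..n-1}. lam j)" if k: "k \<in> {m+1..n}" for k
  proof -
    have "k \<in> {3..n}" using k n by auto
    then have "0 < (\<Sum>j\<in>{k..n}. lam j)"
      using iota[OF k] Q_iota[OF N Q n', of k Y] unfolding lam_def a_def by auto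
    moreover have "{k..n} = insert n {k..n-1}" "n \<notin> {k..n-1}" using k n by auto
    ultimately show ?thesis unfolding \<mu>_def by simp
  qed
  have \<mu>pos: "0 < \<mu>" using pos[of n] n by auto
  obtain C B where C: "\<And>k. k \<in> {2..n-2} \<Longrightarrow> 0 < C k"
    and B: "\<And>k. k \<in> {2..n-1} \<Longrightarrow> 0 < B k" "\<And>k. k \<in> {2..n-1} \<Longrightarrow> B (n + 1 - k) = B k"
    and BC: "\<And>j. j \<in> {2..n-2} \<Longrightarrow> B (j + 1) * C j = B j * C (n - j)"
    and c1: "0 < \<alpha> + (\<Sum>k\<in>{2..n-2}. C k)"
    and ck: "\<And>k. k \<in> {2..n-1} \<Longrightarrow> (if 3 \<le> k then C (k - 1) else 0) - (if k \<le> n - 2 then C k else 0) - B k < lam k"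
    and cn: "(\<Sum>k\<in>{2..n-1}. B k) < 2 * \<mu>" and \<alpha>\<mu>: "- \<alpha> < \<mu>"
  proof (cases "0 \<le> \<alpha>")
    case True
    have m2: "2 \<le> m" using n by auto
    show thesis
    proof (rule Q_coefficients_nonneg[OF m2 n(1) True lam \<mu>pos])
      fix C B :: "nat \<Rightarrow> real"
      assume C: "\<And>k. k \<in> {2..n-2} \<Longrightarrow> 0 < C k"
        and B: "\<And>k. k \<in> {2..n-1} \<Longrightarrow> 0 < B k" "\<And>k. k \<in> {2..n-1} \<Longrightarrow> B (n + 1 - k) = B k"
        and BC: "\<And>j. j \<in> {2..n-2} \<Longrightarrow> B (j + 1) * C j = B j * C (n - j)"
        and c1: "0 < \<alpha> + (\<Sum>k\<in>{2..n-2}. C k)"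
        and ck: "\<And>k. k \<in> {2..n-1} \<Longrightarrow> (if 3 \<le> k then C (k - 1) else 0) - (if k \<le> n - 2 then C k else 0) - B k < lam k"
        and cn: "(\<Sum>k\<in>{2..n-1}. B k) < 2 * \<mu>"
      show thesis
        by (rule that[OF C B BC _ ck cn]) (use c1 True \<mu>pos in auto)
    qed
  next
    case False
    have lam': "lam k = \<mu> / 2 - (- \<alpha>) * (real k - real m - 1/2)" if "k \<in> {2..n-1}" for k
      using lam[OF that] by simp
    have a: "0 < - \<alpha>" using False by simp
    show thesis
    proof (rule Q_coefficients_neg[OF n(2,1) a lam' pos])
      fix C B :: "nat \<Rightarrow> real"
      assume C: "\<And>k. k \<in> {2..n-2} \<Longrightarrow> 0 < C k"
        and B: "\<And>k. k \<in> {2..n-1} \<Longrightarrow> 0 < B k" "\<And>k. k \<in> {2..n-1} \<Longrightarrow> B (n + 1 - k) = B k"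
        and BC: "\<And>j. j \<in> {2..n-2} \<Longrightarrow> B (j + 1) * C j = B j * C (n - j)"
        and c1: "0 < - (- \<alpha>) + (\<Sum>k\<in>{2..n-2}. C k)"
        and ck: "\<And>k. k \<in> {2..n-1} \<Longrightarrow> (if 3 \<le> k then C (k - 1) else 0) - (if k \<le> n - 2 then C k else 0) - B k < lam k"
        and cn: "(\<Sum>k\<in>{2..n-1}. B k) < 2 * \<mu>" and "- \<alpha> < \<mu>"
      show thesis
        by (rule that[OF C B BC _ ck cn]) (use c1 \<open>- \<alpha> < \<mu>\<close> in auto)
    qed
  qed
  (* The weights of X k and X (n + 1 - k) add up to \<mu>, and \<alpha> + \<mu> is positive, hence T. *)
  define T where "T = (\<Sum>k\<in>{1..n}. lam k)"
  have T: "0 < T"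
  proof -
    have "(\<Sum>k\<in>{2..n-1}. lam k) = (\<Sum>k\<in>{2..n-1}. lam (n + 1 - k))"
      by (rule sum.reindex_bij_witness[of _ "\<lambda>k. n + 1 - k" "\<lambda>k. n + 1 - k"]) auto
    then have "2 * (\<Sum>k\<in>{2..n-1}. lam k) = (\<Sum>k\<in>{2..n-1}. lam k + lam (n + 1 - k))"
      by (simp add: sum.distrib)
    also have "\<dots> = (\<Sum>k\<in>{2..n-1}. \<mu>)"
    proof (rule sum.cong[OF refl])
      fix k assume k: "k \<in> {2..n-1}"
      then have k': "n + 1 - k \<in> {2..n-1}" by auto
      have "real (n + 1 - k) = real (n + 1) - real k" using k by (intro of_nat_diff) auto
      then have r: "real (n + 1 - k) = 2 * real m + 1 - real k" using n by simp
      show "lam k + lam (n + 1 - k) = \<mu>" unfolding lam[OF k] lam[OF k'] r by (simp add: field_simps)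
    qed
    also have "0 < \<dots>" using \<mu>pos n' by (intro sum_pos) auto
    finally have "0 < (\<Sum>k\<in>{2..n-1}. lam k)" by simp
    moreover have "{1..n} = insert 1 (insert n {2..n-1})" using n by auto
    then have "T = \<alpha> + (\<mu> + (\<Sum>k\<in>{2..n-1}. lam k))"
      using n unfolding T_def \<mu>_def \<alpha>_def by (simp add: lam_def)
    ultimately show ?thesis using \<alpha>\<mu> by linarith
  qed
  define \<gamma> where "\<gamma> k = (if k \<in> {2..n-2} then sqrt (2 * T * C k) else 1)" for k
  have \<gamma>: "0 < \<gamma> k" for k unfolding \<gamma>_def using C T by auto
  have \<gamma>2: "(\<gamma> k)\<^sup>2 = 2 * T * C k" if "k \<in> {2..n-2}" for k
    using C[OF that] T that unfolding \<gamma>_def by simp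
  define d' where "d' k = (\<Prod>j\<in>{2..<k}. 1 / \<gamma> j)" for k
  define d where "d k = (if k = n then d' 2 * d' (n - 1) / sqrt (2 * T * B 2) else d' k)" for k
  have d': "0 < d' k" for k unfolding d'_def using \<gamma> by (intro prod_pos) auto
  have d: "0 < d k" for k unfolding d_def using d' T B(1)[of 2] n by auto
  have d1: "d 1 = 1" unfolding d_def d'_def using n by simp
  have dS: "d k / d (k + 1) = \<gamma> k" if "k \<in> {2..n-2}" for k
  proof -
    have "d' (k + 1) = d' k * (1 / \<gamma> k)"
      unfolding d'_def using prod.atLeastLessThan_Suc[of 2 k "\<lambda>j. 1 / \<gamma> j"] that by (simp add: Suc_eq_plus1)
    moreover have "k \<noteq> n" "k + 1 \<noteq> n" using that n by auto
    ultimately show ?thesis unfolding d_def using d'[of k] \<gamma>[of k] by simp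
  qed
  define \<beta> where "\<beta> i = d i * d (n + 1 - i) / d n" for i
  have \<beta>2: "(\<beta> i)\<^sup>2 = 2 * T * B i" if "2 \<le> i" "i \<le> n - 1" for i
    using that
  proof (induction i rule: dec_induct)
    case base
    have "n + 1 - 2 = n - 1" "2 \<noteq> n" "n - 1 \<noteq> n" using n by auto
    then have "\<beta> 2 = sqrt (2 * T * B 2)"
      unfolding \<beta>_def d_def using d'[of 2] d'[of "n-1"] by simp
    moreover have "2 \<in> {2..n-1}" using n by auto
    ultimately show ?case using T B(1)[of 2] by simp
  next
    case (step i)
    have i: "i \<in> {2..n-2}" "n - i \<in> {2..n-2}" using step n by auto
    (* Passing from i to i + 1 multiplies \<beta> by a quotient of two of the constants \<gamma>. *)
    have alg: "s * r / D = (p * q / D) * ((r / q) / (p / s))" if "0 < p" "0 < q" for p q r s D :: real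
      using that by simp
    have e: "n + 1 - Suc i = n - i" "n + 1 - i = n - i + 1" "Suc i = i + 1" using step by auto
    have "\<beta> (Suc i) = \<beta> i * ((d (n - i) / d (n - i + 1)) / (d i / d (i + 1)))"
      unfolding \<beta>_def e(1,2) unfolding e(3) by (rule alg[OF d d])
    also have "\<dots> = \<beta> i * (\<gamma> (n - i) / \<gamma> i)" unfolding dS[OF i(1)] dS[OF i(2)] ..
    finally have "(\<beta> (Suc i))\<^sup>2 = (\<beta> i)\<^sup>2 * ((\<gamma> (n - i))\<^sup>2 / (\<gamma> i)\<^sup>2)" by (simp add: power_mult_distrib power_divide)
    also have "\<dots> = 2 * T * (B i * C (n - i) / C i)"
      using step T C[OF i(1)] unfolding \<gamma>2[OF i(1)] \<gamma>2[OF i(2)] by simp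
    also have "B i * C (n - i) / C i = B (Suc i)"
      using BC[OF i(1)] C[OF i(1)] by (simp add: field_simps Suc_eq_plus1)
    finally show ?case .
  qed
  define f where "f i = (if i = n then n + 1 else i)" for i
  define b where "b i j k = coord {1..n} X (br (X i) (X j)) k" for i j k
  define G where "G i j k = (if f i + f j = f k then b i j k * (d i * d j / d k) else 0)" for i j k
  have b: "b i j k = (if i = 1 \<and> 2 \<le> j \<and> k = j + 1 \<and> k \<le> n - 1 then 1
     else if j = 1 \<and> 2 \<le> i \<and> k = i + 1 \<and> k \<le> n - 1 then - 1
     else if 2 \<le> i \<and> 2 \<le> j \<and> i + j = n + 1 \<and> k = n then (- 1) ^ (i + 1) else 0)"
    if "i \<in> {1..n}" "j \<in> {1..n}" "k \<in> {1..n}" for i j k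
    unfolding b_def by (rule Q_structure[OF Q n'(1) that])
  have G: "G i j k = (if i = 1 \<and> 2 \<le> j \<and> k = j + 1 \<and> k \<le> n - 1 then \<gamma> j
     else if j = 1 \<and> 2 \<le> i \<and> k = i + 1 \<and> k \<le> n - 1 then - \<gamma> i
     else if 2 \<le> i \<and> 2 \<le> j \<and> i + j = n + 1 \<and> k = n then (- 1) ^ (i + 1) * \<beta> i else 0)"
    if ijk: "i \<in> {1..n}" "j \<in> {1..n}" "k \<in> {1..n}" for i j k
  proof -
    consider "i = 1" "2 \<le> j" "k = j + 1" "k \<le> n - 1" | "j = 1" "2 \<le> i" "k = i + 1" "k \<le> n - 1"
      | "2 \<le> i" "2 \<le> j" "i + j = n + 1" "k = n" | "b i j k = 0"
      "\<not> (i = 1 \<and> 2 \<le> j \<and> k = j + 1 \<and> k \<le> n - 1)" "\<not> (j = 1 \<and> 2 \<le> i \<and> k = i + 1 \<and> k \<le> n - 1)"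
      "\<not> (2 \<le> i \<and> 2 \<le> j \<and> i + j = n + 1 \<and> k = n)"
      using b[OF ijk] by (auto split: if_splits)
    then show ?thesis
    proof cases
      case 1
      then have "j \<in> {2..n-2}" "f i + f j = f k" unfolding f_def using n by auto
      then show ?thesis using 1 dS[of j] d1 unfolding G_def b[OF ijk] by auto
    next
      case 2
      then have "i \<in> {2..n-2}" "f i + f j = f k" unfolding f_def using n by auto
      then show ?thesis using 2 dS[of i] d1 unfolding G_def b[OF ijk] by auto
    next
      case 3
      then have "f i + f j = f k" "n + 1 - i = j" unfolding f_def using n by auto
      then show ?thesis using 3 unfolding G_def b[OF ijk] \<beta>_def by auto
    next
      case 4
      then show ?thesis unfolding G_def by (simp only: if_False) simp
    qed
  qed
  have sq: "((- 1) ^ i * x)\<^sup>2 = x\<^sup>2" for i and x :: real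
    by (simp add: power_mult_distrib power_even_eq[symmetric] flip: power_mult)
  (* Brackets starting at X i, and below those ending at X i. *)
  have out: "(\<Sum>k\<in>{1..n}. \<Sum>l\<in>{1..n}. (G i k l)\<^sup>2) =
      (if i = 1 then 2 * T * (\<Sum>k\<in>{2..n-2}. C k)
       else (if i \<le> n - 2 then 2 * T * C i else 0) + (if i \<le> n - 1 then 2 * T * B i else 0))"
    if i: "i \<in> {1..n}" for i
  proof (cases "i = 1")
    case True
    have "(\<Sum>k\<in>{1..n}. \<Sum>l\<in>{1..n}. (G i k l)\<^sup>2) = (\<Sum>k\<in>{1..n}. if k \<in> {2..n-2} then 2 * T * C k else 0)"
    proof (rule sum.cong[OF refl])
      fix k assume k: "k \<in> {1..n}"
      have "(\<Sum>l\<in>{1..n}. (G i k l)\<^sup>2) = (\<Sum>l\<in>{1..n}. if l = k + 1 then (if k \<in> {2..n-2} then (\<gamma> k)\<^sup>2 else 0) else 0)"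
        using k i True n by (intro sum.cong refl) (auto simp: G)
      also have "\<dots> = (if k \<in> {2..n-2} then 2 * T * C k else 0)"
        using k n \<gamma>2[of k] by (auto simp: sum.delta)
      finally show "(\<Sum>l\<in>{1..n}. (G i k l)\<^sup>2) = (if k \<in> {2..n-2} then 2 * T * C k else 0)" .
    qed
    also have "\<dots> = (\<Sum>k\<in>{2..n-2}. 2 * T * C k)"
      by (rule sum.mono_neutral_cong_right) auto
    finally show ?thesis using True by (simp add: sum_distrib_left)
  next
    case False
    have "(\<Sum>k\<in>{1..n}. \<Sum>l\<in>{1..n}. (G i k l)\<^sup>2) = (\<Sum>k\<in>{1..n}. \<Sum>l\<in>{1..n}.
        (if k = 1 \<and> l = i + 1 then (if i \<le> n - 2 then (\<gamma> i)\<^sup>2 else 0) else 0)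
      + (if k = n + 1 - i \<and> l = n then (if i \<le> n - 1 then (\<beta> i)\<^sup>2 else 0) else 0))"
    proof (intro sum.cong refl)
      fix k l assume kl: "k \<in> {1..n}" "l \<in> {1..n}"
      consider "k = 1" | "k \<noteq> 1" "k = n + 1 - i" | "k \<noteq> 1" "k \<noteq> n + 1 - i" by blast
      then show "(G i k l)\<^sup>2 = (if k = 1 \<and> l = i + 1 then (if i \<le> n - 2 then (\<gamma> i)\<^sup>2 else 0) else 0)
          + (if k = n + 1 - i \<and> l = n then (if i \<le> n - 1 then (\<beta> i)\<^sup>2 else 0) else 0)"
      proof cases
        case 1
        then show ?thesis using G[OF i kl] False i n by auto
      next
        case 2
        then have "i \<le> n - 1" "i + k = n + 1" "2 \<le> k" "2 \<le> i" using i kl False by auto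
        then show ?thesis using G[OF i kl] 2 sq[of "i+1" "\<beta> i"] by auto
      next
        case 3
        then have "i + k \<noteq> n + 1" by auto
        then show ?thesis using G[OF i kl] 3 False by auto
      qed
    qed
    also have "\<dots> = (if i \<le> n - 2 then (\<gamma> i)\<^sup>2 else 0) + (if i \<le> n - 1 then (\<beta> i)\<^sup>2 else 0)"
    proof -
      have "(\<Sum>k\<in>{1..n}. \<Sum>l\<in>{1..n}. if k = 1 \<and> l = i + 1 then (if i \<le> n - 2 then (\<gamma> i)\<^sup>2 else 0) else 0)
          = (if i \<le> n - 2 then (\<gamma> i)\<^sup>2 else 0)"
      proof (cases "i \<le> n - 2")
        case True
        then have "1 \<in> {1..n}" "i + 1 \<in> {1..n}" using n by auto
        then show ?thesis by (simp only: sum_single_pair finite_atLeastAtMost)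
      qed simp
      moreover have "(\<Sum>k\<in>{1..n}. \<Sum>l\<in>{1..n}. if k = n + 1 - i \<and> l = n then (if i \<le> n - 1 then (\<beta> i)\<^sup>2 else 0) else 0)
          = (if i \<le> n - 1 then (\<beta> i)\<^sup>2 else 0)"
      proof (cases "i \<le> n - 1")
        case True
        then have "n + 1 - i \<in> {1..n}" "n \<in> {1..n}" using i by auto
        then show ?thesis by (simp only: sum_single_pair finite_atLeastAtMost)
      qed simp
      ultimately show ?thesis by (simp add: sum.distrib)
    qed
    also have "\<dots> = (if i \<le> n - 2 then 2 * T * C i else 0) + (if i \<le> n - 1 then 2 * T * B i else 0)"
      using \<gamma>2[of i] \<beta>2[of i] i False by auto
    finally show ?thesis using False by simp
  qed
  have into: "(\<Sum>k\<in>{1..n}. \<Sum>l\<in>{1..n}. (G k l i)\<^sup>2) =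
      (if i = n then 2 * T * (\<Sum>k\<in>{2..n-1}. B k) else if 3 \<le> i then 4 * T * C (i - 1) else 0)"
    if i: "i \<in> {1..n}" for i
  proof -
    consider "i = n" | "i \<noteq> n" "3 \<le> i" | "i \<noteq> n" "i < 3" by linarith
    then show ?thesis
    proof cases
      case 1
      have "(\<Sum>k\<in>{1..n}. \<Sum>l\<in>{1..n}. (G k l i)\<^sup>2) = (\<Sum>k\<in>{1..n}. if k \<in> {2..n-1} then 2 * T * B k else 0)"
      proof (rule sum.cong[OF refl])
        fix k assume k: "k \<in> {1..n}"
        have "(\<Sum>l\<in>{1..n}. (G k l i)\<^sup>2) = (\<Sum>l\<in>{1..n}. if l = n + 1 - k then (if k \<in> {2..n-1} then (\<beta> k)\<^sup>2 else 0) else 0)"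
        proof (rule sum.cong[OF refl])
          fix l assume l: "l \<in> {1..n}"
          show "(G k l i)\<^sup>2 = (if l = n + 1 - k then (if k \<in> {2..n-1} then (\<beta> k)\<^sup>2 else 0) else 0)"
          proof -
            have "\<not> n \<le> n - 1" using n by auto
            then have Gn: "G k l i = (if 2 \<le> k \<and> 2 \<le> l \<and> k + l = n + 1 then (- 1) ^ (k + 1) * \<beta> k else 0)"
              unfolding G[OF k l i] using 1 by simp
            have "2 \<le> k \<and> 2 \<le> l \<and> k + l = n + 1 \<longleftrightarrow> l = n + 1 - k \<and> k \<in> {2..n-1}"
              using k l by auto
            then show ?thesis unfolding Gn using sq[of "k+1" "\<beta> k"] by simp
          qed
        qed
        also have "\<dots> = (if k \<in> {2..n-1} then 2 * T * B k else 0)"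
          using k \<beta>2[of k] by (auto simp: sum.delta)
        finally show "(\<Sum>l\<in>{1..n}. (G k l i)\<^sup>2) = (if k \<in> {2..n-1} then 2 * T * B k else 0)" .
      qed
      also have "\<dots> = (\<Sum>k\<in>{2..n-1}. 2 * T * B k)"
        by (rule sum.mono_neutral_cong_right) auto
      finally show ?thesis using 1 by (simp add: sum_distrib_left)
    next
      case 2
      have "(\<Sum>k\<in>{1..n}. \<Sum>l\<in>{1..n}. (G k l i)\<^sup>2) = (\<Sum>k\<in>{1..n}. \<Sum>l\<in>{1..n}.
          (if k = 1 \<and> l = i - 1 then (\<gamma> (i - 1))\<^sup>2 else 0) + (if k = i - 1 \<and> l = 1 then (\<gamma> (i - 1))\<^sup>2 else 0))"
        using i 2 by (intro sum.cong refl) (auto simp: G)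
      also have "\<dots> = 2 * (\<gamma> (i - 1))\<^sup>2"
      proof -
        have "i - 1 \<in> {1..n}" "1 \<in> {1..n}" using i 2 by auto
        then show ?thesis
          unfolding sum.distrib by (simp only: sum_single_pair finite_atLeastAtMost)
      qed
      also have "\<dots> = 4 * T * C (i - 1)"
      proof -
        have "i - 1 \<in> {2..n-2}" using i 2 by auto
        from \<gamma>2[OF this] show ?thesis by simp
      qed
      finally show ?thesis using 2 by simp
    next
      case 3
      then show ?thesis using i by (auto intro!: sum.neutral simp: G)
    qed
  qed
  show ?thesis
  proof (rule negative_ricci_extension[OF N X Y, where f=f and d=d], unfold a_def[symmetric] b_def[symmetric] G_def[symmetric])
    show "0 < f i" if "i \<in> {1..n}" for i using that unfolding f_def by auto
    show "inj_on f {1..n}" unfolding f_def inj_on_def by auto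
    show "f i \<le> f j" if "i \<in> {1..n}" "j \<in> {1..n}" "a i j \<noteq> 0" for i j
    proof -
      have "i \<le> j" using tri[OF that(1,2)] that(3) by (meson not_le)
      then show ?thesis using that unfolding f_def by auto
    qed
    show "f i + f j \<le> f k" if "i \<in> {1..n}" "j \<in> {1..n}" "k \<in> {1..n}" "b i j k \<noteq> 0" for i j k
      using b[OF that(1-3)] that n unfolding f_def by (auto split: if_splits)
    have G_cases: "(i = 1 \<and> k = j + 1 \<and> k \<le> n - 1 \<and> 2 \<le> j) \<or> (j = 1 \<and> k = i + 1 \<and> k \<le> n - 1 \<and> 2 \<le> i) \<or> (i + j = n + 1 \<and> k = n)"
      if "i \<in> {1..n}" "j \<in> {1..n}" "k \<in> {1..n}" "G i j k \<noteq> 0" for i j k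
      using that(4) unfolding G[OF that(1-3)] by (auto split: if_splits)
    have n0: "0 < n" using n by auto
    show "G i k l = 0 \<or> G j k l = 0"
      if "i \<in> {1..n}" "j \<in> {1..n}" "k \<in> {1..n}" "l \<in> {1..n}" "i \<noteq> j" for i j k l
    proof (rule ccontr)
      assume "\<not> ?thesis"
      then have "G i k l \<noteq> 0" "G j k l \<noteq> 0" by auto
      from G_cases[OF that(1,3,4) this(1)] G_cases[OF that(2,3,4) this(2)] that(5) n0
      show False by (elim disjE conjE; linarith)
    qed
    show "G k l i = 0 \<or> G k l j = 0"
      if "i \<in> {1..n}" "j \<in> {1..n}" "k \<in> {1..n}" "l \<in> {1..n}" "i \<noteq> j" for i j k l
    proof (rule ccontr)
      assume "\<not> ?thesis"
      then have "G k l i \<noteq> 0" "G k l j \<noteq> 0" by auto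
      from G_cases[OF that(3,4,1) this(1)] G_cases[OF that(3,4,2) this(2)] that(5) n0
      show False by (elim disjE conjE; linarith)
    qed
    show "\<exists>i\<in>{1..n}. a i i \<noteq> 0" using \<mu>pos n unfolding \<mu>_def lam_def by (intro bexI[of _ n]) auto
    show "- (\<Sum>k = 1..n. a k k) * a i i - 1 / 2 * (\<Sum>k = 1..n. \<Sum>l = 1..n. (G i k l)\<^sup>2)
         + 1 / 4 * (\<Sum>k = 1..n. \<Sum>l = 1..n. (G k l i)\<^sup>2) < 0" if i: "i \<in> {1..n}" for i
    proof -
      define r where "r = (if i = 1 then \<alpha> + (\<Sum>k\<in>{2..n-2}. C k) else if i = n then \<mu> - 1/2 * (\<Sum>k\<in>{2..n-1}. B k)
         else lam i - ((if 3 \<le> i then C (i - 1) else 0) - (if i \<le> n - 2 then C i else 0) - B i))"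
      have "i \<in> {2..n-1}" if "i \<noteq> 1" "i \<noteq> n" using i that by auto
      then have r: "0 < r" unfolding r_def using c1 cn ck[of i] by auto
      have "- (\<Sum>k = 1..n. a k k) * a i i - 1 / 2 * (\<Sum>k = 1..n. \<Sum>l = 1..n. (G i k l)\<^sup>2)
         + 1 / 4 * (\<Sum>k = 1..n. \<Sum>l = 1..n. (G k l i)\<^sup>2) = - T * r"
      proof -
        consider "i = 1" | "i = n" "i \<noteq> 1" | "i \<noteq> 1" "i \<noteq> n" by blast
        then show ?thesis
        proof cases
          case 1
          then show ?thesis
            unfolding out[OF i] into[OF i] lam_def[symmetric] T_def[symmetric] r_def using n
            by (simp add: lam_def \<alpha>_def[symmetric] algebra_simps)
        next
          case 2
          then have "\<not> i \<le> n - 2" "\<not> i \<le> n - 1" using n by auto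
          then show ?thesis
            unfolding out[OF i] into[OF i] lam_def[symmetric] T_def[symmetric] r_def using 2
            by (simp add: \<mu>_def algebra_simps)
        next
          case 3
          then have "i \<le> n - 1" using i by auto
          then show ?thesis
            unfolding out[OF i] into[OF i] lam_def[symmetric] T_def[symmetric] r_def using 3
            by (auto simp: algebra_simps)
        qed
      qed
      then show ?thesis using T r by simp
    qed
  qed (use d in auto)
qed

end

section \<open>Filiform ideals\<close>

locale filiform_ideal = lie br for br :: "'a::real_vector \<Rightarrow> 'a \<Rightarrow> 'a" +
  fixes N :: "'a set"
  assumes ideal: "lie_ideal br N" and filiform: "filiform br N"
begin

abbreviation C :: "nat \<Rightarrow> 'a set" where "C \<equiv> lower_central br N"
abbreviation n :: nat where "n \<equiv> dim N"

declare lower_central.simps(2) [simp del]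

lemma subspace_N: "subspace N" and br_N: "y \<in> N \<Longrightarrow> br x y \<in> N"
  using ideal unfolding lie_ideal_def by auto

lemma br_N': "x \<in> N \<Longrightarrow> br x y \<in> N"
  using br_N[of x y] skew[of x y] subspace_neg[OF subspace_N] by simp

lemma ideal_C: "lie_ideal br (C i)"
  by (rule lie_ideal_lower_central[OF ideal])

lemma subspace_C: "subspace (C i)" and br_C: "y \<in> C i \<Longrightarrow> br x y \<in> C i"
  using ideal_C[of i] unfolding lie_ideal_def by auto

lemma C_step: "x \<in> N \<Longrightarrow> y \<in> C i \<Longrightarrow> br x y \<in> C (Suc i)"
  by (auto simp: lower_central.simps bracket_span_def intro: span_base)

lemma C_least: "subspace S \<Longrightarrow> (\<And>x y. x \<in> N \<Longrightarrow> y \<in> C i \<Longrightarrow> br x y \<in> S) \<Longrightarrow> C (Suc i) \<subseteq> S"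
  unfolding lower_central.simps bracket_span_def by (rule span_minimal) auto

lemma C_Suc_subset: "C (Suc i) \<subseteq> C i"
  by (rule C_least[OF subspace_C]) (rule br_C)

lemma C_antimono: "i \<le> j \<Longrightarrow> C j \<subseteq> C i"
  by (rule lift_Suc_antimono_le) (use C_Suc_subset in auto)

lemma C_subset_N: "C i \<subseteq> N"
  using C_antimono[of 0 i] by simp

text \<open>By the Jacobi identity a bracket of two elements moves two steps down the series.\<close>

lemma C_1_step: "x \<in> C 1 \<Longrightarrow> y \<in> C i \<Longrightarrow> br x y \<in> C (Suc (Suc i))"
proof -
  assume x: "x \<in> C 1" and y: "y \<in> C i"
  have "C 1 \<subseteq> {x. br x y \<in> C (Suc (Suc i))}"
    unfolding One_nat_def
  proof (rule C_least)
    show "subspace {x. br x y \<in> C (Suc (Suc i))}"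
      using subspace_C[of "Suc (Suc i)"] unfolding subspace_def by (auto simp: br_simps)
    show "br u v \<in> {x. br x y \<in> C (Suc (Suc i))}" if "u \<in> N" "v \<in> C 0" for u v
    proof -
      have "v \<in> N" using that by simp
      have "br (br u v) y = br u (br v y) - br v (br u y)" using leibniz[of u v y] by simp
      then show ?thesis
        using C_step[OF that(1) C_step[OF \<open>v \<in> N\<close> y]] C_step[OF \<open>v \<in> N\<close> C_step[OF that(1) y]]
          subspace_diff[OF subspace_C[of "Suc (Suc i)"]] by simp
    qed
  qed
  then show ?thesis using x by auto
qed

lemma C_zero: "\<exists>k. C k = {0}"
  using filiform unfolding filiform_def lie_nilpotent_def by auto

lemma n_ge_2: "2 \<le> n" and C_nonzero: "C (n - 2) \<noteq> {0}"
  using filiform unfolding filiform_def by auto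

lemma C_strict: "C i \<noteq> {0} \<Longrightarrow> C (Suc i) \<noteq> C i"
proof
  assume nz: "C i \<noteq> {0}" and eq: "C (Suc i) = C i"
  have "C (i + j) = C i" for j
  proof (induction j)
    case (Suc j)
    have "C (i + Suc j) = bracket_span br N (C (i + j))" by (simp add: lower_central.simps)
    then show ?case using Suc eq by (simp add: lower_central.simps)
  qed simp
  moreover obtain k where "C k = {0}" using C_zero by auto
  moreover have "C (i + k) \<subseteq> C k" by (rule C_antimono) simp
  ultimately show False using nz subspace_0[OF subspace_C[of i]] by auto
qed

lemma dim_C_strict: "C i \<noteq> {0} \<Longrightarrow> dim (C (Suc i)) < dim (C i)"
  using C_strict[of i] subspace_dim_equal[OF subspace_C subspace_C C_Suc_subset[of i]] by force

lemma dim_0: "dim {0::'a} = 0"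
  using real_vector.dim_span_eq_card_independent[of "{}"] by (simp add: real_vector.independent_empty)

lemma dim_zero: "subspace (S :: 'a set) \<Longrightarrow> dim S = 0 \<Longrightarrow> S = {0}"
proof -
  assume S: "subspace S" "dim S = 0"
  have "{0} \<subseteq> S" using subspace_0[OF S(1)] by auto
  then show "S = {0}" using subspace_dim_equal[OF subspace_single_0 S(1)] S(2) by auto
qed

text \<open>If the nilradical were generated by one vector modulo its derived algebra, \<open>C 1\<close> and \<open>C 2\<close>
  would coincide and hence vanish, and it would be a line.\<close>

lemma dim_C_1: "dim (C 1) \<le> n - 2"
proof (rule ccontr)
  assume "\<not> ?thesis"
  then have d: "n - 1 \<le> dim (C 1)" by auto
  have "C 0 \<noteq> {0}" using n_ge_2 dim_0 by auto
  then have "C 1 \<noteq> N" using C_strict[of 0] by (simp add: One_nat_def)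
  then obtain x where x: "x \<in> N" "x \<notin> C 1" using C_subset_N[of 1] by auto
  have sp: "span (C 1) = C 1" using subspace_C[of 1] real_vector.span_eq_iff by blast
  have "span (insert x (C 1)) = N"
  proof (rule subspace_dim_equal[OF real_vector.subspace_span subspace_N])
    show "span (insert x (C 1)) \<subseteq> N" using x C_subset_N[of 1] subspace_N by (intro span_minimal) auto
    show "n \<le> dim (span (insert x (C 1)))" using dim_insert[of x "C 1"] x sp d by auto
  qed
  then have ex: "\<exists>t. v - t *\<^sub>R x \<in> C 1" if "v \<in> N" for v
    using that real_vector.span_breakdown_eq[of v x "C 1"] sp by auto
  have "C 1 \<subseteq> C 2"
    unfolding One_nat_def
  proof (rule C_least[OF subspace_C])
    fix u v assume "u \<in> N" "v \<in> C 0"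
    then have uv: "u \<in> N" "v \<in> N" by auto
    obtain s where s: "u - s *\<^sub>R x \<in> C 1" using ex[OF uv(1)] by auto
    obtain t where t: "v - t *\<^sub>R x \<in> C 1" using ex[OF uv(2)] by auto
    have "br u v = br u (v - t *\<^sub>R x) - t *\<^sub>R br x (u - s *\<^sub>R x)"
      using skew[of x u] by (simp add: br_simps alt algebra_simps)
    moreover have "br u (v - t *\<^sub>R x) \<in> C 2" using C_step[OF uv(1) t] by (simp add: numeral_2_eq_2 One_nat_def)
    moreover have "br x (u - s *\<^sub>R x) \<in> C 2" using C_step[OF x(1) s] by (simp add: numeral_2_eq_2 One_nat_def)
    ultimately show "br u v \<in> C 2"
      using subspace_diff[OF subspace_C[of 2]] subspace_scale[OF subspace_C[of 2]] by metis
  qed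
  then have "C (Suc 1) = C 1" using C_Suc_subset[of 1] by (simp add: numeral_2_eq_2 One_nat_def)
  then have "C 1 = {0}" using C_strict[of 1] by blast
  then have "dim (C 1) = 0" using dim_0 by simp
  then show False using d n_ge_2 by auto
qed

text \<open>The series drops by at least two in its first step and by at least one in each of the following
  \<open>n - 2\<close> steps; filiform means that this exhausts the dimension.\<close>

lemma dim_C: "1 \<le> i \<Longrightarrow> i \<le> n - 1 \<Longrightarrow> dim (C i) = n - 1 - i"
proof -
  assume i: "1 \<le> i" "i \<le> n - 1"
  have nz: "C i \<noteq> {0}" if "i \<le> n - 2" for i
    using C_nonzero C_antimono[OF that] subspace_0[OF subspace_C[of "n-2"]] by auto
  have up: "dim (C j) \<le> n - 1 - j" if "1 \<le> j" "j \<le> n - 1" for j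
    using that
  proof (induction j rule: dec_induct)
    case base
    then show ?case using dim_C_1 n_ge_2 by simp
  next
    case (step j)
    have "dim (C (Suc j)) < dim (C j)" using dim_C_strict nz step by auto
    then show ?case using step by auto
  qed
  have low: "n - 1 - j \<le> dim (C j)" if "j \<le> n - 1" for j
  proof -
    have "k \<le> n - 1 \<longrightarrow> k \<le> dim (C (n - 1 - k))" for k
    proof (induction k)
      case (Suc k)
      show ?case
      proof
        assume k: "Suc k \<le> n - 1"
        have "n - 1 - k = Suc (n - 1 - Suc k)" using k by auto
        moreover have "dim (C (Suc (n - 1 - Suc k))) < dim (C (n - 1 - Suc k))"
          by (rule dim_C_strict, rule nz) (use k in auto)
        ultimately show "Suc k \<le> dim (C (n - 1 - Suc k))" using Suc k by simp
      qed
    qed simp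
    from this[of "n - 1 - j"] have "n - 1 - j \<le> dim (C (n - 1 - (n - 1 - j)))" by simp
    moreover have "n - 1 - (n - 1 - j) = j" using that by simp
    ultimately show ?thesis by simp
  qed
  show ?thesis using up[OF i] low[OF i(2)] by simp
qed

lemma C_vanish: "n - 1 \<le> i \<Longrightarrow> C i = {0}"
proof -
  assume i: "n - 1 \<le> i"
  have "dim (C (n - 1)) = 0" using dim_C[of "n-1"] n_ge_2 by simp
  then have "C (n - 1) = {0}" by (rule dim_zero[OF subspace_C])
  then show ?thesis using C_antimono[OF i] subspace_0[OF subspace_C[of i]] by auto
qed

text \<open>The full flag refining the lower central series. Only the hyperplane \<open>S\<close> between the algebra and
  its derived algebra is not canonical, so it is a parameter. Indices are such that \<open>flag S k\<close> has
  codimension \<open>k - 1\<close> and \<open>flag S 0 = flag S 1\<close>.\<close>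

definition flag :: "'a set \<Rightarrow> nat \<Rightarrow> 'a set" where
  "flag S k = (if k \<le> 1 then N else if k = 2 then S else C (k - 2))"

definition hyper :: "'a set \<Rightarrow> bool" where
  "hyper S \<longleftrightarrow> subspace S \<and> C 1 \<subseteq> S \<and> S \<subseteq> N \<and> dim S = n - 1"

context
  fixes S assumes S: "hyper S"
begin

lemma subspace_flag: "subspace (flag S k)"
  using S subspace_N subspace_C unfolding flag_def hyper_def by auto

lemma flag_Suc: "flag S (Suc k) \<subseteq> flag S k"
proof -
  consider "k = 0" | "k = 1" | "k = 2" | "3 \<le> k" by linarith
  then show ?thesis
  proof cases
    case 4
    then have "Suc k - 2 = Suc (k - 2)" by simp
    then show ?thesis using C_Suc_subset[of "k - 2"] 4 unfolding flag_def by simp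
  qed (use S in \<open>auto simp: flag_def hyper_def One_nat_def\<close>)
qed

lemma flag_antimono: "i \<le> j \<Longrightarrow> flag S j \<subseteq> flag S i"
  by (rule lift_Suc_antimono_le) (use flag_Suc in auto)

lemma flag_subset_N: "flag S k \<subseteq> N"
  using flag_antimono[of 0 k] by (simp add: flag_def)

lemma dim_flag: "1 \<le> k \<Longrightarrow> k \<le> n + 1 \<Longrightarrow> dim (flag S k) = n + 1 - k"
  using S dim_C[of "k - 2"] unfolding flag_def hyper_def by auto

lemma flag_vanish: "n + 1 \<le> k \<Longrightarrow> flag S k = {0}"
  using C_vanish[of "k - 2"] n_ge_2 unfolding flag_def by auto

lemma br_flag: "x \<in> N \<Longrightarrow> y \<in> flag S k \<Longrightarrow> 2 \<le> k \<Longrightarrow> br x y \<in> flag S (Suc k)"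
proof -
  assume x: "x \<in> N" and y: "y \<in> flag S k" and k: "2 \<le> k"
  show ?thesis
  proof (cases "k = 2")
    case True
    then have "y \<in> C 0" using y S unfolding flag_def hyper_def by auto
    then have "br x y \<in> C (Suc 0)" by (rule C_step[OF x])
    then show ?thesis using True by (simp add: flag_def)
  next
    case False
    then have "Suc k - 2 = Suc (k - 2)" using k by simp
    then show ?thesis using C_step[OF x, of y "k-2"] y False k unfolding flag_def by simp
  qed
qed

lemma br_flag': "x \<in> N \<Longrightarrow> y \<in> flag S k \<Longrightarrow> 2 \<le> k \<Longrightarrow> br y x \<in> flag S (Suc k)"
  using br_flag[of x y k] skew[of y x] subspace_neg[OF subspace_flag[of "Suc k"]] by simp

lemma br_N_N: "x \<in> N \<Longrightarrow> y \<in> N \<Longrightarrow> br x y \<in> flag S 3"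
  using C_step[of x y 0] by (simp add: flag_def numeral_3_eq_3)

lemma br_flag_3: "x \<in> flag S 3 \<Longrightarrow> y \<in> flag S k \<Longrightarrow> 3 \<le> k \<Longrightarrow> br x y \<in> flag S (k + 2)"
proof -
  assume x: "x \<in> flag S 3" and y: "y \<in> flag S k" and k: "3 \<le> k"
  have "k + 2 - 2 = Suc (Suc (k - 2))" using k by simp
  then show ?thesis using C_1_step[of x y "k - 2", unfolded One_nat_def] x y k unfolding flag_def by simp
qed

lemma flag_ideal: "3 \<le> k \<Longrightarrow> y \<in> flag S k \<Longrightarrow> br z y \<in> flag S k"
  using br_C unfolding flag_def by auto

lemma flag_split:
  assumes k: "1 \<le> k" "k \<le> n" and x: "x \<in> flag S k" "x \<notin> flag S (Suc k)" and v: "v \<in> flag S k"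
  shows "\<exists>t. v - t *\<^sub>R x \<in> flag S (Suc k)"
proof -
  have sp: "span (flag S (Suc k)) = flag S (Suc k)" using subspace_flag real_vector.span_eq_iff by blast
  have "span (insert x (flag S (Suc k))) = flag S k"
  proof (rule subspace_dim_equal[OF real_vector.subspace_span subspace_flag])
    show "span (insert x (flag S (Suc k))) \<subseteq> flag S k"
      using x flag_Suc[of k] subspace_flag[of k] by (intro span_minimal) auto
    show "dim (flag S k) \<le> dim (span (insert x (flag S (Suc k))))"
      using dim_insert[of x "flag S (Suc k)"] x sp dim_flag[of k] dim_flag[of "Suc k"] k by auto
  qed
  then show ?thesis
    using v real_vector.span_breakdown_eq[of v x "flag S (Suc k)"] sp by auto
qed

lemma flag_nonempty: "1 \<le> k \<Longrightarrow> k \<le> n \<Longrightarrow> \<exists>x. x \<in> flag S k \<and> x \<notin> flag S (Suc k)"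
proof (rule ccontr)
  assume k: "1 \<le> k" "k \<le> n" and "\<nexists>x. x \<in> flag S k \<and> x \<notin> flag S (Suc k)"
  then have "flag S k = flag S (Suc k)" using flag_Suc[of k] by auto
  then show False using dim_flag[of k] dim_flag[of "Suc k"] k by auto
qed

text \<open>Vectors of exact depth \<open>1, ..., n\<close> form a frame adapted to the flag.\<close>

lemma flag_frame:
  assumes X: "\<And>k. k \<in> {1..n} \<Longrightarrow> X k \<in> flag S k \<and> X k \<notin> flag S (Suc k)"
  shows "frame {1..n} X N" "\<And>k. 1 \<le> k \<Longrightarrow> span (X ` {k..n}) = flag S k"
proof -
  have fr: "j \<le> n \<longrightarrow> frame {n + 1 - j..n} X (flag S (n + 1 - j))" for j
  proof (induction j)
    case 0
    then show ?case using flag_vanish[of "n+1"] by (simp add: frame_def dependent_def)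
  next
    case (Suc j)
    show ?case
    proof
      assume j: "Suc j \<le> n"
      let ?k = "n + 1 - Suc j"
      have k: "n + 1 - j = Suc ?k" "?k \<in> {1..n}" using j by auto
      have "frame (insert ?k {Suc ?k..n}) X (span (insert (X ?k) (flag S (Suc ?k))))"
        by (rule frame_insert) (use Suc j k X[OF k(2)] in auto)
      moreover have "insert ?k {Suc ?k..n} = {?k..n}" using k by auto
      moreover have "span (insert (X ?k) (flag S (Suc ?k))) = flag S ?k"
      proof
        show "span (insert (X ?k) (flag S (Suc ?k))) \<subseteq> flag S ?k"
          using X[OF k(2)] flag_Suc[of ?k] subspace_flag[of ?k] by (intro span_minimal) auto
        show "flag S ?k \<subseteq> span (insert (X ?k) (flag S (Suc ?k)))"
        proof
          fix v assume "v \<in> flag S ?k"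
          then obtain t where "v - t *\<^sub>R X ?k \<in> flag S (Suc ?k)"
            using flag_split[of ?k "X ?k" v] X[OF k(2)] k by auto
          then show "v \<in> span (insert (X ?k) (flag S (Suc ?k)))"
            unfolding real_vector.span_breakdown_eq[of v] by (auto intro: span_base)
        qed
      qed
      ultimately show "frame {?k..n} X (flag S ?k)" by simp
    qed
  qed
  show "frame {1..n} X N" using fr[of n] by (simp add: flag_def)
  show "span (X ` {k..n}) = flag S k" if "1 \<le> k" for k
  proof (cases "k \<le> n + 1")
    case True
    then show ?thesis using fr[of "n + 1 - k"] that unfolding frame_def by auto
  next
    case False
    then show ?thesis using flag_vanish[of k] by simp
  qed
qed

end

text \<open>A filtration which \<open>J\<close> pushes down bounds the lower central series of \<open>J\<close>, so \<open>J\<close> is nilpotent;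
  the nilradical is the largest nilpotent ideal.\<close>

lemma nilpotent_ideal:
  assumes nil: "is_nilradical br N" and J: "lie_ideal br J" "N \<subseteq> J"
    and JJ: "\<And>x y. x \<in> J \<Longrightarrow> y \<in> J \<Longrightarrow> br x y \<in> N"
    and G: "N \<subseteq> G 0" "G r = {0}" "\<And>i. subspace (G i)"
    and JG: "\<And>i x y. x \<in> J \<Longrightarrow> y \<in> G i \<Longrightarrow> br x y \<in> G (Suc i)"
  shows "J = N"
proof -
  have "lower_central br J (Suc i) \<subseteq> G i" for i
  proof (induction i)
    case 0
    show ?case unfolding lower_central.simps bracket_span_def
      by (rule span_minimal[OF _ G(3)]) (use JJ G(1) in auto)
  next
    case (Suc i)
    have "lower_central br J (Suc (Suc i)) = bracket_span br J (lower_central br J (Suc i))" by (simp add: lower_central.simps)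
    also have "\<dots> \<subseteq> G (Suc i)"
      unfolding bracket_span_def
    proof (rule span_minimal[OF _ G(3)], safe)
      fix x y assume "x \<in> J" "y \<in> lower_central br J (Suc i)"
      then show "br x y \<in> G (Suc i)" using JG Suc by blast
    qed
    finally show ?case .
  qed
  from this[of r] have "lower_central br J (Suc r) \<subseteq> {0}" using G by simp
  moreover have "0 \<in> lower_central br J (Suc r)" by (simp add: lower_central.simps bracket_span_def real_vector.span_zero)
  ultimately have "lower_central br J (Suc r) = {0}" by blast
  then have "lie_nilpotent br J" unfolding lie_nilpotent_def by blast
  then show ?thesis using nil J unfolding is_nilradical_def by blast
qed

end

section \<open>Weights on the flag\<close>

context filiform_ideal
begin

text \<open>The two vectors \<open>X1\<close> and \<open>X2\<close> generate the nilradical modulo its derived algebra.\<close>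

lemma flag_top:
  assumes S: "hyper S" and X: "X1 \<in> N" "X1 \<notin> S" "X2 \<in> S" "X2 \<notin> C 1"
  shows "v \<in> N \<Longrightarrow> \<exists>t. v - t *\<^sub>R X1 \<in> S" "v \<in> S \<Longrightarrow> \<exists>t. v - t *\<^sub>R X2 \<in> C 1"
    and "v \<in> N \<Longrightarrow> \<exists>s t. v - s *\<^sub>R X1 - t *\<^sub>R X2 \<in> C 1"
proof -
  have f3: "flag S (Suc 2) = C 1" "flag S (Suc 1) = S" "flag S 1 = N" "flag S 2 = S"
    by (auto simp: flag_def One_nat_def)
  show A: "\<exists>t. v - t *\<^sub>R X1 \<in> S" if "v \<in> N" for v
    using flag_split[OF S, of 1 X1 v] X that n_ge_2 f3 by auto
  show B: "\<exists>t. v - t *\<^sub>R X2 \<in> C 1" if "v \<in> S" for v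
    using flag_split[OF S, of 2 X2 v] X that n_ge_2 f3 by auto
  assume "v \<in> N"
  then obtain s where "v - s *\<^sub>R X1 \<in> S" using A by auto
  from B[OF this] show "\<exists>s t. v - s *\<^sub>R X1 - t *\<^sub>R X2 \<in> C 1" by auto
qed

text \<open>The term after \<open>flag S k\<close> is generated, modulo the next one, by the brackets of \<open>x\<close> with the two
  generators. As the series strictly decreases, not both can be deeper.\<close>

lemma bracket_generators:
  assumes S: "hyper S" and X: "X1 \<in> N" "X1 \<notin> S" "X2 \<in> S" "X2 \<notin> C 1"
  shows "3 \<le> n \<Longrightarrow> br X1 X2 \<notin> flag S 4"
    and "\<lbrakk>3 \<le> k; k < n; x \<in> flag S k; x \<notin> flag S (Suc k)\<rbrakk> \<Longrightarrow>
      br X1 x \<notin> flag S (k + 2) \<or> br X2 x \<notin> flag S (k + 2)"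
proof -
  have X2N: "X2 \<in> N" using X S unfolding hyper_def by auto
  have f3: "flag S 3 = C 1" by (simp add: flag_def One_nat_def)
  have c: "br c y \<in> flag S 4" if "c \<in> C 1" "y \<in> N" for c y
    using br_flag'[OF S that(2), of c 3] that f3 by (simp add: numeral_eq_Suc)
  have c': "br y c \<in> flag S 4" if "c \<in> C 1" "y \<in> N" for c y
    using br_flag[OF S that(2), of c 3] that f3 by (simp add: numeral_eq_Suc)
  show "br X1 X2 \<notin> flag S 4" if n: "3 \<le> n"
  proof
    assume 12: "br X1 X2 \<in> flag S 4"
    have "C 1 \<subseteq> flag S 4"
      unfolding One_nat_def
    proof (rule C_least[OF subspace_flag[OF S]])
      fix u v assume "u \<in> N" "v \<in> C 0"
      then have uv: "u \<in> N" "v \<in> N" by auto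
      obtain s t where st: "u - s *\<^sub>R X1 - t *\<^sub>R X2 \<in> C 1" using flag_top(3)[OF S X uv(1)] by auto
      obtain s' t' where st': "v - s' *\<^sub>R X1 - t' *\<^sub>R X2 \<in> C 1" using flag_top(3)[OF S X uv(2)] by auto
      let ?c = "u - s *\<^sub>R X1 - t *\<^sub>R X2" and ?c' = "v - s' *\<^sub>R X1 - t' *\<^sub>R X2"
      have "br u v = br ?c v + br (s *\<^sub>R X1 + t *\<^sub>R X2) ?c' + (s * t' - t * s') *\<^sub>R br X1 X2"
        using skew[of X2 X1] by (simp add: br_simps alt algebra_simps)
      moreover have "br ?c v \<in> flag S 4" by (rule c[OF st uv(2)])
      moreover have "br (s *\<^sub>R X1 + t *\<^sub>R X2) ?c' \<in> flag S 4"
        using X X2N subspace_N by (intro c'[OF st'] subspace_add subspace_scale) auto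
      ultimately show "br u v \<in> flag S 4"
        using 12 subspace_flag[OF S, of 4] by (auto intro!: subspace_add subspace_scale)
    qed
    then have "flag S 3 \<subseteq> flag S (Suc 3)" using f3 by (simp add: numeral_eq_Suc)
    then show False using flag_nonempty[OF S, of 3] n by auto
  qed
  assume k: "3 \<le> k" "k < n" and x: "x \<in> flag S k" "x \<notin> flag S (Suc k)"
  show "br X1 x \<notin> flag S (k + 2) \<or> br X2 x \<notin> flag S (k + 2)"
  proof (rule ccontr)
    assume "\<not> ?thesis"
    then have 12: "br X1 x \<in> flag S (k + 2)" "br X2 x \<in> flag S (k + 2)" by auto
    have k2: "Suc k - 2 = Suc (k - 2)" using k by simp
    have "C (Suc (k - 2)) \<subseteq> flag S (k + 2)"
    proof (rule C_least[OF subspace_flag[OF S]])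
      fix u v assume u: "u \<in> N" and "v \<in> C (k - 2)"
      then have v: "v \<in> flag S k" using k by (simp add: flag_def)
      obtain s t where st: "u - s *\<^sub>R X1 - t *\<^sub>R X2 \<in> C 1" using flag_top(3)[OF S X u] by auto
      obtain r where r: "v - r *\<^sub>R x \<in> flag S (Suc k)" using flag_split[OF S, of k x v] k x v by auto
      have "br u v = br (u - s *\<^sub>R X1 - t *\<^sub>R X2) v + br (s *\<^sub>R X1 + t *\<^sub>R X2) (v - r *\<^sub>R x)
          + ((s * r) *\<^sub>R br X1 x + (t * r) *\<^sub>R br X2 x)"
        by (simp add: br_simps algebra_simps)
      moreover have "br (u - s *\<^sub>R X1 - t *\<^sub>R X2) v \<in> flag S (k + 2)"
        using br_flag_3[OF S _ v k(1)] st f3 by simp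
      moreover have "br (s *\<^sub>R X1 + t *\<^sub>R X2) (v - r *\<^sub>R x) \<in> flag S (Suc (Suc k))"
        using X X2N subspace_N k r by (intro br_flag[OF S] subspace_add subspace_scale) auto
      ultimately show "br u v \<in> flag S (k + 2)"
        using 12 subspace_flag[OF S, of "k + 2"] by (auto intro!: subspace_add subspace_scale)
    qed
    then have "flag S (Suc k) \<subseteq> flag S (Suc (Suc k))" using k k2 by (simp add: flag_def)
    then show False using flag_nonempty[OF S, of "Suc k"] k by auto
  qed
qed

text \<open>On each line \<open>flag S k / flag S (k + 1)\<close> the map \<open>ad Z\<close> is a scalar \<open>w k\<close>. If the next line is generated
  by \<open>[X1, x]\<close> or by \<open>[X2, x]\<close>, the derivation rule shows that its scalar is \<open>w k + \<alpha>\<close> or \<open>w k + \<beta>\<close>.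
  In the first case \<open>ad Z\<close> may add to \<open>X1\<close> a multiple of \<open>X2\<close>; this is harmless because
  \<open>[X2, x]\<close> is then known to be deeper.\<close>

lemma flag_weights:
  assumes S: "hyper S" and n: "3 \<le> n"
    and X: "X1 \<in> N" "X1 \<notin> S" "X2 \<in> S" "X2 \<notin> C 1"
    and D: "br Z X1 - \<alpha> *\<^sub>R X1 \<in> S" "br Z X2 - \<beta> *\<^sub>R X2 \<in> C 1"
  obtains w where "w 1 = \<alpha>" "w 2 = \<beta>" "w 3 = \<alpha> + \<beta>"
    "\<And>k. 3 \<le> k \<Longrightarrow> w (Suc k) = w k + \<alpha> \<or> w (Suc k) = w k + \<beta>"
    "\<And>k v. 1 \<le> k \<Longrightarrow> v \<in> flag S k \<Longrightarrow> br Z v - w k *\<^sub>R v \<in> flag S (Suc k)"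
proof -
  have X2N: "X2 \<in> N" using X S unfolding hyper_def by auto
  have f: "flag S 3 = C 1" "flag S 1 = N" "flag S 2 = S" "flag S (Suc 1) = S" "flag S (Suc 2) = C 1"
    by (simp_all add: flag_def One_nat_def)
  have sS: "subspace S" using S unfolding hyper_def by auto
  define ok where "ok k c \<longleftrightarrow> (\<forall>v\<in>flag S k. br Z v - c *\<^sub>R v \<in> flag S (Suc k))" for k c
  (* The scalar is determined on any vector outside the next term. *)
  have ext: "ok k c" if k: "3 \<le> k" "k \<le> n" and u: "u \<in> flag S k" "u \<notin> flag S (Suc k)"
    and uc: "br Z u - c *\<^sub>R u \<in> flag S (Suc k)" for k c u
    unfolding ok_def
  proof
    fix v assume v: "v \<in> flag S k"
    then obtain t where t: "v - t *\<^sub>R u \<in> flag S (Suc k)" using flag_split[OF S, of k u v] k u by auto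
    have "br Z v - c *\<^sub>R v = t *\<^sub>R (br Z u - c *\<^sub>R u) + (br Z (v - t *\<^sub>R u) - c *\<^sub>R (v - t *\<^sub>R u))"
      by (simp add: br_simps algebra_simps)
    moreover have "br Z (v - t *\<^sub>R u) \<in> flag S (Suc k)" using flag_ideal[OF S _ t] k by simp
    ultimately show "br Z v - c *\<^sub>R v \<in> flag S (Suc k)"
      using uc t subspace_flag[OF S, of "Suc k"] by (auto intro!: subspace_add subspace_diff subspace_scale)
  qed
  have ok2: "ok 2 \<beta>"
    unfolding ok_def f
  proof
    fix v assume "v \<in> S"
    then obtain t where t: "v - t *\<^sub>R X2 \<in> C 1" using flag_top(2)[OF S X] by auto
    have "br Z v - \<beta> *\<^sub>R v = t *\<^sub>R (br Z X2 - \<beta> *\<^sub>R X2) + (br Z (v - t *\<^sub>R X2) - \<beta> *\<^sub>R (v - t *\<^sub>R X2))"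
      by (simp add: br_simps algebra_simps)
    moreover have "br Z (v - t *\<^sub>R X2) \<in> C 1" by (rule br_C[OF t])
    ultimately show "br Z v - \<beta> *\<^sub>R v \<in> C 1"
      using D(2) t subspace_C[of 1] by (auto intro!: subspace_add subspace_diff subspace_scale)
  qed
  have ZS: "br Z v \<in> S" if "v \<in> S" for v
  proof -
    have "br Z v - \<beta> *\<^sub>R v \<in> S" using ok2 that S unfolding ok_def f hyper_def by auto
    then have "(br Z v - \<beta> *\<^sub>R v) + \<beta> *\<^sub>R v \<in> S" using that sS by (intro subspace_add subspace_scale) auto
    then show ?thesis by simp
  qed
  have ok1: "ok 1 \<alpha>"
    unfolding ok_def f
  proof
    fix v assume "v \<in> N"
    then obtain t where t: "v - t *\<^sub>R X1 \<in> S" using flag_top(1)[OF S X] by auto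
    have "br Z v - \<alpha> *\<^sub>R v = t *\<^sub>R (br Z X1 - \<alpha> *\<^sub>R X1) + (br Z (v - t *\<^sub>R X1) - \<alpha> *\<^sub>R (v - t *\<^sub>R X1))"
      by (simp add: br_simps algebra_simps)
    then show "br Z v - \<alpha> *\<^sub>R v \<in> S"
      using D(1) t ZS[OF t] sS by (auto intro!: subspace_add subspace_diff subspace_scale)
  qed
  have c_br: "br c y \<in> flag S (k + 2)" if "c \<in> C 1" "y \<in> flag S k" "3 \<le> k" for c y k
    using br_flag_3[OF S _ that(2,3)] that f by simp
  have ok3: "ok 3 (\<alpha> + \<beta>)"
  proof (rule ext[of 3 "br X1 X2"])
    show "br X1 X2 \<in> flag S 3" using br_N_N[OF S X(1) X2N] .
    show "br X1 X2 \<notin> flag S (Suc 3)" using bracket_generators(1)[OF S X n] by (simp add: numeral_eq_Suc)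
    obtain t where t: "br Z X1 - \<alpha> *\<^sub>R X1 - t *\<^sub>R X2 \<in> C 1" using flag_top(2)[OF S X D(1)] by auto
    have "br Z (br X1 X2) - (\<alpha> + \<beta>) *\<^sub>R br X1 X2
        = br (br Z X1 - \<alpha> *\<^sub>R X1 - t *\<^sub>R X2) X2 + br X1 (br Z X2 - \<beta> *\<^sub>R X2)"
      unfolding leibniz[of Z X1 X2] by (simp add: br_simps alt algebra_simps)
    moreover have "br (br Z X1 - \<alpha> *\<^sub>R X1 - t *\<^sub>R X2) X2 \<in> flag S (Suc 3)"
      using br_flag'[OF S X2N, of _ 3] t f by simp
    moreover have "br X1 (br Z X2 - \<beta> *\<^sub>R X2) \<in> flag S (Suc 3)"
      using br_flag[OF S X(1), of _ 3] D(2) f by simp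
    ultimately show "br Z (br X1 X2) - (\<alpha> + \<beta>) *\<^sub>R br X1 X2 \<in> flag S (Suc 3)"
      using subspace_add[OF subspace_flag[OF S]] by simp
  qed (use n in auto)
  have step: "\<exists>c'. ok (Suc k) c' \<and> (c' = c + \<alpha> \<or> c' = c + \<beta>)" if k: "3 \<le> k" and c: "ok k c" for k c
  proof (cases "n \<le> k")
    case True
    then have "flag S (Suc k) = {0}" "flag S (Suc (Suc k)) = {0}" using flag_vanish[OF S] by auto
    then have "ok (Suc k) (c + \<alpha>)" unfolding ok_def by (simp add: br_simps)
    then show ?thesis by blast
  next
    case False
    then obtain x where x: "x \<in> flag S k" "x \<notin> flag S (Suc k)" using flag_nonempty[OF S, of k] k by auto
    define y where "y = br Z x - c *\<^sub>R x"
    have y: "y \<in> flag S (Suc k)" using c x unfolding ok_def y_def by auto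
    have mem: "br X1 x \<in> flag S (Suc k)" "br X2 x \<in> flag S (Suc k)"
      using br_flag[OF S _ x(1)] X(1) X2N k by auto
    have my: "br X1 y \<in> flag S (Suc (Suc k))" "br X2 y \<in> flag S (Suc (Suc k))"
      using br_flag[OF S _ y] X(1) X2N k by auto
    have sub: "subspace (flag S (Suc (Suc k)))" by (rule subspace_flag[OF S])
    show ?thesis
    proof (cases "br X2 x \<in> flag S (Suc (Suc k))")
      case False
      have "br Z (br X2 x) - (c + \<beta>) *\<^sub>R br X2 x = br (br Z X2 - \<beta> *\<^sub>R X2) x + br X2 y"
        unfolding leibniz[of Z X2 x] y_def by (simp add: br_simps algebra_simps)
      then have "br Z (br X2 x) - (c + \<beta>) *\<^sub>R br X2 x \<in> flag S (Suc (Suc k))"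
        using c_br[OF D(2) x(1) k] my(2) sub by (auto intro!: subspace_add)
      then have "ok (Suc k) (c + \<beta>)"
        using ext[of "Suc k" "br X2 x"] False mem k \<open>\<not> n \<le> k\<close> by auto
      then show ?thesis by blast
    next
      case True
      then have 1: "br X1 x \<notin> flag S (Suc (Suc k))"
        using bracket_generators(2)[OF S X k _ x] \<open>\<not> n \<le> k\<close> by auto
      obtain t where t: "br Z X1 - \<alpha> *\<^sub>R X1 - t *\<^sub>R X2 \<in> C 1" using flag_top(2)[OF S X D(1)] by auto
      have "br Z (br X1 x) - (c + \<alpha>) *\<^sub>R br X1 x = br (br Z X1 - \<alpha> *\<^sub>R X1 - t *\<^sub>R X2) x + t *\<^sub>R br X2 x + br X1 y"
        unfolding leibniz[of Z X1 x] y_def by (simp add: br_simps algebra_simps)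
      then have "br Z (br X1 x) - (c + \<alpha>) *\<^sub>R br X1 x \<in> flag S (Suc (Suc k))"
        using c_br[OF t x(1) k] my(1) True sub by (auto intro!: subspace_add subspace_scale)
      then have "ok (Suc k) (c + \<alpha>)"
        using ext[of "Suc k" "br X1 x"] 1 mem k \<open>\<not> n \<le> k\<close> by auto
      then show ?thesis by blast
    qed
  qed
  obtain g where g0: "g 0 = \<alpha> + \<beta>" and g: "\<And>i. ok (i + 3) (g i)" "\<And>i. g (Suc i) = g i + \<alpha> \<or> g (Suc i) = g i + \<beta>"
  proof -
    have "\<exists>g. \<forall>i. (ok (i + 3) (g i) \<and> (i = 0 \<longrightarrow> g i = \<alpha> + \<beta>)) \<and> (g (Suc i) = g i + \<alpha> \<or> g (Suc i) = g i + \<beta>)"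
    proof (rule dependent_nat_choice)
      show "\<exists>x. ok (0 + 3) x \<and> (0 = 0 \<longrightarrow> x = \<alpha> + \<beta>)" using ok3 by auto
      show "\<exists>y. (ok (Suc i + 3) y \<and> (Suc i = 0 \<longrightarrow> y = \<alpha> + \<beta>)) \<and> (y = x + \<alpha> \<or> y = x + \<beta>)"
        if "ok (i + 3) x \<and> (i = 0 \<longrightarrow> x = \<alpha> + \<beta>)" for x i
        using step[of "i + 3" x] that by auto
    qed
    then show thesis using that by blast
  qed
  define w where "w k = (if k \<le> 1 then \<alpha> else if k = 2 then \<beta> else g (k - 3))" for k
  show thesis
  proof (rule that[of w])
    show "w 1 = \<alpha>" "w 2 = \<beta>" "w 3 = \<alpha> + \<beta>" unfolding w_def using g0 by auto
    show "w (Suc k) = w k + \<alpha> \<or> w (Suc k) = w k + \<beta>" if "3 \<le> k" for k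
    proof -
      have "Suc k - 3 = Suc (k - 3)" using that by simp
      then show ?thesis using g(2)[of "k - 3"] that unfolding w_def by auto
    qed
    show "br Z v - w k *\<^sub>R v \<in> flag S (Suc k)" if k: "1 \<le> k" and v: "v \<in> flag S k" for k v
    proof -
      consider "k = 1" | "k = 2" | "3 \<le> k" using k by linarith
      then have "ok k (w k)"
      proof cases
        case 3
        then show ?thesis using g(1)[of "k - 3"] unfolding w_def by auto
      qed (use ok1 ok2 in \<open>auto simp: w_def\<close>)
      then show ?thesis using v unfolding ok_def by auto
    qed
  qed
qed

text \<open>The operator \<open>(ad Z - \<mu>) ^ m\<close>. Generalised eigenvectors take the place of eigenvectors because
  \<open>ad Z\<close> may fail to be semisimple.\<close>

fun shifted :: "'a \<Rightarrow> real \<Rightarrow> nat \<Rightarrow> 'a \<Rightarrow> 'a" where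
  "shifted Z \<mu> 0 v = v"
| "shifted Z \<mu> (Suc m) v = shifted Z \<mu> m (br Z v - \<mu> *\<^sub>R v)"

definition weight_space :: "'a \<Rightarrow> real \<Rightarrow> 'a set" where
  "weight_space Z \<mu> = {v. \<exists>m. shifted Z \<mu> m v = 0}"

lemma shifted_linear: "shifted Z \<mu> m (u + v) = shifted Z \<mu> m u + shifted Z \<mu> m v"
  "shifted Z \<mu> m (t *\<^sub>R v) = t *\<^sub>R shifted Z \<mu> m v"
proof -
  show "shifted Z \<mu> m (u + v) = shifted Z \<mu> m u + shifted Z \<mu> m v"
  proof (induction m arbitrary: u v)
    case (Suc m)
    have "br Z (u + v) - \<mu> *\<^sub>R (u + v) = (br Z u - \<mu> *\<^sub>R u) + (br Z v - \<mu> *\<^sub>R v)"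
      by (simp add: br_simps algebra_simps)
    then show ?case using Suc by simp
  qed simp
  show "shifted Z \<mu> m (t *\<^sub>R v) = t *\<^sub>R shifted Z \<mu> m v"
  proof (induction m arbitrary: v)
    case (Suc m)
    have "br Z (t *\<^sub>R v) - \<mu> *\<^sub>R (t *\<^sub>R v) = t *\<^sub>R (br Z v - \<mu> *\<^sub>R v)"
      by (simp add: br_simps algebra_simps)
    then show ?case using Suc by simp
  qed simp
qed

lemma shifted_0: "shifted Z \<mu> m 0 = 0"
  using shifted_linear(2)[of Z \<mu> m 0 0] by simp

lemma shifted_Suc': "shifted Z \<mu> (Suc m) v = br Z (shifted Z \<mu> m v) - \<mu> *\<^sub>R shifted Z \<mu> m v"
  by (induction m arbitrary: v) auto

text \<open>\<open>ad Z - (\<mu> + \<nu>)\<close> acts on a bracket by \<open>ad Z - \<mu>\<close> on the first plus \<open>ad Z - \<nu>\<close> on the second factor, so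
  the sum of the exponents suffices.\<close>

lemma weight_space_bracket:
  assumes "x \<in> weight_space Z \<mu>" "y \<in> weight_space Z \<nu>"
  shows "br x y \<in> weight_space Z (\<mu> + \<nu>)"
proof -
  have "shifted Z (\<mu> + \<nu>) (a + b) (br x y) = 0" if "shifted Z \<mu> a x = 0" "shifted Z \<nu> b y = 0" for a b x y
    using that
  proof (induction "a + b" arbitrary: a b x y)
    case 0
    then show ?case by (simp add: br_simps)
  next
    case (Suc s)
    show ?case
    proof (cases "a = 0 \<or> b = 0")
      case True
      then have "br x y = 0" using Suc.prems by (auto simp: br_simps)
      then show ?thesis by (simp add: shifted_0)
    next
      case False
      then obtain a' b' where ab: "a = Suc a'" "b = Suc b'" by (meson not0_implies_Suc)
      have "br Z (br x y) - (\<mu> + \<nu>) *\<^sub>R br x y = br (br Z x - \<mu> *\<^sub>R x) y + br x (br Z y - \<nu> *\<^sub>R y)"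
        unfolding leibniz[of Z x y] by (simp add: br_simps algebra_simps)
      moreover have "shifted Z (\<mu> + \<nu>) (a' + b) (br (br Z x - \<mu> *\<^sub>R x) y) = 0"
        by (rule Suc.hyps(1)) (use Suc ab in auto)
      moreover have "shifted Z (\<mu> + \<nu>) (a + b') (br x (br Z y - \<nu> *\<^sub>R y)) = 0"
        by (rule Suc.hyps(1)) (use Suc ab in auto)
      ultimately show ?thesis using ab by (simp add: shifted_linear)
    qed
  qed
  then show ?thesis using assms unfolding weight_space_def by blast
qed

context
  fixes S Z w
  assumes S: "hyper S"
    and w: "\<And>k v. 1 \<le> k \<Longrightarrow> v \<in> flag S k \<Longrightarrow> br Z v - w k *\<^sub>R v \<in> flag S (Suc k)"
begin

lemma br_flag_weight: "1 \<le> k \<Longrightarrow> v \<in> flag S k \<Longrightarrow> br Z v \<in> flag S k"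
proof -
  assume k: "1 \<le> k" and v: "v \<in> flag S k"
  have "br Z v - w k *\<^sub>R v \<in> flag S k" using w[OF k v] flag_Suc[OF S, of k] by auto
  then have "(br Z v - w k *\<^sub>R v) + w k *\<^sub>R v \<in> flag S k"
    using v subspace_flag[OF S] by (intro subspace_add subspace_scale) auto
  then show ?thesis by simp
qed

lemma shifted_flag:
  assumes k: "1 \<le> k" and v: "v \<in> flag S k"
  shows "shifted Z \<mu> m v - (w k - \<mu>) ^ m *\<^sub>R v \<in> flag S (Suc k)"
    and "shifted Z \<mu> m v \<in> flag S k"
proof -
  show A: "shifted Z \<mu> m v \<in> flag S k" for m
  proof (induction m)
    case (Suc m)
    then show ?case unfolding shifted_Suc'
      using br_flag_weight[OF k Suc] subspace_flag[OF S, of k] by (intro subspace_diff subspace_scale) auto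
  qed (use v in simp)
  show "shifted Z \<mu> m v - (w k - \<mu>) ^ m *\<^sub>R v \<in> flag S (Suc k)"
  proof (induction m)
    case 0
    then show ?case using subspace_0[OF subspace_flag[OF S]] by simp
  next
    case (Suc m)
    let ?s = "shifted Z \<mu> m v"
    have "shifted Z \<mu> (Suc m) v - (w k - \<mu>) ^ Suc m *\<^sub>R v
        = (br Z ?s - w k *\<^sub>R ?s) + (w k - \<mu>) *\<^sub>R (?s - (w k - \<mu>) ^ m *\<^sub>R v)"
      unfolding shifted_Suc' by (simp add: algebra_simps)
    then show ?case
      using w[OF k A[of m]] Suc subspace_flag[OF S, of "Suc k"] by (auto intro!: subspace_add subspace_scale simp del: shifted.simps)
  qed
qed

text \<open>On the line \<open>flag S k / flag S (k + 1)\<close> the operator \<open>(ad Z - \<mu>) ^ m\<close> is the scalar \<open>(w k - \<mu>) ^ m\<close>,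
  so a nonzero class of weight \<open>\<mu>\<close> requires \<open>\<mu> = w k\<close>.\<close>

lemma weight_leading:
  assumes k: "1 \<le> k" and v: "v \<in> flag S k" "v \<in> weight_space Z \<mu>" and ne: "w k \<noteq> \<mu>"
  shows "v \<in> flag S (Suc k)"
proof -
  obtain m where m: "shifted Z \<mu> m v = 0" using v unfolding weight_space_def by auto
  have "- ((w k - \<mu>) ^ m *\<^sub>R v) \<in> flag S (Suc k)" using shifted_flag(1)[OF k v(1), of \<mu> m] m by simp
  then have "inverse (- ((w k - \<mu>) ^ m)) *\<^sub>R (- ((w k - \<mu>) ^ m *\<^sub>R v)) \<in> flag S (Suc k)"
    by (rule subspace_scale[OF subspace_flag[OF S]])
  then show ?thesis using ne by simp
qed

lemma weight_leading_range:
  assumes v: "v \<in> flag S i" "v \<in> weight_space Z \<mu>" and i: "1 \<le> i" "i \<le> j"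
    and ne: "\<And>l. i \<le> l \<Longrightarrow> l < j \<Longrightarrow> w l \<noteq> \<mu>"
  shows "v \<in> flag S j"
  using i(2) ne
proof (induction j rule: dec_induct)
  case (step j)
  then show ?case using weight_leading[of j v \<mu>] v i by auto
qed (use v in auto)

text \<open>Start with any vector of depth \<open>k\<close> and push its image under powers of \<open>ad Z - w k\<close> down the flag. At
  depth \<open>j\<close> either \<open>w j = w k\<close> and one more application helps, or \<open>ad Z - w k\<close> is invertible on the line
  and the vector can be corrected by one of depth \<open>j\<close>.\<close>

lemma weight_vector_exists:
  assumes k: "1 \<le> k" "k \<le> n"
  shows "\<exists>x\<in>weight_space Z (w k). x \<in> flag S k \<and> x \<notin> flag S (Suc k)"
proof -
  have "\<exists>x m. x \<in> flag S k \<and> x \<notin> flag S (Suc k) \<and> shifted Z (w k) m x \<in> flag S j"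
    if "Suc k \<le> j" "j \<le> n + 1" for j
    using that
  proof (induction j rule: dec_induct)
    case base
    obtain x where x: "x \<in> flag S k" "x \<notin> flag S (Suc k)" using flag_nonempty[OF S k] by auto
    then have "shifted Z (w k) 1 x \<in> flag S (Suc k)" using w[OF k(1) x(1)] by (simp add: One_nat_def)
    then show ?case using x by blast
  next
    case (step j)
    then obtain x m where x: "x \<in> flag S k" "x \<notin> flag S (Suc k)" and y: "shifted Z (w k) m x \<in> flag S j" by auto
    have j: "1 \<le> j" using step by auto
    show ?case
    proof (cases "w j = w k")
      case True
      have "shifted Z (w k) (Suc m) x \<in> flag S (Suc j)"
        unfolding shifted_Suc' using w[OF j y] True by simp
      then show ?thesis using x by blast
    next
      case False
      define y' where "y' = shifted Z (w k) m x"
      define u where "u = - (inverse ((w j - w k) ^ m)) *\<^sub>R y'"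
      have u: "u \<in> flag S j" unfolding u_def y'_def using y by (rule subspace_scale[OF subspace_flag[OF S]])
      have "u \<in> flag S (Suc k)" using u flag_antimono[OF S step.hyps(1)] by auto
      moreover have "flag S (Suc k) \<subseteq> flag S k" by (rule flag_Suc[OF S])
      ultimately have "x + u \<in> flag S k" "x + u \<notin> flag S (Suc k)"
        using x subspace_add[OF subspace_flag[OF S], of x k u] subspace_diff[OF subspace_flag[OF S], of "x + u" "Suc k" u] by auto
      moreover have "shifted Z (w k) m (x + u) = shifted Z (w k) m u - (w j - w k) ^ m *\<^sub>R u"
        unfolding shifted_linear y'_def[symmetric] using False unfolding u_def by simp
      then have "shifted Z (w k) m (x + u) \<in> flag S (Suc j)"
        using shifted_flag(1)[OF j u, of "w k" m] by simp
      ultimately show ?thesis by blast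
    qed
  qed
  from this[of "n + 1"] k flag_vanish[OF S, of "n+1"] show ?thesis
    unfolding weight_space_def by auto
qed

end

lemma flag_frame_exists:
  assumes S: "hyper S"
  obtains X where "\<And>k. k \<in> {1..n} \<Longrightarrow> X k \<in> flag S k \<and> X k \<notin> flag S (Suc k)"
proof -
  have "\<forall>k\<in>{1..n}. \<exists>x. x \<in> flag S k \<and> x \<notin> flag S (Suc k)"
    using flag_nonempty[OF S] by auto
  then show thesis using that by metis
qed

lemma flag_coord:
  assumes S: "hyper S" and X: "\<And>k. k \<in> {1..n} \<Longrightarrow> X k \<in> flag S k \<and> X k \<notin> flag S (Suc k)" and k: "1 \<le> k"
  shows "v \<in> flag S k \<longleftrightarrow> v \<in> N \<and> (\<forall>j\<in>{1..n}. j < k \<longrightarrow> coord {1..n} X v j = 0)"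
  using span_tail_iff[OF flag_frame(1)[OF S X] k] flag_frame(2)[OF S X k] by auto

section \<open>Extensions with positive weights\<close>

text \<open>Degrees 1, 2, 3 and from then on \<open>2 ^ k\<close> let only the bracket of \<open>X 1\<close> and \<open>X 2\<close> survive, with its
  component along \<open>X 3\<close>. It makes the entry at \<open>X 1\<close> negative even if \<open>w 1 = 0\<close>; at \<open>X 3\<close> it contributes
  positively, and is scaled down by \<open>R\<close> to be dominated by \<open>T * w 3\<close>.\<close>

lemma positive_weights_sufficient:
  assumes S: "hyper S" and n: "3 \<le> n" and Y: "one_dim_extension_by N Y"
    and w: "\<And>k v. 1 \<le> k \<Longrightarrow> v \<in> flag S k \<Longrightarrow> br Y v - w k *\<^sub>R v \<in> flag S (Suc k)"
    and pos: "0 \<le> w 1" "\<And>k. k \<in> {2..n} \<Longrightarrow> 0 < w k"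
  shows "\<exists>ip. inner_product ip \<and> negative_ricci br ip"
proof -
  obtain X where X: "\<And>k. k \<in> {1..n} \<Longrightarrow> X k \<in> flag S k \<and> X k \<notin> flag S (Suc k)"
    using flag_frame_exists[OF S] by blast
  have frame: "frame {1..n} X N" by (rule flag_frame(1)[OF S]) (use X in auto)
  have XN: "X i \<in> N" if "i \<in> {1..n}" for i using frame_in[OF frame that] .
  define a where "a i = coord {1..n} X (br Y (X i))" for i
  have a: "a i j = (if i = j then w i else 0)" if ij: "i \<in> {1..n}" "j \<in> {1..n}" "j \<le> i" for i j
  proof -
    have "br Y (X i) - w i *\<^sub>R X i \<in> flag S (Suc i)" using w[of i "X i"] X[OF ij(1)] ij by auto
    then have "coord {1..n} X (br Y (X i) - w i *\<^sub>R X i) j = 0"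
      using flag_coord[OF S X, of "Suc i"] ij by auto
    moreover have "coord {1..n} X (br Y (X i)) j = coord {1..n} X ((br Y (X i) - w i *\<^sub>R X i) + w i *\<^sub>R X i) j"
      by simp
    moreover have "\<dots> = coord {1..n} X (br Y (X i) - w i *\<^sub>R X i) j + w i * coord {1..n} X (X i) j"
      using XN[OF ij(1)] br_N[OF XN[OF ij(1)]] subspace_N
      by (subst coord_add[OF frame]) (auto simp: coord_scale[OF frame XN[OF ij(1)]] intro: subspace_diff subspace_scale)
    ultimately show ?thesis unfolding a_def using coord_basis[OF frame ij(1,2)] by simp
  qed
  define b where "b i j k = coord {1..n} X (br (X i) (X j)) k" for i j k
  have b0: "b i j k = 0" if ijk: "i \<in> {1..n}" "j \<in> {1..n}" "k \<in> {1..n}" "k \<le> i \<or> k \<le> j \<or> k \<le> 2" for i j k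
  proof -
    have lt: "b i j k = 0 \<and> br (X i) (X j) \<in> N" if ij: "i \<in> {1..n}" "j \<in> {1..n}" "i < j" "k \<le> j \<or> k \<le> 2" for i j
    proof -
      have "br (X i) (X j) \<in> flag S (Suc j)"
        using br_flag[OF S XN[OF ij(1)], of "X j" j] X[OF ij(2)] ij by auto
      then show ?thesis unfolding b_def using flag_coord[OF S X, of "Suc j"] ijk(3) ij by auto
    qed
    consider "i < j" | "i = j" | "j < i" by linarith
    then show ?thesis
    proof cases
      case 1 then show ?thesis using lt[OF ijk(1,2)] ijk by auto
    next
      case 2 then show ?thesis unfolding b_def by (simp add: alt coord_zero)
    next
      case 3
      then have "b j i k = 0 \<and> br (X j) (X i) \<in> N" using lt[OF ijk(2,1)] ijk by auto
      then show ?thesis using coord_skew[OF frame, of "X j" "X i" k] unfolding b_def by simp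
    qed
  qed
  have m: "1 \<in> {1..n}" "2 \<in> {1..n}" "3 \<in> {1..n}" using n by auto
  have f3: "flag S (Suc 1) = S" "flag S 1 = N" "flag S 2 = S" "flag S (Suc 2) = C 1" "flag S (Suc 3) = flag S 4"
    by (simp_all add: flag_def One_nat_def numeral_eq_Suc)
  have X12: "X 1 \<in> N" "X 1 \<notin> S" "X 2 \<in> S" "X 2 \<notin> C 1" using X[OF m(1)] X[OF m(2)] f3 by auto
  have b3: "b 1 2 3 \<noteq> 0"
  proof
    assume z: "b 1 2 3 = 0"
    have "coord {1..n} X (br (X 1) (X 2)) j = 0" if "j \<in> {1..n}" "j < 4" for j
    proof (cases "j = 3")
      case False
      then have "j \<le> 2" using that by auto
      then show ?thesis using b0[OF m(1,2) that(1)] unfolding b_def by auto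
    qed (use z in \<open>simp add: b_def\<close>)
    then have "br (X 1) (X 2) \<in> flag S 4" using flag_coord[OF S X, of 4] br_N[OF XN[OF m(2)]] by auto
    then show False using bracket_generators(1)[OF S X12 n] by blast
  qed
  have b21: "b 2 1 k = - b 1 2 k" for k
    unfolding b_def by (rule coord_skew[OF frame br_N[OF XN[OF m(2)]]])
  define T where "T = (\<Sum>k\<in>{1..n}. w k)"
  have T: "0 < T" unfolding T_def
  proof (rule sum_pos2[of _ 2])
    show "0 \<le> w i" if "i \<in> {1..n}" for i using pos(1) pos(2)[of i] that by (cases "i = 1") (auto simp: less_imp_le)
  qed (use pos(2)[of 2] n in auto)
  have e: "0 < 2 * T * w 3" using T pos(2)[of 3] n by auto
  (* Replacing X 3 by its multiple with R divides the constant of the bracket by R. *)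
  define R where "R = 1 + (b 1 2 3)\<^sup>2 / (2 * T * w 3)"
  have R: "1 \<le> R" "(b 1 2 3)\<^sup>2 < R * (2 * T * w 3)" unfolding R_def using e by (auto simp: field_simps)
  define g where "g = b 1 2 3 / R"
  have g: "g \<noteq> 0" "g\<^sup>2 < 2 * T * w 3"
  proof -
    show "g \<noteq> 0" unfolding g_def using b3 R by auto
    have "g\<^sup>2 = (b 1 2 3)\<^sup>2 / (R * R)" unfolding g_def by (simp add: power2_eq_square)
    also have "\<dots> < (R * (2 * T * w 3)) / (R * R)" using R by (intro divide_strict_right_mono) auto
    also have "\<dots> = (2 * T * w 3) / R" using R by simp
    also have "\<dots> \<le> 2 * T * w 3" using R(1) e by (simp add: divide_le_eq mult_le_cancel_left1)
    finally show "g\<^sup>2 < 2 * T * w 3" .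
  qed
  define d where "d k = (if k = 3 then R else 1)" for k :: nat
  define f where "f k = (if k \<le> 3 then k else 2 ^ k)" for k :: nat
  have f_le: "f i \<le> 2 ^ i" for i
  proof -
    have "i < 2 ^ i" by (rule less_exp)
    then show ?thesis unfolding f_def by auto
  qed
  have f_strict: "f i + f j < f k" if "i < j" "j < k" "4 \<le> k" for i j k
  proof -
    have "f i + f j \<le> 2 ^ i + 2 ^ j" using f_le[of i] f_le[of j] by linarith
    also have "(2::nat) ^ i + 2 ^ j < 2 ^ (Suc j)" using power_strict_increasing[OF that(1), of "2::nat"] by simp
    also have "(2::nat) ^ (Suc j) \<le> 2 ^ k" using that(2) by (intro power_increasing) auto
    finally show ?thesis unfolding f_def using that(3) by simp
  qed
  have f_mono: "f i < f j" if "i < j" for i j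
  proof (cases "4 \<le> j")
    case True
    have "f i \<le> 2 ^ i" by (rule f_le)
    also have "(2::nat) ^ i < 2 ^ j" using that by simp
    finally show ?thesis using True unfolding f_def by simp
  qed (use that in \<open>auto simp: f_def\<close>)
  have b_graded: "f i + f j \<le> f k \<and> (f i + f j = f k \<longrightarrow> k = 3 \<and> (i = 1 \<and> j = 2 \<or> i = 2 \<and> j = 1))"
    if ijk: "i \<in> {1..n}" "j \<in> {1..n}" "k \<in> {1..n}" "b i j k \<noteq> 0" for i j k
  proof -
    have "\<not> (k \<le> i \<or> k \<le> j \<or> k \<le> 2)" using b0[OF ijk(1-3)] ijk(4) by blast
    then have k: "i < k" "j < k" "3 \<le> k" by auto
    have ij: "i \<noteq> j" using ijk(4) unfolding b_def by (auto simp: alt coord_zero)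
    show ?thesis
    proof (cases "4 \<le> k")
      case True
      then show ?thesis using f_strict[of i j k] f_strict[of j i k] k ij by (cases "i < j") auto
    next
      case False
      then have "k = 3" "i = 1 \<and> j = 2 \<or> i = 2 \<and> j = 1" using k ij ijk by auto
      then show ?thesis unfolding f_def by auto
    qed
  qed
  define G where "G i j k = (if f i + f j = f k then b i j k * (d i * d j / d k) else 0)" for i j k
  have G: "G i j k = (if i = 1 \<and> j = 2 \<and> k = 3 then g else if i = 2 \<and> j = 1 \<and> k = 3 then - g else 0)"
    if ijk: "i \<in> {1..n}" "j \<in> {1..n}" "k \<in> {1..n}" for i j k
  proof -
    consider "i = 1 \<and> j = 2 \<and> k = 3" | "i = 2 \<and> j = 1 \<and> k = 3"
      | "\<not> (i = 1 \<and> j = 2 \<and> k = 3)" "\<not> (i = 2 \<and> j = 1 \<and> k = 3)" by blast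
    then show ?thesis
    proof cases
      case 3
      then have "G i j k = 0" unfolding G_def using b_graded[OF ijk] by auto
      then show ?thesis using 3 by auto
    qed (auto simp: G_def f_def d_def g_def b21)
  qed
  have out: "(\<Sum>k\<in>{1..n}. \<Sum>l\<in>{1..n}. (G i k l)\<^sup>2) = (if i = 1 \<or> i = 2 then g\<^sup>2 else 0)" if i: "i \<in> {1..n}" for i
  proof -
    have "(\<Sum>k\<in>{1..n}. \<Sum>l\<in>{1..n}. (G i k l)\<^sup>2) = (\<Sum>k\<in>{1..n}. \<Sum>l\<in>{1..n}.
        if k = 3 - i \<and> l = 3 then (if i = 1 \<or> i = 2 then g\<^sup>2 else 0) else 0)"
      using i by (intro sum.cong refl) (auto simp: G)
    also have "\<dots> = (if i = 1 \<or> i = 2 then g\<^sup>2 else 0)"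
    proof (cases "i = 1 \<or> i = 2")
      case True
      then have "3 - i \<in> {1..n}" using n by auto
      then show ?thesis using m(3) by (simp only: sum_single_pair finite_atLeastAtMost)
    qed simp
    finally show ?thesis .
  qed
  have into: "(\<Sum>k\<in>{1..n}. \<Sum>l\<in>{1..n}. (G k l i)\<^sup>2) = (if i = 3 then 2 * g\<^sup>2 else 0)" if i: "i \<in> {1..n}" for i
  proof (cases "i = 3")
    case True
    have "(\<Sum>k\<in>{1..n}. \<Sum>l\<in>{1..n}. (G k l i)\<^sup>2) = (\<Sum>k\<in>{1..n}. \<Sum>l\<in>{1..n}.
        (if k = 1 \<and> l = 2 then g\<^sup>2 else 0) + (if k = 2 \<and> l = 1 then g\<^sup>2 else 0))"
      using i True by (intro sum.cong refl) (auto simp: G)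
    also have "\<dots> = 2 * g\<^sup>2"
      unfolding sum.distrib using m by (simp only: sum_single_pair finite_atLeastAtMost)
    finally show ?thesis using True by simp
  next
    case False
    then show ?thesis using i by (auto intro!: sum.neutral simp: G)
  qed
  have Ta: "(\<Sum>k = 1..n. a k k) = T" unfolding T_def using a by (intro sum.cong) auto
  show ?thesis
  proof (rule negative_ricci_extension[OF ideal frame Y, where f=f and d=d], unfold a_def[symmetric] b_def[symmetric] G_def[symmetric])
    show "0 < f i" if "i \<in> {1..n}" for i using f_mono[of 0 i] that by simp
    show "inj_on f {1..n}"
      using f_mono by (metis inj_onI less_irrefl linorder_neqE_nat)
    show "0 < d i" for i unfolding d_def using R by auto
    show "f i \<le> f j" if "i \<in> {1..n}" "j \<in> {1..n}" "a i j \<noteq> 0" for i j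
      using a[OF that(1,2)] that(3) f_mono[of i j] by (cases "j \<le> i") (auto split: if_splits)
    show "f i + f j \<le> f k" if "i \<in> {1..n}" "j \<in> {1..n}" "k \<in> {1..n}" "b i j k \<noteq> 0" for i j k
      using b_graded[OF that] by simp
    show "G i k l = 0 \<or> G j k l = 0"
      if "i \<in> {1..n}" "j \<in> {1..n}" "k \<in> {1..n}" "l \<in> {1..n}" "i \<noteq> j" for i j k l
      using G[OF that(1,3,4)] G[OF that(2,3,4)] that(5) by (auto split: if_splits)
    show "G k l i = 0 \<or> G k l j = 0"
      if "i \<in> {1..n}" "j \<in> {1..n}" "k \<in> {1..n}" "l \<in> {1..n}" "i \<noteq> j" for i j k l
      using G[OF that(3,4,1)] G[OF that(3,4,2)] that(5) by (auto split: if_splits)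
    show "\<exists>i\<in>{1..n}. a i i \<noteq> 0"
      using a[OF m(2,2)] pos(2)[of 2] n by (intro bexI[of _ 2]) auto
    show "- (\<Sum>k = 1..n. a k k) * a i i - 1 / 2 * (\<Sum>k = 1..n. \<Sum>l = 1..n. (G i k l)\<^sup>2)
         + 1 / 4 * (\<Sum>k = 1..n. \<Sum>l = 1..n. (G k l i)\<^sup>2) < 0" if i: "i \<in> {1..n}" for i
    proof -
      have aii: "a i i = w i" using a[OF i i] by simp
      have g2: "0 < g\<^sup>2" using g(1) by simp
      have Tw: "0 \<le> T * w 1" "i \<noteq> 1 \<Longrightarrow> 0 < T * w i" using T pos(1) pos(2)[of i] i by auto
      consider "i = 1" | "i = 2" | "i = 3" | "4 \<le> i" using i by fastforce
      then show ?thesis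
      proof cases
        case 1
        have e: "- T * w 1 - 1 / 2 * g\<^sup>2 + 1 / 4 * 0 < 0" using Tw(1) g2 by linarith
        show ?thesis unfolding Ta out[OF i] into[OF i] aii using e 1 by simp
      next
        case 2
        then have "0 < T * w 2" using Tw(2) by simp
        then have e: "- T * w 2 - 1 / 2 * g\<^sup>2 + 1 / 4 * 0 < 0" using g2 by linarith
        show ?thesis unfolding Ta out[OF i] into[OF i] aii using e 2 by simp
      next
        case 3
        have e: "- T * w 3 - 1 / 2 * 0 + 1 / 4 * (2 * g\<^sup>2) < 0" using g(2) by simp
        show ?thesis unfolding Ta out[OF i] into[OF i] aii using e 3 by simp
      next
        case 4
        then show ?thesis unfolding Ta out[OF i] into[OF i] aii using Tw(2) by simp
      qed
    qed
  qed
qed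

section \<open>Filiform algebras with weights of both signs\<close>

text \<open>Put \<open>x 1 = X1\<close>, \<open>x 2 = X2\<close> with generalised weights 1 and \<open>\<beta> \<le> 0\<close>, and \<open>x (k + 1) = [X1, x k]\<close>, of
  weight \<open>\<beta> + k - 1\<close>. A bracket of \<open>x i\<close> and \<open>x j\<close> with \<open>i, j \<ge> 2\<close> has weight
  \<open>2 \<beta> + i + j - 4\<close>, which, \<open>\<beta>\<close> being at most 0, is not the weight of any \<open>x l\<close> with
  \<open>l \<ge> i + j - 1\<close>, while the bracket has at least this depth. So brackets are deep wherever the \<open>x l\<close>
  span the flag.

  If each \<open>x k\<close> has exact depth \<open>k\<close>, all brackets not involving \<open>X1\<close> vanish, and the algebra is \<open>L\<close>.
  Otherwise let \<open>k\<close> be the first index with \<open>x (k + 1)\<close> too deep. Then \<open>z = [X2, x k]\<close> takes its place,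
  and applying \<open>ad X1\<close> to brackets of total index \<open>k + 1\<close> shows that the bracket of \<open>x i\<close> and
  \<open>x (k + 2 - i)\<close> is \<open>(-1) ^ i z\<close> up to deeper terms. For \<open>k = n - 1\<close> this is \<open>Q\<close>; setting \<open>x i\<close> against
  itself shows that \<open>n\<close> is even.

  If \<open>k < n - 1\<close> there is a contradiction. Comparing coefficients at depth \<open>k + 1\<close> (\<open>\<psi>\<close>) shows in the
  same way that \<open>k\<close> is odd. At depth \<open>k + 2\<close> (\<open>\<phi>\<close>) the coefficients of \<open>[x i, x (k + 3 - i)]\<close> are multiples
  of \<open>u = \<phi> [X1, z]\<close>, with a nonzero factor in the middle, where the bracket is that of a vector with
  itself; so \<open>u = 0\<close> and \<open>[X2, z]\<close> must generate this depth. But the Jacobi identity for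
  \<open>x 2, x 3, x (k - 1)\<close> gives \<open>\<phi> [X2, z] = 0\<close>.\<close>

lemma classification:
  assumes S: "hyper S" and n4: "4 \<le> n"
    and K: "\<And>x y. x \<in> S \<Longrightarrow> y \<in> C 1 \<Longrightarrow> br x y \<in> flag S 5"
    and w: "\<And>k v. 1 \<le> k \<Longrightarrow> v \<in> flag S k \<Longrightarrow> br Y v - w k *\<^sub>R v \<in> flag S (Suc k)"
    and w12: "w 1 = 1" "w 2 = \<beta>" and \<beta>: "\<beta> \<le> 0"
  shows "isomorphic_L br N \<or> isomorphic_Q br N"
proof -
  have lead: "v \<in> flag S j" if "v \<in> flag S i" "v \<in> weight_space Y \<mu>" "1 \<le> i" "i \<le> j"
    "\<And>l. i \<le> l \<Longrightarrow> l < j \<Longrightarrow> w l \<noteq> \<mu>" for v i j \<mu>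
    using weight_leading_range[OF S w, of v i \<mu> j] that by blast
  have f: "flag S 3 = C 1" "flag S 1 = N" "flag S 2 = S" "flag S (Suc 1) = S" "flag S (Suc 2) = C 1"
    by (simp_all add: flag_def One_nat_def)
  obtain X1 where X1: "X1 \<in> weight_space Y 1" "X1 \<in> N" "X1 \<notin> S"
    using weight_vector_exists[OF S w, of 1] w12 f n4 by auto
  obtain X2 where X2: "X2 \<in> weight_space Y \<beta>" "X2 \<in> S" "X2 \<notin> C 1"
    using weight_vector_exists[OF S w, of 2] w12 f n4 by auto
  note X12 = X1(2,3) X2(2,3)
  have X2N: "X2 \<in> N" using X2 S unfolding hyper_def by auto
  define x where "x k = (if k = 1 then X1 else ((br X1) ^^ (k - 2)) X2)" for k
  have x12: "x 1 = X1" "x 2 = X2" unfolding x_def by auto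
  have xS: "x (Suc k) = br X1 (x k)" if "2 \<le> k" for k
  proof -
    have "Suc k - 2 = Suc (k - 2)" using that by simp
    then show ?thesis unfolding x_def using that by auto
  qed
  have x3: "x 3 = br X1 X2" using xS[of 2] x12 by (simp add: numeral_3_eq_3 numeral_2_eq_2)
  have xW: "x k \<in> weight_space Y (\<beta> + (real k - 2))" if "2 \<le> k" for k
    using that
  proof (induction k rule: dec_induct)
    case base
    then show ?case using X2 x12 by simp
  next
    case (step k)
    have e: "\<beta> + (real (Suc k) - 2) = 1 + (\<beta> + (real k - 2))" by simp
    show ?case unfolding xS[OF step(1)] e by (rule weight_space_bracket[OF X1(1) step(3)])
  qed
  have xF: "x k \<in> flag S k" if "2 \<le> k" for k
    using that
  proof (induction k rule: dec_induct)
    case base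
    then show ?case using X2 x12 f by simp
  next
    case (step k)
    then show ?case using br_flag[OF S X1(2) step(3)] xS by simp
  qed
  have xN: "x k \<in> N" if "1 \<le> k" for k
    using xF[of k] flag_subset_N[OF S, of k] X1 x12 that by (cases "k = 1") auto
  have P: "br (x i) y \<in> flag S (i + j - 1)" if "2 \<le> i" "2 \<le> j" "y \<in> flag S j" for i j y
    using that
  proof (induction i arbitrary: j y rule: dec_induct)
    case base
    then show ?case using br_flag[OF S X2N base(2)] x12 by simp
  next
    case (step i)
    have "br (x (Suc i)) y = br X1 (br (x i) y) - br (x i) (br X1 y)"
      unfolding xS[OF step.hyps(1)] using leibniz[of X1 "x i" y] by simp
    moreover have "br X1 (br (x i) y) \<in> flag S (Suc (i + j - 1))"
      using br_flag[OF S X1(2) step.IH[OF step.prems]] step by auto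
    moreover have "br (x i) (br X1 y) \<in> flag S (i + Suc j - 1)"
      by (rule step.IH) (use step br_flag[OF S X1(2), of y j] in auto)
    moreover have "Suc (i + j - 1) = Suc i + j - 1" "i + Suc j - 1 = Suc i + j - 1" using step by auto
    ultimately show ?case using subspace_diff[OF subspace_flag[OF S]] by metis
  qed
  have xnot1: "x 1 \<notin> flag S (Suc 1)" "x 2 \<notin> flag S (Suc 2)" using X12 x12 f by auto
  have xnot3: "x 3 \<notin> flag S (Suc 3)"
    using bracket_generators(1)[OF S X12] n4 x3 by (simp add: numeral_eq_Suc)
  (* Here K is used: it excludes that x 4 is already too deep, hence k is at least 4 below. *)
  have xnot4: "x 4 \<notin> flag S (Suc 4)"
  proof -
    have "br X2 (x 3) \<in> flag S 5" using K[OF X2(2)] xF[of 3] f by auto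
    moreover have "br X1 (x 3) \<notin> flag S (3 + 2) \<or> br X2 (x 3) \<notin> flag S (3 + 2)"
      by (rule bracket_generators(2)[OF S X12]) (use n4 xF[of 3] xnot3 in auto)
    ultimately have "br X1 (x 3) \<notin> flag S 5" by simp
    then show ?thesis using xS[of 3] by (simp add: numeral_eq_Suc)
  qed
  have wx: "w k = \<beta> + (real k - 2)" if "2 \<le> k" "x k \<notin> flag S (Suc k)" for k
    using weight_leading[OF S w, of k "x k" "\<beta> + (real k - 2)"] xF xW that by auto
  have no: "\<beta> + (real l - 2) \<noteq> 2 * \<beta> + (real i + real j - 4)" if "i + j - 1 \<le> l" "2 \<le> i" "2 \<le> j" for i j l
  proof
    assume "\<beta> + (real l - 2) = 2 * \<beta> + (real i + real j - 4)"
    then have "\<beta> = real l + 2 - real i - real j" by simp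
    moreover have "real i + real j \<le> real l + 1" using that by linarith
    ultimately show False using \<beta> by linarith
  qed
  have brW: "br (x i) (x j) \<in> weight_space Y (2 * \<beta> + (real i + real j - 4))" if "2 \<le> i" "2 \<le> j" for i j
    using weight_space_bracket[OF xW[OF that(1)] xW[OF that(2)]] by (simp add: algebra_simps)
  show ?thesis
  proof (cases "\<forall>k\<in>{3..n-1}. x (Suc k) \<notin> flag S (Suc (Suc k))")
    case True
    have xflag: "x k \<in> flag S k \<and> x k \<notin> flag S (Suc k)" if k: "k \<in> {1..n}" for k
    proof -
      consider "k = 1" | "k = 2" | "k = 3" | "4 \<le> k" using k by fastforce
      then show ?thesis
      proof cases
        case 4
        then have kk: "k - 1 \<in> {3..n-1}" "Suc (k - 1) = k" using k by auto
        then have "x (Suc (k - 1)) \<notin> flag S (Suc (Suc (k - 1)))" using True by blast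
        then show ?thesis using xF[of k] 4 kk(2) by simp
      qed (use X12 x12 f xnot1 xnot3 xF[of 2] xF[of 3] in auto)
    qed
    have zero: "br (x i) (x j) = 0" if ij: "2 \<le> i" "i < j" "j \<le> n" for i j
    proof (cases "n + 1 \<le> i + j - 1")
      case True
      then show ?thesis using P[OF ij(1), of j "x j"] xF[of j] ij flag_vanish[OF S True] by auto
    next
      case False
      have "br (x i) (x j) \<in> flag S (n + 1)"
      proof (rule lead[OF P[OF ij(1)] brW])
        show "w l \<noteq> 2 * \<beta> + (real i + real j - 4)" if "i + j - 1 \<le> l" "l < n + 1" for l
        proof -
          have "l \<in> {1..n}" "2 \<le> l" using that ij by auto
          then show ?thesis using no[OF that(1)] wx[of l] xflag[of l] ij by auto
        qed
      qed (use ij False xF[of j] in auto)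
      then show ?thesis using flag_vanish[OF S, of "n+1"] by auto
    qed
    have "L_basis br n x N"
      unfolding L_basis_def frame_basis_family
    proof (intro conjI ballI impI)
      show "frame {1..n} x N" by (rule flag_frame(1)[OF S]) (use xflag in auto)
      fix i j assume ij: "i \<in> {1..n}" "j \<in> {1..n}" "i < j"
      consider "i = 1" "j \<le> n - 1" | "i = 1" "j = n" | "2 \<le> i" using ij by fastforce
      then show "br (x i) (x j) = (if i = 1 \<and> j \<le> n - 1 then x (j + 1) else 0)"
      proof cases
        case 1
        then show ?thesis using xS[of j] ij x12 by (simp add: Suc_eq_plus1)
      next
        case 2
        then have "br (x i) (x j) \<in> flag S (Suc n)" using br_flag[OF S X1(2) xF[of n]] x12 n4 by auto
        then have "br (x i) (x j) = 0" using flag_vanish[OF S, of "Suc n"] by auto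
        moreover have "\<not> j \<le> n - 1" using 2 n4 by auto
        ultimately show ?thesis by simp
      next
        case 3
        then show ?thesis using zero[of i j] ij by auto
      qed
    qed
    then show ?thesis unfolding isomorphic_L_def by blast
  next
    case False
    define k where "k = (LEAST k. k \<in> {3..n-1} \<and> x (Suc k) \<in> flag S (Suc (Suc k)))"
    have ex: "\<exists>k. k \<in> {3..n-1} \<and> x (Suc k) \<in> flag S (Suc (Suc k))" using False by auto
    have k0: "k \<in> {3..n-1}" "x (Suc k) \<in> flag S (Suc (Suc k))"
      using LeastI_ex[OF ex] unfolding k_def by auto
    have kmin: "x (Suc j) \<notin> flag S (Suc (Suc j))" if "j \<in> {3..n-1}" "j < k" for j
      using not_less_Least[of j "\<lambda>k. k \<in> {3..n-1} \<and> x (Suc k) \<in> flag S (Suc (Suc k))"] that unfolding k_def by auto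
    have k4: "4 \<le> k" "k \<le> n - 1"
    proof -
      have "Suc 3 = 4" by simp
      then have "k \<noteq> 3" using k0(2) xnot4 by metis
      then show "4 \<le> k" "k \<le> n - 1" using k0 by auto
    qed
    have xnot: "x j \<notin> flag S (Suc j)" if j: "1 \<le> j" "j \<le> k" for j
    proof -
      consider "j = 1" | "j = 2" | "j = 3" | "4 \<le> j" using j by fastforce
      then show ?thesis
      proof cases
        case 4
        then have "j - 1 \<in> {3..n-1}" "j - 1 < k" "Suc (j - 1) = j" using j k4 by auto
        then show ?thesis using kmin[of "j - 1"] by simp
      qed (use xnot1 xnot3 in auto)
    qed
    define z where "z = br X2 (x k)"
    have zF: "z \<in> flag S (Suc k)" unfolding z_def using br_flag[OF S X2N xF[of k]] k4 by auto
    have znot: "z \<notin> flag S (Suc (Suc k))"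
    proof -
      have "br X1 (x k) \<notin> flag S (k + 2) \<or> br X2 (x k) \<notin> flag S (k + 2)"
        by (rule bracket_generators(2)[OF S X12]) (use k4 xF[of k] xnot[of k] in auto)
      then show ?thesis using k0(2) xS[of k] k4 unfolding z_def by auto
    qed
    have zW: "z \<in> weight_space Y (2 * \<beta> + (real k - 2))"
      unfolding z_def using weight_space_bracket[OF X2(1) xW[of k]] k4 by (simp add: algebra_simps)
    have wk: "w (Suc k) = 2 * \<beta> + (real k - 2)"
      using weight_leading[OF S w _ zF zW] znot by auto
    have Q1: "br (x i) (x j) \<in> flag S (k + 2)" if ij: "2 \<le> i" "2 \<le> j" "i + j \<le> k + 1" for i j
    proof (rule lead[OF P[OF ij(1)] brW])
      show "w l \<noteq> 2 * \<beta> + (real i + real j - 4)" if l: "i + j - 1 \<le> l" "l < k + 2" for l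
      proof (cases "l = Suc k")
        case True
        have "real i + real j \<noteq> real k + 2" using ij(3) by linarith
        then show ?thesis unfolding True wk by auto
      next
        case False
        then have "2 \<le> l" "l \<le> k" using l ij by auto
        then show ?thesis using no[OF l(1)] wx[of l] xnot[of l] ij by auto
      qed
    qed (use ij xF[of j] in auto)
    have br_k2: "br u v \<in> flag S (k + 3)" "br v u \<in> flag S (k + 3)" if "u \<in> N" "v \<in> flag S (k + 2)" for u v
      using br_flag[OF S that] br_flag'[OF S that] by (simp_all add: numeral_eq_Suc)
    have rec: "br (x (Suc i)) (x j) + br (x i) (x (Suc j)) = br X1 (br (x i) (x j))" if "2 \<le> i" "2 \<le> j" for i j
      using leibniz[of X1 "x i" "x j"] xS that by simp
    show ?thesis
    proof (cases "k = n - 1")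
      case True
      have kn: "k + 2 = n + 1" "Suc k = n" using True k4 by auto
      have van: "flag S (n + 1) = {0}" by (rule flag_vanish[OF S]) simp
      have zero: "br (x i) (x j) = 0" if "2 \<le> i" "2 \<le> j" "i + j \<le> n" for i j
      proof -
        have "i + j \<le> k + 1" using that kn by simp
        from Q1[OF that(1,2) this] have "br (x i) (x j) \<in> flag S (n + 1)" unfolding kn(1) .
        then show ?thesis unfolding van by simp
      qed
      have zero': "br (x i) (x j) = 0" if "2 \<le> i" "2 \<le> j" "i + j \<ge> n + 2" for i j
      proof -
        have "br (x i) (x j) \<in> flag S (i + j - 1)" using P[OF that(1,2)] xF[OF that(2)] by auto
        moreover have "flag S (i + j - 1) = {0}" by (rule flag_vanish[OF S]) (use that in auto)
        ultimately show ?thesis by auto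
      qed
      have mid: "br (x i) (x (n + 1 - i)) = (- 1) ^ i *\<^sub>R z" if "2 \<le> i" "i \<le> n - 1" for i
        using that
      proof (induction i rule: dec_induct)
        case base
        have "n + 1 - 2 = k" using True by simp
        then show ?case using x12 unfolding z_def by simp
      next
        case (step i)
        have j: "2 \<le> n - i" "Suc (n - i) = n + 1 - i" "n + 1 - Suc i = n - i" using step by auto
        have "br (x (Suc i)) (x (n - i)) + br (x i) (x (n + 1 - i)) = br X1 (br (x i) (x (n - i)))"
          using rec[OF step.hyps(1) j(1)] j by simp
        also have "br (x i) (x (n - i)) = 0" using zero[OF step.hyps(1) j(1)] step by simp
        finally show ?case using step j by (simp add: br_simps eq_neg_iff_add_eq_0)
      qed
      have z0: "z \<noteq> 0" using znot subspace_0[OF subspace_flag[OF S]] by auto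
      have even: "even n"
      proof (rule ccontr)
        assume odd: "odd n"
        define i where "i = (n + 1) div 2"
        obtain q where "n = 2 * q + 1" using odd by (auto elim: oddE)
        then have i: "n + 1 - i = i" "2 \<le> i" "i \<le> n - 1" using n4 unfolding i_def by auto
        from mid[OF i(2,3)] i(1) z0 show False by (simp add: alt)
      qed
      (* The sign of the last vector matches the sign convention (-1) ^ (i + 1) for Q. *)
      define X where "X j = (if j = n then - z else x j)" for j
      have Xflag: "X j \<in> flag S j \<and> X j \<notin> flag S (Suc j)" if j: "j \<in> {1..n}" for j
      proof (cases "j = n")
        case True
        then show ?thesis unfolding X_def
          using zF znot kn subspace_neg[OF subspace_flag[OF S], of z n] subspace_neg[OF subspace_flag[OF S], of "- z" "Suc n"] by auto
      next
        case False
        then show ?thesis unfolding X_def using xF[of j] xnot[of j] X1 x12 f j kn by (cases "j = 1") auto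
      qed
      have Xn0: "br (X i) (X n) = 0" if "i \<in> {1..n}" for i
      proof -
        have "X i \<in> N" using Xflag[OF that] flag_subset_N[OF S] by auto
        moreover have "X n \<in> flag S n" using Xflag[of n] n4 by auto
        ultimately have "br (X i) (X n) \<in> flag S (Suc n)" using br_flag[OF S] n4 by auto
        then show ?thesis using van by (simp add: Suc_eq_plus1)
      qed
      have "Q_basis br n X N"
        unfolding Q_basis_def frame_basis_family
      proof (intro conjI ballI impI)
        show "frame {1..n} X N" by (rule flag_frame(1)[OF S]) (use Xflag in auto)
        fix i j assume ij: "i \<in> {1..n}" "j \<in> {1..n}" "i < j"
        consider "j = n" | "i = 1" "j \<le> n - 2" | "i = 1" "j = n - 1" | "2 \<le> i" "j \<le> n - 1" "i + j = n + 1"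
          | "2 \<le> i" "j \<le> n - 1" "i + j \<noteq> n + 1"
          using ij by fastforce
        then show "br (X i) (X j) = (if i = 1 \<and> j \<le> n - 2 then X (j + 1)
           else if 2 \<le> i \<and> j = n - i + 1 then (- 1) ^ (i + 1) *\<^sub>R X n else 0)"
        proof cases
          case 1
          then show ?thesis using Xn0[OF ij(1)] ij n4 by auto
        next
          case 2
          then have "j \<noteq> n" "j + 1 \<noteq> n" "i \<noteq> n" using n4 by auto
          then show ?thesis unfolding X_def using 2 xS[of j] ij x12 by (simp add: Suc_eq_plus1)
        next
          case 3
          have e: "X i = X1" "X j = x k" "2 \<le> k" unfolding X_def using 3 True n4 x12 k4 by auto
          then have "br (X i) (X j) = x (Suc k)" unfolding e(1,2) xS[OF e(3)] by simp
          moreover have "Suc (Suc k) = n + 1" using kn by simp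
          then have "x (Suc k) \<in> {0}" using k0(2) van by metis
          then have "x (Suc k) = 0" by simp
          moreover have "\<not> j \<le> n - 2" using 3 n4 by auto
          ultimately show ?thesis using 3 by simp
        next
          case 4
          then have e: "j = n + 1 - i" "i \<noteq> n" "j \<noteq> n" "j = n - i + 1" using ij by auto
          then show ?thesis unfolding X_def using mid[of i] 4 ij by (simp add: power_add)
        next
          case 5
          have "br (x i) (x j) = 0"
            using zero[of i j] zero'[of i j] 5 ij by (cases "i + j \<le> n") auto
          moreover have "j \<noteq> n - i + 1" "i \<noteq> n" "j \<noteq> n" using 5 ij by auto
          ultimately show ?thesis unfolding X_def using 5 by simp
        qed
      qed
      then show ?thesis unfolding isomorphic_Q_def using even by blast
    next
      case False
      then have kn: "k + 2 \<le> n" using k4 by auto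
      obtain E where E: "\<And>k. k \<in> {1..n} \<Longrightarrow> E k \<in> flag S k \<and> E k \<notin> flag S (Suc k)"
        using flag_frame_exists[OF S] by blast
      have fr: "frame {1..n} E N" by (rule flag_frame(1)[OF S]) (use E in auto)
      define \<phi> where "\<phi> v = coord {1..n} E v (k + 2)" for v
      define \<psi> where "\<psi> v = coord {1..n} E v (k + 1)" for v
      note fc = flag_coord[OF S E]
      have \<phi>0: "\<phi> v = 0" if "v \<in> flag S (k + 3)" for v using that fc[of "k + 3" v] kn unfolding \<phi>_def by auto
      have \<psi>0: "\<psi> v = 0" if "v \<in> flag S (k + 2)" for v using that fc[of "k + 2" v] kn unfolding \<psi>_def by auto
      have \<phi>1: "v \<in> flag S (k + 3)" if v: "v \<in> flag S (k + 2)" "\<phi> v = 0" for v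
      proof -
        have "coord {1..n} E v j = 0" if "j \<in> {1..n}" "j < k + 3" for j
          using v fc[of "k + 2" v] that unfolding \<phi>_def by (cases "j = k + 2") auto
        then show ?thesis using fc[of "k + 3" v] v(1) flag_subset_N[OF S] by auto
      qed
      have \<psi>1: "v \<in> flag S (k + 2)" if v: "v \<in> flag S (Suc k)" "\<psi> v = 0" for v
      proof -
        have "coord {1..n} E v j = 0" if "j \<in> {1..n}" "j < k + 2" for j
          using v fc[of "Suc k" v] that unfolding \<psi>_def by (cases "j = k + 1") auto
        then show ?thesis using fc[of "k + 2" v] v(1) flag_subset_N[OF S] by auto
      qed
      have \<phi>_add: "\<phi> (u + v) = \<phi> u + \<phi> v" if "u \<in> N" "v \<in> N" for u v
        unfolding \<phi>_def by (rule coord_add[OF fr that])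
      have \<psi>_add: "\<psi> (u + v) = \<psi> u + \<psi> v" if "u \<in> N" "v \<in> N" for u v
        unfolding \<psi>_def by (rule coord_add[OF fr that])
      have \<phi>_sc: "\<phi> (t *\<^sub>R v) = t * \<phi> v" if "v \<in> N" for t v unfolding \<phi>_def by (rule coord_scale[OF fr that])
      have \<psi>_sc: "\<psi> (t *\<^sub>R v) = t * \<psi> v" if "v \<in> N" for t v unfolding \<psi>_def by (rule coord_scale[OF fr that])
      have zN: "z \<in> N" using zF flag_subset_N[OF S] by auto
      have brxN: "br (x i) v \<in> N" if "1 \<le> i" for i v using br_N'[OF xN[OF that]] .
      have brX1N: "br X1 v \<in> N" "br X2 v \<in> N" for v using br_N'[OF X1(2)] br_N'[OF X2N] by auto
      have c: "\<psi> z \<noteq> 0" using \<psi>1[OF zF] znot by auto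
      have a: "\<psi> (br (x i) (x (k + 2 - i))) = (- 1) ^ i * \<psi> z" if "2 \<le> i" "i \<le> k" for i
        using that
      proof (induction i rule: dec_induct)
        case base
        then show ?case using x12 unfolding z_def by simp
      next
        case (step i)
        have j: "2 \<le> k + 1 - i" "Suc (k + 1 - i) = k + 2 - i" "k + 2 - Suc i = k + 1 - i" using step by auto
        have "br (x i) (x (k + 1 - i)) \<in> flag S (k + 2)" using Q1[OF step.hyps(1) j(1)] step by auto
        then have "br X1 (br (x i) (x (k + 1 - i))) \<in> flag S (k + 3)" by (rule br_k2(1)[OF X1(2)])
        then have "br X1 (br (x i) (x (k + 1 - i))) \<in> flag S (k + 2)"
          using flag_antimono[OF S, of "k+2" "k+3"] by auto
        then have "\<psi> (br (x (Suc i)) (x (k + 1 - i)) + br (x i) (x (k + 2 - i))) = 0"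
          using \<psi>0 rec[OF step.hyps(1) j(1)] j by simp
        then have "\<psi> (br (x (Suc i)) (x (k + 1 - i))) + \<psi> (br (x i) (x (k + 2 - i))) = 0"
          using \<psi>_add[OF brxN brxN] step by simp
        then show ?case using step j by simp
      qed
      have odd: "odd k"
      proof
        assume even: "even k"
        define i where "i = (k + 2) div 2"
        obtain q where "k = 2 * q" using even by (auto elim: evenE)
        then have i: "k + 2 - i = i" "2 \<le> i" "i \<le> k" using k4 unfolding i_def by auto
        from a[OF i(2,3)] i(1) c have "\<psi> 0 \<noteq> 0" by (simp add: alt)
        then show False unfolding \<psi>_def by (simp add: coord_zero)
      qed
      then have k5: "5 \<le> k" using k4 by presburger
      define u where "u = \<phi> (br X1 z)"
      have mid: "br (x i) (x (k + 2 - i)) - (- 1) ^ i *\<^sub>R z \<in> flag S (k + 2)" if i: "2 \<le> i" "i \<le> k" for i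
      proof (rule \<psi>1)
        have "br (x i) (x (k + 2 - i)) \<in> flag S (Suc k)"
          using P[OF i(1), of "k + 2 - i" "x (k + 2 - i)"] xF[of "k + 2 - i"] i by auto
        then show "br (x i) (x (k + 2 - i)) - (- 1) ^ i *\<^sub>R z \<in> flag S (Suc k)"
          using zF subspace_flag[OF S, of "Suc k"] by (intro subspace_diff subspace_scale) auto
        have "1 \<le> i" using i by simp
        then have "\<psi> (br (x i) (x (k + 2 - i)) + (- ((- 1) ^ i)) *\<^sub>R z)
            = \<psi> (br (x i) (x (k + 2 - i))) + \<psi> ((- ((- 1) ^ i)) *\<^sub>R z)"
          by (intro \<psi>_add brxN subspace_scale[OF subspace_N zN]) auto
        also have "\<dots> = 0" unfolding a[OF i] \<psi>_sc[OF zN] by simp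
        finally show "\<psi> (br (x i) (x (k + 2 - i)) - (- 1) ^ i *\<^sub>R z) = 0" by simp
      qed
      have up: "\<phi> (br X1 (br (x i) (x (k + 2 - i)))) = (- 1) ^ i * u" if i: "2 \<le> i" "i \<le> k" for i
      proof -
        have "br X1 (br (x i) (x (k + 2 - i))) = br X1 (br (x i) (x (k + 2 - i)) - (- 1) ^ i *\<^sub>R z) + (- 1) ^ i *\<^sub>R br X1 z"
          by (simp add: br_simps)
        moreover have "\<phi> (br X1 (br (x i) (x (k + 2 - i)) - (- 1) ^ i *\<^sub>R z)) = 0"
          by (rule \<phi>0, rule br_k2(1)[OF X1(2) mid[OF i]])
        ultimately show ?thesis
          using \<phi>_add[OF brX1N(1), of "(- 1) ^ i *\<^sub>R br X1 z"] \<phi>_sc[OF brX1N(1)] subspace_scale[OF subspace_N brX1N(1)]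
          unfolding u_def by simp
      qed
      have b: "\<phi> (br (x i) (x (k + 3 - i))) = (- 1) ^ (i + 1) * (real i - 2) * u" if "3 \<le> i" "i \<le> k" for i
        using that
      proof (induction i rule: dec_induct)
        case base
        have "br (x 3) (x k) + br (x 2) (br X1 (x k)) = br X1 (br (x 2) (x k))"
          using leibniz[of X1 X2 "x k"] x3 x12 by simp
        moreover have "br (x 2) (br X1 (x k)) \<in> flag S (k + 3)"
        proof (rule br_k2(1))
          show "x 2 \<in> N" using xN[of 2] by simp
          show "br X1 (x k) \<in> flag S (k + 2)" using k0(2) xS[of k] k4 by simp
        qed
        ultimately have "\<phi> (br (x 3) (x k)) + 0 = u"
          using \<phi>_add[OF brxN brxN, of 3 2 "x k" "br X1 (x k)"] \<phi>0 x12 unfolding u_def z_def by simp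
        then show ?case by simp
      next
        case (step i)
        have j: "2 \<le> k + 2 - i" "Suc (k + 2 - i) = k + 3 - i" "k + 3 - Suc i = k + 2 - i" "2 \<le> i" "i \<le> k" using step by auto
        have "\<phi> (br (x (Suc i)) (x (k + 2 - i)) + br (x i) (x (k + 3 - i))) = (- 1) ^ i * u"
          using up[OF j(4,5)] rec[OF j(4,1)] j by simp
        then have "\<phi> (br (x (Suc i)) (x (k + 2 - i))) = (- 1) ^ i * u - \<phi> (br (x i) (x (k + 3 - i)))"
          using \<phi>_add[OF brxN brxN, of "Suc i" i] j by simp
        then show ?case using step j by (simp add: algebra_simps power_add)
      qed
      have u0: "u = 0"
      proof -
        define i where "i = (k + 3) div 2"
        obtain q where "k = 2 * q + 1" using odd by (auto elim: oddE)
        then have i: "k + 3 - i = i" "3 \<le> i" "i \<le> k" using k5 unfolding i_def by auto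
        have "\<phi> 0 = (- 1) ^ (i + 1) * (real i - 2) * u" using b[OF i(2,3)] i(1) by (simp add: alt)
        moreover have "\<phi> 0 = 0" unfolding \<phi>_def by (simp add: coord_zero)
        ultimately show ?thesis using i(2) by simp
      qed
      have zz: "br X1 z \<in> flag S (k + 2)" "br X2 z \<in> flag S (k + 2)"
        using br_flag[OF S X1(2) zF] br_flag[OF S X2N zF] k4 by auto
      have "br X1 z \<in> flag S (k + 3)" using \<phi>1[OF zz(1)] u0 unfolding u_def by simp
      moreover have "br X1 z \<notin> flag S (Suc k + 2) \<or> br X2 z \<notin> flag S (Suc k + 2)"
        by (rule bracket_generators(2)[OF S X12]) (use k4 kn zF znot in auto)
      ultimately have v: "\<phi> (br X2 z) \<noteq> 0" using \<phi>1[OF zz(2)] by (auto simp: numeral_eq_Suc)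
      have e: "k + 2 - 3 = k - 1" using k5 by simp
      have "br X2 (br (x 3) (x (k - 1))) = br (br X2 (x 3)) (x (k - 1)) + br (x 3) (br X2 (x (k - 1)))"
        by (rule leibniz)
      moreover have "br (br X2 (x 3)) (x (k - 1)) \<in> flag S (k + 3)"
        using br_k2(2)[OF xN[of "k-1"] Q1[of 2 3]] k5 x12 by auto
      moreover have "br (x 3) (br X2 (x (k - 1))) \<in> flag S (k + 3)"
        using br_k2(1)[OF xN[of 3] Q1[of 2 "k-1"]] k5 x12 by auto
      ultimately have A: "\<phi> (br X2 (br (x 3) (x (k - 1)))) = 0"
        using \<phi>0 subspace_add[OF subspace_flag[OF S]] by metis
      have "br (x 3) (x (k - 1)) + z \<in> flag S (k + 2)" using mid[of 3] k5 e by (simp add: power3_eq_cube)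
      then have "\<phi> (br X2 (br (x 3) (x (k - 1)) + z)) = 0" using br_k2(1)[OF X2N] \<phi>0 by blast
      then have "\<phi> (br X2 (br (x 3) (x (k - 1)))) + \<phi> (br X2 z) = 0"
        using \<phi>_add[OF brX1N(2) brX1N(2)] by (simp add: br_simps)
      then show ?thesis using A v by simp
    qed
  qed
qed

end

section \<open>The action on the abelianisation\<close>

text \<open>A matrix commuting with a non-scalar 2 by 2 matrix is a combination of that matrix and the
  identity.\<close>

lemma centralizer_2x2:
  fixes b11 b12 b21 b22 r11 r12 r21 r22 :: real
  assumes ns: "\<not> (b12 = 0 \<and> b21 = 0 \<and> b11 = b22)"
    and c: "r12 * b21 = r21 * b12" "(r11 - r22) * b12 = (b11 - b22) * r12" "(r11 - r22) * b21 = (b11 - b22) * r21"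
  shows "\<exists>x y. r11 = x + y * b11 \<and> r12 = y * b12 \<and> r21 = y * b21 \<and> r22 = x + y * b22"
proof -
  have "\<exists>y. r12 = y * b12 \<and> r21 = y * b21 \<and> r11 - r22 = y * (b11 - b22)"
  proof -
    consider "b12 \<noteq> 0" | "b21 \<noteq> 0" | "b11 - b22 \<noteq> 0" using ns by auto
    then show ?thesis
    proof cases
      case 1
      show ?thesis by (rule exI[of _ "r12 / b12"]) (use 1 c in \<open>simp add: field_simps\<close>)
    next
      case 2
      show ?thesis by (rule exI[of _ "r21 / b21"]) (use 2 c in \<open>simp add: field_simps\<close>)
    next
      case 3
      show ?thesis by (rule exI[of _ "(r11 - r22) / (b11 - b22)"]) (use 3 c in \<open>simp add: field_simps\<close>)
    qed
  qed
  then obtain y where "r12 = y * b12" "r21 = y * b21" "r11 - r22 = y * (b11 - b22)" by auto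
  then have "r11 = (r11 - y * b11) + y * b11 \<and> r12 = y * b12 \<and> r21 = y * b21 \<and> r22 = (r11 - y * b11) + y * b22"
    by (simp add: algebra_simps)
  then show ?thesis by blast
qed

context filiform_ideal
begin

lemma hyperI:
  assumes "subspace S" "C 1 \<subseteq> S" "S \<subseteq> N" "S \<noteq> C 1" "S \<noteq> N"
  shows "hyper S"
proof -
  have "dim (C 1) \<noteq> dim S" using subspace_dim_equal[OF subspace_C assms(1,2)] assms(4) by auto
  moreover have "dim (C 1) \<le> dim S" by (rule dim_mono[OF assms(2)])
  moreover have "dim S \<noteq> n" using subspace_dim_equal[OF assms(1) subspace_N assms(3)] assms(5) by auto
  moreover have "dim S \<le> n" by (rule dim_mono[OF assms(3)])
  moreover have "dim (C 1) = n - 2" using dim_C[of 1] n_ge_2 by simp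
  ultimately have "dim S = n - 1" by linarith
  then show ?thesis using assms unfolding hyper_def by auto
qed

lemma hyper_exists: "\<exists>S. hyper S"
proof -
  have d: "dim (C 1) = n - 2" using dim_C[of 1] n_ge_2 by simp
  then have "C 1 \<noteq> N" using n_ge_2 by auto
  then obtain x where x: "x \<in> N" "x \<notin> C 1" using C_subset_N[of 1] by auto
  have sp: "span (C 1) = C 1" using subspace_C[of 1] real_vector.span_eq_iff by blast
  have "dim (span (insert x (C 1))) = n - 1" using dim_insert[of x "C 1"] x sp d n_ge_2 by auto
  moreover have "span (insert x (C 1)) \<subseteq> N" using x C_subset_N[of 1] subspace_N by (intro span_minimal) auto
  moreover have "C 1 \<subseteq> span (insert x (C 1))" by (meson insertI2 span_base subsetI)
  ultimately show ?thesis unfolding hyper_def by (intro exI[of _ "span (insert x (C 1))"]) auto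
qed

text \<open>If all weights of \<open>Z\<close> on the flag are zero, the ideal spanned by \<open>Z\<close> and the nilradical is
  nilpotent.\<close>

lemma nilpotent_element:
  assumes nil: "is_nilradical br N" and S: "hyper S"
    and Z: "\<And>k v. 1 \<le> k \<Longrightarrow> v \<in> flag S k \<Longrightarrow> br Z v \<in> flag S (Suc k)"
    and idl: "\<And>W. br W Z \<in> span (insert Z N)"
  shows "Z \<in> N"
proof -
  let ?J = "span (insert Z N)"
  have spN: "span N = N" using subspace_N real_vector.span_eq_iff by blast
  have J: "\<exists>t. y - t *\<^sub>R Z \<in> N" if "y \<in> ?J" for y
    using that real_vector.span_breakdown_eq[of y Z N] spN by auto
  have NJ: "N \<subseteq> ?J" by (meson insertI2 span_base subsetI)
  have ZJ: "Z \<in> ?J" by (simp add: span_base)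
  have "?J = N"
  proof (rule nilpotent_ideal[OF nil, where G="\<lambda>i. flag S (Suc i)" and r=n])
    show "lie_ideal br ?J"
      unfolding lie_ideal_def
    proof (intro conjI allI ballI)
      fix x y assume "y \<in> ?J"
      then obtain t where t: "y - t *\<^sub>R Z \<in> N" using J by auto
      have "br x y = br x (y - t *\<^sub>R Z) + t *\<^sub>R br x Z" by (simp add: br_simps)
      then show "br x y \<in> ?J" using br_N[OF t, of x] NJ idl[of x] by (auto intro!: span_add span_scale)
    qed auto
    show "N \<subseteq> ?J" by (rule NJ)
    have ZN: "br Z v \<in> N" if "v \<in> N" for v by (rule br_N[OF that])
    show "br x y \<in> N" if x: "x \<in> ?J" and y: "y \<in> ?J" for x y
    proof -
      obtain s where s: "x - s *\<^sub>R Z \<in> N" using J[OF x] by auto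
      obtain t where t: "y - t *\<^sub>R Z \<in> N" using J[OF y] by auto
      have "br x y = br (x - s *\<^sub>R Z) y + s *\<^sub>R br Z (y - t *\<^sub>R Z)" by (simp add: br_simps alt)
      then show ?thesis using br_N'[OF s] ZN[OF t] subspace_N by (auto intro!: subspace_add subspace_scale)
    qed
    show "N \<subseteq> flag S (Suc 0)" by (simp add: flag_def)
    show "flag S (Suc n) = {0}" by (rule flag_vanish[OF S]) simp
    show "subspace (flag S (Suc i))" for i by (rule subspace_flag[OF S])
    show "br x y \<in> flag S (Suc (Suc i))" if x: "x \<in> ?J" and y: "y \<in> flag S (Suc i)" for i x y
    proof -
      obtain s where s: "x - s *\<^sub>R Z \<in> N" using J[OF x] by auto
      have "br (x - s *\<^sub>R Z) y \<in> flag S (Suc (Suc i))"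
      proof (cases "i = 0")
        case True
        then have "br (x - s *\<^sub>R Z) y \<in> flag S 3" using br_N_N[OF S s] y by (simp add: flag_def)
        then show ?thesis using flag_antimono[OF S, of "Suc (Suc i)" 3] True by auto
      next
        case False
        then show ?thesis using br_flag[OF S s y] by auto
      qed
      moreover have "br x y = br (x - s *\<^sub>R Z) y + s *\<^sub>R br Z y" by (simp add: br_simps)
      ultimately show ?thesis using Z[OF _ y] subspace_flag[OF S] by (auto intro!: subspace_add subspace_scale)
    qed
  qed
  then show ?thesis using ZJ by simp
qed

text \<open>If \<open>Z\<close> acts on the abelianisation as the scalar \<open>c\<close>, possibly up to a nilpotent part, each weight
  on the flag is a positive multiple of \<open>c\<close>. This is needed for \<open>c = 0\<close> and \<open>c = 1\<close>.\<close>

lemma scalar_weights: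
  assumes S: "hyper S" and X: "X1 \<in> N" "X1 \<notin> S" "X2 \<in> S" "X2 \<notin> C 1"
    and D: "br Z X1 - c *\<^sub>R X1 \<in> S" "br Z X2 - c *\<^sub>R X2 \<in> C 1"
  obtains w where "\<And>k v. 1 \<le> k \<Longrightarrow> v \<in> flag S k \<Longrightarrow> br Z v - w k *\<^sub>R v \<in> flag S (Suc k)"
    "\<And>k. 1 \<le> k \<Longrightarrow> \<exists>m\<ge>1. w k = real m * c"
proof (cases "3 \<le> n")
  case True
  obtain w where w: "w 1 = c" "w 2 = c" "w 3 = c + c"
    "\<And>k. 3 \<le> k \<Longrightarrow> w (Suc k) = w k + c \<or> w (Suc k) = w k + c"
    "\<And>k v. 1 \<le> k \<Longrightarrow> v \<in> flag S k \<Longrightarrow> br Z v - w k *\<^sub>R v \<in> flag S (Suc k)"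
    using flag_weights[OF S True X D] by blast
  have m3: "\<exists>m\<ge>1. w k = real m * c" if "3 \<le> k" for k
    using that
  proof (induction k rule: dec_induct)
    case base
    then show ?case using w(3) by (intro exI[of _ 2]) auto
  next
    case (step k)
    then obtain m :: nat where "1 \<le> m" "w k = real m * c" by auto
    then show ?case using w(4)[OF step(1)] by (intro exI[of _ "Suc m"]) (auto simp: algebra_simps)
  qed
  show thesis
  proof (rule that[OF w(5)])
    fix k :: nat assume "1 \<le> k"
    then consider "k = 1" | "k = 2" | "3 \<le> k" by linarith
    then show "\<exists>m\<ge>1. w k = real m * c"
    proof cases
      case 1 then show ?thesis using w(1) by (intro exI[of _ 1]) auto
    next
      case 2 then show ?thesis using w(2) by (intro exI[of _ 1]) auto
    next
      case 3 then show ?thesis by (rule m3)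
    qed
  qed
next
  case False
  then have n2: "n = 2" using n_ge_2 by simp
  have sS: "subspace S" using S unfolding hyper_def by auto
  have f: "flag S (Suc 1) = S" "flag S 1 = N" "flag S 2 = S" "flag S (Suc 2) = C 1"
    by (simp_all add: flag_def One_nat_def)
  have C1: "C 1 = {0}" using C_vanish[of 1] n2 by simp
  show thesis
  proof (rule that[of "\<lambda>_. c"])
    fix k v assume k: "1 \<le> (k::nat)" and v: "v \<in> flag S k"
    have two: "br Z v - c *\<^sub>R v \<in> C 1" if v: "v \<in> S" for v
    proof -
      obtain t where t: "v - t *\<^sub>R X2 \<in> C 1" using flag_top(2)[OF S X v] by blast
      then have "v = t *\<^sub>R X2" using C1 by auto
      then have "br Z v - c *\<^sub>R v = t *\<^sub>R (br Z X2 - c *\<^sub>R X2)" by (simp add: br_simps algebra_simps)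
      then show ?thesis using D(2) subspace_scale[OF subspace_C] by simp
    qed
    consider "k = 1" | "k = 2" | "3 \<le> k" using k by linarith
    then show "br Z v - c *\<^sub>R v \<in> flag S (Suc k)"
    proof cases
      case 1
      then have "v \<in> N" using v f by simp
      then obtain t where t: "v - t *\<^sub>R X1 \<in> S" using flag_top(1)[OF S X, of v] by blast
      have "br Z v - c *\<^sub>R v = t *\<^sub>R (br Z X1 - c *\<^sub>R X1) + (br Z (v - t *\<^sub>R X1) - c *\<^sub>R (v - t *\<^sub>R X1))"
        by (simp add: br_simps algebra_simps)
      moreover have "br Z (v - t *\<^sub>R X1) - c *\<^sub>R (v - t *\<^sub>R X1) \<in> S" using two[OF t] S unfolding hyper_def by auto
      ultimately show ?thesis using D(1) sS 1 f by (auto intro!: subspace_add subspace_scale)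
    next
      case 2
      then show ?thesis using two v f by simp
    next
      case 3
      then have "flag S k = {0}" using flag_vanish[OF S, of k] n2 by auto
      then show ?thesis using v subspace_0[OF subspace_flag[OF S]] by (simp add: br_simps)
    qed
  qed (auto intro!: exI[of _ "1::nat"])
qed

text \<open>The last term of the derived series at which \<open>K\<close> is not absorbed by the nilradical: brackets
  inside it that stay in \<open>K\<close> lie in the nilradical.\<close>

lemma last_derived:
  assumes solv: "lie_solvable br UNIV" and K: "\<not> K \<subseteq> N"
  shows "\<exists>i. \<not> derived_series br UNIV i \<inter> K \<subseteq> N \<and> derived_series br UNIV (Suc i) \<inter> K \<subseteq> N"
proof -
  obtain k where k: "derived_series br UNIV k = {0}" using solv unfolding lie_solvable_def by auto
  let ?P = "\<lambda>i. derived_series br UNIV i \<inter> K \<subseteq> N"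
  have Pk: "?P k" using k subspace_0[OF subspace_N] by auto
  have P0: "\<not> ?P 0" using K by auto
  define i where "i = (LEAST i. ?P i)"
  have i: "?P i" unfolding i_def using Pk by (rule LeastI)
  then have "i \<noteq> 0" using P0 by metis
  then obtain j where j: "i = Suc j" using not0_implies_Suc by blast
  have "\<not> ?P j" using not_less_Least[of j ?P] j unfolding i_def by auto
  then show ?thesis using i j by blast
qed

lemma bracket_derived: "x \<in> derived_series br UNIV i \<Longrightarrow> y \<in> derived_series br UNIV i \<Longrightarrow> br x y \<in> derived_series br UNIV (Suc i)"
  by (auto simp: bracket_span_def intro: span_base)

text \<open>The elements mapping \<open>N\<close> into its derived algebra form an ideal \<open>K\<close>, which pushes down the whole
  lower central series. Were \<open>K\<close> not contained in the nilradical, then by solvability the last term of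
  the derived series meeting \<open>K\<close> outside the nilradical would generate with it a larger nilpotent ideal.\<close>

lemma kernel_on_abelianization:
  assumes nil: "is_nilradical br N" and solv: "lie_solvable br UNIV"
    and Z: "\<And>x. x \<in> N \<Longrightarrow> br Z x \<in> C 1"
  shows "Z \<in> N"
proof (rule ccontr)
  define K where "K = {z. \<forall>x\<in>N. br z x \<in> C 1}"
  assume "Z \<notin> N"
  then have "\<not> K \<subseteq> N" using Z unfolding K_def by auto
  then obtain i where i: "\<not> derived_series br UNIV i \<inter> K \<subseteq> N" "derived_series br UNIV (Suc i) \<inter> K \<subseteq> N"
    using last_derived[OF solv] by blast
  let ?D = "derived_series br UNIV i"
  have sD: "subspace ?D" and brD: "\<And>x y. y \<in> ?D \<Longrightarrow> br x y \<in> ?D"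
    using lie_ideal_derived_series[of i] unfolding lie_ideal_def by auto
  have sK: "subspace K"
    unfolding K_def subspace_def using subspace_C[of 1]
    by (auto simp: br_simps subspace_0 subspace_add subspace_scale)
  have brK: "br w z \<in> K" if z: "z \<in> K" for w z
    unfolding K_def
  proof (intro CollectI ballI)
    fix x assume x: "x \<in> N"
    have "br (br w z) x = br w (br z x) - br z (br w x)" using leibniz[of w z x] by simp
    moreover have "br w (br z x) \<in> C 1" "br z (br w x) \<in> C 1"
      using z x br_C br_N[OF x] unfolding K_def by auto
    ultimately show "br (br w z) x \<in> C 1" using subspace_diff[OF subspace_C] by simp
  qed
  have K_C: "br z v \<in> C (Suc i)" if z: "z \<in> K" and v: "v \<in> C i" for z v i
    using v
  proof (induction i arbitrary: v)
    case 0
    then show ?case using z unfolding K_def by (simp add: One_nat_def)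
  next
    case (Suc i)
    have "C (Suc i) \<subseteq> {v. br z v \<in> C (Suc (Suc i))}"
    proof (rule C_least)
      show "subspace {v. br z v \<in> C (Suc (Suc i))}"
        using subspace_C[of "Suc (Suc i)"] unfolding subspace_def by (auto simp: br_simps)
      fix u c assume u: "u \<in> N" and c: "c \<in> C i"
      have "br z u \<in> C 1" using z u unfolding K_def by auto
      then have "br (br z u) c \<in> C (Suc (Suc i))" by (rule C_1_step[OF _ c])
      moreover have "br u (br z c) \<in> C (Suc (Suc i))" by (rule C_step[OF u Suc.IH[OF c]])
      ultimately show "br u c \<in> {v. br z v \<in> C (Suc (Suc i))}"
        unfolding mem_Collect_eq leibniz[of z u c] by (rule subspace_add[OF subspace_C])
    qed
    then show ?case using Suc.prems by auto
  qed
  define M where "M = ?D \<inter> K"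
  define J where "J = {x + y | x y. x \<in> M \<and> y \<in> N}"
  have NK: "N \<subseteq> K" unfolding K_def using C_step[of _ _ 0] by (auto simp: One_nat_def)
  have M0: "0 \<in> M" unfolding M_def using subspace_0[OF sD] subspace_0[OF sK] by auto
  have "J = N"
  proof (rule nilpotent_ideal[OF nil, where G=C and r="n - 1"])
    have sM: "subspace M" unfolding M_def using sD sK by (rule subspace_inter)
    have brM: "br w x \<in> M" if "x \<in> M" for w x using that brD brK unfolding M_def by auto
    show "lie_ideal br J"
      unfolding lie_ideal_def
    proof (intro conjI allI ballI)
      show "subspace J" unfolding J_def by (rule real_vector.subspace_sums[OF sM subspace_N])
      fix w v assume "v \<in> J"
      then obtain x y where xy: "v = x + y" "x \<in> M" "y \<in> N" unfolding J_def by auto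
      have "br w v = br w x + br w y" unfolding xy(1) by (simp add: br_simps)
      then show "br w v \<in> J" unfolding J_def using brM[OF xy(2)] br_N[OF xy(3)] by blast
    qed
    show "N \<subseteq> J" unfolding J_def using M0 by force
    show "br u v \<in> N" if u: "u \<in> J" and v: "v \<in> J" for u v
    proof -
      obtain x y where xy: "u = x + y" "x \<in> M" "y \<in> N" using u unfolding J_def by auto
      obtain x' y' where xy': "v = x' + y'" "x' \<in> M" "y' \<in> N" using v unfolding J_def by auto
      have "br x x' \<in> derived_series br UNIV (Suc i)" "br x x' \<in> K"
        using bracket_derived[of x i x'] xy(2) xy'(2) brK unfolding M_def by auto
      then have "br x x' \<in> N" using i(2) by auto
      moreover have "br u v = br x x' + (br x y' + br y v)" unfolding xy(1) xy'(1) by (simp add: br_simps)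
      moreover have "br x y' \<in> N" "br y v \<in> N" using br_N[OF xy'(3)] br_N'[OF xy(3)] by auto
      ultimately show ?thesis using subspace_add[OF subspace_N] by metis
    qed
    show "N \<subseteq> C 0" by simp
    show "C (n - 1) = {0}" by (rule C_vanish) simp
    show "subspace (C j)" for j by (rule subspace_C)
    show "br u c \<in> C (Suc j)" if u: "u \<in> J" and c: "c \<in> C j" for j u c
    proof -
      obtain x y where xy: "u = x + y" "x \<in> M" "y \<in> N" using u unfolding J_def by auto
      have "u \<in> K" unfolding xy(1) using xy(2,3) NK unfolding M_def by (auto intro: subspace_add[OF sK])
      then show ?thesis using K_C c by blast
    qed
  qed
  moreover have "M \<subseteq> J" unfolding J_def using subspace_0[OF subspace_N] by force
  ultimately show False using i(1) unfolding M_def by auto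
qed

end

text \<open>A frame adapted to a flag is fixed, so that the action on the two-dimensional abelianisation of
  the nilradical can be written by matrices in the classes of \<open>X 1\<close> and \<open>X 2\<close>.\<close>

locale solvable_extension = filiform_ideal br N for br :: "'a::real_vector \<Rightarrow> 'a \<Rightarrow> 'a" and N +
  fixes S :: "'a set" and X :: "nat \<Rightarrow> 'a"
  assumes nil: "is_nilradical br N" and solv: "lie_solvable br UNIV"
    and S: "hyper S" and X: "\<And>k. k \<in> {1..n} \<Longrightarrow> X k \<in> flag S k \<and> X k \<notin> flag S (Suc k)"
begin

lemma frame_X: "frame {1..n} X N"
  by (rule flag_frame(1)[OF S]) (use X in auto)

lemma X12: "X 1 \<in> N" "X 1 \<notin> S" "X 2 \<in> S" "X 2 \<notin> C 1" "X 2 \<in> N"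
proof -
  have f: "flag S (Suc 1) = S" "flag S 1 = N" "flag S 2 = S" "flag S (Suc 2) = C 1"
    by (simp_all add: flag_def One_nat_def)
  have "1 \<in> {1..n}" "2 \<in> {1..n}" using n_ge_2 by auto
  then show "X 1 \<in> N" "X 1 \<notin> S" "X 2 \<in> S" "X 2 \<notin> C 1" using X[of 1] X[of 2] f by auto
  then show "X 2 \<in> N" using S unfolding hyper_def by auto
qed

text \<open>For \<open>i\<close> and \<open>j\<close> in \<open>{1, 2}\<close>, the matrix of \<open>ad Z\<close> on the abelianisation, with the image of \<open>X i\<close> in row
  \<open>i\<close>. With rows as images, products of matrices appear in the opposite order.\<close>

definition rho :: "'a \<Rightarrow> nat \<Rightarrow> nat \<Rightarrow> real" where
  "rho Z i j = coord {1..n} X (br Z (X i)) j"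

lemma C1_iff: "v \<in> C 1 \<longleftrightarrow> v \<in> N \<and> coord {1..n} X v 1 = 0 \<and> coord {1..n} X v 2 = 0"
proof -
  have "flag S 3 = C 1" by (simp add: flag_def One_nat_def)
  moreover have "v \<in> flag S 3 \<longleftrightarrow> v \<in> N \<and> (\<forall>j\<in>{1..n}. j < 3 \<longrightarrow> coord {1..n} X v j = 0)"
    by (rule flag_coord[OF S]) (use X in auto)
  moreover have "{j \<in> {1..n}. j < 3} = {1, 2}" using n_ge_2 by auto
  then have "(\<forall>j\<in>{1..n}. j < 3 \<longrightarrow> P j) \<longleftrightarrow> P 1 \<and> P 2" for P
    by (metis (no_types, lifting) insertCI insertE mem_Collect_eq singletonD)
  ultimately show ?thesis by simp
qed

lemma X_in: "i = 1 \<or> i = 2 \<Longrightarrow> X i \<in> N" "i = 1 \<or> i = 2 \<Longrightarrow> i \<in> {1..n}"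
  using X12 n_ge_2 by auto

lemma split_C1: "v \<in> N \<Longrightarrow> v - (coord {1..n} X v 1 *\<^sub>R X 1 + coord {1..n} X v 2 *\<^sub>R X 2) \<in> C 1"
proof -
  assume v: "v \<in> N"
  let ?u = "coord {1..n} X v 1 *\<^sub>R X 1 + coord {1..n} X v 2 *\<^sub>R X 2"
  have u: "?u \<in> N" using X12 subspace_N by (intro subspace_add subspace_scale) auto
  have cu: "coord {1..n} X ?u j = coord {1..n} X v j" if "j = 1 \<or> j = 2" for j
    using that X12 X_in subspace_scale[OF subspace_N]
    by (auto simp: coord_add[OF frame_X] coord_scale[OF frame_X] coord_basis[OF frame_X])
  have "coord {1..n} X (v - ?u) j = coord {1..n} X v j - coord {1..n} X ?u j" for j
    using coord_add[OF frame_X subspace_diff[OF subspace_N v u] u, of j] unfolding diff_add_cancel by linarith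
  then show ?thesis unfolding C1_iff using cu subspace_diff[OF subspace_N v u] by simp
qed

lemma coord_action:
  assumes v: "v \<in> N" and j: "j = 1 \<or> j = 2"
  shows "coord {1..n} X (br Z v) j = coord {1..n} X v 1 * rho Z 1 j + coord {1..n} X v 2 * rho Z 2 j"
proof -
  let ?u = "coord {1..n} X v 1 *\<^sub>R X 1 + coord {1..n} X v 2 *\<^sub>R X 2"
  have "br Z (v - ?u) \<in> C 1" by (rule br_C[OF split_C1[OF v]])
  then have cN: "br Z (v - ?u) \<in> N" "coord {1..n} X (br Z (v - ?u)) j = 0" using j unfolding C1_iff by auto
  have e: "br Z v = br Z (v - ?u) + (coord {1..n} X v 1 *\<^sub>R br Z (X 1) + coord {1..n} X v 2 *\<^sub>R br Z (X 2))"
    by (simp add: br_simps algebra_simps)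
  have m: "br Z (X 1) \<in> N" "br Z (X 2) \<in> N" using X12 br_N by auto
  show ?thesis
    unfolding e rho_def
    using cN m subspace_scale[OF subspace_N m(1)] subspace_scale[OF subspace_N m(2)]
    by (simp add: coord_add[OF frame_X] coord_scale[OF frame_X] subspace_add[OF subspace_N])
qed

lemma rho_commutator:
  assumes ij: "i = 1 \<or> i = 2" "j = 1 \<or> j = 2"
  shows "rho (br Z W) i j = (rho W i 1 * rho Z 1 j + rho W i 2 * rho Z 2 j) - (rho Z i 1 * rho W 1 j + rho Z i 2 * rho W 2 j)"
proof -
  have m: "br W (X i) \<in> N" "br Z (X i) \<in> N" using X_in(1)[OF ij(1)] br_N by auto
  have "br Z (br W (X i)) = br (br Z W) (X i) + br W (br Z (X i))" by (rule leibniz)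
  then have "coord {1..n} X (br Z (br W (X i))) j = rho (br Z W) i j + coord {1..n} X (br W (br Z (X i))) j"
    unfolding rho_def using coord_add[OF frame_X br_N[OF X_in(1)[OF ij(1)]] br_N[OF m(2)]] by simp
  then show ?thesis unfolding coord_action[OF m(1) ij(2)] coord_action[OF m(2) ij(2)] rho_def by simp
qed

lemma rho_linear:
  assumes "i = 1 \<or> i = 2"
  shows "rho (Z + W) i j = rho Z i j + rho W i j" "rho (c *\<^sub>R Z) i j = c * rho Z i j" "rho (Z - W) i j = rho Z i j - rho W i j"
proof -
  have m: "br Z (X i) \<in> N" for Z using X_in(1)[OF assms] br_N by auto
  show A: "rho (Z + W) i j = rho Z i j + rho W i j" for Z W
    unfolding rho_def by (simp add: br_simps coord_add[OF frame_X m m])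
  show B: "rho (c *\<^sub>R Z) i j = c * rho Z i j" for c Z
    unfolding rho_def by (simp add: br_simps coord_scale[OF frame_X m])
  show "rho (Z - W) i j = rho Z i j - rho W i j"
    using A[of Z "(-1) *\<^sub>R W"] B[of "-1" W] by simp
qed

lemma rho_zero_iff: "rho Z 1 1 = 0 \<and> rho Z 1 2 = 0 \<and> rho Z 2 1 = 0 \<and> rho Z 2 2 = 0 \<longleftrightarrow> Z \<in> N"
proof
  assume r: "rho Z 1 1 = 0 \<and> rho Z 1 2 = 0 \<and> rho Z 2 1 = 0 \<and> rho Z 2 2 = 0"
  show "Z \<in> N"
  proof (rule kernel_on_abelianization[OF nil solv])
    fix x assume x: "x \<in> N"
    show "br Z x \<in> C 1" unfolding C1_iff using coord_action[OF x] r br_N[OF x] by simp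
  qed
next
  assume Z: "Z \<in> N"
  have "br Z (X i) \<in> C 1" if "i = 1 \<or> i = 2" for i
    using C_step[OF Z, of "X i" 0] X_in(1)[OF that] by (simp add: One_nat_def)
  then show "rho Z 1 1 = 0 \<and> rho Z 1 2 = 0 \<and> rho Z 2 1 = 0 \<and> rho Z 2 2 = 0"
    unfolding rho_def C1_iff by auto
qed

text \<open>A substitute for Lie's theorem. If some commutator is not in the nilradical, choose by solvability
  an element \<open>B\<close> outside the nilradical in the last possible term of the derived series. Its matrix is
  traceless and not zero, and commutators \<open>[W, B]\<close>, which lie in the same term, commute with \<open>B\<close> modulo
  the nilradical; being traceless they are multiples \<open>l B\<close>. If \<open>B\<close> is not nilpotent, \<open>l = 0\<close> because
  a commutator with \<open>B\<close> is orthogonal to \<open>B\<close> for the trace form; so all matrices commute with \<open>B\<close>, and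
  therefore with each other. If \<open>B\<close> is nilpotent, it respects a flag with zero weights and lies in the
  nilradical. Both are contradictions.\<close>

lemma commutators_in_N: "br Z W \<in> N"
proof (rule ccontr)
  assume nc: "br Z W \<notin> N"
  let ?D = "derived_series br UNIV"
  obtain i where i: "\<not> ?D i \<inter> ?D 1 \<subseteq> N" "?D (Suc i) \<inter> ?D 1 \<subseteq> N"
    using last_derived[OF solv, of "?D 1"] nc bracket_derived[of Z 0 W] by (auto simp: One_nat_def simp del: derived_series.simps(2))
  have D1: "?D (Suc i) \<subseteq> ?D 1"
  proof -
    have "?D (Suc i) \<subseteq> span {br x y |x y. True}"
      unfolding derived_series.simps bracket_span_def by (rule span_mono) auto
    then show ?thesis by (simp add: bracket_span_def One_nat_def)
  qed
  obtain B where B: "B \<in> ?D i" "B \<in> ?D 1" "B \<notin> N" using i(1) by auto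
  have tr: "rho Z 1 1 + rho Z 2 2 = 0" if "Z \<in> ?D 1" for Z
  proof -
    have "Z \<in> span {br x y |x y. True}" using that by (simp add: bracket_span_def One_nat_def)
    then show ?thesis
    proof (induction rule: span_induct_alt)
      case base
      then show ?case unfolding rho_def by (simp add: br_simps coord_zero)
    next
      case (step c x y)
      then obtain u v where "x = br u v" by auto
      then have "rho x 1 1 + rho x 2 2 = 0" by (simp add: rho_commutator)
      moreover have "rho (c *\<^sub>R x + y) 1 1 + rho (c *\<^sub>R x + y) 2 2 = c * (rho x 1 1 + rho x 2 2) + (rho y 1 1 + rho y 2 2)"
        by (simp add: rho_linear algebra_simps)
      ultimately show ?case using step by simp
    qed
  qed
  define p q r where "p = rho B 1 1" and "q = rho B 1 2" and "r = rho B 2 1"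
  have b22: "rho B 2 2 = - p" using tr[OF B(2)] unfolding p_def by simp
  have Bnz: "p \<noteq> 0 \<or> q \<noteq> 0 \<or> r \<noteq> 0" using rho_zero_iff[of B] B(3) b22 unfolding p_def q_def r_def by auto
  have ns: "\<not> (q = 0 \<and> r = 0 \<and> p = - p)" using Bnz by auto
  have sub: "\<exists>l. br W B - l *\<^sub>R B \<in> N \<and> (l = 0 \<or> p * p + q * r = 0)" for W
  proof -
    define M where "M = br W B"
    have MD: "M \<in> ?D i" using lie_ideal_derived_series[of i] B(1) unfolding lie_ideal_def M_def by auto
    have "M \<in> ?D 1" unfolding M_def using bracket_derived[of W 0 B] by (simp add: One_nat_def del: derived_series.simps(2))
    then have m22: "rho M 2 2 = - rho M 1 1" using tr[of M] by simp
    have "br M B \<in> ?D (Suc i)" by (rule bracket_derived[OF MD B(1)])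
    then have "br M B \<in> N" using i(2) D1 by auto
    then have z: "rho (br M B) 1 1 = 0" "rho (br M B) 1 2 = 0" "rho (br M B) 2 1 = 0"
      using rho_zero_iff[of "br M B"] by auto
    have "\<exists>x y. rho M 1 1 = x + y * p \<and> rho M 1 2 = y * q \<and> rho M 2 1 = y * r \<and> - rho M 1 1 = x + y * (- p)"
      by (rule centralizer_2x2[OF ns])
        (use z m22 b22 in \<open>simp_all add: rho_commutator p_def[symmetric] q_def[symmetric] r_def[symmetric] algebra_simps\<close>)
    then obtain x l where xl: "rho M 1 1 = x + l * p" "rho M 1 2 = l * q" "rho M 2 1 = l * r" "- rho M 1 1 = x + l * (- p)" by blast
    then have x0: "x = 0" by linarith
    have "M - l *\<^sub>R B \<in> N"
      unfolding rho_zero_iff[symmetric] using xl x0 m22 b22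
      by (simp add: rho_linear p_def[symmetric] q_def[symmetric] r_def[symmetric])
    moreover have "l = 0 \<or> p * p + q * r = 0"
    proof -
      have "2 * rho M 1 1 * p + rho M 1 2 * r + rho M 2 1 * q = 0"
        unfolding M_def using b22
        by (simp add: rho_commutator p_def[symmetric] q_def[symmetric] r_def[symmetric] algebra_simps)
      then have "2 * l * (p * p + q * r) = 0" unfolding xl(1-3) x0 by (simp add: algebra_simps)
      then show ?thesis by simp
    qed
    ultimately show ?thesis unfolding M_def by blast
  qed
  (* The square of the traceless matrix B is the scalar p * p + q * r. *)
  show False
  proof (cases "p * p + q * r = 0")
    case True
    (* The kernel of B on the abelianisation gives a flag on which B has zero weights. *)
    define S' where "S' = {v \<in> N. br B v \<in> C 1}"
    have BB: "br B (br B v) \<in> C 1" if v: "v \<in> N" for v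
    proof -
      have m: "br B v \<in> N" by (rule br_N[OF v])
      have e: "coord {1..n} X (br B (br B v)) j = coord {1..n} X (br B v) 1 * rho B 1 j + coord {1..n} X (br B v) 2 * rho B 2 j"
        if "j = 1 \<or> j = 2" for j by (rule coord_action[OF m that])
      have e1: "coord {1..n} X (br B v) 1 = coord {1..n} X v 1 * p + coord {1..n} X v 2 * r"
        using coord_action[OF v, of 1 B] unfolding p_def r_def by simp
      have e2: "coord {1..n} X (br B v) 2 = coord {1..n} X v 1 * q - coord {1..n} X v 2 * p"
        using coord_action[OF v, of 2 B] b22 unfolding q_def by simp
      have "coord {1..n} X (br B (br B v)) 1 = coord {1..n} X v 1 * (p * p + q * r)"
        using e[of 1] unfolding e1 e2 p_def[symmetric] r_def[symmetric] by (simp add: algebra_simps)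
      moreover have "coord {1..n} X (br B (br B v)) 2 = coord {1..n} X v 2 * (p * p + q * r)"
        using e[of 2] unfolding e1 e2 b22 q_def[symmetric] by (simp add: algebra_simps)
      ultimately show ?thesis unfolding C1_iff using True br_N[OF m] by simp
    qed
    have H: "hyper S'"
    proof (rule hyperI)
      show "subspace S'" unfolding S'_def subspace_def using subspace_N subspace_C[of 1]
        by (auto simp: br_simps subspace_0 subspace_add subspace_scale)
      show "C 1 \<subseteq> S'" unfolding S'_def using C_subset_N br_C by auto
      show "S' \<subseteq> N" unfolding S'_def by auto
      show ne: "S' \<noteq> N"
      proof
        assume "S' = N"
        then have "B \<in> N" by (intro kernel_on_abelianization[OF nil solv]) (auto simp: S'_def)
        then show False using B by simp
      qed
      show "S' \<noteq> C 1"
      proof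
        assume e: "S' = C 1"
        have "br B v \<in> C 1" if "v \<in> N" for v using BB[OF that] br_N[OF that] e unfolding S'_def by auto
        then have "S' = N" unfolding S'_def by auto
        then show False using ne by simp
      qed
    qed
    obtain E where E: "\<And>k. k \<in> {1..n} \<Longrightarrow> E k \<in> flag S' k \<and> E k \<notin> flag S' (Suc k)"
      using flag_frame_exists[OF H] by blast
    interpret E: solvable_extension br N S' E
      by unfold_locales (use nil solv H E in auto)
    note E12 = E.X12
    have z1: "br B (E 1) - 0 *\<^sub>R E 1 \<in> S'" using BB[OF E12(1)] br_N[OF E12(1)] unfolding S'_def by simp
    have z2: "br B (E 2) - 0 *\<^sub>R E 2 \<in> C 1" using E12(3) unfolding S'_def by simp
    obtain w where w: "\<And>k v. 1 \<le> k \<Longrightarrow> v \<in> flag S' k \<Longrightarrow> br B v - w k *\<^sub>R v \<in> flag S' (Suc k)"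
      "\<And>k. 1 \<le> k \<Longrightarrow> \<exists>m\<ge>1. w k = real m * 0"
      using scalar_weights[OF H E12(1-4) z1 z2] by blast
    have "B \<in> N"
    proof (rule nilpotent_element[OF nil H])
      show "br B v \<in> flag S' (Suc k)" if "1 \<le> k" "v \<in> flag S' k" for k v
        using w(1)[OF that] w(2)[OF that(1)] by auto
      fix W
      obtain l where l: "br W B - l *\<^sub>R B \<in> N" using sub by blast
      have "br W B = (br W B - l *\<^sub>R B) + l *\<^sub>R B" by simp
      moreover have "\<dots> \<in> span (insert B N)" using l by (intro span_add span_scale span_base) auto
      ultimately show "br W B \<in> span (insert B N)" by simp
    qed
    then show False using B by simp
  next
    case False
    have com: "br W B \<in> N" for W using sub[of W] False by auto
    have cen: "\<exists>x y. rho W 1 1 = x + y * p \<and> rho W 1 2 = y * q \<and> rho W 2 1 = y * r \<and> rho W 2 2 = x + y * (- p)" for W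
    proof -
      have z: "rho (br W B) 1 1 = 0" "rho (br W B) 1 2 = 0" "rho (br W B) 2 1 = 0"
        using rho_zero_iff[of "br W B"] com by auto
      show ?thesis
        by (rule centralizer_2x2[OF ns])
          (use z b22 in \<open>simp_all add: rho_commutator p_def[symmetric] q_def[symmetric] r_def[symmetric] algebra_simps\<close>)
    qed
    obtain x y where xy: "rho Z 1 1 = x + y * p" "rho Z 1 2 = y * q" "rho Z 2 1 = y * r" "rho Z 2 2 = x + y * (- p)"
      using cen by blast
    obtain x' y' where xy': "rho W 1 1 = x' + y' * p" "rho W 1 2 = y' * q" "rho W 2 1 = y' * r" "rho W 2 2 = x' + y' * (- p)"
      using cen by blast
    have "br Z W \<in> N"
      unfolding rho_zero_iff[symmetric] by (simp add: rho_commutator xy xy' algebra_simps)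
    then show False using nc by simp
  qed
qed

end

section \<open>Extensions of dimension greater than one\<close>

context solvable_extension
begin

text \<open>An operator that is triangular for the flag with nonzero diagonal is onto; solve from the bottom of
  the flag upwards.\<close>

lemma weight_surjective:
  assumes w: "\<And>k v. 1 \<le> k \<Longrightarrow> v \<in> flag S k \<Longrightarrow> br Z v - w k *\<^sub>R v \<in> flag S (Suc k)"
    and nz: "\<And>k. 1 \<le> k \<Longrightarrow> w k \<noteq> 0" and v: "v \<in> N"
  shows "\<exists>u\<in>N. br Z u = v"
proof -
  have "j \<le> n \<longrightarrow> (\<forall>v\<in>flag S (n + 1 - j). \<exists>u\<in>flag S (n + 1 - j). br Z u = v)" for j
  proof (induction j)
    case 0
    have "flag S (n + 1 - 0) = {0}" using flag_vanish[OF S, of "n + 1"] by simp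
    then show ?case by (simp add: br_simps)
  next
    case (Suc j)
    show ?case
    proof (intro impI ballI)
      assume j: "Suc j \<le> n"
      let ?k = "n + 1 - Suc j"
      have k: "1 \<le> ?k" "n + 1 - j = Suc ?k" using j by auto
      fix v assume v: "v \<in> flag S ?k"
      define u0 where "u0 = (1 / w ?k) *\<^sub>R v"
      have u0: "u0 \<in> flag S ?k" unfolding u0_def by (rule subspace_scale[OF subspace_flag[OF S] v])
      have "w ?k *\<^sub>R u0 = v" unfolding u0_def using nz[OF k(1)] by simp
      then have "br Z u0 - v \<in> flag S (Suc ?k)" using w[OF k(1) u0] by simp
      then obtain u' where u': "u' \<in> flag S (Suc ?k)" "br Z u' = br Z u0 - v" using Suc j k by auto
      have "u' \<in> flag S ?k" using u'(1) flag_Suc[OF S] by auto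
      then have "u0 - u' \<in> flag S ?k" by (rule subspace_diff[OF subspace_flag[OF S] u0])
      moreover have "br Z (u0 - u') = v" using u'(2) by (simp add: br_simps)
      ultimately show "\<exists>u\<in>flag S ?k. br Z u = v" by blast
    qed
  qed
  from this[of n] v show ?thesis by (simp add: flag_def)
qed

text \<open>By \<open>commutators_in_N\<close> the matrices of the action commute. If one of them is a nonzero scalar, it is
  a multiple of the identity; if not, any two independent ones combine to the identity, since a matrix
  commuting with a non-scalar one is a combination of it and the identity.\<close>

lemma identity_element:
  assumes ext: "1 < extension_dim N"
  obtains Y A where "rho Y 1 1 = 1" "rho Y 1 2 = 0" "rho Y 2 1 = 0" "rho Y 2 2 = 1"
    "A \<notin> span (insert Y N)" "Y \<notin> N" "\<And>W. \<exists>x y. W - x *\<^sub>R Y - y *\<^sub>R A \<in> N"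
proof -
  have spN: "span N = N" using subspace_N real_vector.span_eq_iff by blast
  have d: "n + 2 \<le> dim (UNIV :: 'a set)" using ext unfolding extension_dim_def by linarith
  have ex: "\<exists>A. A \<notin> span (insert Y N)" for Y
  proof (rule ccontr)
    assume "\<nexists>A. A \<notin> span (insert Y N)"
    then have "span (insert Y N) = UNIV" by auto
    then have "dim (UNIV :: 'a set) = dim (insert Y N)" by (metis real_vector.dim_span)
    also have "\<dots> \<le> n + 1" using dim_insert[of Y N] by auto
    finally show False using d by simp
  qed
  have mem: "v \<in> span (insert Y N) \<longleftrightarrow> (\<exists>t. v - t *\<^sub>R Y \<in> N)" for v Y
    using real_vector.span_breakdown_eq[of v Y N] spN by simp
  have commute: "rho W 1 2 * rho Z 2 1 = rho W 2 1 * rho Z 1 2"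
    "(rho W 1 1 - rho W 2 2) * rho Z 1 2 = (rho Z 1 1 - rho Z 2 2) * rho W 1 2"
    "(rho W 1 1 - rho W 2 2) * rho Z 2 1 = (rho Z 1 1 - rho Z 2 2) * rho W 2 1" for Z W
  proof -
    have "br Z W \<in> N" by (rule commutators_in_N)
    then have "rho (br Z W) 1 1 = 0" "rho (br Z W) 1 2 = 0" "rho (br Z W) 2 1 = 0"
      using rho_zero_iff[of "br Z W"] by auto
    then show "rho W 1 2 * rho Z 2 1 = rho W 2 1 * rho Z 1 2"
      "(rho W 1 1 - rho W 2 2) * rho Z 1 2 = (rho Z 1 1 - rho Z 2 2) * rho W 1 2"
      "(rho W 1 1 - rho W 2 2) * rho Z 2 1 = (rho Z 1 1 - rho Z 2 2) * rho W 2 1"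
      by (simp_all add: rho_commutator algebra_simps)
  qed
  define scalar where "scalar Z \<longleftrightarrow> rho Z 1 2 = 0 \<and> rho Z 2 1 = 0 \<and> rho Z 1 1 = rho Z 2 2" for Z
  have cen: "\<exists>x y. rho W 1 1 = x + y * rho Z 1 1 \<and> rho W 1 2 = y * rho Z 1 2 \<and> rho W 2 1 = y * rho Z 2 1 \<and> rho W 2 2 = x + y * rho Z 2 2"
    if "\<not> scalar Z" for W Z
    by (rule centralizer_2x2) (use that commute in \<open>auto simp: scalar_def\<close>)
  obtain A0 where A0: "A0 \<notin> N" using ex[of 0] mem[of _ 0] by (metis scaleR_zero_right diff_zero)
  have "\<exists>Y. rho Y 1 1 = 1 \<and> rho Y 1 2 = 0 \<and> rho Y 2 1 = 0 \<and> rho Y 2 2 = 1"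
  proof (cases "scalar A0")
    case True
    then have c: "rho A0 1 1 \<noteq> 0" using A0 rho_zero_iff[of A0] unfolding scalar_def by auto
    show ?thesis
      by (rule exI[of _ "(1 / rho A0 1 1) *\<^sub>R A0"]) (use True c in \<open>simp add: rho_linear scalar_def\<close>)
  next
    case False
    obtain A1 where A1: "A1 \<notin> span (insert A0 N)" using ex by blast
    obtain x y where xy: "rho A1 1 1 = x + y * rho A0 1 1" "rho A1 1 2 = y * rho A0 1 2"
      "rho A1 2 1 = y * rho A0 2 1" "rho A1 2 2 = x + y * rho A0 2 2" using cen[OF False] by blast
    have "x \<noteq> 0"
    proof
      assume "x = 0"
      then have "A1 - y *\<^sub>R A0 \<in> N" unfolding rho_zero_iff[symmetric] by (simp add: rho_linear xy)
      then show False using A1 mem by blast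
    qed
    then show ?thesis
      by (intro exI[of _ "(1 / x) *\<^sub>R (A1 - y *\<^sub>R A0)"]) (simp add: rho_linear xy)
  qed
  then obtain Y where Y: "rho Y 1 1 = 1" "rho Y 1 2 = 0" "rho Y 2 1 = 0" "rho Y 2 2 = 1" by blast
  obtain A where A: "A \<notin> span (insert Y N)" using ex by blast
  have nsA: "\<not> scalar A"
  proof
    assume "scalar A"
    then have "A - rho A 1 1 *\<^sub>R Y \<in> N"
      unfolding rho_zero_iff[symmetric] by (simp add: rho_linear Y scalar_def)
    then show False using A mem by blast
  qed
  show thesis
  proof (rule that[OF Y A])
    show "Y \<notin> N" using rho_zero_iff[of Y] Y by auto
    fix W
    obtain x y where "rho W 1 1 = x + y * rho A 1 1" "rho W 1 2 = y * rho A 1 2"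
      "rho W 2 1 = y * rho A 2 1" "rho W 2 2 = x + y * rho A 2 2" using cen[OF nsA] by blast
    then have "W - x *\<^sub>R Y - y *\<^sub>R A \<in> N"
      unfolding rho_zero_iff[symmetric] by (simp add: rho_linear Y)
    then show "\<exists>x y. W - x *\<^sub>R Y - y *\<^sub>R A \<in> N" by blast
  qed
qed

text \<open>Let \<open>Y\<close> act as the identity and \<open>A0\<close> as a non-scalar matrix. The commutator of \<open>Y\<close> and \<open>A0\<close> lies in the
  nilradical, on which \<open>ad Y\<close> is onto, so \<open>A0\<close> can be corrected to commute with \<open>Y\<close>. Subtracting a
  multiple of \<open>Y\<close> then makes the diagonals of \<open>Y\<close> and \<open>A\<close> orthogonal. The degrees are 1, 1 and from then
  on \<open>3 ^ k\<close>: all brackets of the nilradical raise the degree strictly, while the block of \<open>X 1\<close> and \<open>X 2\<close>,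
  on which \<open>A\<close> acts by a non-scalar matrix, survives the limit. So the symmetric part of the limit of
  \<open>A\<close> is not zero, after changing the ratio of the lengths of \<open>X 1\<close> and \<open>X 2\<close> if necessary.\<close>

lemma higher_extension_sufficient:
  assumes ext: "1 < extension_dim N"
  shows "\<exists>ip. inner_product ip \<and> negative_ricci br ip"
proof -
  obtain Y A0 where Y: "rho Y 1 1 = 1" "rho Y 1 2 = 0" "rho Y 2 1 = 0" "rho Y 2 2 = 1"
    and A0: "A0 \<notin> span (insert Y N)" and YN: "Y \<notin> N"
    and gen: "\<And>W. \<exists>x y. W - x *\<^sub>R Y - y *\<^sub>R A0 \<in> N"
    using identity_element[OF ext] by blast
  have spN: "span N = N" using subspace_N real_vector.span_eq_iff by blast
  have mem: "v \<in> span (insert Y N) \<longleftrightarrow> (\<exists>t. v - t *\<^sub>R Y \<in> N)" for v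
    using real_vector.span_breakdown_eq[of v Y N] spN by simp
  have XN: "X i \<in> N" if "i \<in> {1..n}" for i using frame_in[OF frame_X that] .
  have one: "1 \<in> {1..n}" "2 \<in> {1..n}" using n_ge_2 by auto
  have id: "br Y (X i) - 1 *\<^sub>R X i \<in> C 1" if i: "i = 1 \<or> i = 2" for i
  proof -
    have m: "X i \<in> N" "br Y (X i) \<in> N" using X_in(1)[OF i] br_N by auto
    have "coord {1..n} X (br Y (X i) - X i) j = rho Y i j - coord {1..n} X (X i) j" for j
      unfolding rho_def by (rule coord_diff[OF frame_X m(2,1)])
    then show ?thesis
      unfolding C1_iff using Y i X_in(2)[OF i] one subspace_diff[OF subspace_N m(2,1)]
      by (auto simp: coord_basis[OF frame_X])
  qed
  have "br Y (X 1) - 1 *\<^sub>R X 1 \<in> S" using id[of 1] S unfolding hyper_def by auto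
  then obtain w where w: "\<And>k v. 1 \<le> k \<Longrightarrow> v \<in> flag S k \<Longrightarrow> br Y v - w k *\<^sub>R v \<in> flag S (Suc k)"
    and "\<And>k. 1 \<le> k \<Longrightarrow> \<exists>m\<ge>1. w k = real m * 1"
    using scalar_weights[OF S X12(1-4), of Y 1] id[of 2] by blast
  then have wpos: "0 < w k" if "1 \<le> k" for k using that by force
  obtain u where u: "u \<in> N" "br Y u = br Y A0"
    using weight_surjective[OF w, of "br Y A0"] wpos commutators_in_N by (metis less_irrefl)
  define A1 where "A1 = A0 - u"
  have YA1: "br Y A1 = 0" unfolding A1_def using u(2) by (simp add: br_simps)
  define a where "a i j = coord {1..n} X (br Y (X i)) j" for i j
  define a1 where "a1 i j = coord {1..n} X (br A1 (X i)) j" for i j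
  have coord_sub: "coord {1..n} X (v - c *\<^sub>R v') j = coord {1..n} X v j - c * coord {1..n} X v' j" if "v \<in> N" "v' \<in> N" for v v' c j
    using coord_diff[OF frame_X that(1) subspace_scale[OF subspace_N that(2)]] coord_scale[OF frame_X that(2)] by simp
  have aii: "a i i = w i" if i: "i \<in> {1..n}" for i
  proof -
    have "br Y (X i) - w i *\<^sub>R X i \<in> flag S (Suc i)" using w[of i "X i"] X[OF i] i by auto
    then have "coord {1..n} X (br Y (X i) - w i *\<^sub>R X i) i = 0"
      using flag_coord[OF S X, of "Suc i"] i by auto
    then show ?thesis
      unfolding a_def using coord_sub[OF br_N[OF XN[OF i]] XN[OF i]] i by (simp add: coord_basis[OF frame_X])
  qed
  define c where "c = (\<Sum>i\<in>{1..n}. w i * a1 i i) / (\<Sum>i\<in>{1..n}. w i * w i)"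
  have wsum: "0 < (\<Sum>i\<in>{1..n}. w i * w i)" using wpos n_ge_2 by (intro sum_pos) auto
  define A where "A = A1 - c *\<^sub>R Y"
  have YA: "br Y A = 0" unfolding A_def using YA1 by (simp add: br_simps alt)
  define a2 where "a2 i j = coord {1..n} X (br A (X i)) j" for i j
  have a2: "a2 i j = a1 i j - c * a i j" if "i \<in> {1..n}" for i j
    unfolding a2_def a1_def a_def A_def using coord_sub[OF br_N[OF XN[OF that]] br_N[OF XN[OF that]]] by (simp add: br_simps)
  have orth: "(\<Sum>i\<in>{1..n}. w i * a2 i i) = 0"
  proof -
    have "(\<Sum>i\<in>{1..n}. w i * a2 i i) = (\<Sum>i\<in>{1..n}. w i * a1 i i) - c * (\<Sum>i\<in>{1..n}. w i * w i)"
      using a2 aii by (simp add: sum_subtractf right_diff_distrib sum_distrib_left mult_ac)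
    then show ?thesis unfolding c_def using wsum by simp
  qed
  have Aout: "A \<notin> span (insert Y N)"
  proof
    assume "A \<in> span (insert Y N)"
    then obtain t where t: "A - t *\<^sub>R Y \<in> N" using mem by auto
    have "A0 - (t + c) *\<^sub>R Y = (A - t *\<^sub>R Y) + u" unfolding A_def A1_def by (simp add: algebra_simps)
    then have "A0 - (t + c) *\<^sub>R Y \<in> N" using subspace_add[OF subspace_N t u(1)] by simp
    then show False using A0 mem by blast
  qed
  have full: "span (insert A (span (insert Y N))) = UNIV"
  proof -
    have "W \<in> span (insert A (span (insert Y N)))" for W
    proof -
      obtain x y where xy: "W - x *\<^sub>R Y - y *\<^sub>R A0 \<in> N" using gen by blast
      have "(W - y *\<^sub>R A) - (x + y * c) *\<^sub>R Y = (W - x *\<^sub>R Y - y *\<^sub>R A0) + y *\<^sub>R u"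
        unfolding A_def A1_def by (simp add: algebra_simps)
      also have "\<dots> \<in> N" using xy u(1) subspace_N by (intro subspace_add subspace_scale) auto
      finally have "W - y *\<^sub>R A \<in> span (insert Y N)" using mem by blast
      then show ?thesis unfolding real_vector.span_breakdown_eq[of W] by (meson real_vector.span_base)
    qed
    then show ?thesis by auto
  qed
  have rhoA: "rho A i j = a2 i j" for i j unfolding rho_def a2_def ..
  have ns: "\<not> (a2 1 2 = 0 \<and> a2 2 1 = 0 \<and> a2 1 1 = a2 2 2)"
  proof
    assume "a2 1 2 = 0 \<and> a2 2 1 = 0 \<and> a2 1 1 = a2 2 2"
    then have "A - a2 1 1 *\<^sub>R Y \<in> N"
      unfolding rho_zero_iff[symmetric] by (simp add: rho_linear Y rhoA)
    then show False using Aout mem by blast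
  qed
  (* If A acts skew-symmetrically on the abelianisation, scaling X 2 by 2 destroys the skew-symmetry. *)
  obtain s :: real where s: "s \<noteq> 0" "a2 1 1 \<noteq> 0 \<or> a2 2 2 \<noteq> 0 \<or> a2 1 2 / s + s * a2 2 1 \<noteq> 0"
  proof (cases "a2 1 1 \<noteq> 0 \<or> a2 2 2 \<noteq> 0 \<or> a2 1 2 + a2 2 1 \<noteq> 0")
    case True
    then show ?thesis by (intro that[of 1]) auto
  next
    case False
    then show ?thesis using ns by (intro that[of 2]) auto
  qed
  define d where "d i = (if i = 2 then s else 1)" for i :: nat
  have d: "d i \<noteq> 0" for i unfolding d_def using s by simp
  define X' where "X' i = d i *\<^sub>R X i" for i
  have frame': "frame {1..n} X' N" unfolding X'_def by (rule frame_rescale[OF frame_X d])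
  have coord': "coord {1..n} X' v j = coord {1..n} X v j / d j" if "v \<in> N" "j \<in> {1..n}" for v j
    unfolding X'_def by (rule coord_rescale[OF frame_X d that])
  have X'flag: "X' i \<in> flag S i" if "i \<in> {1..n}" for i
    unfolding X'_def using X[OF that] subspace_scale[OF subspace_flag[OF S]] by auto
  have X'N: "X' i \<in> N" if "i \<in> {1..n}" for i using frame_in[OF frame' that] .
  let ?J = "{1..n}" and ?P = "{0, Suc n}"
  define e where "e = X'(0 := Y, Suc n := A)"
  have eJ: "e i = X' i" if "i \<in> ?J" for i using that unfolding e_def by auto
  have e0: "e 0 = Y" "e (Suc n) = A" unfolding e_def by auto
  have imJ: "e ` ?J = X' ` ?J" using eJ by auto
  have frJ: "frame ?J e N"
  proof -
    have "inj_on e ?J = inj_on X' ?J" by (rule inj_on_cong) (erule eJ)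
    then show ?thesis using frame' unfolding frame_def imJ by simp
  qed
  have fr: "frame (?P \<union> ?J) e UNIV"
  proof -
    have "frame (insert 0 ?J) e (span (insert (e 0) N))"
      by (rule frame_insert[OF frJ]) (use YN e0 in auto)
    then have "frame (insert (Suc n) (insert 0 ?J)) e (span (insert (e (Suc n)) (span (insert (e 0) N))))"
      by (rule frame_insert) (use Aout e0 in auto)
    moreover have "insert (Suc n) (insert 0 ?J) = ?P \<union> ?J" by auto
    ultimately show ?thesis using full e0 by simp
  qed
  define k where "k i j = coord (?P \<union> ?J) e (br (e i) (e j))" for i j
  have brN: "br u v \<in> N" for u v by (rule commutators_in_N)
  have coordN: "coord (?P \<union> ?J) e v j = (if j \<in> ?J then coord ?J X' v j else 0)" if "v \<in> N" "j \<in> ?P \<union> ?J" for v j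
  proof -
    have "v \<in> span (e ` ?J)" using that(1) frJ unfolding frame_def by auto
    from coord_subframe[OF fr Un_upper2 this that(2)]
    have "coord (?P \<union> ?J) e v j = (if j \<in> ?J then coord ?J e v j else 0)" .
    moreover have "coord ?J e v j = coord ?J X' v j" if "j \<in> ?J" unfolding coord_def imJ eJ[OF that] ..
    ultimately show ?thesis by simp
  qed
  have kP: "k p i j = coord ?J X (br (e p) (X i)) j * d i / d j" if "i \<in> ?J" "j \<in> ?J" for p i j
  proof -
    have "br (e p) (e i) = d i *\<^sub>R br (e p) (X i)" unfolding eJ[OF that(1)] X'_def by (simp add: br_simps)
    then have "coord ?J X (br (e p) (e i)) j = d i * coord ?J X (br (e p) (X i)) j"
      using coord_scale[OF frame_X brN] by simp
    then show ?thesis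
      unfolding k_def coordN[OF brN UnI2[OF that(2)]] using that(2) coord'[OF brN that(2)] by simp
  qed
  have k_flag: "k i j l = 0" if "br (e i) (e j) \<in> flag S m" "1 \<le> m" "l \<in> ?P \<union> ?J" "l \<notin> ?J \<or> l < m" for i j l m
  proof (cases "l \<in> ?J")
    case True
    then have "coord ?J X (br (e i) (e j)) l = 0" using flag_coord[OF S X that(2), of "br (e i) (e j)"] that by auto
    then show ?thesis unfolding k_def using coordN[OF brN that(3)] coord'[OF brN True] True by simp
  next
    case False
    then show ?thesis unfolding k_def using coordN[OF brN that(3)] by (simp only: if_False)
  qed
  have k_skew: "k i j l = - k j i l" for i j l unfolding k_def by (rule coord_skew[OF fr]) simp
  define f where "f i = (if i = 0 \<or> i = Suc n then 0 else if i \<le> 2 then 1 else 3 ^ i :: nat)" for i :: nat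
  have f_ge1: "1 \<le> f i" if "i \<in> ?J" for i using that unfolding f_def by auto
  have f_le: "f i \<le> 3 ^ i" for i unfolding f_def by auto
  have f_mono: "f i \<le> f j" if "i \<le> j" "j \<in> ?J" for i j
  proof (cases "j \<le> 2")
    case False
    then have fj: "f j = 3 ^ j" using that unfolding f_def by auto
    have "f i \<le> 3 ^ i" by (rule f_le)
    also have "(3::nat) ^ i \<le> 3 ^ j" using that(1) by (intro power_increasing) auto
    finally show ?thesis using fj by simp
  qed (use that in \<open>auto simp: f_def\<close>)
  have f_strict: "f i + f j < f l" if "i < j" "j < l" "3 \<le> l" "l \<in> ?J" for i j l
  proof -
    have "f i + f j \<le> 3 ^ i + 3 ^ j" using f_le[of i] f_le[of j] by linarith
    also have "(3::nat) ^ i + 3 ^ j < 3 ^ Suc j"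
      using power_strict_increasing[OF that(1), of "3::nat"] unfolding power_Suc by linarith
    also have "(3::nat) ^ Suc j \<le> 3 ^ l" using that(2) by (intro power_increasing) auto
    finally show ?thesis unfolding f_def using that(3,4) by auto
  qed
  have strict: "f i + f j < f l" if ijl: "i \<in> ?J" "j \<in> ?J" "l \<in> ?J" "k i j l \<noteq> 0" for i j l
  proof -
    have lt: "f i + f j < f l" if ij: "i \<in> ?J" "j \<in> ?J" "i < j" "k i j l \<noteq> 0" for i j
    proof -
      have "br (e i) (e j) \<in> flag S (Suc j)"
        unfolding eJ[OF ij(1)] eJ[OF ij(2)] using br_flag[OF S X'N[OF ij(1)] X'flag[OF ij(2)]] ij by auto
      then have "\<not> l < Suc j" using k_flag[of i j "Suc j" l] ij ijl(3) by auto
      then have "j < l" by simp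
      then show ?thesis using f_strict[of i j l] ij ijl(3) by auto
    qed
    have ne: "i \<noteq> j" using ijl(4) unfolding k_def by (auto simp: alt coord_zero)
    have "k j i l \<noteq> 0" using ijl(4) k_skew[of i j l] by auto
    then show ?thesis using lt[OF ijl(1,2)] lt[OF ijl(2,1)] ijl(4) ne by (cases "i < j") auto
  qed
  have gradedP: "f j \<le> f l" if "p \<in> ?P" "j \<in> ?J" "l \<in> ?P \<union> ?J" "k p j l \<noteq> 0" for p j l
  proof -
    have lJ: "l \<in> ?J" using that(4) coordN[OF brN that(3)] unfolding k_def by (auto split: if_splits)
    show ?thesis
    proof (cases "j \<le> 2")
      case True
      then have "f j = 1" using that(2) unfolding f_def by auto
      then show ?thesis using f_ge1[OF lJ] by simp
    next
      case False
      then have "br (e p) (e j) \<in> flag S j"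
        unfolding eJ[OF that(2)] using flag_ideal[OF S _ X'flag[OF that(2)]] by auto
      then have "\<not> l < j" using k_flag[of p j j l] that by auto
      then have "j \<le> l" by simp
      then show ?thesis using f_mono lJ by blast
    qed
  qed
  have YAe: "br (e p) (e p') = 0" if "p \<in> ?P" "p' \<in> ?P" for p p'
    using that YA e0 skew[of A Y] by (auto simp: alt)
  show ?thesis
  proof (rule negative_ricci_codim2[OF fr, where f=f], unfold k_def[symmetric])
    show "br (e 0) (e (Suc n)) = 0" using YA e0 by simp
    show "f 0 = 0" "f (Suc n) = 0" unfolding f_def by auto
    show "0 < f i" if "i \<in> ?J" for i using f_ge1[OF that] by simp
    show "f i + f j \<le> f l" if "i \<le> Suc n" "j \<le> Suc n" "l \<le> Suc n" "k i j l \<noteq> 0" for i j l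
    proof -
      have m: "i \<in> ?P \<union> ?J" "j \<in> ?P \<union> ?J" "l \<in> ?P \<union> ?J" using that by auto
      have f0: "f p = 0" if "p \<in> ?P" for p using that unfolding f_def by auto
      consider "i \<in> ?P" "j \<in> ?P" | "i \<in> ?P" "j \<in> ?J" | "i \<in> ?J" "j \<in> ?P" | "i \<in> ?J" "j \<in> ?J" using m by blast
      then show ?thesis
      proof cases
        case 1
        then show ?thesis using YAe that(4) unfolding k_def by (simp add: coord_zero)
      next
        case 2
        then show ?thesis using gradedP[OF 2 m(3) that(4)] f0 by simp
      next
        case 3
        then show ?thesis using gradedP[OF 3(2,1) m(3)] that(4) k_skew[of i j l] f0 by simp
      next
        case 4
        have "l \<in> ?J" using that(4) coordN[OF brN m(3)] unfolding k_def by (auto split: if_splits)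
        then show ?thesis using strict[OF 4 _ that(4)] by simp
      qed
    qed
    show "f i + f j < f l" if "i \<in> ?J" "j \<in> ?J" "l \<in> ?J" "k i j l \<noteq> 0" for i j l by (rule strict[OF that])
    show "k 0 i j = 0" if ij: "i \<in> ?J" "j \<in> ?J" "f i = f j" "i \<noteq> j" for i j
    proof -
      have inj: "(3::nat) ^ i \<noteq> 3 ^ j" using ij(4) by simp
      have big: "(1::nat) < 3 ^ i" "(1::nat) < 3 ^ j" using ij by auto
      have "i \<le> 2 \<and> j \<le> 2" using ij inj big unfolding f_def by (auto split: if_splits)
      then have "rho Y i j = 0" using ij Y by (auto simp: le_Suc_eq numeral_2_eq_2 One_nat_def)
      then show ?thesis unfolding kP[OF ij(1,2)] e0 rho_def by simp
    qed
    have k0: "k 0 i i = w i" if "i \<in> ?J" for i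
      unfolding kP[OF that that] e0 using aii[OF that] d unfolding a_def by simp
    have kA: "k (Suc n) i j = a2 i j * d i / d j" if "i \<in> ?J" "j \<in> ?J" for i j
      unfolding kP[OF that] e0 a2_def ..
    show "0 < k 0 i i" if "i \<in> ?J" for i using k0[OF that] wpos that by auto
    show "0 < n" using n_ge_2 by simp
    show "(\<Sum>i = 1..n. k 0 i i * k (Suc n) i i) = 0"
      using orth k0 kA d by simp
    show "\<exists>i\<in>?J. \<exists>j\<in>?J. f i = f j \<and> k (Suc n) i j + k (Suc n) j i \<noteq> 0"
    proof -
      have f12: "f 1 = f 2" using n_ge_2 unfolding f_def by auto
      have v: "k (Suc n) 1 1 = a2 1 1" "k (Suc n) 2 2 = a2 2 2" "k (Suc n) 1 2 = a2 1 2 / s" "k (Suc n) 2 1 = s * a2 2 1"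
        using kA[OF one(1,1)] kA[OF one(2,2)] kA[OF one(1,2)] kA[OF one(2,1)] s(1) unfolding d_def by auto
      consider "a2 1 1 \<noteq> 0" | "a2 2 2 \<noteq> 0" | "a2 1 2 / s + s * a2 2 1 \<noteq> 0" using s(2) by blast
      then show ?thesis
      proof cases
        case 1 then show ?thesis using one v by (intro bexI[of _ 1]) auto
      next
        case 2 then show ?thesis using one v by (intro bexI[of _ 2]) auto
      next
        case 3
        then have "k (Suc n) 1 2 + k (Suc n) 2 1 \<noteq> 0" unfolding v by simp
        then show ?thesis using one f12 by blast
      qed
    qed
  qed
qed

end

section \<open>One-dimensional extensions of other filiform algebras\<close>

context filiform_ideal
begin

text \<open>The hyperplane \<open>S\<close> of all \<open>x\<close> that map the derived algebra two steps down, into \<open>C 3\<close>, is invariant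
  under derivations, so \<open>Y\<close> has weights \<open>\<alpha>\<close> and \<open>\<beta>\<close> on the corresponding flag. If \<open>\<alpha>\<close> and \<open>\<beta>\<close> have the same
  sign, or only \<open>\<alpha>\<close> vanishes, a multiple of \<open>Y\<close> satisfies \<open>positive_weights_sufficient\<close>; both cannot vanish,
  as \<open>Y\<close> would be in the nilradical; the remaining case is excluded by \<open>classification\<close>.\<close>

lemma other_filiform_sufficient:
  assumes nil: "is_nilradical br N" and n4: "4 \<le> n" and Y: "one_dim_extension_by N Y"
    and other: "\<not> isomorphic_L br N" "\<not> isomorphic_Q br N"
  shows "\<exists>ip. inner_product ip \<and> negative_ricci br ip"
proof -
  obtain S0 where S0: "hyper S0" using hyper_exists by blast
  obtain E where E: "\<And>k. k \<in> {1..n} \<Longrightarrow> E k \<in> flag S0 k \<and> E k \<notin> flag S0 (Suc k)"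
    using flag_frame_exists[OF S0] by blast
  have f: "flag S' (Suc 1) = S'" "flag S' 1 = N" "flag S' 2 = S'" "flag S' (Suc 2) = C 1" "flag S' 3 = C 1"
    "flag S' 4 = C 2" "flag S' (Suc 3) = C 2" "flag S' 5 = C 3" "flag S' (Suc 4) = C 3" "flag S' (3 + 2) = C 3" for S'
    by (simp_all add: flag_def One_nat_def numeral_eq_Suc)
  have E12: "E 1 \<in> N" "E 1 \<notin> S0" "E 2 \<in> S0" "E 2 \<notin> C 1" using E[of 1] E[of 2] n4 f by auto
  have E3: "E 3 \<in> C 1" "E 3 \<notin> C 2" and E4: "E 4 \<in> C 2" "E 4 \<notin> C 3" using E[of 3] E[of 4] n4 f by auto
  have E2N: "E 2 \<in> N" using E12 S0 unfolding hyper_def by auto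
  have CC: "br x y \<in> C 3" if "x \<in> C 1" "y \<in> C 1" for x y
    using C_1_step[OF that] by (simp add: numeral_eq_Suc One_nat_def)
  have NC: "br x y \<in> C 3" if "x \<in> N" "y \<in> C 2" for x y
    using C_step[OF that] by (simp add: numeral_eq_Suc)
  have NC1: "br x y \<in> C 2" if "x \<in> N" "y \<in> C 1" for x y
    using C_step[OF that] by (simp add: numeral_eq_Suc)
  define S where "S = {x \<in> N. br x (E 3) \<in> C 3}"
  have split3: "\<exists>t. y - t *\<^sub>R E 3 \<in> C 2" if "y \<in> C 1" for y
    using flag_split[OF S0, of 3 "E 3" y] E3 that n4 f by auto
  have SC: "br x y \<in> C 3" if x: "x \<in> S" and y: "y \<in> C 1" for x y
  proof -
    obtain t where t: "y - t *\<^sub>R E 3 \<in> C 2" using split3[OF y] by auto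
    have "br x y = br x (y - t *\<^sub>R E 3) + t *\<^sub>R br x (E 3)" by (simp add: br_simps)
    then show ?thesis using x NC[OF _ t] subspace_C[of 3] unfolding S_def by (auto intro!: subspace_add subspace_scale)
  qed
  have S: "hyper S"
  proof (rule hyperI)
    show "subspace S" unfolding S_def subspace_def using subspace_N subspace_C[of 3]
      by (auto simp: br_simps subspace_0 subspace_add subspace_scale)
    show "C 1 \<subseteq> S" unfolding S_def using CC[OF _ E3(1)] C_subset_N by auto
    show "S \<subseteq> N" unfolding S_def by auto
    have gen: "br (E 1) (E 3) \<notin> C 3 \<or> br (E 2) (E 3) \<notin> C 3"
      using bracket_generators(2)[OF S0 E12, of 3 "E 3"] n4 E3 f by auto
    then show "S \<noteq> N" using E12 E2N unfolding S_def by auto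
    have ex4: "\<exists>t. y - t *\<^sub>R E 4 \<in> C 3" if "y \<in> C 2" for y
      using flag_split[OF S0, of 4 "E 4" y] E4 that n4 f by auto
    obtain p where p: "br (E 1) (E 3) - p *\<^sub>R E 4 \<in> C 3" using ex4[OF NC1[OF E12(1) E3(1)]] by auto
    obtain q where q: "br (E 2) (E 3) - q *\<^sub>R E 4 \<in> C 3" using ex4[OF NC1[OF E2N E3(1)]] by auto
    have pq: "p \<noteq> 0 \<or> q \<noteq> 0" using gen p q by auto
    (* A combination of the two generators whose bracket with E 3 is too deep, so S exceeds C 1. *)
    define v where "v = q *\<^sub>R E 1 - p *\<^sub>R E 2"
    have vN: "v \<in> N" unfolding v_def using E12 E2N subspace_N by (intro subspace_diff subspace_scale) auto
    have "br v (E 3) = q *\<^sub>R (br (E 1) (E 3) - p *\<^sub>R E 4) - p *\<^sub>R (br (E 2) (E 3) - q *\<^sub>R E 4)"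
      unfolding v_def by (simp add: br_simps algebra_simps)
    then have "v \<in> S" using vN p q subspace_C[of 3] unfolding S_def by (auto intro!: subspace_diff subspace_scale)
    moreover have "v \<notin> C 1"
    proof
      assume v: "v \<in> C 1"
      have fr: "frame {1..n} E N" by (rule flag_frame(1)[OF S0]) (use E in auto)
      have "coord {1..n} E v 1 = 0 \<and> coord {1..n} E v 2 = 0"
        using flag_coord[OF S0 E, of 3 v] v n4 f by auto
      moreover have "v = q *\<^sub>R E 1 + (- p) *\<^sub>R E 2" unfolding v_def by simp
      moreover have "coord {1..n} E (q *\<^sub>R E 1 + (- p) *\<^sub>R E 2) j = q * coord {1..n} E (E 1) j + (- p) * coord {1..n} E (E 2) j" for j
        using coord_add[OF fr subspace_scale[OF subspace_N E12(1), of q] subspace_scale[OF subspace_N E2N, of "- p"], of j]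
          coord_scale[OF fr E12(1), of q j] coord_scale[OF fr E2N, of "- p" j] by simp
      ultimately show False using pq n4 coord_basis[OF fr] by simp
    qed
    ultimately show "S \<noteq> C 1" by auto
  qed
  have YS: "br Y x \<in> S" if x: "x \<in> S" for x
  proof -
    have xN: "x \<in> N" using x unfolding S_def by auto
    have "br (br Y x) (E 3) = br Y (br x (E 3)) - br x (br Y (E 3))" using leibniz[of Y x "E 3"] by simp
    moreover have "br Y (br x (E 3)) \<in> C 3" using x br_C unfolding S_def by auto
    moreover have "br x (br Y (E 3)) \<in> C 3" by (rule SC[OF x br_C[OF E3(1)]])
    ultimately show ?thesis unfolding S_def using br_N[OF xN] subspace_diff[OF subspace_C] by auto
  qed
  obtain X where X: "\<And>k. k \<in> {1..n} \<Longrightarrow> X k \<in> flag S k \<and> X k \<notin> flag S (Suc k)"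
    using flag_frame_exists[OF S] by blast
  have X12: "X 1 \<in> N" "X 1 \<notin> S" "X 2 \<in> S" "X 2 \<notin> C 1" using X[of 1] X[of 2] n4 f by auto
  obtain \<alpha> where \<alpha>: "br Y (X 1) - \<alpha> *\<^sub>R X 1 \<in> S" using flag_top(1)[OF S X12 br_N[OF X12(1)]] by blast
  obtain \<beta> where \<beta>: "br Y (X 2) - \<beta> *\<^sub>R X 2 \<in> C 1" using flag_top(2)[OF S X12 YS[OF X12(3)]] by blast
  have n3: "3 \<le> n" using n4 by simp
  obtain w where w: "w 1 = \<alpha>" "w 2 = \<beta>" "w 3 = \<alpha> + \<beta>"
    "\<And>k. 3 \<le> k \<Longrightarrow> w (Suc k) = w k + \<alpha> \<or> w (Suc k) = w k + \<beta>"
    "\<And>k v. 1 \<le> k \<Longrightarrow> v \<in> flag S k \<Longrightarrow> br Y v - w k *\<^sub>R v \<in> flag S (Suc k)"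
    using flag_weights[OF S n3 X12 \<alpha> \<beta>] by blast
  have scaled: "one_dim_extension_by N (t *\<^sub>R Y)" if "t \<noteq> 0" for t
  proof -
    have YN: "Y \<notin> N" and sp: "span (insert Y N) = UNIV" using Y unfolding one_dim_extension_by_def by auto
    have "t *\<^sub>R Y \<notin> N"
    proof
      assume "t *\<^sub>R Y \<in> N"
      then have "(1 / t) *\<^sub>R (t *\<^sub>R Y) \<in> N" by (rule subspace_scale[OF subspace_N])
      then show False using YN that by simp
    qed
    moreover have "insert Y N \<subseteq> span (insert (t *\<^sub>R Y) N)"
    proof -
      have "(1 / t) *\<^sub>R (t *\<^sub>R Y) \<in> span (insert (t *\<^sub>R Y) N)" by (rule span_scale[OF span_base]) simp
      then have "Y \<in> span (insert (t *\<^sub>R Y) N)" using that by simp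
      then show ?thesis by (auto intro: span_base)
    qed
    then have "span (insert Y N) \<subseteq> span (insert (t *\<^sub>R Y) N)" by (rule span_minimal) auto
    ultimately show ?thesis using sp unfolding one_dim_extension_by_def by auto
  qed
  have wt: "br (t *\<^sub>R Y) v - (t * w k) *\<^sub>R v \<in> flag S (Suc k)" if "1 \<le> k" "v \<in> flag S k" for t k v
  proof -
    have "br (t *\<^sub>R Y) v - (t * w k) *\<^sub>R v = t *\<^sub>R (br Y v - w k *\<^sub>R v)" by (simp add: br_simps algebra_simps)
    then show ?thesis using subspace_scale[OF subspace_flag[OF S] w(5)[OF that]] by simp
  qed
  have positive: ?thesis if t: "t \<noteq> 0" "0 \<le> t * \<alpha>" "0 < t * \<beta>" for t
  proof (rule positive_weights_sufficient[OF S n3 scaled[OF t(1)] wt])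
    show "0 \<le> t * w 1" using t w(1) by simp
    have pos3: "0 < t * w k" if "3 \<le> k" for k
      using that
    proof (induction k rule: dec_induct)
      case base
      have "t * w 3 = t * \<alpha> + t * \<beta>" using w(3) by (simp add: algebra_simps)
      then show ?case using t by linarith
    next
      case (step k)
      have "t * w (Suc k) = t * w k + t * \<alpha> \<or> t * w (Suc k) = t * w k + t * \<beta>"
        using w(4)[OF step(1)] by (auto simp: algebra_simps)
      then show ?case using step t by linarith
    qed
    show "0 < t * w k" if "k \<in> {2..n}" for k
      using pos3[of k] w(2) t that by (cases "k = 2") auto
  qed
  show ?thesis
  proof (cases "\<alpha> = 0")
    case True
    show ?thesis
    proof (cases "\<beta> = 0")
      case True
      have w0: "w k = 0" if "1 \<le> k" for k
      proof -
        have "w k = 0" if "3 \<le> k" for k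
          using that
        proof (induction k rule: dec_induct)
          case base
          show ?case using w(3) True \<open>\<alpha> = 0\<close> by simp
        next
          case (step k)
          then show ?case using w(4)[OF step(1)] True \<open>\<alpha> = 0\<close> by auto
        qed
        moreover consider "k = 1" | "k = 2" | "3 \<le> k" using \<open>1 \<le> k\<close> by linarith
        ultimately show ?thesis using w(1,2) True \<open>\<alpha> = 0\<close> by metis
      qed
      have "Y \<in> N"
      proof (rule nilpotent_element[OF nil S])
        show "br Y v \<in> flag S (Suc k)" if "1 \<le> k" "v \<in> flag S k" for k v
          using w(5)[OF that] w0[OF that(1)] by simp
        show "br W Y \<in> span (insert Y N)" for W
          using Y unfolding one_dim_extension_by_def by auto
      qed
      then show ?thesis using Y unfolding one_dim_extension_by_def by simp
    next
      case False
      then show ?thesis using positive[of "1 / \<beta>"] True by simp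
    qed
  next
    case False
    show ?thesis
    proof (cases "0 < \<beta> / \<alpha>")
      case True
      then show ?thesis using positive[of "1 / \<alpha>"] False by simp
    next
      case b: False
      have "isomorphic_L br N \<or> isomorphic_Q br N"
      proof (rule classification[OF S n4 _ wt[of _ _ "1 / \<alpha>"]])
        show "br x y \<in> flag S 5" if "x \<in> S" "y \<in> C 1" for x y using SC[OF that] f by simp
        show "1 / \<alpha> * w 1 = 1" using w(1) False by simp
        show "1 / \<alpha> * w 2 = \<beta> / \<alpha>" using w(2) by simp
        show "\<beta> / \<alpha> \<le> 0" using b by simp
      qed
      then show ?thesis using other by simp
    qed
  qed
qed

text \<open>For \<open>n = 4\<close> exchange \<open>X 1\<close> and \<open>X 2\<close>.\<close>

lemma Q4_isomorphic_L:
  assumes "isomorphic_Q br N" and n4: "n = 4"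
  shows "isomorphic_L br N"
proof -
  obtain X where Q: "Q_basis br 4 X N" using assms unfolding isomorphic_Q_def by auto
  have fr: "frame {1..4} X N" using Q unfolding Q_basis_def frame_basis_family by auto
  have Qb: "br (X i) (X j) = (if i = 1 \<and> j \<le> 4 - 2 then X (j + 1)
           else if 2 \<le> i \<and> j = 4 - i + 1 then (-1) ^ (i + 1) *\<^sub>R X 4 else 0)"
    if "i \<in> {1..4}" "j \<in> {1..4}" "i < j" for i j using Q that unfolding Q_basis_def by blast
  have b: "br (X 1) (X 2) = X 3" "br (X 1) (X 3) = 0" "br (X 1) (X 4) = 0" "br (X 2) (X 3) = - X 4"
    "br (X 2) (X 4) = 0" "br (X 3) (X 4) = 0"
    using Qb[of 1 2] Qb[of 1 3] Qb[of 1 4] Qb[of 2 3] Qb[of 2 4] Qb[of 3 4] by simp_all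
  define p :: "nat \<Rightarrow> nat" where "p i = (if i = 1 then 2 else if i = 2 then 1 else i)" for i
  define s :: "nat \<Rightarrow> real" where "s i = (if i = 3 then - 1 else 1)" for i
  define X' where "X' i = s i *\<^sub>R X (p i)" for i
  have X': "X' 1 = X 2" "X' 2 = X 1" "X' 3 = - X 3" "X' 4 = X 4" unfolding X'_def s_def p_def by auto
  have J: "{1..4::nat} = {1, 2, 3, 4}" by auto
  have "frame {1..4} (\<lambda>i. X (p i)) N"
  proof -
    have pj: "p ` {1..4} = {1..4}" unfolding J p_def by auto
    then have im: "(\<lambda>i. X (p i)) ` {1..4} = X ` {1..4}" by (metis image_image)
    have "inj_on p {1..4}" unfolding J p_def inj_on_def by auto
    then have "inj_on (\<lambda>i. X (p i)) {1..4}"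
      using fr pj comp_inj_on[of p "{1..4}" X] unfolding frame_def by (simp add: o_def)
    then show ?thesis using fr unfolding frame_def im by simp
  qed
  then have "frame {1..4} X' N" unfolding X'_def by (rule frame_rescale) (simp add: s_def)
  moreover have "br (X' i) (X' j) = (if i = 1 \<and> j \<le> 4 - 1 then X' (j + 1) else 0)"
    if "i \<in> {1..4}" "j \<in> {1..4}" "i < j" for i j
  proof -
    have "(i, j) \<in> {(1,2),(1,3),(1,4),(2,3),(2,4),(3,4)}" using that unfolding J by auto
    then show ?thesis
      using b X' skew[of "X 2" "X 1"] by (auto simp: br_simps)
  qed
  ultimately have "L_basis br 4 X' N" unfolding L_basis_def frame_basis_family by blast
  then show ?thesis unfolding isomorphic_L_def n4 by blast
qed

end

section \<open>The characterisation\<close>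

theorem theorem3:
  fixes br :: "'a::real_vector \<Rightarrow> 'a \<Rightarrow> 'a" and N :: "'a set" and n :: nat
  assumes "lie_algebra br"
    and "lie_solvable br UNIV"
    and "\<not> lie_nilpotent br UNIV"
    and "is_nilradical br N"
    and "filiform br N"
    and "n = dim N"
    and forms_defined: "4 \<le> n \<or> extension_dim N > 1"
  shows "(\<exists>ip. inner_product ip \<and> negative_ricci br ip) \<longleftrightarrow>
     (\<exists>X Y. L_basis br n X N \<and> one_dim_extension_by N Y \<and>
        iota_L2 br n X Y > 0 \<and> iota_Ln br n X Y > 0)
   \<or> (\<exists>m Y. n = 2 * m \<and> m > 2 \<and> isomorphic_Q br N \<and> one_dim_extension_by N Y \<and>
        (\<forall>k\<in>{m + 1..n}. iota_Q br N k Y > 0))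
   \<or> (\<not> isomorphic_L br N \<and> \<not> isomorphic_Q br N)
   \<or> ((isomorphic_L br N \<or> isomorphic_Q br N) \<and> extension_dim N > 1)"
    (is "?neg \<longleftrightarrow> ?L \<or> ?Q \<or> ?other \<or> ?big")
proof -
  have N: "lie_ideal br N" using assms(4) unfolding is_nilradical_def by auto
  interpret filiform_ideal br N
    by unfold_locales (use assms N in auto)
  have n: "n = dim N" by (rule assms(6))
  have spN: "span N = N" using subspace_N real_vector.span_eq_iff by blast
  have big: ?neg if ext: "extension_dim N > 1"
  proof -
    obtain S where S: "hyper S" using hyper_exists by blast
    obtain X where X: "\<And>k. k \<in> {1..dim N} \<Longrightarrow> X k \<in> flag S k \<and> X k \<notin> flag S (Suc k)"
      using flag_frame_exists[OF S] by blast
    interpret solvable_extension br N S X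
      by unfold_locales (use assms S X in auto)
    show ?neg by (rule higher_extension_sufficient[OF ext])
  qed
  have "N \<noteq> UNIV" using assms(3,4) unfolding is_nilradical_def by auto
  have one_dim: "one_dim_extension_by N Y" if ext: "\<not> extension_dim N > 1" and Y: "Y \<notin> N" for Y
  proof -
    have "dim (span (insert Y N)) = dim N + 1" using dim_insert[of Y N] spN Y by simp
    then have "dim (UNIV :: 'a set) \<le> dim (span (insert Y N))" using ext unfolding extension_dim_def by simp
    then have "span (insert Y N) = UNIV" by (intro subspace_dim_equal) auto
    then show ?thesis unfolding one_dim_extension_by_def using Y by simp
  qed
  show ?thesis
  proof
    assume ?neg
    then obtain ip where ip: "inner_product ip" "negative_ricci br ip" by auto
    show "?L \<or> ?Q \<or> ?other \<or> ?big"
    proof (cases "extension_dim N > 1 \<or> ?other")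
      case True
      then show ?thesis by blast
    next
      case False
      then have n4: "4 \<le> n" using forms_defined by auto
      let ?H = "mean_curvature_vector br ip"
      show ?thesis
      proof (cases "isomorphic_L br N")
        case True
        then obtain X where X: "L_basis br n X N" unfolding isomorphic_L_def n by auto
        note H = L_necessary[OF N X n4 ip]
        have "one_dim_extension_by N ?H" by (rule one_dim) (use False H in auto)
        then show ?thesis using X H by blast
      next
        case notL: False
        then have Q: "isomorphic_Q br N" using False by auto
        then obtain m where m: "n = 2 * m" unfolding isomorphic_Q_def n by (auto elim: evenE)
        obtain X where X: "Q_basis br n X N" using Q unfolding isomorphic_Q_def n by auto
        (* In dimension 4 the algebra Q is L, which is excluded here. *)
        have "n \<noteq> 4" using Q4_isomorphic_L[OF Q] notL n by auto
        then have m3: "3 \<le> m" using m n4 by linarith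
        note H = Q_necessary[OF N X m m3 ip]
        have "one_dim_extension_by N ?H" by (rule one_dim) (use False H in auto)
        then show ?thesis using Q m m3 H by auto
      qed
    qed
  next
    assume rhs: "?L \<or> ?Q \<or> ?other \<or> ?big"
    show ?neg
    proof (cases "extension_dim N > 1")
      case True
      then show ?thesis by (rule big)
    next
      case False
      then have n4: "4 \<le> n" using forms_defined by auto
      consider ?L | ?Q | ?other using rhs False by blast
      then show ?thesis
      proof cases
        case 1
        then show ?thesis using L_sufficient[OF N _ n4] by blast
      next
        case 2
        then obtain m Y where m: "n = 2 * m" "m > 2" and Q: "isomorphic_Q br N"
          and Y: "one_dim_extension_by N Y" "\<forall>k\<in>{m + 1..n}. iota_Q br N k Y > 0" by auto
        obtain X where X: "Q_basis br n X N" using Q unfolding isomorphic_Q_def n by auto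
        show ?thesis by (rule Q_sufficient[OF N X m(1) _ Y(1)]) (use m Y in auto)
      next
        case 3
        obtain Y where "Y \<notin> N" using \<open>N \<noteq> UNIV\<close> by auto
        then have "one_dim_extension_by N Y" by (rule one_dim[OF False])
        then show ?thesis using other_filiform_sufficient[OF assms(4) _ _ _ _] n4 n 3 by blast
      qed
    qed
  qed
qed

end
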